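(* For every $\alpha>0$ and every $\beta\in\mathbb R$, $$M^{2,2}_{\alpha,\beta}=H^\beta(\mathbb R^d)$$ with equivalence of norms. In particular, $M^{2,2}_{\alpha,0}=L^2(\mathbb R^d)$.
   Context: Conventions: $\widehat f(\eta)=\int_{\mathbb R^d}f(t)e^{-it\cdot\eta}\,dt$; $\langle f,g\rangle=\int f\overline g$, extended to a sesquilinear pairing of $\mathcal S'$ with $\mathcal S$; $B(c,r)$ is a Euclidean ball; $H^\beta$ is the $L^2$-based Sobolev space with norm $\|\langle\eta\rangle^\beta\widehat f\|_{L^2}$. Subdyadic lattice at scale $\rho\in(0,\rho_0]$. Here $\rho_0,a>0$ are fixed sufficiently small constants and $b>0$ a fixed constant, depending only on $d,\alpha$. For $n\in\mathbb N_0$ let $A_n=\{2^n\le|\xi|<2^{n+1}\}$, $h_n=\rho2^{n(1-\alpha)}$. Partition $\mathbb R^d$ into half-open cubes of side $h_n$ and choose one point of $A_n$ in each cube meeting $A_n$ (candidates). Order all candidates first by $n$ and arbitrarily inside each annulus, and process them in this order, retaining a candidate $\xi$ exactly when the ball $\{|\eta-\xi|<a\rho|\xi|^{1-\alpha}\}$ is disjoint from all such balls of previously retained candidates. Enumerate the retained points as $\{\xi_k\}_{k\in\mathbb N}$ and set $x_j^k=b\rho|\xi_k|^{\alpha-1}j$, $j\in\mathbb Z^d$; $\Omega_\alpha=\{(x_j^k,\xi_k)\}$. There is a constant $A_{\mathrm{cov}}>1$ depending only on $d,\alpha$ such that the balls $\{|\eta-\xi_k|\le A_{\mathrm{cov}}\rho|\xi_k|^{1-\alpha}\}$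 cover $\{|\eta|\ge1\}$. A subdyadic frame pair $(\phi,\Omega_\alpha)$ is fixed: $\phi\in\mathcal S(\mathbb R^d)$ is real-valued, even, $L^2$-normalized, with $\widehat\phi\in C_c^\infty$, $\operatorname{supp}\widehat\phi\subset B(0,R_1)$, $|\widehat\phi|\ge m_0>0$ on $\{|\zeta|\le R_0\}$, where $3\cdot2^{\max\{\alpha-1,0\}}<R_0<R_1$; and $\Omega_\alpha$ is a subdyadic lattice at a scale $\rho_\ast\le\rho_0$, i.e. $\Omega_\alpha=\{(x_j^k,\xi_k):k\in\mathbb N,\ j\in\mathbb Z^d\}$ where the $\xi_k$ are the centers retained by the selection procedure run with $\rho=\rho_\ast$ and $x_j^k=b\rho_\ast|\xi_k|^{\alpha-1}j$, with $A_{\mathrm{cov}}\rho_\ast<R_0$ and $b\rho_\ast R_1<\pi$. Packets: $\phi_{x,\xi}(t)=|\xi|^{\frac d2(1-\alpha)}\phi((t-x)|\xi|^{1-\alpha})e^{it\cdot\xi}$. For $f\in\mathcal S'(\mathbb R^d)$ put $c_{j,k}(f)=\langle f,\phi_{x_j^k,\xi_k}\rangle$. For $1\le p,q\le\infty$, $M^{p,q}_{\alpha,\beta}$ is the set of $f\in\mathcal S'(\mathbb R^d)$ with $\|f\|_{M^{p,q}_{\alpha,\beta}}=\big(\sum_k(\sum_j|c_{j,k}(f)|^p)^{q/p}(1+|\xi_k|)^{\beta q}\big)^{1/q}<\infty$ (suprema if $p$ or $q$ is infinite). *)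

theory Defs
  imports "HOL-Analysis.Analysis"
begin

section \<open>Schwartz functions and tempered distributions\<close>

fun iter_deriv :: "'a::euclidean_space list \<Rightarrow> ('a \<Rightarrow> complex) \<Rightarrow> 'a \<Rightarrow> complex" where
  "iter_deriv [] f = f"
| "iter_deriv (v # vs) f = (\<lambda>x. frechet_derivative (iter_deriv vs f) (at x) v)"

definition smooth :: "('a::euclidean_space \<Rightarrow> complex) \<Rightarrow> bool" where
  "smooth f \<longleftrightarrow> (\<forall>vs \<in> lists Basis. \<forall>x. iter_deriv vs f differentiable (at x))"

definition schwartz :: "('a::euclidean_space \<Rightarrow> complex) set" where
  "schwartz = {f. smooth f \<and>
     (\<forall>vs \<in> lists Basis. \<forall>N. bounded (range (\<lambda>x. (1 + norm x) ^ N *\<^sub>R iter_deriv vs f x)))}"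

definition schwartz_norm :: "nat \<Rightarrow> ('a::euclidean_space \<Rightarrow> complex) \<Rightarrow> real" where
  "schwartz_norm N f =
     (\<Sum>vs | vs \<in> lists Basis \<and> length vs \<le> N. SUP x. (1 + norm x) ^ N * cmod (iter_deriv vs f x))"

text \<open>Tempered distributions: the continuous linear functionals on the Schwartz space. They are
  taken to be extensional, so that two of them are equal as soon as they agree on Schwartz
  functions.\<close>

type_synonym 'a dist = "('a \<Rightarrow> complex) \<Rightarrow> complex"

definition tempered :: "'a::euclidean_space dist set" where
  "tempered = {u \<in> extensional schwartz.
     (\<forall>f \<in> schwartz. \<forall>g \<in> schwartz. u (\<lambda>x. f x + g x) = u f + u g) \<and>
     (\<forall>f \<in> schwartz. \<forall>c. u (\<lambda>x. c * f x) = c * u f) \<and>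
     (\<exists>C N. \<forall>f \<in> schwartz. cmod (u f) \<le> C * schwartz_norm N f)}"

text \<open>The sesquilinear pairing extending $\int f \overline g$.\<close>

definition pairing :: "'a::euclidean_space dist \<Rightarrow> ('a \<Rightarrow> complex) \<Rightarrow> complex" where
  "pairing u g = u (\<lambda>t. cnj (g t))"

definition fun_dist :: "('a::euclidean_space \<Rightarrow> complex) \<Rightarrow> 'a dist" where
  "fun_dist g = (\<lambda>\<psi>\<in>schwartz. LINT t|lborel. g t * \<psi> t)"

definition fourier :: "('a::euclidean_space \<Rightarrow> complex) \<Rightarrow> 'a \<Rightarrow> complex" where
  "fourier f \<eta> = (LINT t|lborel. f t * cis (- (t \<bullet> \<eta>)))"

definition fourier_dist :: "'a::euclidean_space dist \<Rightarrow> 'a dist" where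
  "fourier_dist u = (\<lambda>\<psi>\<in>schwartz. u (fourier \<psi>))"


section \<open>The spaces $L^2$ and $H^\beta$\<close>

definition l2_fun :: "('a::euclidean_space \<Rightarrow> complex) \<Rightarrow> bool" where
  "l2_fun g \<longleftrightarrow> g \<in> borel_measurable lborel \<and> integrable lborel (\<lambda>t. (cmod (g t))\<^sup>2)"

definition l2_norm :: "('a::euclidean_space \<Rightarrow> complex) \<Rightarrow> real" where
  "l2_norm g = sqrt (LINT t|lborel. (cmod (g t))\<^sup>2)"

definition L2_space :: "'a::euclidean_space dist set" where
  "L2_space = fun_dist ` {g. l2_fun g}"

definition jbracket :: "'a::euclidean_space \<Rightarrow> real" where
  "jbracket \<eta> = sqrt (1 + (norm \<eta>)\<^sup>2)"

definition bessel_weight :: "real \<Rightarrow> ('a::euclidean_space \<Rightarrow> complex) \<Rightarrow> 'a \<Rightarrow> complex" where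
  "bessel_weight \<beta> g \<eta> = of_real (jbracket \<eta> powr \<beta>) * g \<eta>"

text \<open>\<open>g\<close> is a function representing the Fourier transform of \<open>u\<close>; it is determined by \<open>u\<close> up to a
  null set, so the choice in \<open>sobolev_norm\<close> is immaterial.\<close>

definition sobolev_density ::
  "real \<Rightarrow> 'a::euclidean_space dist \<Rightarrow> ('a \<Rightarrow> complex) \<Rightarrow> bool" where
  "sobolev_density \<beta> u g \<longleftrightarrow> l2_fun (bessel_weight \<beta> g) \<and> fourier_dist u = fun_dist g"

definition sobolev :: "real \<Rightarrow> 'a::euclidean_space dist set" where
  "sobolev \<beta> = {u \<in> tempered. \<exists>g. sobolev_density \<beta> u g}"

definition sobolev_norm :: "real \<Rightarrow> 'a::euclidean_space dist \<Rightarrow> real" where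
  "sobolev_norm \<beta> u = l2_norm (bessel_weight \<beta> (SOME g. sobolev_density \<beta> u g))"


section \<open>Subdyadic lattices\<close>

definition annulus :: "nat \<Rightarrow> 'a::euclidean_space set" where
  "annulus n = {\<xi>. 2 ^ n \<le> norm \<xi> \<and> norm \<xi> < 2 ^ (n + 1)}"

definition mesh :: "real \<Rightarrow> real \<Rightarrow> nat \<Rightarrow> real" where
  "mesh \<alpha> \<rho> n = \<rho> * 2 powr (real n * (1 - \<alpha>))"

definition half_open_cube :: "'a::euclidean_space \<Rightarrow> real \<Rightarrow> 'a set" where
  "half_open_cube c h = {x. \<forall>i\<in>Basis. c \<bullet> i \<le> x \<bullet> i \<and> x \<bullet> i < c \<bullet> i + h}"

text \<open>\<open>S\<close> is a possible set of candidates in the \<open>n\<close>-th annulus.\<close>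

definition candidates :: "real \<Rightarrow> real \<Rightarrow> nat \<Rightarrow> 'a::euclidean_space set \<Rightarrow> bool" where
  "candidates \<alpha> \<rho> n S \<longleftrightarrow> (\<exists>P pick.
     partition_on UNIV P \<and> (\<forall>Q\<in>P. \<exists>c. Q = half_open_cube c (mesh \<alpha> \<rho> n)) \<and>
     (\<forall>Q\<in>P. Q \<inter> annulus n \<noteq> {} \<longrightarrow> pick Q \<in> Q \<inter> annulus n) \<and>
     S = pick ` {Q \<in> P. Q \<inter> annulus n \<noteq> {}})"

text \<open>\<open>z\<close> lists all candidates in an order of processing. Each \<open>S n\<close> is finite and nonempty, so
  every order that goes first by \<open>n\<close> is of this form.\<close>

definition processing_order :: "(nat \<Rightarrow> 'a::euclidean_space set) \<Rightarrow> (nat \<Rightarrow> 'a) \<Rightarrow> bool" where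
  "processing_order S z \<longleftrightarrow> bij_betw z UNIV (\<Union>n. S n) \<and>
     (\<forall>m n i j. m < n \<longrightarrow> z i \<in> S m \<longrightarrow> z j \<in> S n \<longrightarrow> i < j)"

definition sel_ball :: "real \<Rightarrow> real \<Rightarrow> real \<Rightarrow> 'a::euclidean_space \<Rightarrow> 'a set" where
  "sel_ball \<alpha> a \<rho> \<xi> = ball \<xi> (a * \<rho> * norm \<xi> powr (1 - \<alpha>))"

fun retained :: "real \<Rightarrow> real \<Rightarrow> real \<Rightarrow> (nat \<Rightarrow> 'a::euclidean_space) \<Rightarrow> nat \<Rightarrow> bool" where
  "retained \<alpha> a \<rho> z i \<longleftrightarrow>
     (\<forall>i' \<in> {..<i}. retained \<alpha> a \<rho> z i' \<longrightarrow> sel_ball \<alpha> a \<rho> (z i) \<inter> sel_ball \<alpha> a \<rho> (z i') = {})"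

declare retained.simps [simp del]

definition subdyadic_centers ::
  "real \<Rightarrow> real \<Rightarrow> real \<Rightarrow> (nat \<Rightarrow> 'a::euclidean_space) \<Rightarrow> bool" where
  "subdyadic_centers \<alpha> a \<rho> \<xi> \<longleftrightarrow> (\<exists>S z. (\<forall>n. candidates \<alpha> \<rho> n (S n)) \<and>
     processing_order S z \<and> bij_betw \<xi> UNIV {z i | i. retained \<alpha> a \<rho> z i})"

text \<open>The type argument fixes the dimension. One constant has to serve all scales up to \<open>\<rho>\<^sub>0\<close>
  and all choices made in the selection procedure; such a constant exists by
  \<open>covering_constant_exists\<close> below.\<close>

definition covering_constant ::
  "'a::euclidean_space itself \<Rightarrow> real \<Rightarrow> real \<Rightarrow> real \<Rightarrow> real \<Rightarrow> bool" where
  "covering_constant _ \<alpha> a \<rho>\<^sub>0 A \<longleftrightarrow> 1 < A \<and>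
     (\<forall>\<rho> (\<xi> :: nat \<Rightarrow> 'a). 0 < \<rho> \<and> \<rho> \<le> \<rho>\<^sub>0 \<and> subdyadic_centers \<alpha> a \<rho> \<xi> \<longrightarrow>
        {\<eta>. 1 \<le> norm \<eta>} \<subseteq> (\<Union>k. cball (\<xi> k) (A * \<rho> * norm (\<xi> k) powr (1 - \<alpha>))))"

definition int_lattice :: "'a::euclidean_space set" where
  "int_lattice = {j. \<forall>i\<in>Basis. j \<bullet> i \<in> \<int>}"

definition lattice_point :: "real \<Rightarrow> real \<Rightarrow> real \<Rightarrow> 'a::euclidean_space \<Rightarrow> 'a \<Rightarrow> 'a" where
  "lattice_point \<alpha> b \<rho> \<xi> j = (b * \<rho> * norm \<xi> powr (\<alpha> - 1)) *\<^sub>R j"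

definition frame_window ::
  "real \<Rightarrow> real \<Rightarrow> real \<Rightarrow> real \<Rightarrow> ('a::euclidean_space \<Rightarrow> complex) \<Rightarrow> bool" where
  "frame_window \<alpha> m\<^sub>0 R\<^sub>0 R\<^sub>1 \<phi> \<longleftrightarrow>
     \<phi> \<in> schwartz \<and> (\<forall>t. \<phi> t \<in> \<real>) \<and> (\<forall>t. \<phi> (- t) = \<phi> t) \<and> l2_norm \<phi> = 1 \<and>
     smooth (fourier \<phi>) \<and> compact (closure {\<zeta>. fourier \<phi> \<zeta> \<noteq> 0}) \<and>
     closure {\<zeta>. fourier \<phi> \<zeta> \<noteq> 0} \<subseteq> ball 0 R\<^sub>1 \<and>
     0 < m\<^sub>0 \<and> (\<forall>\<zeta>. norm \<zeta> \<le> R\<^sub>0 \<longrightarrow> m\<^sub>0 \<le> cmod (fourier \<phi> \<zeta>)) \<and>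
     3 * 2 powr max (\<alpha> - 1) 0 < R\<^sub>0 \<and> R\<^sub>0 < R\<^sub>1"

text \<open>The lattice \<open>\<Omega>\<^sub>\<alpha>\<close> of the frame pair is the set of all
  \<open>(lattice_point \<alpha> b \<rho> (\<xi> k) j, \<xi> k)\<close>; it is given by its scale \<open>\<rho>\<close> and its centers \<open>\<xi>\<close>.\<close>

definition subdyadic_frame_pair ::
  "real \<Rightarrow> real \<Rightarrow> real \<Rightarrow> real \<Rightarrow> real \<Rightarrow> ('a::euclidean_space \<Rightarrow> complex) \<Rightarrow> real \<Rightarrow> (nat \<Rightarrow> 'a) \<Rightarrow> bool"
  where
  "subdyadic_frame_pair \<alpha> a b \<rho>\<^sub>0 A \<phi> \<rho> \<xi> \<longleftrightarrow>
     0 < \<rho> \<and> \<rho> \<le> \<rho>\<^sub>0 \<and> subdyadic_centers \<alpha> a \<rho> \<xi> \<and>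
     (\<exists>m\<^sub>0 R\<^sub>0 R\<^sub>1. frame_window \<alpha> m\<^sub>0 R\<^sub>0 R\<^sub>1 \<phi> \<and> A * \<rho> < R\<^sub>0 \<and> b * \<rho> * R\<^sub>1 < pi)"


section \<open>The spaces $M^{p,q}_{\alpha,\beta}$\<close>

definition packet ::
  "real \<Rightarrow> ('a::euclidean_space \<Rightarrow> complex) \<Rightarrow> 'a \<Rightarrow> 'a \<Rightarrow> 'a \<Rightarrow> complex" where
  "packet \<alpha> \<phi> x \<xi> t = of_real (norm \<xi> powr (real DIM('a) / 2 * (1 - \<alpha>))) *
     \<phi> (norm \<xi> powr (1 - \<alpha>) *\<^sub>R (t - x)) * cis (t \<bullet> \<xi>)"

definition coefficient ::
  "real \<Rightarrow> real \<Rightarrow> ('a::euclidean_space \<Rightarrow> complex) \<Rightarrow> real \<Rightarrow> (nat \<Rightarrow> 'a) \<Rightarrow> 'a \<Rightarrow> nat \<Rightarrow> 'a dist \<Rightarrow> complex"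
  where
  "coefficient \<alpha> b \<phi> \<rho> \<xi> j k f = pairing f (packet \<alpha> \<phi> (lattice_point \<alpha> b \<rho> (\<xi> k) j) (\<xi> k))"

text \<open>Powers with exponent \<open>r > 0\<close>.\<close>

definition epow :: "ennreal \<Rightarrow> real \<Rightarrow> ennreal" where
  "epow x r = (if x = \<infinity> then \<infinity> else ennreal (enn2real x powr r))"

definition lp_norm :: "ennreal \<Rightarrow> 'i set \<Rightarrow> ('i \<Rightarrow> ennreal) \<Rightarrow> ennreal" where
  "lp_norm p I c = (if p = \<infinity> then SUP i\<in>I. c i
     else epow (\<integral>\<^sup>+ i. epow (c i) (enn2real p) \<partial>count_space I) (1 / enn2real p))"

text \<open>For \<open>1 \<le> p, q \<le> \<infinity>\<close>.\<close>

definition modulation_norm ::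
  "real \<Rightarrow> real \<Rightarrow> ('a::euclidean_space \<Rightarrow> complex) \<Rightarrow> real \<Rightarrow> (nat \<Rightarrow> 'a) \<Rightarrow>
   ennreal \<Rightarrow> ennreal \<Rightarrow> real \<Rightarrow> 'a dist \<Rightarrow> ennreal" where
  "modulation_norm \<alpha> b \<phi> \<rho> \<xi> p q \<beta> f =
     lp_norm q UNIV (\<lambda>k. lp_norm p int_lattice (\<lambda>j. ennreal (cmod (coefficient \<alpha> b \<phi> \<rho> \<xi> j k f)))
       * ennreal ((1 + norm (\<xi> k)) powr \<beta>))"

definition modulation_space ::
  "real \<Rightarrow> real \<Rightarrow> ('a::euclidean_space \<Rightarrow> complex) \<Rightarrow> real \<Rightarrow> (nat \<Rightarrow> 'a) \<Rightarrow>
   ennreal \<Rightarrow> ennreal \<Rightarrow> real \<Rightarrow> 'a dist set" where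
  "modulation_space \<alpha> b \<phi> \<rho> \<xi> p q \<beta> = {f \<in> tempered. modulation_norm \<alpha> b \<phi> \<rho> \<xi> p q \<beta> f < \<infinity>}"


section \<open>Existence of the covering constant\<close>

lemma half_open_cube_norm_diff:
  fixes x y :: "'a::euclidean_space"
  assumes "x \<in> half_open_cube c h" "y \<in> half_open_cube c h"
  shows "norm (x - y) \<le> real DIM('a) * h"
proof -
  have "norm (x - y) \<le> (\<Sum>i\<in>Basis. \<bar>(x - y) \<bullet> i\<bar>)"
    by (rule norm_le_l1)
  also have "\<dots> \<le> (\<Sum>i\<in>(Basis::'a set). h)"
  proof (rule sum_mono)
    fix i :: 'a assume "i \<in> Basis"
    then have "c \<bullet> i \<le> x \<bullet> i \<and> x \<bullet> i < c \<bullet> i + h" "c \<bullet> i \<le> y \<bullet> i \<and> y \<bullet> i < c \<bullet> i + h"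
      using assms by (auto simp: half_open_cube_def)
    then show "\<bar>(x - y) \<bullet> i\<bar> \<le> h"
      by (simp add: inner_diff_left abs_le_iff)
  qed
  finally show ?thesis by simp
qed

lemma mesh_le:
  assumes "2 ^ n \<le> r" "r < 2 ^ (n + 1)" "0 < \<rho>" "0 < \<alpha>"
  shows "mesh \<alpha> \<rho> n \<le> \<rho> * 2 powr \<alpha> * r powr (1 - \<alpha>)"
proof -
  have r0: "r > 0" using assms(1) by (meson less_le_trans zero_less_numeral zero_less_power)
  have eq: "2 powr (real n * (1 - \<alpha>)) = ((2::real) ^ n) powr (1 - \<alpha>)"
    by (simp add: powr_powr[symmetric] powr_realpow)
  have "((2::real) ^ n) powr (1 - \<alpha>) \<le> 2 powr \<alpha> * r powr (1 - \<alpha>)"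
  proof (cases "\<alpha> \<le> 1")
    case True
    have "((2::real) ^ n) powr (1 - \<alpha>) \<le> r powr (1 - \<alpha>)"
      using True assms by (intro powr_mono2) auto
    also have "\<dots> \<le> 2 powr \<alpha> * r powr (1 - \<alpha>)"
      using assms(4) by (simp add: mult_le_cancel_right1 ge_one_powr_ge_zero)
    finally show ?thesis .
  next
    case False
    have "((2::real) ^ n) powr (1 - \<alpha>) \<le> (r / 2) powr (1 - \<alpha>)"
      using False assms r0 by (intro powr_mono2') auto
    also have "\<dots> = 2 powr (\<alpha> - 1) * r powr (1 - \<alpha>)"
      using r0 by (simp add: powr_divide powr_diff field_simps)
    also have "\<dots> \<le> 2 powr \<alpha> * r powr (1 - \<alpha>)"
      by (intro mult_right_mono powr_mono) auto
    finally show ?thesis .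
  qed
  then show ?thesis
    using assms(3) unfolding mesh_def eq by (simp add: mult.assoc)
qed

lemma powr_comparable:
  fixes x y :: "'a::real_normed_vector"
  assumes "0 < \<alpha>" "0 < a" "0 < \<rho>" "\<rho> \<le> \<rho>\<^sub>0" "1 \<le> norm x" "1 \<le> norm y" "norm y \<le> 2 * norm x"
    and d: "norm (x - y) < a * \<rho> * norm x powr (1 - \<alpha>) + a * \<rho> * norm y powr (1 - \<alpha>)"
  shows "norm x powr (1 - \<alpha>) \<le>
    (2 powr \<alpha> + 2 * (1 + a * \<rho>\<^sub>0) + (2 * a * \<rho>\<^sub>0) powr (1 / \<alpha>)) * norm y powr (1 - \<alpha>)"
    (is "_ \<le> (?p + ?q + ?r) * _")
proof (cases "\<alpha> \<le> 1")
  case False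
  have "norm x powr (1 - \<alpha>) \<le> (norm y / 2) powr (1 - \<alpha>)"
    using False assms by (intro powr_mono2') auto
  also have "\<dots> = 2 powr (\<alpha> - 1) * norm y powr (1 - \<alpha>)"
    using assms by (simp add: powr_divide powr_diff field_simps)
  also have "\<dots> \<le> (?p + ?q + ?r) * norm y powr (1 - \<alpha>)"
  proof (intro mult_right_mono)
    have "(2::real) powr (\<alpha> - 1) \<le> 2 powr \<alpha>" by (rule powr_mono) auto
    moreover have "0 \<le> ?q" "0 \<le> ?r" using assms by auto
    ultimately show "2 powr (\<alpha> - 1) \<le> ?p + ?q + ?r" by linarith
  qed auto
  finally show ?thesis .
next
  case True
  have ar: "a * \<rho> \<le> a * \<rho>\<^sub>0" "0 \<le> a * \<rho>" using assms by auto
  have ar0: "0 \<le> a * \<rho>\<^sub>0" using ar by linarith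
  have q: "1 \<le> ?q" using ar0 by auto
  have K1: "1 \<le> ?q + ?r" using q powr_ge_zero[of "2 * a * \<rho>\<^sub>0" "1 / \<alpha>"] by linarith
  have le: "norm x \<le> (?q + ?r) * norm y"
  proof (cases "a * \<rho>\<^sub>0 * norm x powr (- \<alpha>) \<le> 1 / 2")
    case A: True
    have e: "norm x powr (1 - \<alpha>) = norm x * norm x powr (- \<alpha>)"
      using assms(5) by (simp add: powr_diff powr_minus divide_inverse)
    have "a * \<rho> * norm x powr (1 - \<alpha>) \<le> a * \<rho>\<^sub>0 * norm x powr (1 - \<alpha>)"
      using ar by (intro mult_right_mono) auto
    also have "\<dots> = (a * \<rho>\<^sub>0 * norm x powr (- \<alpha>)) * norm x" by (simp add: e)
    also have "\<dots> \<le> 1 / 2 * norm x" using A by (intro mult_right_mono) auto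
    finally have 1: "a * \<rho> * norm x powr (1 - \<alpha>) \<le> norm x / 2" by simp
    have "norm y powr (1 - \<alpha>) \<le> norm y powr 1"
      using assms by (intro powr_mono) auto
    then have "a * \<rho> * norm y powr (1 - \<alpha>) \<le> a * \<rho>\<^sub>0 * norm y"
      using ar by (intro mult_mono[of "a * \<rho>"]) auto
    with 1 d have "norm (x - y) < norm x / 2 + a * \<rho>\<^sub>0 * norm y" by linarith
    moreover have "norm x \<le> norm y + norm (x - y)"
      by (metis add.commute norm_triangle_sub)
    ultimately have "norm x \<le> ?q * norm y" by (simp add: algebra_simps)
    moreover have "0 \<le> ?r * norm y" by auto
    ultimately show ?thesis unfolding distrib_right by linarith
  next
    case False
    have "norm x powr \<alpha> \<le> 2 * a * \<rho>\<^sub>0"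
    proof -
      have p: "0 < norm x powr \<alpha>" using assms(5) by auto
      have "1 / 2 < a * \<rho>\<^sub>0 / norm x powr \<alpha>"
        using False unfolding powr_minus divide_inverse by linarith
      then show ?thesis using pos_less_divide_eq[OF p, of "1/2" "a * \<rho>\<^sub>0"] by linarith
    qed
    then have "(norm x powr \<alpha>) powr (1 / \<alpha>) \<le> ?r"
      using assms(1) by (intro powr_mono2) auto
    then have "norm x \<le> ?r" using assms(1,5) by (simp add: powr_powr)
    also have "\<dots> \<le> ?q + ?r" using q by linarith
    also have "\<dots> \<le> (?q + ?r) * norm y"
      using K1 assms(6) by (simp add: mult_le_cancel_left1)
    finally show ?thesis .
  qed
  have "norm x powr (1 - \<alpha>) \<le> ((?q + ?r) * norm y) powr (1 - \<alpha>)"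
    using le True by (intro powr_mono2) auto
  also have "\<dots> = (?q + ?r) powr (1 - \<alpha>) * norm y powr (1 - \<alpha>)"
    using K1 by (simp add: powr_mult)
  also have "\<dots> \<le> (?p + ?q + ?r) * norm y powr (1 - \<alpha>)"
  proof (intro mult_right_mono)
    have "(?q + ?r) powr (1 - \<alpha>) \<le> (?q + ?r) powr 1"
      using K1 assms(1) by (intro powr_mono) auto
    also have "\<dots> = ?q + ?r" using K1 by simp
    finally show "(?q + ?r) powr (1 - \<alpha>) \<le> ?p + ?q + ?r"
      using powr_ge_zero[of 2 \<alpha>] by linarith
  qed auto
  finally show ?thesis .
qed

theorem covering_constant_exists:
  assumes "0 < \<alpha>" "0 < a" "0 < \<rho>\<^sub>0"
  shows "\<exists>A. covering_constant TYPE('a::euclidean_space) \<alpha> a \<rho>\<^sub>0 A"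
proof -
  define K where "K = 2 powr \<alpha> + 2 * (1 + a * \<rho>\<^sub>0) + (2 * a * \<rho>\<^sub>0) powr (1 / \<alpha>)"
  define D where "D = real DIM('a) * 2 powr \<alpha>"
  define A where "A = 2 + D * K + a * K + a + D"
  have pos: "0 \<le> K" "0 \<le> D" using assms unfolding K_def D_def by auto
  have A1: "1 < A"
  proof -
    have "0 \<le> D * K" "0 \<le> a * K" using pos assms by auto
    then show ?thesis using pos assms unfolding A_def by linarith
  qed
  have "\<exists>k. \<eta> \<in> cball (\<xi> k) (A * \<rho> * norm (\<xi> k) powr (1 - \<alpha>))"
    if \<rho>: "0 < \<rho>" "\<rho> \<le> \<rho>\<^sub>0" and c: "subdyadic_centers \<alpha> a \<rho> \<xi>" and \<eta>: "1 \<le> norm \<eta>"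
    for \<rho> and \<xi> :: "nat \<Rightarrow> 'a" and \<eta>
  proof -
    obtain S z where S: "\<And>n. candidates \<alpha> \<rho> n (S n)" and z: "processing_order S z"
      and \<xi>: "bij_betw \<xi> UNIV {z i | i. retained \<alpha> a \<rho> z i}"
      using c unfolding subdyadic_centers_def by (elim exE conjE) (rule that, auto)
    have Sann: "S n \<subseteq> annulus n" for n
      using S[of n] unfolding candidates_def by (elim exE conjE) auto
    have bij: "bij_betw z UNIV (\<Union>n. S n)"
      and ord: "\<And>m n i j. m < n \<Longrightarrow> z i \<in> S m \<Longrightarrow> z j \<in> S n \<Longrightarrow> i < j"
      using z unfolding processing_order_def by simp_all
    have zS: "\<exists>n. z i \<in> S n" for i
      using bij_betwE[OF bij] by auto
    have "\<exists>n. 2 ^ n \<le> norm \<eta> \<and> norm \<eta> < 2 ^ (n + 1)"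
    proof -
      obtain N where "norm \<eta> < 2 ^ N" using real_arch_pow[of 2 "norm \<eta>"] by auto
      then have ex: "\<exists>N. norm \<eta> < 2 ^ N" by blast
      define N where "N = (LEAST N. norm \<eta> < 2 ^ N)"
      have N: "norm \<eta> < 2 ^ N" unfolding N_def using ex by (rule LeastI_ex)
      then have "N \<noteq> 0" using \<eta> by (cases N) auto
      then obtain n where n: "N = Suc n" by (cases N) auto
      then have "\<not> norm \<eta> < 2 ^ n" using not_less_Least[of n "\<lambda>N. norm \<eta> < 2 ^ N"]
        unfolding N_def by simp
      then show ?thesis using N n by (intro exI[of _ n]) auto
    qed
    then obtain n where n: "2 ^ n \<le> norm \<eta>" "norm \<eta> < 2 ^ (n + 1)" by blast
    obtain P pick where P: "partition_on UNIV P"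
      "\<forall>Q\<in>P. \<exists>c. Q = half_open_cube c (mesh \<alpha> \<rho> n)"
      "\<forall>Q\<in>P. Q \<inter> annulus n \<noteq> {} \<longrightarrow> pick Q \<in> Q \<inter> annulus n"
      "S n = pick ` {Q \<in> P. Q \<inter> annulus n \<noteq> {}}"
      using S[of n] unfolding candidates_def by (elim exE conjE) (rule that, assumption+)
    obtain Q where Q: "Q \<in> P" "\<eta> \<in> Q" using P(1) unfolding partition_on_def by blast
    have "\<eta> \<in> annulus n" using n unfolding annulus_def by simp
    then have Qn: "Q \<inter> annulus n \<noteq> {}" using Q by blast
    define x where "x = pick Q"
    have x: "x \<in> Q" "x \<in> annulus n" "x \<in> S n" using P(3,4) Q Qn unfolding x_def by auto
    have xn: "2 ^ n \<le> norm x" "norm x < 2 ^ (n + 1)" using x(2) unfolding annulus_def by auto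
    have x1: "1 \<le> norm x" using order_trans[OF one_le_power[of "2::real" n] xn(1)] by simp
    have dx: "norm (\<eta> - x) \<le> D * \<rho> * norm x powr (1 - \<alpha>)"
    proof -
      have "norm (\<eta> - x) \<le> real DIM('a) * mesh \<alpha> \<rho> n"
        using P(2)[rule_format, OF Q(1)] Q(2) x(1) half_open_cube_norm_diff by auto
      also have "\<dots> \<le> real DIM('a) * (\<rho> * 2 powr \<alpha> * norm x powr (1 - \<alpha>))"
        using mesh_le[OF xn \<rho>(1) assms(1)] by (intro mult_left_mono) auto
      finally show ?thesis by (simp add: D_def ac_simps)
    qed
    have "x \<in> range z" using bij_betw_imp_surj_on[OF bij] x(3) by auto
    then obtain i where i: "x = z i" by (rule rangeE)
    have "\<exists>i'. retained \<alpha> a \<rho> z i' \<and>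
        norm (\<eta> - z i') \<le> A * \<rho> * norm (z i') powr (1 - \<alpha>)"
    proof (cases "retained \<alpha> a \<rho> z i")
      case True
      have "D * \<rho> * norm x powr (1 - \<alpha>) \<le> A * \<rho> * norm x powr (1 - \<alpha>)"
        using \<rho> pos assms unfolding A_def by (intro mult_right_mono) auto
      then show ?thesis using True dx i by force
    next
      case False
      then obtain i' w where i': "i' < i" "retained \<alpha> a \<rho> z i'"
        and w: "w \<in> sel_ball \<alpha> a \<rho> (z i)" "w \<in> sel_ball \<alpha> a \<rho> (z i')"
        unfolding retained.simps[of \<alpha> a \<rho> z i] by blast
      define y where "y = z i'"
      obtain m where m: "y \<in> S m" using zS y_def by blast
      have "\<not> n < m" using ord[of n m i i'] m x(3) i i'(1) y_def by auto
      then have mn: "m \<le> n" by simp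
      have yn: "2 ^ m \<le> norm y" "norm y < 2 ^ (m + 1)"
        using m Sann unfolding annulus_def by auto
      have y1: "1 \<le> norm y" using order_trans[OF one_le_power[of "2::real" m] yn(1)] by simp
      have "norm y \<le> 2 ^ (n + 1)"
        using yn(2) mn power_increasing[of "m + 1" "n + 1" "2::real"] by linarith
      then have y2: "norm y \<le> 2 * norm x" using xn(1) by simp
      have dxy: "norm (x - y) < a * \<rho> * norm x powr (1 - \<alpha>) + a * \<rho> * norm y powr (1 - \<alpha>)"
        using w dist_triangle2[of x y w] unfolding sel_ball_def i[symmetric] y_def[symmetric]
        by (auto simp: dist_norm[symmetric])
      have cmp: "norm x powr (1 - \<alpha>) \<le> K * norm y powr (1 - \<alpha>)"
        unfolding K_def by (rule powr_comparable[OF assms(1,2) \<rho> x1 y1 y2 dxy])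
      have "norm (\<eta> - y) \<le> norm (\<eta> - x) + norm (x - y)"
        using norm_triangle_ineq[of "\<eta> - x" "x - y"] by simp
      also have "\<dots> \<le> (D + a) * \<rho> * norm x powr (1 - \<alpha>) + a * \<rho> * norm y powr (1 - \<alpha>)"
        using dx dxy by (simp add: algebra_simps)
      also have "\<dots> \<le> (D + a) * \<rho> * (K * norm y powr (1 - \<alpha>)) + a * \<rho> * norm y powr (1 - \<alpha>)"
        using cmp pos assms \<rho> by (intro add_right_mono mult_left_mono) auto
      also have "\<dots> = (D * K + a * K + a) * \<rho> * norm y powr (1 - \<alpha>)"
        by (simp add: algebra_simps)
      also have "\<dots> \<le> A * \<rho> * norm y powr (1 - \<alpha>)"
        using \<rho> pos assms unfolding A_def by (intro mult_right_mono) auto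
      finally show ?thesis using i' y_def by blast
    qed
    then obtain i' where i': "retained \<alpha> a \<rho> z i'"
      "norm (\<eta> - z i') \<le> A * \<rho> * norm (z i') powr (1 - \<alpha>)" by blast
    have "z i' \<in> range \<xi>" unfolding bij_betw_imp_surj_on[OF \<xi>] using i'(1) by auto
    then obtain k where "\<xi> k = z i'" by (metis rangeE)
    then show ?thesis using i'(2) by (intro exI[of _ k]) (simp add: dist_norm norm_minus_commute)
  qed
  then have "covering_constant TYPE('a) \<alpha> a \<rho>\<^sub>0 A"
    unfolding covering_constant_def using A1 by (auto simp del: mem_cball)
  then show ?thesis by blast
qed

end

theory Submission
  imports Defs
begin

text \<open>Write \<open>r k = norm (\<xi> k) powr (1 - \<alpha>)\<close>. On the Fourier side the packet at
  \<open>(x, \<xi> k)\<close> is a multiple of the bump \<open>fourier \<phi> ((\<eta> - \<xi> k) / r k)\<close> modulated with frequency \<open>- x\<close>. The condition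
  \<open>b * \<rho> * R\<^sub>1 < pi\<close> says that this bump is supported in a cube centered at \<open>\<xi> k\<close> whose dual lattice
  consists of the nodes of the \<open>k\<close>-th packets. So, for fixed \<open>k\<close>, the coefficients of \<open>f\<close> are the Fourier
  coefficients on that cube of the transform of \<open>f\<close> times the bump. By Parseval's identity the
  square of the modulation norm should be comparable with the integral of the squared modulus of the transform
  against \<open>square_fun (2 * \<beta>) \<eta> = (\<Sum>k. (1 + norm (\<xi> k)) powr (2 * \<beta>) * (cmod (bump k \<eta>))\<^sup>2)\<close>. This function is
  comparable with \<open>jbracket \<eta> powr (2 * \<beta>)\<close> (\<open>square_fun_bounds\<close>): the bumps cover with a lower
  bound, disjointness of the selection balls bounds their overlap, and \<open>\<alpha> > 0\<close> makes \<open>r k\<close> small against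
  \<open>norm (\<xi> k)\<close>, so that frequencies on one bump have the same size.

  If the transform of \<open>f\<close> is known to be a function, then Bessel's inequality on each cube bounds the
  modulation norm by the Sobolev norm (\<open>energy_le\<close>). The converse has to start from a tempered
  distribution and goes by duality. A test function \<open>\<psi>\<close> is decomposed as
  \<open>\<Sum>k. weight k * bump k * (bump k * \<psi> / square_fun)\<close>. The Fourier series of the second factor on
  the cube expresses the value of the transform of \<open>f\<close> on each summand by coefficients of \<open>f\<close>
  (\<open>tempered_fourier_series\<close>), and two applications of the Cauchy-Schwarz inequality
  bound the transform of \<open>f\<close> on \<open>\<psi>\<close> by the modulation norm times the norm of \<open>\<psi>\<close> with the inverse weight
  (\<open>test_fun_bound\<close>). The Riesz representation turns this into a density of the transform
  (\<open>density_exists\<close>), and testing this density returns the bound of the Sobolev norm (\<open>energy_ge\<close>).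

  For \<open>\<beta> = 0\<close> it remains to identify \<open>sobolev 0\<close> with \<open>L2_space\<close>. The Plancherel identity for Schwartz functions
  bounds the distributions in question by \<open>L\<^sup>2\<close> norms, so that the Riesz representation gives the functions,
  again by duality (\<open>L2_space_eq_sobolev\<close>, \<open>sobolev_norm_zero\<close>).

  Convergence in the Schwartz space is handled through bounded families: an error that tends to zero
  is exhibited as \<open>1 / n\<close> times a bounded family, on which a tempered distribution is bounded.\<close>

section \<open>Calculus of iterated partial derivatives\<close>

abbreviation pd :: "'a::euclidean_space \<Rightarrow> ('a \<Rightarrow> complex) \<Rightarrow> 'a \<Rightarrow> complex" where
  "pd v f \<equiv> (\<lambda>x. frechet_derivative f (at x) v)"

lemma pd_eq:
  assumes "\<And>x. (f has_derivative f' x) (at x)"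
  shows "pd v f = (\<lambda>x. f' x v)"
  using frechet_derivative_at[OF assms] by simp

lemma iter_deriv_snoc: "iter_deriv (vs @ [v]) f = iter_deriv vs (pd v f)"
  by (induction vs) auto

text \<open>The class of $n$ times differentiable functions. Closure of \<open>smooth\<close> under products and inverses needs an induction on
  the order of differentiation in which the functions vary, since the derivative of a product
  consists of products of other functions.\<close>

definition class_C :: "nat \<Rightarrow> ('a::euclidean_space \<Rightarrow> complex) \<Rightarrow> bool" where
  "class_C n f \<longleftrightarrow> (\<forall>vs \<in> lists Basis. length vs < n \<longrightarrow> (\<forall>x. iter_deriv vs f differentiable at x))"

lemma smooth_iff_class_C: "smooth f \<longleftrightarrow> (\<forall>n. class_C n f)"
  unfolding smooth_def class_C_def by (metis lessI)

lemma class_C_0 [simp]: "class_C 0 f" by (simp add: class_C_def)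

text \<open>The derivative that is applied first is peeled off; \<open>iter_deriv\<close> itself unfolds the one that is applied last.\<close>

lemma class_C_Suc:
  "class_C (Suc n) f \<longleftrightarrow> (\<forall>x. f differentiable at x) \<and> (\<forall>v\<in>Basis. class_C n (pd v f))"
proof (intro iffI conjI ballI)
  assume L: "class_C (Suc n) f"
  show "\<forall>x. f differentiable at x" using L unfolding class_C_def by (auto dest!: bspec[of _ _ "[]"])
  fix v :: 'a assume v: "v \<in> Basis"
  show "class_C n (pd v f)"
    unfolding class_C_def iter_deriv_snoc[symmetric] using L v by (auto simp: class_C_def)
next
  assume R: "(\<forall>x. f differentiable at x) \<and> (\<forall>v\<in>Basis. class_C n (pd v f))"
  show "class_C (Suc n) f"
    unfolding class_C_def
  proof (intro ballI impI)
    fix vs :: "'a list" assume vs: "vs \<in> lists Basis" "length vs < Suc n"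
    show "\<forall>x. iter_deriv vs f differentiable at x"
    proof (cases vs rule: rev_cases)
      case Nil then show ?thesis using R by simp
    next
      case (snoc ws v)
      then show ?thesis using R vs unfolding snoc iter_deriv_snoc by (auto simp: class_C_def)
    qed
  qed
qed

lemma class_C_Suc_imp: "class_C (Suc n) f \<Longrightarrow> class_C n f" by (auto simp: class_C_def)

lemma smooth_differentiable: "smooth f \<Longrightarrow> f differentiable at x"
  unfolding smooth_def by (auto dest!: bspec[of _ _ "[]"])

lemma smooth_has_derivative:
  "smooth f \<Longrightarrow> (f has_derivative frechet_derivative f (at x)) (at x)"
  using smooth_differentiable frechet_derivative_works by blast

lemma smooth_pd: "smooth f \<Longrightarrow> v \<in> Basis \<Longrightarrow> smooth (pd v f)"
  unfolding smooth_iff_class_C using class_C_Suc by blast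

lemma smooth_iter_deriv: "smooth f \<Longrightarrow> vs \<in> lists Basis \<Longrightarrow> smooth (iter_deriv vs f)"
  by (induction vs) (auto intro: smooth_pd)

lemma smooth_continuous_on: "smooth f \<Longrightarrow> continuous_on S f"
  by (meson continuous_at_imp_continuous_on differentiable_imp_continuous_within smooth_differentiable)

lemma smooth_borel_measurable: "smooth f \<Longrightarrow> f \<in> borel_measurable borel"
  by (intro borel_measurable_continuous_onI smooth_continuous_on)

lemma frechet_derivative_worksI:
  "f differentiable at x \<Longrightarrow> (f has_derivative frechet_derivative f (at x)) (at x)"
  using frechet_derivative_works by blast

lemma pd_add:
  assumes "\<And>x. f differentiable at x" "\<And>x. g differentiable at x"
  shows "pd v (\<lambda>x. f x + g x) = (\<lambda>x. pd v f x + pd v g x)"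
  by (subst pd_eq[OF has_derivative_add[OF frechet_derivative_worksI frechet_derivative_worksI]])
     (use assms in auto)

lemma pd_mult:
  assumes "\<And>x. f differentiable at x" "\<And>x. g differentiable at x"
  shows "pd v (\<lambda>x. f x * g x) = (\<lambda>x. pd v f x * g x + f x * pd v g x)"
  by (subst pd_eq[OF has_derivative_mult[OF frechet_derivative_worksI frechet_derivative_worksI]])
     (use assms in \<open>auto simp: algebra_simps\<close>)

lemma class_C_add: "class_C n f \<Longrightarrow> class_C n g \<Longrightarrow> class_C n (\<lambda>x. f x + g x)"
proof (induction n arbitrary: f g)
  case (Suc n) then show ?case by (auto simp: class_C_Suc pd_add)
qed simp

lemma class_C_mult: "class_C n f \<Longrightarrow> class_C n g \<Longrightarrow> class_C n (\<lambda>x. f x * g x)"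
proof (induction n arbitrary: f g)
  case (Suc n)
  have "class_C n f" "class_C n g" using Suc.prems class_C_Suc_imp by blast+
  then show ?case using Suc by (auto simp: class_C_Suc pd_mult intro!: class_C_add)
qed simp

lemma class_C_const: "class_C n (\<lambda>x. c)"
  by (induction n arbitrary: c) (auto simp: class_C_Suc)

lemma class_C_inverse:
  assumes "\<And>x. f x \<noteq> 0"
  shows "class_C n f \<Longrightarrow> class_C n (\<lambda>x. inverse (f x))"
proof (induction n)
  case (Suc n)
  then have d: "\<And>x. f differentiable at x" and c: "class_C n f"
    using class_C_Suc_imp by (auto simp: class_C_Suc)
  have 1: "((\<lambda>x. inverse (f x)) has_derivative
      (\<lambda>h. - (inverse (f x) * frechet_derivative f (at x) h * inverse (f x)))) (at x)" for x
    using Deriv.has_derivative_inverse[of f x _ UNIV] assms d frechet_derivative_works by blast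
  have "pd v (\<lambda>x. inverse (f x)) = (\<lambda>x. (-1) * (inverse (f x) * pd v f x * inverse (f x)))" for v
    by (subst pd_eq[OF 1]) simp
  moreover have "\<forall>x. (\<lambda>x. inverse (f x)) differentiable at x" using 1 differentiable_def by blast
  moreover have "class_C n (\<lambda>x. (-1) * (inverse (f x) * pd v f x * inverse (f x)))" if "v \<in> Basis" for v
    using Suc c that unfolding class_C_Suc by (intro class_C_mult class_C_const) auto
  ultimately show ?case unfolding class_C_Suc by simp
qed simp

lemma smooth_add: "smooth f \<Longrightarrow> smooth g \<Longrightarrow> smooth (\<lambda>x. f x + g x)"
  by (simp add: smooth_iff_class_C class_C_add)
lemma smooth_mult: "smooth f \<Longrightarrow> smooth g \<Longrightarrow> smooth (\<lambda>x. f x * g x)"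
  by (simp add: smooth_iff_class_C class_C_mult)
lemma smooth_const: "smooth (\<lambda>x. c)" by (simp add: smooth_iff_class_C class_C_const)
lemma smooth_inverse: "smooth f \<Longrightarrow> (\<And>x. f x \<noteq> 0) \<Longrightarrow> smooth (\<lambda>x. inverse (f x))"
  by (simp add: smooth_iff_class_C class_C_inverse)
lemma smooth_sum: "(\<And>i. i \<in> I \<Longrightarrow> smooth (f i)) \<Longrightarrow> smooth (\<lambda>x. \<Sum>i\<in>I. f i x)"
  by (induction I rule: infinite_finite_induct) (auto intro: smooth_const smooth_add)

lemma iter_deriv_add:
  "smooth f \<Longrightarrow> smooth g \<Longrightarrow> vs \<in> lists Basis \<Longrightarrow>
   iter_deriv vs (\<lambda>x. f x + g x) = (\<lambda>x. iter_deriv vs f x + iter_deriv vs g x)"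
proof (induction vs)
  case (Cons v vs)
  then show ?case
    by (auto simp: pd_add smooth_differentiable smooth_iter_deriv)
qed simp

lemma iter_deriv_cmult:
  assumes "smooth f" "vs \<in> lists Basis"
  shows "iter_deriv vs (\<lambda>x. c * f x) = (\<lambda>x. c * iter_deriv vs f x)"
  using assms(2)
proof (induction vs)
  case (Cons v vs)
  then have vs: "v \<in> Basis" "vs \<in> lists Basis" by auto
  with Cons.IH show ?case
    using smooth_differentiable[OF smooth_iter_deriv[OF assms(1) vs(2)]] by (simp add: pd_mult)
qed simp

lemma iter_deriv_zero: "iter_deriv vs (\<lambda>x. 0) = (\<lambda>x. 0)"
  by (induction vs) auto

lemma iter_deriv_const: "iter_deriv vs (\<lambda>x. c) = (\<lambda>x. if vs = [] then c else 0)"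
  by (induction vs) auto

lemma iter_deriv_sum:
  "(\<And>i. i \<in> I \<Longrightarrow> smooth (f i)) \<Longrightarrow> vs \<in> lists Basis \<Longrightarrow>
   iter_deriv vs (\<lambda>x. \<Sum>i\<in>I. f i x) = (\<lambda>x. \<Sum>i\<in>I. iter_deriv vs (f i) x)"
  by (induction I rule: infinite_finite_induct) (simp_all add: iter_deriv_zero iter_deriv_add smooth_sum)

text \<open>Only the germ of a function enters its derivatives, so they can be computed from any local
  formula.\<close>

lemma iter_deriv_local:
  assumes "open U" "\<And>x. x \<in> U \<Longrightarrow> f x = g x" "x \<in> U"
  shows "iter_deriv vs f x = iter_deriv vs g x"
  using assms(3)
proof (induction vs arbitrary: x)
  case (Cons v vs)
  have *: "(iter_deriv vs f has_derivative D) (at x) \<longleftrightarrow> (iter_deriv vs g has_derivative D) (at x)" for D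
    using has_derivative_transform_within_open[OF _ assms(1) Cons.prems, of "iter_deriv vs f" D UNIV "iter_deriv vs g"]
      has_derivative_transform_within_open[OF _ assms(1) Cons.prems, of "iter_deriv vs g" D UNIV "iter_deriv vs f"]
      Cons.IH by auto
  then show ?case by (simp add: frechet_derivative_def)
qed (use assms in auto)

lemma smooth_local:
  assumes "\<And>x. \<exists>U g. open U \<and> x \<in> U \<and> smooth g \<and> (\<forall>y\<in>U. f y = g y)"
  shows "smooth f"
  unfolding smooth_def
proof (intro ballI allI)
  fix vs :: "'a list" and x :: 'a assume vs: "vs \<in> lists Basis"
  obtain U g where U: "open U" "x \<in> U" "smooth g" "\<And>y. y \<in> U \<Longrightarrow> f y = g y" using assms[of x] by blast
  have eq: "\<And>y. y \<in> U \<Longrightarrow> iter_deriv vs g y = iter_deriv vs f y"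
    using iter_deriv_local[OF U(1), of f g] U by auto
  obtain D where "(iter_deriv vs g has_derivative D) (at x)"
    using smooth_differentiable[OF smooth_iter_deriv[OF U(3) vs]] unfolding differentiable_def by blast
  from has_derivative_transform_within_open[OF this U(1,2) eq]
  show "iter_deriv vs f differentiable at x" by (auto simp: differentiable_def)
qed

text \<open>A guess \<open>F\<close> for all iterated derivatives at once is verified by one differentiation.\<close>

lemma smooth_iter_deriv_eqI:
  assumes "F [] = f"
    "\<And>vs v x. vs \<in> lists Basis \<Longrightarrow> v \<in> Basis \<Longrightarrow> F vs differentiable at x \<and> pd v (F vs) = F (v # vs)"
  shows "smooth f" "vs \<in> lists Basis \<Longrightarrow> iter_deriv vs f = F vs"
proof -
  have *: "iter_deriv vs f = F vs" if "vs \<in> lists Basis" for vs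
    using that
  proof (induction vs)
    case (Cons v vs)
    then show ?case using assms(2)[of vs v] by auto
  qed (simp add: assms(1))
  then show "vs \<in> lists Basis \<Longrightarrow> iter_deriv vs f = F vs" by simp
  show "smooth f"
    unfolding smooth_def using * assms(2) by (metis nonempty_Basis some_in_eq)
qed

lemma iter_deriv_affine:
  assumes "smooth f"
  shows "smooth (\<lambda>x. f (s *\<^sub>R (x - c)))"
    and "vs \<in> lists Basis \<Longrightarrow>
      iter_deriv vs (\<lambda>x. f (s *\<^sub>R (x - c))) = (\<lambda>x. complex_of_real s ^ length vs * iter_deriv vs f (s *\<^sub>R (x - c)))"
proof -
  let ?F = "\<lambda>vs x. complex_of_real s ^ length vs * iter_deriv vs f (s *\<^sub>R (x - c))"
  have 1: "?F vs differentiable at x \<and> pd v (?F vs) = ?F (v # vs)"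
    if "vs \<in> lists Basis" "v \<in> Basis" for vs v x
  proof -
    let ?g = "iter_deriv vs f"
    have a: "((\<lambda>x. s *\<^sub>R (x - c)) has_derivative (\<lambda>h. s *\<^sub>R h)) (at x)" for x
      by (auto intro!: derivative_eq_intros)
    have "((\<lambda>x. ?g (s *\<^sub>R (x - c))) has_derivative
        (\<lambda>h. frechet_derivative ?g (at (s *\<^sub>R (x - c))) (s *\<^sub>R h))) (at x)" for x
      by (rule has_derivative_compose[OF a smooth_has_derivative[OF smooth_iter_deriv[OF assms that(1)]]])
    from has_derivative_mult_right[OF this]
    have d: "(?F vs has_derivative (\<lambda>h. complex_of_real s ^ length vs *
        frechet_derivative ?g (at (s *\<^sub>R (x - c))) (s *\<^sub>R h))) (at x)" for x .
    have l: "frechet_derivative ?g (at y) (s *\<^sub>R h) = s * frechet_derivative ?g (at y) h" for y h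
      using linear_scale[OF has_derivative_linear[OF smooth_has_derivative[OF smooth_iter_deriv[OF assms that(1)]]]]
      by (simp add: scaleR_conv_of_real)
    show ?thesis using d pd_eq[OF d, of v] by (auto simp: differentiable_def l mult.assoc)
  qed
  from smooth_iter_deriv_eqI[of ?F, OF _ 1]
  show "smooth (\<lambda>x. f (s *\<^sub>R (x - c)))"
    and "vs \<in> lists Basis \<Longrightarrow>
      iter_deriv vs (\<lambda>x. f (s *\<^sub>R (x - c))) = (\<lambda>x. complex_of_real s ^ length vs * iter_deriv vs f (s *\<^sub>R (x - c)))"
    by auto
qed

lemma iter_deriv_cnj:
  assumes "smooth f"
  shows "smooth (\<lambda>x. cnj (f x))"
    and "vs \<in> lists Basis \<Longrightarrow> iter_deriv vs (\<lambda>x. cnj (f x)) = (\<lambda>x. cnj (iter_deriv vs f x))"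
proof -
  let ?F = "\<lambda>vs x. cnj (iter_deriv vs f x)"
  have 1: "?F vs differentiable at x \<and> pd v (?F vs) = ?F (v # vs)"
    if "vs \<in> lists Basis" "v \<in> Basis" for vs v x
  proof -
    have d: "(?F vs has_derivative (\<lambda>h. cnj (frechet_derivative (iter_deriv vs f) (at x) h))) (at x)" for x
      using smooth_has_derivative[OF smooth_iter_deriv[OF assms that(1)]] has_derivative_cnj by blast
    show ?thesis using d pd_eq[OF d, of v] by (auto simp: differentiable_def)
  qed
  from smooth_iter_deriv_eqI[of ?F, OF _ 1]
  show "smooth (\<lambda>x. cnj (f x))"
    and "vs \<in> lists Basis \<Longrightarrow> iter_deriv vs (\<lambda>x. cnj (f x)) = (\<lambda>x. cnj (iter_deriv vs f x))" by auto
qed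

lemma has_derivative_cis_inner:
  "((\<lambda>x. cis (w \<bullet> x)) has_derivative (\<lambda>h. \<i> * of_real (w \<bullet> h) * cis (w \<bullet> x))) (at x)"
proof -
  have "((\<lambda>x. w \<bullet> x) has_derivative (\<lambda>h. w \<bullet> h)) (at x)"
    by (auto intro!: derivative_eq_intros)
  moreover have "(cis has_derivative (\<lambda>h. h *\<^sub>R (\<i> * cis t))) (at t)" for t
    unfolding cis_conv_exp has_vector_derivative_def[symmetric]
    by (auto intro!: derivative_eq_intros has_vector_derivative_real_field)
  ultimately show ?thesis
    using has_derivative_compose[of "\<lambda>x. w \<bullet> x" "\<lambda>h. w \<bullet> h" x UNIV cis "\<lambda>h. h *\<^sub>R (\<i> * cis (w \<bullet> x))"]
    by (simp add: scaleR_conv_of_real mult.assoc mult.left_commute)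
qed

text \<open>The symbol of an iterated derivative, by which it acts on the exponential with frequency \<open>w\<close>.\<close>

definition cprod :: "('a::euclidean_space) \<Rightarrow> 'a list \<Rightarrow> complex" where
  "cprod w vs = (\<Prod>v\<leftarrow>vs. \<i> * of_real (w \<bullet> v))"

lemma iter_deriv_cis:
  shows "smooth (\<lambda>x. cis (w \<bullet> x))"
    and "vs \<in> lists Basis \<Longrightarrow> iter_deriv vs (\<lambda>x. cis (w \<bullet> x)) = (\<lambda>x. cprod w vs * cis (w \<bullet> x))"
proof -
  let ?F = "\<lambda>vs x. cprod w vs * cis (w \<bullet> x)"
  have 1: "?F vs differentiable at x \<and> pd v (?F vs) = ?F (v # vs)"
    if "vs \<in> lists Basis" "v \<in> Basis" for vs v x
  proof -
    have d: "(?F vs has_derivative (\<lambda>h. cprod w vs * (\<i> * of_real (w \<bullet> h) * cis (w \<bullet> x)))) (at x)" for x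
      by (rule has_derivative_mult_right[OF has_derivative_cis_inner])
    show ?thesis using d pd_eq[OF d, of v] by (auto simp: differentiable_def cprod_def ac_simps)
  qed
  have 0: "?F [] = (\<lambda>x. cis (w \<bullet> x))" by (simp add: cprod_def)
  from smooth_iter_deriv_eqI[of ?F, OF 0 1]
  show "smooth (\<lambda>x. cis (w \<bullet> x))"
    and "vs \<in> lists Basis \<Longrightarrow> iter_deriv vs (\<lambda>x. cis (w \<bullet> x)) = (\<lambda>x. cprod w vs * cis (w \<bullet> x))" by auto
qed

lemma norm_cprod_le: "vs \<in> lists Basis \<Longrightarrow> cmod (cprod w vs) \<le> norm w ^ length vs"
proof (induction vs)
  case (Cons v vs)
  have "\<bar>w \<bullet> v\<bar> \<le> norm w" using Cons Basis_le_norm by auto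
  then show ?case using Cons by (auto simp: cprod_def norm_mult intro!: mult_mono)
qed (simp add: cprod_def)

section \<open>Bounded families of Schwartz functions\<close>

text \<open>Bounded sets of the Schwartz space, indexed so that a sequence can be treated as a whole.\<close>

definition bounded_family :: "('i \<Rightarrow> 'a::euclidean_space \<Rightarrow> complex) \<Rightarrow> bool" where
  "bounded_family f \<longleftrightarrow> (\<forall>i. smooth (f i)) \<and>
     (\<forall>vs \<in> lists Basis. \<forall>N. \<exists>K. \<forall>i x. (1 + norm x) ^ N * cmod (iter_deriv vs (f i) x) \<le> K)"

text \<open>Multipliers of the Schwartz space, with estimates that are uniform in the index. They refer to
  a set \<open>U\<close> because the partial sums of a Fourier series approximate a function on one cell only.\<close>

definition poly_growth_on :: "'a::euclidean_space set \<Rightarrow> ('i \<Rightarrow> 'a \<Rightarrow> complex) \<Rightarrow> bool" where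
  "poly_growth_on U f \<longleftrightarrow> (\<forall>i. smooth (f i)) \<and>
     (\<forall>vs \<in> lists Basis. \<exists>K N. \<forall>i. \<forall>x\<in>U. cmod (iter_deriv vs (f i) x) \<le> K * (1 + norm x) ^ N)"

abbreviation poly_growth :: "('i \<Rightarrow> 'a::euclidean_space \<Rightarrow> complex) \<Rightarrow> bool" where
  "poly_growth \<equiv> poly_growth_on UNIV"

lemma poly_growth_def:
  "poly_growth f \<longleftrightarrow> (\<forall>i. smooth (f i)) \<and>
     (\<forall>vs \<in> lists Basis. \<exists>K N. \<forall>i x. cmod (iter_deriv vs (f i) x) \<le> K * (1 + norm x) ^ N)"
  by (simp add: poly_growth_on_def)

lemma bounded_familyD: "bounded_family f \<Longrightarrow> vs \<in> lists Basis \<Longrightarrow> \<exists>K>0. \<forall>i x. (1 + norm x) ^ N * cmod (iter_deriv vs (f i) x) \<le> K"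
proof -
  assume "bounded_family f" "vs \<in> lists Basis"
  then obtain K where K: "\<And>i x. (1 + norm x) ^ N * cmod (iter_deriv vs (f i) x) \<le> K"
    unfolding bounded_family_def by blast
  show ?thesis by (intro exI[of _ "\<bar>K\<bar> + 1"]) (use K in \<open>auto intro: order_trans[OF K]\<close>)
qed

lemma schwartz_iff_bounded_family: "f \<in> schwartz \<longleftrightarrow> bounded_family (\<lambda>_::'i. f)"
proof -
  have "(\<exists>K. \<forall>x. cmod ((1 + norm x) ^ N *\<^sub>R iter_deriv vs f x) \<le> K) \<longleftrightarrow>
    (\<exists>K. \<forall>i::'i. \<forall>x. (1 + norm x) ^ N * cmod (iter_deriv vs f x) \<le> K)" for vs N
    by (simp add: abs_of_nonneg)
  then show ?thesis unfolding schwartz_def bounded_family_def bounded_iff by auto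
qed

lemma bounded_family_schwartz: "bounded_family f \<Longrightarrow> f i \<in> schwartz"
  unfolding schwartz_iff_bounded_family[where 'i=unit] bounded_family_def by meson

lemma schwartz_smooth: "f \<in> schwartz \<Longrightarrow> smooth f" by (simp add: schwartz_def)

lemma bounded_family_pd: fixes f :: "'i \<Rightarrow> 'a::euclidean_space \<Rightarrow> complex" assumes "bounded_family f" "v \<in> Basis" shows "bounded_family (\<lambda>i. pd v (f i))"
  unfolding bounded_family_def
proof (intro conjI allI ballI)
  fix vs :: "'a list" and N assume "vs \<in> lists Basis"
  then have "vs @ [v] \<in> lists Basis" using assms by auto
  then show "\<exists>K. \<forall>i x. (1 + norm x) ^ N * cmod (iter_deriv vs (pd v (f i)) x) \<le> K"
    using assms(1) unfolding bounded_family_def iter_deriv_snoc[symmetric] by blast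
qed (use assms in \<open>auto simp: bounded_family_def smooth_pd\<close>)

lemma poly_growth_on_pd:
  fixes f :: "'i \<Rightarrow> 'a::euclidean_space \<Rightarrow> complex"
  assumes "poly_growth_on U f" "v \<in> Basis"
  shows "poly_growth_on U (\<lambda>i. pd v (f i))"
  unfolding poly_growth_on_def
proof (intro conjI allI ballI)
  fix vs :: "'a list" assume "vs \<in> lists Basis"
  then have "vs @ [v] \<in> lists Basis" using assms by auto
  then show "\<exists>K N. \<forall>i. \<forall>x\<in>U. cmod (iter_deriv vs (pd v (f i)) x) \<le> K * (1 + norm x) ^ N"
    using assms(1) unfolding poly_growth_on_def iter_deriv_snoc[symmetric] by blast
qed (use assms in \<open>auto simp: poly_growth_on_def smooth_pd\<close>)

lemma bounded_family_add: fixes f :: "'i \<Rightarrow> 'a::euclidean_space \<Rightarrow> complex" assumes "bounded_family f" "bounded_family g" shows "bounded_family (\<lambda>i x. f i x + g i x)"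
  unfolding bounded_family_def
proof (intro conjI allI ballI)
  fix vs :: "'a list" and N assume vs: "vs \<in> lists Basis"
  obtain K1 K2 where K: "\<And>i x. (1 + norm x) ^ N * cmod (iter_deriv vs (f i) x) \<le> K1"
    "\<And>i x. (1 + norm x) ^ N * cmod (iter_deriv vs (g i) x) \<le> K2"
    using bounded_familyD[OF assms(1) vs] bounded_familyD[OF assms(2) vs] by meson
  have "(1 + norm x) ^ N * cmod (iter_deriv vs (\<lambda>x. f i x + g i x) x) \<le> K1 + K2" for i x
  proof -
    have "(1 + norm x) ^ N * cmod (iter_deriv vs (f i) x + iter_deriv vs (g i) x)
      \<le> (1 + norm x) ^ N * (cmod (iter_deriv vs (f i) x) + cmod (iter_deriv vs (g i) x))"
      by (intro mult_left_mono norm_triangle_ineq) auto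
    then show ?thesis using K[of x i] assms vs
      by (simp add: iter_deriv_add bounded_family_def distrib_left)
  qed
  then show "\<exists>K. \<forall>i x. (1 + norm x) ^ N * cmod (iter_deriv vs (\<lambda>x. f i x + g i x) x) \<le> K" by blast
qed (use assms in \<open>auto simp: bounded_family_def intro: smooth_add\<close>)

text \<open>By the product rule; both families vary in the induction, as one factor is replaced by its derivative.\<close>

lemma bounded_family_mult_on:
  fixes f :: "'i \<Rightarrow> 'a::euclidean_space \<Rightarrow> complex"
  assumes "vs \<in> lists Basis" "bounded_family f" "poly_growth_on U g"
  shows "\<exists>K. \<forall>i. \<forall>x\<in>U. (1 + norm x) ^ N * cmod (iter_deriv vs (\<lambda>x. f i x * g i x) x) \<le> K"
  using assms
proof (induction vs arbitrary: f g rule: rev_induct)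
  case Nil
  obtain K M where K: "\<And>i x. x \<in> U \<Longrightarrow> cmod (g i x) \<le> K * (1 + norm x) ^ M"
    using \<open>poly_growth_on U g\<close> unfolding poly_growth_on_def by (metis iter_deriv.simps(1) lists.Nil)
  obtain L where L: "\<And>i x. (1 + norm x) ^ (N + M) * cmod (f i x) \<le> L"
    using bounded_familyD[OF \<open>bounded_family f\<close>, of "[]" "N + M"] by auto
  have "(1 + norm x) ^ N * cmod (f i x * g i x) \<le> L * \<bar>K\<bar>" if "x \<in> U" for i x
  proof -
    have "cmod (g i x) \<le> \<bar>K\<bar> * (1 + norm x) ^ M"
      by (rule order_trans[OF K[OF that]]) (intro mult_right_mono, auto)
    then have "(1 + norm x) ^ N * cmod (f i x * g i x) \<le> (1 + norm x) ^ N * (cmod (f i x) * (\<bar>K\<bar> * (1 + norm x) ^ M))"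
      unfolding norm_mult by (intro mult_left_mono) auto
    also have "\<dots> = (1 + norm x) ^ (N + M) * cmod (f i x) * \<bar>K\<bar>" by (simp add: power_add)
    also have "\<dots> \<le> L * \<bar>K\<bar>" by (intro mult_right_mono L) auto
    finally show ?thesis .
  qed
  then show ?case by auto
next
  case (snoc v vs)
  then have v: "v \<in> Basis" "vs \<in> lists Basis" by auto
  have sm: "smooth (f i)" "smooth (g i)" for i using snoc.prems by (auto simp: bounded_family_def poly_growth_on_def)
  have eq: "iter_deriv (vs @ [v]) (\<lambda>x. f i x * g i x) =
    (\<lambda>x. iter_deriv vs (\<lambda>x. pd v (f i) x * g i x) x + iter_deriv vs (\<lambda>x. f i x * pd v (g i) x) x)" for i
    unfolding iter_deriv_snoc using sm[of i] v
    by (subst pd_mult) (auto simp: smooth_differentiable smooth_pd intro!: iter_deriv_add smooth_mult)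
  obtain K1 where 1: "\<And>i x. x \<in> U \<Longrightarrow> (1 + norm x) ^ N * cmod (iter_deriv vs (\<lambda>x. pd v (f i) x * g i x) x) \<le> K1"
    using snoc.IH[OF v(2) bounded_family_pd[OF snoc.prems(2) v(1)] snoc.prems(3)] by blast
  obtain K2 where 2: "\<And>i x. x \<in> U \<Longrightarrow> (1 + norm x) ^ N * cmod (iter_deriv vs (\<lambda>x. f i x * pd v (g i) x) x) \<le> K2"
    using snoc.IH[OF v(2) snoc.prems(2) poly_growth_on_pd[OF snoc.prems(3) v(1)]] by blast
  have "(1 + norm x) ^ N * cmod (iter_deriv (vs @ [v]) (\<lambda>x. f i x * g i x) x) \<le> K1 + K2" if "x \<in> U" for i x
  proof -
    have "(1 + norm x) ^ N * cmod (iter_deriv (vs @ [v]) (\<lambda>x. f i x * g i x) x) \<le>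
      (1 + norm x) ^ N * (cmod (iter_deriv vs (\<lambda>x. pd v (f i) x * g i x) x) + cmod (iter_deriv vs (\<lambda>x. f i x * pd v (g i) x) x))"
      unfolding eq by (intro mult_left_mono norm_triangle_ineq) auto
    then show ?thesis using 1[OF that, of i] 2[OF that, of i] by (simp add: distrib_left)
  qed
  then show ?case by blast
qed

lemma bounded_family_mult:
  fixes f :: "'i \<Rightarrow> 'a::euclidean_space \<Rightarrow> complex"
  assumes "bounded_family f" "poly_growth g" shows "bounded_family (\<lambda>i x. f i x * g i x)"
  using bounded_family_mult_on[OF _ assms] assms by (auto simp: bounded_family_def poly_growth_def intro: smooth_mult)

lemma poly_growth_const: "poly_growth (\<lambda>i (x::'a::euclidean_space). c)"
proof -
  have "cmod (iter_deriv vs (\<lambda>x. c) x) \<le> cmod c * (1 + norm x) ^ 0" for vs and x :: 'a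
    by (simp add: iter_deriv_const)
  then show ?thesis unfolding poly_growth_def by (blast intro: smooth_const)
qed

lemma poly_growth_inner: "poly_growth (\<lambda>i x. of_real (x \<bullet> v))" for v :: "'a::euclidean_space"
proof -
  have d: "((\<lambda>x. complex_of_real (x \<bullet> v)) has_derivative (\<lambda>h. of_real (h \<bullet> v))) (at x)" for x
    by (auto intro!: derivative_eq_intros)
  define F where "F vs = (case vs of [] \<Rightarrow> (\<lambda>x. complex_of_real (x \<bullet> v)) | w # ws \<Rightarrow>
    (\<lambda>x. if ws = [] then of_real (w \<bullet> v) else 0))" for vs :: "'a list"
  have "F vs differentiable at x \<and> pd w (F vs) = F (w # vs)" for vs w x
    using d by (cases vs) (auto simp: F_def pd_eq[OF d] differentiable_def)
  note * = smooth_iter_deriv_eqI[of F, OF _ this]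
  have F0: "F [] = (\<lambda>x. complex_of_real (x \<bullet> v))" by (simp add: F_def)
  show ?thesis unfolding poly_growth_def
  proof (intro conjI allI ballI)
    show "smooth (\<lambda>x. complex_of_real (x \<bullet> v))" using *(1)[OF F0] by simp
    fix vs :: "'a list" assume vs: "vs \<in> lists Basis"
    have "cmod (F vs x) \<le> (norm v * (1 + (case vs of [] \<Rightarrow> 0 | w # ws \<Rightarrow> norm w))) * (1 + norm x) ^ 1" for x
    proof (cases vs)
      case Nil
      have "\<bar>x \<bullet> v\<bar> \<le> norm x * norm v" by (rule Cauchy_Schwarz_ineq2)
      also have "\<dots> \<le> norm v * (1 + norm x)" by (simp add: algebra_simps)
      finally show ?thesis using Nil by (simp add: F_def)
    next
      case (Cons w ws)
      have a: "\<bar>w \<bullet> v\<bar> \<le> norm w * norm v" by (rule Cauchy_Schwarz_ineq2)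
      have "0 \<le> norm v" "0 \<le> norm v * norm w" "0 \<le> norm v * norm x" "0 \<le> norm v * norm w * norm x" by auto
      then have "norm w * norm v \<le> norm v * (1 + norm w) * (1 + norm x)" by (simp add: algebra_simps)
      with a show ?thesis using Cons by (auto simp: F_def)
    qed
    then show "\<exists>K N. \<forall>i x. cmod (iter_deriv vs (\<lambda>x. complex_of_real (x \<bullet> v)) x) \<le> K * (1 + norm x) ^ N"
      using *(2)[OF F0 vs] by metis
  qed
qed

lemma poly_growth_cis: "poly_growth (\<lambda>i x. cis (w \<bullet> x))" for w :: "'a::euclidean_space"
  unfolding poly_growth_def
proof (intro conjI allI ballI)
  fix vs :: "'a list" assume vs: "vs \<in> lists Basis"
  show "\<exists>K N. \<forall>i x. cmod (iter_deriv vs (\<lambda>x. cis (w \<bullet> x)) x) \<le> K * (1 + norm x) ^ N"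
    by (rule exI[of _ "cmod (cprod w vs)"], rule exI[of _ 0]) (simp add: iter_deriv_cis(2)[OF vs] norm_mult)
qed (rule iter_deriv_cis(1))

lemma schwartz_poly_growth: assumes "f \<in> schwartz" shows "poly_growth (\<lambda>i. f)"
  unfolding poly_growth_def
proof (intro conjI allI ballI)
  fix vs :: "'a list" assume vs: "vs \<in> lists Basis"
  obtain K where "\<And>x. (1 + norm x) ^ 0 * cmod (iter_deriv vs f x) \<le> K"
    using bounded_familyD[OF assms[unfolded schwartz_iff_bounded_family[where 'i=unit]] vs, of 0] by auto
  then show "\<exists>K N. \<forall>i x. cmod (iter_deriv vs f x) \<le> K * (1 + norm x) ^ N"
    by (intro exI[of _ K] exI[of _ 0]) simp
qed (use assms in \<open>auto simp: schwartz_def\<close>)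

lemma schwartz_add: "f \<in> schwartz \<Longrightarrow> g \<in> schwartz \<Longrightarrow> (\<lambda>x. f x + g x) \<in> schwartz"
  unfolding schwartz_iff_bounded_family[where 'i=unit] by (rule bounded_family_add)

lemma schwartz_mult_poly_growth: "f \<in> schwartz \<Longrightarrow> poly_growth (\<lambda>_::unit. g) \<Longrightarrow> (\<lambda>x. f x * g x) \<in> schwartz"
  unfolding schwartz_iff_bounded_family[where 'i=unit] by (rule bounded_family_mult)

lemma schwartz_mult: "f \<in> schwartz \<Longrightarrow> g \<in> schwartz \<Longrightarrow> (\<lambda>x. f x * g x) \<in> schwartz"
  by (rule schwartz_mult_poly_growth[OF _ schwartz_poly_growth])

lemma schwartz_cmult: "f \<in> schwartz \<Longrightarrow> (\<lambda>x. c * f x) \<in> schwartz"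
  using schwartz_mult_poly_growth[OF _ poly_growth_const, of f c] by (simp add: mult.commute)

lemma schwartz_cnj: assumes "f \<in> schwartz" shows "(\<lambda>x. cnj (f x)) \<in> schwartz"
  using assms unfolding schwartz_def bounded_iff by (auto simp: iter_deriv_cnj)

lemma schwartz_affine:
  assumes f: "f \<in> schwartz" and s: "s \<noteq> 0" shows "(\<lambda>x. f (s *\<^sub>R (x - c))) \<in> schwartz"
  unfolding schwartz_iff_bounded_family[where 'i=unit] bounded_family_def
proof (intro conjI allI ballI)
  show "smooth (\<lambda>x. f (s *\<^sub>R (x - c)))" by (rule iter_deriv_affine[OF schwartz_smooth[OF f]])
  fix vs :: "'a list" and N assume vs: "vs \<in> lists Basis"
  obtain K where K: "K > 0" "\<And>x. (1 + norm x) ^ N * cmod (iter_deriv vs f x) \<le> K"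
    using bounded_familyD[OF f[unfolded schwartz_iff_bounded_family[where 'i=unit]] vs, of N] by auto
  define B where "B = 1 + norm c + 1 / \<bar>s\<bar>"
  have "(1 + norm x) ^ N * cmod (iter_deriv vs (\<lambda>x. f (s *\<^sub>R (x - c))) x) \<le> B ^ N * \<bar>s\<bar> ^ length vs * K" for x
  proof -
    let ?y = "s *\<^sub>R (x - c)"
    have "1 + norm x \<le> B * (1 + norm ?y)"
    proof -
      have 1: "norm x \<le> norm c + norm (x - c)" by (metis add.commute norm_triangle_sub)
      have 2: "norm (x - c) = norm ?y * (1 / \<bar>s\<bar>)" using s by simp
      have "0 \<le> norm ?y" "0 \<le> norm c * norm ?y" "0 \<le> 1 / \<bar>s\<bar>" by auto
      moreover have "1 / \<bar>s\<bar> * norm ?y = norm (x - c)" using 2 by simp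
      ultimately show ?thesis using 1 unfolding B_def distrib_right distrib_left by linarith
    qed
    then have "(1 + norm x) ^ N \<le> (B * (1 + norm ?y)) ^ N" by (intro power_mono) auto
    then have "(1 + norm x) ^ N * cmod (iter_deriv vs (\<lambda>x. f (s *\<^sub>R (x - c))) x) \<le>
       (B * (1 + norm ?y)) ^ N * (\<bar>s\<bar> ^ length vs * cmod (iter_deriv vs f ?y))"
      unfolding iter_deriv_affine(2)[OF schwartz_smooth[OF f] vs]
      by (simp add: norm_mult norm_power mult_right_mono)
    also have "\<dots> = B ^ N * \<bar>s\<bar> ^ length vs * ((1 + norm ?y) ^ N * cmod (iter_deriv vs f ?y))"
      by (simp add: power_mult_distrib)
    also have "\<dots> \<le> B ^ N * \<bar>s\<bar> ^ length vs * K"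
      by (intro mult_left_mono K) (auto simp: B_def)
    finally show ?thesis .
  qed
  then show "\<exists>K. \<forall>(i::unit) x. (1 + norm x) ^ N * cmod (iter_deriv vs (\<lambda>x. f (s *\<^sub>R (x - c))) x) \<le> K" by blast
qed

lemma schwartz_uminus: "f \<in> schwartz \<Longrightarrow> (\<lambda>x. f (- x)) \<in> schwartz"
  using schwartz_affine[of f "-1" 0] by simp

text \<open>A smooth function with compact support is a Schwartz function, as its derivatives vanish
  outside the support as well.\<close>

lemma iter_deriv_outside:
  assumes "\<And>x. norm x > T \<Longrightarrow> f x = 0" "norm x > T"
  shows "iter_deriv vs f x = 0"
proof -
  have "open {x::'a. norm x > T}" by (intro open_Collect_less continuous_intros)
  then have "iter_deriv vs f x = iter_deriv vs (\<lambda>_. 0) x"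
    by (rule iter_deriv_local) (use assms in auto)
  then show ?thesis by (simp add: iter_deriv_zero)
qed

lemma schwartz_compact_support:
  assumes "smooth f" "\<And>x. norm x > T \<Longrightarrow> f x = 0"
  shows "f \<in> schwartz"
  unfolding schwartz_def
proof (intro CollectI conjI ballI allI assms)
  fix vs :: "'a list" and N assume vs: "vs \<in> lists Basis"
  let ?g = "\<lambda>x. (1 + norm x) ^ N *\<^sub>R iter_deriv vs f x"
  have "compact (?g ` cball 0 T)"
    by (intro compact_continuous_image continuous_intros smooth_continuous_on smooth_iter_deriv assms vs) auto
  then have "bounded (insert 0 (?g ` cball 0 T))" using compact_imp_bounded by auto
  moreover have "range ?g \<subseteq> insert 0 (?g ` cball 0 T)"
    using iter_deriv_outside[of T f, OF assms(2)] by (force simp: not_le)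
  ultimately show "bounded (range ?g)" by (rule bounded_subset)
qed

lemma schwartz_zero: "(\<lambda>x. 0) \<in> schwartz"
  by (rule schwartz_compact_support[of _ 0]) (auto intro: smooth_const)

section \<open>Integration of rapidly decaying functions\<close>

lemma lborel_affine_integral:
  fixes f :: "'a::euclidean_space \<Rightarrow> complex"
  assumes [measurable]: "f \<in> borel_measurable borel" and c: "c \<noteq> 0"
  shows "integrable lborel (\<lambda>x. f (t + c *\<^sub>R x)) \<longleftrightarrow> integrable lborel f"
    and "(LINT x|lborel. f (t + c *\<^sub>R x)) = of_real (1 / \<bar>c\<bar> ^ DIM('a)) * (LINT x|lborel. f x)"
proof -
  have e: "integrable lborel f \<longleftrightarrow> integrable lborel (\<lambda>x. \<bar>c\<bar> ^ DIM('a) *\<^sub>R f (t + c *\<^sub>R x))"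
    by (subst lborel_affine[OF c, of t], subst integrable_density) (auto simp: integrable_distr_eq)
  show "integrable lborel (\<lambda>x. f (t + c *\<^sub>R x)) \<longleftrightarrow> integrable lborel f"
  proof -
    have "complex_of_real (\<bar>c\<bar> ^ DIM('a)) \<noteq> 0" using c by simp
    then show ?thesis unfolding e scaleR_conv_of_real
      using integrable_mult_right[of "complex_of_real (\<bar>c\<bar> ^ DIM('a))" lborel "\<lambda>x. f (t + c *\<^sub>R x)"]
        integrable_mult_right[of "inverse (complex_of_real (\<bar>c\<bar> ^ DIM('a)))" lborel
          "\<lambda>x. complex_of_real (\<bar>c\<bar> ^ DIM('a)) * f (t + c *\<^sub>R x)"]
      by (auto simp: mult.assoc[symmetric])
  qed
  have "(LINT x|lborel. f x) = (LINT x|lborel. \<bar>c\<bar> ^ DIM('a) *\<^sub>R f (t + c *\<^sub>R x))"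
    by (subst lborel_affine[OF c, of t], subst integral_density) (auto simp: integral_distr)
  then show "(LINT x|lborel. f (t + c *\<^sub>R x)) = of_real (1 / \<bar>c\<bar> ^ DIM('a)) * (LINT x|lborel. f x)"
    using c by (simp add: scaleR_conv_of_real)
qed

text \<open>The exponent exceeds the dimension, so that this majorant of Schwartz functions is integrable.\<close>

definition decay :: "'a::euclidean_space \<Rightarrow> real" where
  "decay x = 1 / (1 + norm x) ^ (DIM('a) + 2)"

lemma decay_pos: "0 < decay x" unfolding decay_def by (intro divide_pos_pos zero_less_power) (auto intro: add_pos_nonneg)

lemma decay_measurable [measurable]: "decay \<in> borel_measurable borel"
  unfolding decay_def by measurable

text \<open>The unit shell at radius \<open>n\<close> sits in a ball of volume of order \<open>n ^ d\<close>, which leaves a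
  convergent series of inverse squares.\<close>

lemma integrable_decay: "integrable lborel (decay :: 'a::euclidean_space \<Rightarrow> real)"
proof (rule integrableI_bounded)
  let ?d = "DIM('a)"
  define V where "V = unit_ball_vol ?d"
  have V: "0 \<le> V" unfolding V_def by simp
  have "(\<integral>\<^sup>+ x. ennreal (norm (decay (x::'a))) \<partial>lborel) \<le>
    (\<integral>\<^sup>+ x. (\<Sum>n. ennreal (1 / real (n + 1) ^ (?d + 2)) * indicator (ball (0::'a) (real (n + 1))) x) \<partial>lborel)"
  proof (intro nn_integral_mono)
    fix x :: 'a
    define n where "n = nat \<lfloor>norm x\<rfloor>"
    have "real n = of_int \<lfloor>norm x\<rfloor>" unfolding n_def by simp
    then have n: "real n \<le> norm x" "norm x < real (n + 1)" by linarith+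
    have "decay x \<le> 1 / real (n + 1) ^ (?d + 2)"
      unfolding decay_def using n by (intro divide_left_mono power_mono mult_pos_pos zero_less_power) auto
    then have "ennreal (norm (decay x)) \<le> ennreal (1 / real (n + 1) ^ (?d + 2)) * indicator (ball (0::'a) (real (n + 1))) x"
      using n less_imp_le[OF decay_pos[of x]] by (simp add: ennreal_leI)
    also have "\<dots> \<le> (\<Sum>n. ennreal (1 / real (n + 1) ^ (?d + 2)) * indicator (ball (0::'a) (real (n + 1))) x)"
      using sum_le_suminf[of "\<lambda>n. ennreal (1 / real (n + 1) ^ (?d + 2)) * indicator (ball (0::'a) (real (n + 1))) x" "{n}"]
      by (simp del: sum_mult_indicator indicator_simps)
    finally show "ennreal (norm (decay x)) \<le> \<dots>" .
  qed
  also have "\<dots> = (\<Sum>n. \<integral>\<^sup>+ x. ennreal (1 / real (n + 1) ^ (?d + 2)) * indicator (ball (0::'a) (real (n + 1))) x \<partial>lborel)"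
  proof (rule nn_integral_suminf)
    note borel_open[OF open_ball, measurable]
    show "(\<lambda>x. ennreal (1 / real (n + 1) ^ (?d + 2)) * indicator (ball (0::'a) (real (n + 1))) x) \<in> borel_measurable lborel" for n
      by measurable
  qed
  also have "\<dots> = (\<Sum>n. ennreal (V * (1 / real (n + 1) ^ 2)))"
  proof (intro suminf_cong)
    fix n
    have "(\<integral>\<^sup>+ x. ennreal (1 / real (n + 1) ^ (?d + 2)) * indicator (ball (0::'a) (real (n + 1))) x \<partial>lborel)
      = ennreal (1 / real (n + 1) ^ (?d + 2)) * emeasure lborel (ball (0::'a) (real (n + 1)))"
      by (subst nn_integral_cmult_indicator) auto
    also have "emeasure lborel (ball (0::'a) (real (n + 1))) = ennreal (V * real (n + 1) ^ ?d)"
      unfolding V_def by (rule emeasure_ball) simp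
    also have "ennreal (1 / real (n + 1) ^ (?d + 2)) * ennreal (V * real (n + 1) ^ ?d) =
        ennreal (1 / real (n + 1) ^ (?d + 2) * (V * real (n + 1) ^ ?d))"
      by (rule ennreal_mult'[symmetric]) simp
    also have "1 / real (n + 1) ^ (?d + 2) * (V * real (n + 1) ^ ?d) = V * (1 / real (n + 1) ^ 2)"
      by (simp add: power_add power2_eq_square field_simps del: of_nat_Suc of_nat_add)
    finally show "(\<integral>\<^sup>+ x. ennreal (1 / real (n + 1) ^ (?d + 2)) * indicator (ball (0::'a) (real (n + 1))) x \<partial>lborel)
      = ennreal (V * (1 / real (n + 1) ^ 2))" .
  qed
  also have "\<dots> < \<infinity>"
  proof -
    have "summable (\<lambda>n. V * (1 / real (n + 1) ^ 2))"
      using inverse_power_summable[of 2, where 'a=real] summable_Suc_iff[of "\<lambda>n. inverse (real n ^ 2)"]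
      by (intro summable_mult) (simp add: field_simps)
    then show ?thesis using V by (subst suminf_ennreal2) auto
  qed
  finally show "(\<integral>\<^sup>+ x. ennreal (norm (decay (x::'a))) \<partial>lborel) < \<infinity>" .
qed simp

text \<open>Besides Schwartz functions these are the bounded functions with bounded support, which have
  smooth transforms as well.\<close>

definition rapid :: "('a::euclidean_space \<Rightarrow> complex) \<Rightarrow> bool" where
  "rapid f \<longleftrightarrow> f \<in> borel_measurable borel \<and> (\<forall>N. integrable lborel (\<lambda>t. (1 + norm t) ^ N * cmod (f t)))"

lemma bounded_family_bound:
  fixes f :: "'i \<Rightarrow> 'a::euclidean_space \<Rightarrow> complex"
  assumes "bounded_family f" "vs \<in> lists Basis"
  shows "\<exists>K>0. \<forall>i x. cmod (iter_deriv vs (f i) x) \<le> K / (1 + norm x) ^ N"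
proof -
  obtain K where K: "K > 0" "\<And>i x. (1 + norm x) ^ N * cmod (iter_deriv vs (f i) x) \<le> K"
    using bounded_familyD[OF assms] by blast
  have "cmod (iter_deriv vs (f i) x) \<le> K / (1 + norm x) ^ N" for i x
  proof -
    have "0 < (1 + norm x) ^ N" by (intro zero_less_power add_pos_nonneg) auto
    then show ?thesis using K(2)[of x i] by (simp add: pos_le_divide_eq mult.commute)
  qed
  then show ?thesis using K(1) by blast
qed

lemma bounded_family_bound_decay:
  fixes f :: "'i \<Rightarrow> 'a::euclidean_space \<Rightarrow> complex"
  assumes "bounded_family f"
  shows "\<exists>K>0. \<forall>i x. (1 + norm x) ^ N * cmod (f i x) \<le> K * decay x"
proof -
  obtain K where K: "K > 0" "\<And>i x. cmod (iter_deriv [] (f i) x) \<le> K / (1 + norm x) ^ (N + (DIM('a) + 2))"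
    using bounded_family_bound[OF assms, of "[]"] by blast
  have "(1 + norm x) ^ N * cmod (f i x) \<le> K * decay x" for i x
  proof -
    have p: "0 < (1 + norm x) ^ N" by (intro zero_less_power add_pos_nonneg) auto
    have "(1 + norm x) ^ N * cmod (f i x) \<le> (1 + norm x) ^ N * (K / (1 + norm x) ^ (N + (DIM('a) + 2)))"
      using K(2)[of i x] p by (intro mult_left_mono) auto
    also have "\<dots> = K * decay x" using p unfolding power_add[of _ N] decay_def by simp
    finally show ?thesis .
  qed
  then show ?thesis using K(1) by blast
qed

lemma schwartz_bound_decay:
  fixes f :: "'a::euclidean_space \<Rightarrow> complex"
  assumes "f \<in> schwartz"
  shows "\<exists>K>0. \<forall>x. (1 + norm x) ^ N * cmod (f x) \<le> K * decay x"
  using bounded_family_bound_decay[OF assms[unfolded schwartz_iff_bounded_family[where 'i=unit]]] by simp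

lemma schwartz_borel [measurable_dest]: "f \<in> schwartz \<Longrightarrow> f \<in> borel_measurable borel"
  using smooth_borel_measurable schwartz_smooth by blast

lemma schwartz_rapid: assumes f: "f \<in> schwartz" shows "rapid f"
  unfolding rapid_def
proof (intro conjI allI)
  show [measurable]: "f \<in> borel_measurable borel" using f by measurable
  fix N
  obtain K where "\<And>x. (1 + norm x) ^ N * cmod (f x) \<le> K * decay x"
    using schwartz_bound_decay[OF f] by blast
  then show "integrable lborel (\<lambda>t. (1 + norm t) ^ N * cmod (f t))"
    by (intro Bochner_Integration.integrable_bound[OF integrable_mult_right[OF integrable_decay, of K]])
       (auto simp: abs_of_nonneg intro: order_trans[OF _ abs_ge_self])
qed

lemma rapid_integrable: "rapid f \<Longrightarrow> integrable lborel f"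
  using integrable_norm_cancel[of lborel f] unfolding rapid_def by (auto dest: spec[of _ 0])

lemma rapid_mult_bounded:
  assumes "rapid f" "g \<in> borel_measurable borel" "\<And>x. cmod (g x) \<le> K * (1 + norm x) ^ M"
  shows "rapid (\<lambda>x. g x * f x)"
  unfolding rapid_def
proof (intro conjI allI)
  have [measurable]: "f \<in> borel_measurable borel" using assms by (simp add: rapid_def)
  note assms(2)[measurable]
  show "(\<lambda>x. g x * f x) \<in> borel_measurable borel" by measurable
  fix N
  have i: "integrable lborel (\<lambda>x. K * ((1 + norm x) ^ (N + M) * cmod (f x)))"
    using assms(1) by (auto simp: rapid_def)
  show "integrable lborel (\<lambda>x. (1 + norm x) ^ N * cmod (g x * f x))"
  proof (rule Bochner_Integration.integrable_bound[OF i])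
    have "(1 + norm x) ^ N * (cmod (g x) * cmod (f x)) \<le> (1 + norm x) ^ N * ((K * (1 + norm x) ^ M) * cmod (f x))" for x
      using assms(3)[of x] by (intro mult_left_mono mult_right_mono) auto
    then have "norm ((1 + norm x) ^ N * cmod (g x * f x)) \<le> norm (K * ((1 + norm x) ^ (N + M) * cmod (f x)))" for x
      by (simp add: norm_mult power_add abs_of_nonneg algebra_simps) (metis abs_ge_self abs_mult order_trans mult.commute)
    then show "AE x in lborel. norm ((1 + norm x) ^ N * cmod (g x * f x)) \<le> norm (K * ((1 + norm x) ^ (N + M) * cmod (f x)))"
      by simp
  qed measurable
qed

section \<open>The Fourier transform on Schwartz functions\<close>

lemma cis_taylor2: "cmod (cis y - 1 - \<i> * of_real y) \<le> y\<^sup>2"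
  using Taylor_exp[of "\<i> * of_real y" 1] by (simp add: cis_conv_exp norm_mult numeral_2_eq_2 algebra_simps power2_eq_square)

lemma cis_borel [measurable]: "cis \<in> borel_measurable borel"
  by (intro borel_measurable_continuous_onI continuous_intros)

lemma integrable_cis:
  assumes "integrable lborel f" "g \<in> borel_measurable borel"
  shows "integrable lborel (\<lambda>t. f t * cis (g t))"
  by (rule Bochner_Integration.integrable_bound[OF assms(1)])
     (use assms borel_measurable_integrable[OF assms(1)] in \<open>auto simp: norm_mult\<close>)

lemma fourier_bound: "cmod (fourier f \<eta>) \<le> (LINT t|lborel. cmod (f t))"
  unfolding fourier_def using integral_norm_bound[of lborel "\<lambda>t. f t * cis (- (t \<bullet> \<eta>))"]
  by (simp add: norm_mult)

lemma inner_le_weight: "\<bar>t \<bullet> h\<bar> \<le> norm h * (1 + norm t)"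
proof -
  have "\<bar>t \<bullet> h\<bar> \<le> norm t * norm h" by (rule Cauchy_Schwarz_ineq2)
  also have "\<dots> \<le> norm h * (1 + norm t)" by (simp add: algebra_simps)
  finally show ?thesis .
qed

text \<open>Differentiation under the integral sign: by the second-order Taylor estimate for \<open>cis\<close>, the remainder is at most
  \<open>(norm h)\<^sup>2\<close> times a weighted integral of \<open>f\<close>.\<close>

lemma fourier_has_derivative:
  assumes f: "rapid f"
  shows "(fourier f has_derivative (\<lambda>h. fourier (\<lambda>t. - (\<i> * of_real (t \<bullet> h)) * f t) \<eta>)) (at \<eta>)"
proof (rule has_derivativeI_sandwich[of 1])
  have [measurable]: "f \<in> borel_measurable borel" using f by (simp add: rapid_def)
  let ?D = "\<lambda>h. fourier (\<lambda>t. - (\<i> * of_real (t \<bullet> h)) * f t) \<eta>"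
  define C where "C n = (LINT t|lborel. (1 + norm t) ^ n * cmod (f t))" for n :: nat
  have i: "integrable lborel (\<lambda>t. (1 + norm t) ^ n * cmod (f t))" for n using f by (simp add: rapid_def)
  have fi: "integrable lborel (\<lambda>t. f t * cis (- (t \<bullet> \<eta>)))" for \<eta>
    by (rule integrable_cis[OF rapid_integrable[OF f]]) simp
  have "rapid (\<lambda>t. - (\<i> * of_real (t \<bullet> h)) * f t)" for h
  proof (rule rapid_mult_bounded[OF f])
    show "cmod (- (\<i> * of_real (t \<bullet> h))) \<le> norm h * (1 + norm t) ^ 1" for t
      using inner_le_weight[of t h] by (simp add: norm_mult)
  qed measurable
  then have Di: "integrable lborel (\<lambda>t. - (\<i> * of_real (t \<bullet> h)) * f t * cis (- (t \<bullet> \<eta>)))" for h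
    by (intro integrable_cis rapid_integrable) auto
  show "bounded_linear ?D"
  proof (rule bounded_linear_intro)
    show "?D (x + y) = ?D x + ?D y" for x y
      unfolding fourier_def
      by (subst Bochner_Integration.integral_add[symmetric, OF Di Di])
         (rule Bochner_Integration.integral_cong, auto simp: inner_add_right algebra_simps)
    show "?D (r *\<^sub>R x) = r *\<^sub>R ?D x" for r x
      unfolding fourier_def
      by (subst integral_scaleR_right[symmetric])
         (rule Bochner_Integration.integral_cong, auto simp: scaleR_conv_of_real)
    show "norm (?D h) \<le> norm h * C 1" for h
    proof -
      have "norm (?D h) \<le> (LINT t|lborel. cmod (- (\<i> * of_real (t \<bullet> h)) * f t))" by (rule fourier_bound)
      also have "\<dots> \<le> (LINT t|lborel. norm h * ((1 + norm t) ^ 1 * cmod (f t)))"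
      proof (rule integral_mono')
        show "integrable lborel (\<lambda>t. norm h * ((1 + norm t) ^ 1 * cmod (f t)))"
          using i by (intro integrable_mult_right)
        fix t
        from mult_right_mono[OF inner_le_weight[of t h], of "cmod (f t)"]
        show "cmod (- (\<i> * of_real (t \<bullet> h)) * f t) \<le> norm h * ((1 + norm t) ^ 1 * cmod (f t))"
          by (simp add: norm_mult algebra_simps)
      qed auto
      finally show ?thesis by (simp add: C_def)
    qed
  qed
  show "((\<lambda>y. norm (y - \<eta>) * C 2) \<longlongrightarrow> 0) (at \<eta>)"
    by (auto intro!: tendsto_eq_intros)
  fix y assume y: "y \<noteq> \<eta>"
  define h where "h = y - \<eta>"
  have "norm (fourier f y - fourier f \<eta> - ?D h) \<le> norm h ^ 2 * C 2"
  proof -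
    have "fourier f y - fourier f \<eta> - ?D h =
      (LINT t|lborel. f t * cis (- (t \<bullet> y)) - f t * cis (- (t \<bullet> \<eta>)) - - (\<i> * of_real (t \<bullet> h)) * f t * cis (- (t \<bullet> \<eta>)))"
      unfolding fourier_def using fi Di by simp
    also have "norm \<dots> \<le> (LINT t|lborel. norm h ^ 2 * ((1 + norm t) ^ 2 * cmod (f t)))"
    proof (rule order_trans[OF integral_norm_bound integral_mono'])
      show "integrable lborel (\<lambda>t. norm h ^ 2 * ((1 + norm t) ^ 2 * cmod (f t)))"
        using i by (intro integrable_mult_right)
      fix t
      have e: "f t * cis (- (t \<bullet> y)) - f t * cis (- (t \<bullet> \<eta>)) - - (\<i> * of_real (t \<bullet> h)) * f t * cis (- (t \<bullet> \<eta>))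
        = f t * cis (- (t \<bullet> \<eta>)) * (cis (- (t \<bullet> h)) - 1 - \<i> * of_real (- (t \<bullet> h)))"
      proof -
        have "cis (- (t \<bullet> y)) = cis (- (t \<bullet> \<eta>)) * cis (- (t \<bullet> h))"
          by (simp add: h_def inner_diff_right cis_mult)
        then show ?thesis by (simp only:) (simp add: algebra_simps)
      qed
      have "(- (t \<bullet> h))\<^sup>2 \<le> (norm h * (1 + norm t))\<^sup>2"
        using inner_le_weight[of t h] by (simp add: abs_le_square_iff[symmetric] abs_mult)
      then have "cmod (cis (- (t \<bullet> h)) - 1 - \<i> * of_real (- (t \<bullet> h))) \<le> norm h ^ 2 * (1 + norm t) ^ 2"
        using cis_taylor2[of "- (t \<bullet> h)"] by (simp add: power_mult_distrib)
      from mult_left_mono[OF this, of "cmod (f t)"]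
      show "cmod (f t * cis (- (t \<bullet> y)) - f t * cis (- (t \<bullet> \<eta>)) - - (\<i> * of_real (t \<bullet> h)) * f t * cis (- (t \<bullet> \<eta>)))
        \<le> norm h ^ 2 * ((1 + norm t) ^ 2 * cmod (f t))"
        unfolding e norm_mult by (simp add: ac_simps)
    qed auto
    finally show ?thesis by (simp add: C_def)
  qed
  then show "norm (fourier f y - fourier f \<eta> - ?D (y - \<eta>)) / norm (y - \<eta>) \<le> norm (y - \<eta>) * C 2"
    using y unfolding h_def by (simp add: divide_le_eq power2_eq_square ac_simps)
qed auto

lemma cprod_borel [measurable]: "(\<lambda>t. cprod (- t) vs) \<in> borel_measurable borel"
  by (induction vs) (auto simp: cprod_def)

lemma rapid_cprod:
  assumes "rapid f" "vs \<in> lists Basis"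
  shows "rapid (\<lambda>t. cprod (- t) vs * f t)"
proof (rule rapid_mult_bounded[OF assms(1)])
  show "cmod (cprod (- t) vs) \<le> 1 * (1 + norm t) ^ length vs" for t
    using norm_cprod_le[OF assms(2), of "- t"] power_mono[of "norm t" "1 + norm t" "length vs"] by simp
qed measurable

lemma iter_deriv_fourier:
  assumes f: "rapid f"
  shows "smooth (fourier f)"
    and "vs \<in> lists Basis \<Longrightarrow> iter_deriv vs (fourier f) = fourier (\<lambda>t. cprod (- t) vs * f t)"
proof -
  let ?F = "\<lambda>vs. fourier (\<lambda>t. cprod (- t) vs * f t)"
  have 0: "?F [] = fourier f" by (simp add: cprod_def)
  have 1: "?F vs differentiable at x \<and> pd v (?F vs) = ?F (v # vs)" if "vs \<in> lists Basis" "v \<in> Basis" for vs v x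
    using fourier_has_derivative[OF rapid_cprod[OF f that(1)]]
      pd_eq[OF fourier_has_derivative[OF rapid_cprod[OF f that(1)]], of v]
    by (auto simp: differentiable_def cprod_def mult.assoc)
  from smooth_iter_deriv_eqI[of ?F, OF 0 1]
  show "smooth (fourier f)"
    and "vs \<in> lists Basis \<Longrightarrow> iter_deriv vs (fourier f) = fourier (\<lambda>t. cprod (- t) vs * f t)" by auto
qed

lemma difference_quotient_bound:
  assumes "smooth f" "0 < s" "\<And>r. 0 \<le> r \<Longrightarrow> r \<le> s \<Longrightarrow> cmod (pd v f (t + r *\<^sub>R v)) \<le> B"
  shows "cmod (f (t + s *\<^sub>R v) - f t) \<le> s * B"
proof -
  have vd: "((\<lambda>r. f (t + r *\<^sub>R v)) has_vector_derivative pd v f (t + r *\<^sub>R v)) (at r)" for r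
  proof -
    have a: "((\<lambda>r. t + r *\<^sub>R v) has_derivative (\<lambda>h. h *\<^sub>R v)) (at r)" by (auto intro!: derivative_eq_intros)
    show ?thesis
      using has_derivative_compose[OF a smooth_has_derivative[OF assms(1)]]
        linear_scale[OF has_derivative_linear[OF smooth_has_derivative[OF assms(1)]]]
      by (simp add: has_vector_derivative_def)
  qed
  have "norm (f (t + s *\<^sub>R v) - f (t + 0 *\<^sub>R v)) \<le> s * B - 0 * B"
  proof (rule differentiable_bound_general[where f="\<lambda>r. f (t + r *\<^sub>R v)" and \<phi>="\<lambda>r. r * B"
      and f'="\<lambda>r. pd v f (t + r *\<^sub>R v)" and \<phi>'="\<lambda>r. B"])
    show "continuous_on {0..s} (\<lambda>r. f (t + r *\<^sub>R v))"
      by (intro continuous_on_compose2[OF smooth_continuous_on[OF assms(1)]] continuous_intros) auto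
  qed (use assms vd in \<open>auto intro!: continuous_intros derivative_eq_intros\<close>)
  then show ?thesis by simp
qed

lemma fourier_translate:
  assumes f: "integrable lborel f"
  shows "fourier (\<lambda>t. f (t + c)) \<eta> = cis (c \<bullet> \<eta>) * fourier f \<eta>"
proof -
  have [measurable]: "f \<in> borel_measurable borel" using f by auto
  have "fourier (\<lambda>t. f (t + c)) \<eta> = (LINT t|lborel. cis (c \<bullet> \<eta>) * (f (c + 1 *\<^sub>R t) * cis (- ((c + 1 *\<^sub>R t) \<bullet> \<eta>))))"
    unfolding fourier_def
    by (rule Bochner_Integration.integral_cong) (auto simp: inner_add_left cis_mult add.commute mult.left_commute)
  also have "\<dots> = cis (c \<bullet> \<eta>) * (LINT t|lborel. (f (c + 1 *\<^sub>R t) * cis (- ((c + 1 *\<^sub>R t) \<bullet> \<eta>))))"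
    by simp
  also have "(LINT t|lborel. (f (c + 1 *\<^sub>R t) * cis (- ((c + 1 *\<^sub>R t) \<bullet> \<eta>)))) = fourier f \<eta>"
    by (subst lborel_affine_integral(2)[of "\<lambda>t. f t * cis (- (t \<bullet> \<eta>))" 1 c]) (auto simp: fourier_def)
  finally show ?thesis .
qed

text \<open>Translation invariance replaces integration by parts: the transforms of the difference
  quotients of \<open>f\<close> are multiples of the transform of \<open>f\<close>, and the quotients converge dominatedly.\<close>

lemma fourier_pd:
  fixes f :: "'a::euclidean_space \<Rightarrow> complex"
  assumes f: "f \<in> schwartz" and v: "v \<in> Basis"
  shows "fourier (pd v f) \<eta> = \<i> * of_real (v \<bullet> \<eta>) * fourier f \<eta>"
proof -
  have sm: "smooth f" using f by (rule schwartz_smooth)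
  have [measurable]: "f \<in> borel_measurable borel" "pd v f \<in> borel_measurable borel"
    using sm smooth_pd[OF sm v] by (auto intro: smooth_borel_measurable)
  let ?s = "\<lambda>n t. of_real (real (Suc n)) * (f (t + (1 / real (Suc n)) *\<^sub>R v) - f t)"
  let ?N = "DIM('a) + 2"
  have "bounded_family (\<lambda>_::unit. pd v f)"
    using f bounded_family_pd[of "\<lambda>_::unit. f", OF _ v] unfolding schwartz_iff_bounded_family[where 'i=unit] by simp
  from bounded_family_bound[OF this, of "[]" ?N] obtain K where
    K: "K > 0" "\<And>x. cmod (pd v f x) \<le> K / (1 + norm x) ^ ?N" by auto
  \<comment> \<open>The mean value theorem; a shift by at most 1 changes the decay by a bounded factor.\<close>
  have bnd: "cmod (?s n t) \<le> K * 2 ^ ?N * decay t" for n t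
  proof -
    have "cmod (f (t + (1 / real (Suc n)) *\<^sub>R v) - f t) \<le> (1 / real (Suc n)) * (K * 2 ^ ?N * decay t)"
    proof (rule difference_quotient_bound[OF sm])
      fix r :: real assume r: "0 \<le> r" "r \<le> 1 / real (Suc n)"
      have r1: "r \<le> 1" using r(2) by (rule order_trans) simp
      have "norm t \<le> norm (t + r *\<^sub>R v) + norm (r *\<^sub>R v)" by (metis add_diff_cancel norm_triangle_ineq4)
      moreover have "norm (r *\<^sub>R v) \<le> 1" using r r1 v by simp
      ultimately have "1 + norm t \<le> 2 + norm (t + r *\<^sub>R v)" by linarith
      then have "1 + norm t \<le> 2 * (1 + norm (t + r *\<^sub>R v))" using norm_ge_zero[of "t + r *\<^sub>R v"] by argo
      then have "(1 + norm t) ^ ?N \<le> (2 * (1 + norm (t + r *\<^sub>R v))) ^ ?N" by (intro power_mono) auto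
      then have le: "(1 + norm t) ^ ?N \<le> 2 ^ ?N * (1 + norm (t + r *\<^sub>R v)) ^ ?N" by (simp only: power_mult_distrib)
      have p: "0 < (1 + norm x) ^ ?N" for x :: 'a by (intro zero_less_power add_pos_nonneg) auto
      have "1 / (1 + norm (t + r *\<^sub>R v)) ^ ?N \<le> 2 ^ ?N * decay t"
        unfolding decay_def using le p[of t] p[of "t + r *\<^sub>R v"] by (simp add: divide_le_eq field_simps)
      then have "K * (1 / (1 + norm (t + r *\<^sub>R v)) ^ ?N) \<le> K * (2 ^ ?N * decay t)"
        using K(1) by (intro mult_left_mono) auto
      then show "cmod (pd v f (t + r *\<^sub>R v)) \<le> K * 2 ^ ?N * decay t"
        using K(2)[of "t + r *\<^sub>R v"] by simp
    qed auto
    from mult_left_mono[OF this, of "real (Suc n)"]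
    have "real (Suc n) * cmod (f (t + (1 / real (Suc n)) *\<^sub>R v) - f t) \<le> K * 2 ^ ?N * decay t"
      by (simp del: of_nat_Suc)
    moreover have "cmod (?s n t) = real (Suc n) * cmod (f (t + (1 / real (Suc n)) *\<^sub>R v) - f t)"
      by (simp only: norm_mult norm_of_real abs_of_nat)
    ultimately show ?thesis by linarith
  qed
  have lim: "(\<lambda>n. ?s n t) \<longlonglongrightarrow> pd v f t" for t
  proof -
    have a: "((\<lambda>r. t + r *\<^sub>R v) has_derivative (\<lambda>h. h *\<^sub>R v)) (at 0)" by (auto intro!: derivative_eq_intros)
    have "((\<lambda>r. f (t + r *\<^sub>R v)) has_derivative (\<lambda>h. h *\<^sub>R pd v f t)) (at 0)"
      using has_derivative_compose[OF a smooth_has_derivative[OF sm]]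
        linear_scale[OF has_derivative_linear[OF smooth_has_derivative[OF sm]]] by simp
    then have "((\<lambda>r. norm (f (t + r *\<^sub>R v) - f t - r *\<^sub>R pd v f t) / norm r) \<longlongrightarrow> 0) (at 0)"
      by (simp add: has_derivative_at)
    moreover have "\<forall>\<^sub>F r in at 0. norm (f (t + r *\<^sub>R v) - f t - r *\<^sub>R pd v f t) / norm r =
        norm ((1 / r) *\<^sub>R (f (t + r *\<^sub>R v) - f t) - pd v f t)"
    proof (rule eventually_at_filter[THEN iffD2, OF always_eventually], intro allI impI)
      fix r :: real assume "r \<noteq> 0"
      then have "(1 / r) *\<^sub>R (f (t + r *\<^sub>R v) - f t) - pd v f t = (1 / r) *\<^sub>R (f (t + r *\<^sub>R v) - f t - r *\<^sub>R pd v f t)"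
        by (simp add: scaleR_diff_right)
      then show "norm (f (t + r *\<^sub>R v) - f t - r *\<^sub>R pd v f t) / norm r =
        norm ((1 / r) *\<^sub>R (f (t + r *\<^sub>R v) - f t) - pd v f t)" by (simp only: norm_scaleR) simp
    qed
    ultimately have "((\<lambda>r. norm ((1 / r) *\<^sub>R (f (t + r *\<^sub>R v) - f t) - pd v f t)) \<longlongrightarrow> 0) (at 0)"
      by (rule Lim_transform_eventually)
    then have "((\<lambda>r. (1 / r) *\<^sub>R (f (t + r *\<^sub>R v) - f t)) \<longlongrightarrow> pd v f t) (at 0)"
      by (simp only: tendsto_norm_zero_iff LIM_zero_iff)
    moreover have "filterlim (\<lambda>n. 1 / real (Suc n)) (at 0) sequentially"
      by (intro filterlim_atI LIMSEQ_Suc lim_1_over_n) auto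
    ultimately have "(\<lambda>n. (1 / (1 / real (Suc n))) *\<^sub>R (f (t + (1 / real (Suc n)) *\<^sub>R v) - f t)) \<longlonglongrightarrow> pd v f t"
      by (rule filterlim_compose)
    then show ?thesis by (simp add: scaleR_conv_of_real)
  qed
  have "(\<lambda>n. fourier (?s n) \<eta>) \<longlonglongrightarrow> fourier (pd v f) \<eta>"
    unfolding fourier_def
  proof (rule integral_dominated_convergence[where w="\<lambda>t. K * 2 ^ ?N * decay t"])
    show "integrable lborel (\<lambda>t::'a. K * 2 ^ ?N * decay t)" by (intro integrable_mult_right integrable_decay)
    show "AE t in lborel. (\<lambda>n. ?s n t * cis (- (t \<bullet> \<eta>))) \<longlonglongrightarrow> pd v f t * cis (- (t \<bullet> \<eta>))"
      by (intro AE_I2 tendsto_mult lim tendsto_const)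
    show "AE t in lborel. norm (?s n t * cis (- (t \<bullet> \<eta>))) \<le> K * 2 ^ ?N * decay t" for n
      using bnd[of n] by (simp only: norm_mult[of _ "cis _"] norm_cis mult_1_right) simp
  qed measurable
  moreover have "fourier (?s n) \<eta> = of_real (real (Suc n)) * (cis ((1 / real (Suc n)) * (v \<bullet> \<eta>)) - 1) * fourier f \<eta>" for n
  proof -
    have fi: "integrable lborel f" by (rule rapid_integrable[OF schwartz_rapid[OF f]])
    have i1: "integrable lborel (\<lambda>t. f (t + c) * cis (- (t \<bullet> \<eta>)))" for c
      using lborel_affine_integral(1)[of f 1 c] fi by (intro integrable_cis) (auto simp: add.commute)
    have "fourier (?s n) \<eta> = (LINT t|lborel. of_real (real (Suc n)) *
        (f (t + (1 / real (Suc n)) *\<^sub>R v) * cis (- (t \<bullet> \<eta>)) - f (t + 0) * cis (- (t \<bullet> \<eta>))))"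
      unfolding fourier_def by (rule Bochner_Integration.integral_cong) (auto simp: algebra_simps)
    also have "\<dots> = of_real (real (Suc n)) * (fourier (\<lambda>t. f (t + (1 / real (Suc n)) *\<^sub>R v)) \<eta> - fourier (\<lambda>t. f (t + 0)) \<eta>)"
      unfolding fourier_def
      by (subst integral_mult_right_zero, subst Bochner_Integration.integral_diff[OF i1 i1]) simp
    finally show ?thesis using fourier_translate[OF fi] by (simp add: algebra_simps)
  qed
  moreover have "(\<lambda>n. of_real (real (Suc n)) * (cis ((1 / real (Suc n)) * (v \<bullet> \<eta>)) - 1) * fourier f \<eta>)
      \<longlonglongrightarrow> \<i> * of_real (v \<bullet> \<eta>) * fourier f \<eta>"
  proof (rule tendsto_mult[OF _ tendsto_const])
    define y where "y = v \<bullet> \<eta>"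
    have "(\<lambda>n. of_real (real (Suc n)) * (cis ((1 / real (Suc n)) * y) - 1) - \<i> * of_real y) \<longlonglongrightarrow> 0"
    proof (rule Lim_null_comparison[where g="\<lambda>n. y\<^sup>2 * (1 / real (Suc n))"])
      show "\<forall>\<^sub>F n in sequentially. norm (of_real (real (Suc n)) * (cis ((1 / real (Suc n)) * y) - 1) - \<i> * of_real y) \<le> y\<^sup>2 * (1 / real (Suc n))"
      proof (intro always_eventually allI)
        fix n
        let ?x = "(1 / real (Suc n)) * y"
        have "of_real (real (Suc n)) * (cis ?x - 1) - \<i> * of_real y = of_real (real (Suc n)) * (cis ?x - 1 - \<i> * of_real ?x)"
          by (simp add: algebra_simps del: of_nat_Suc)
        also have "norm \<dots> \<le> real (Suc n) * ?x\<^sup>2"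
          unfolding norm_mult norm_of_real abs_of_nat by (intro mult_left_mono cis_taylor2) auto
        also have "\<dots> = y\<^sup>2 * (1 / real (Suc n))" by (simp add: power2_eq_square del: of_nat_Suc)
        finally show "norm (of_real (real (Suc n)) * (cis ?x - 1) - \<i> * of_real y) \<le> y\<^sup>2 * (1 / real (Suc n))" .
      qed
      show "(\<lambda>n. y\<^sup>2 * (1 / real (Suc n))) \<longlonglongrightarrow> 0"
        using tendsto_mult[OF tendsto_const LIMSEQ_Suc[OF lim_1_over_n]] by simp
    qed
    then show "(\<lambda>n. of_real (real (Suc n)) * (cis ((1 / real (Suc n)) * (v \<bullet> \<eta>)) - 1)) \<longlonglongrightarrow> \<i> * of_real (v \<bullet> \<eta>)"
      unfolding y_def by (simp only: LIM_zero_iff)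
  qed
  ultimately show ?thesis using LIMSEQ_unique by fastforce
qed

text \<open>Each factor \<open>1 + norm \<eta>\<close> costs one derivative, because \<open>norm \<eta>\<close> is at most the sum of the
  moduli of the symbols of the partial derivatives.\<close>

lemma fourier_decay:
  fixes f :: "'i \<Rightarrow> 'a::euclidean_space \<Rightarrow> complex"
  assumes "bounded_family f"
  shows "\<exists>K. \<forall>i \<eta>. (1 + norm \<eta>) ^ N * cmod (fourier (f i) \<eta>) \<le> K"
  using assms
proof (induction N arbitrary: f)
  case 0
  obtain K where K: "\<And>i x. (1 + norm x) ^ 0 * cmod (f i x) \<le> K * decay x" using bounded_family_bound_decay[OF 0] by blast
  have "cmod (fourier (f i) \<eta>) \<le> (LINT t|lborel. K * decay (t::'a))" for i \<eta>
    by (rule order_trans[OF fourier_bound], rule integral_mono')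
       (use K in \<open>auto intro!: integrable_mult_right integrable_decay intro: order_trans[OF norm_ge_zero]\<close>)
  then show ?case by auto
next
  case (Suc N)
  obtain K0 where K0: "\<And>i \<eta>. (1 + norm \<eta>) ^ N * cmod (fourier (f i) \<eta>) \<le> K0" using Suc by blast
  have "\<forall>v. \<exists>K. v \<in> Basis \<longrightarrow> (\<forall>i \<eta>. (1 + norm \<eta>) ^ N * cmod (fourier (pd v (f i)) \<eta>) \<le> K)"
    using Suc.IH[OF bounded_family_pd[OF Suc.prems]] by blast
  then obtain K where K: "\<And>v i \<eta>. v \<in> Basis \<Longrightarrow> (1 + norm \<eta>) ^ N * cmod (fourier (pd v (f i)) \<eta>) \<le> K v"
    by metis
  have "(1 + norm \<eta>) ^ Suc N * cmod (fourier (f i) \<eta>) \<le> K0 + (\<Sum>v\<in>Basis. K v)" for i \<eta>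
  proof -
    have "norm \<eta> \<le> (\<Sum>v\<in>Basis. \<bar>\<eta> \<bullet> v\<bar>)" by (rule norm_le_l1)
    then have "norm \<eta> * ((1 + norm \<eta>) ^ N * cmod (fourier (f i) \<eta>)) \<le>
      (\<Sum>v\<in>Basis. \<bar>\<eta> \<bullet> v\<bar>) * ((1 + norm \<eta>) ^ N * cmod (fourier (f i) \<eta>))" by (intro mult_right_mono) auto
    also have "\<dots> = (\<Sum>v\<in>Basis. (1 + norm \<eta>) ^ N * cmod (fourier (pd v (f i)) \<eta>))"
      unfolding sum_distrib_right
      by (rule sum.cong) (auto simp: fourier_pd[OF bounded_family_schwartz[OF Suc.prems]] norm_mult inner_commute)
    also have "\<dots> \<le> (\<Sum>v\<in>Basis. K v)" by (intro sum_mono K)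
    finally show ?thesis using K0[of \<eta> i] by (simp add: distrib_right)
  qed
  then show ?case by blast
qed

lemma bounded_family_cprod:
  assumes "bounded_family f" shows "vs \<in> lists Basis \<Longrightarrow> bounded_family (\<lambda>i t. cprod (- t) vs * f i t)"
proof (induction vs)
  case Nil then show ?case using assms by (simp add: cprod_def)
next
  case (Cons v vs)
  then have "bounded_family (\<lambda>i t. cprod (- t) vs * f i t)" by auto
  from bounded_family_mult[OF bounded_family_mult[OF this poly_growth_inner[of v]] poly_growth_const[of "- \<i>"]]
  show ?case by (simp add: cprod_def ac_simps)
qed

text \<open>Continuity of the transform on the Schwartz space: derivatives of the transform come from polynomial
  factors, its decay from derivatives.\<close>

theorem bounded_family_fourier:
  fixes f :: "'i \<Rightarrow> 'a::euclidean_space \<Rightarrow> complex"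
  assumes "bounded_family f" shows "bounded_family (\<lambda>i. fourier (f i))"
  unfolding bounded_family_def
proof (intro conjI allI ballI)
  have r: "rapid (f i)" for i using assms by (intro schwartz_rapid bounded_family_schwartz)
  show "smooth (fourier (f i))" for i by (rule iter_deriv_fourier(1)[OF r])
  fix vs :: "'a list" and N assume vs: "vs \<in> lists Basis"
  show "\<exists>K. \<forall>i x. (1 + norm x) ^ N * cmod (iter_deriv vs (fourier (f i)) x) \<le> K"
    unfolding iter_deriv_fourier(2)[OF r vs] by (rule fourier_decay[OF bounded_family_cprod[OF assms vs]])
qed

lemma schwartz_fourier: "f \<in> schwartz \<Longrightarrow> fourier f \<in> schwartz"
  unfolding schwartz_iff_bounded_family[where 'i=unit] by (rule bounded_family_fourier)

section \<open>Fourier inversion and the Plancherel identity\<close>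

lemma integrable_product_kernel:
  fixes f :: "'a::euclidean_space \<Rightarrow> complex" and g :: "'b::euclidean_space \<Rightarrow> complex"
  assumes f: "integrable lborel f" and g: "integrable lborel g"
    and [measurable]: "k \<in> borel_measurable (lborel \<Otimes>\<^sub>M lborel)" and k: "\<And>z. cmod (k z) \<le> 1"
  shows "integrable (lborel \<Otimes>\<^sub>M lborel) (\<lambda>(x, y). f x * g y * k (x, y))"
proof (rule lborel_pair.Fubini_integrable)
  have [measurable]: "f \<in> borel_measurable borel" "g \<in> borel_measurable borel"
    using f g by auto
  show m: "(\<lambda>(x, y). f x * g y * k (x, y)) \<in> borel_measurable (lborel \<Otimes>\<^sub>M lborel)" by measurable
  have i: "integrable lborel (\<lambda>y. f x * g y * k (x, y))" for x
  proof (rule Bochner_Integration.integrable_bound[OF integrable_mult_right[OF g, of "f x"]])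
    show "AE y in lborel. norm (f x * g y * k (x, y)) \<le> norm (f x * g y)"
      using k mult_left_mono[OF k, of "cmod (f x * g _)"] by (intro AE_I2) (simp add: norm_mult)
  qed measurable
  then show "AE x in lborel. integrable lborel (\<lambda>y. case (x, y) of (x, y) \<Rightarrow> f x * g y * k (x, y))" by simp
  have "integrable lborel (\<lambda>x. LINT y|lborel. cmod (f x * g y * k (x, y)))"
  proof (rule Bochner_Integration.integrable_bound)
    show "integrable lborel (\<lambda>x. cmod (f x) * (LINT y|lborel. cmod (g y)))"
      using f by (intro integrable_mult_left integrable_norm)
    show "AE x in lborel. norm (LINT y|lborel. cmod (f x * g y * k (x, y))) \<le> norm (cmod (f x) * (LINT y|lborel. cmod (g y)))"
    proof (intro AE_I2)
      fix x
      have "(LINT y|lborel. cmod (f x * g y * k (x, y))) \<le> (LINT y|lborel. cmod (f x) * cmod (g y))"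
        using k mult_left_mono[OF k, of "cmod (f x * g _)"] g i
        by (intro integral_mono integrable_norm integrable_mult_right) (auto simp: norm_mult)
      then show "norm (LINT y|lborel. cmod (f x * g y * k (x, y))) \<le> norm (cmod (f x) * (LINT y|lborel. cmod (g y)))"
        by (simp add: abs_mult)
    qed
  qed measurable
  then show "integrable lborel (\<lambda>x. LINT y|lborel. cmod (case (x, y) of (x, y) \<Rightarrow> f x * g y * k (x, y)))" by simp
qed

text \<open>Fubini's theorem for a symmetric kernel.\<close>

lemma fourier_multiplication:
  fixes f g :: "'a::euclidean_space \<Rightarrow> complex"
  assumes f: "integrable lborel f" and g: "integrable lborel g"
  shows "(LINT x|lborel. fourier f x * g x) = (LINT x|lborel. f x * fourier g x)"
proof -
  have "integrable (lborel \<Otimes>\<^sub>M lborel) (\<lambda>(x, y). f x * g y * cis (- (x \<bullet> y)))"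
    using integrable_product_kernel[OF f g, of "\<lambda>z. cis (- (fst z \<bullet> snd z))"] by simp
  from lborel_pair.Fubini_integral[OF this]
  have "(LINT y|lborel. LINT x|lborel. f x * g y * cis (- (x \<bullet> y))) =
    (LINT x|lborel. LINT y|lborel. f x * g y * cis (- (x \<bullet> y)))" .
  moreover have "(LINT x|lborel. f x * g y * cis (- (x \<bullet> y))) = fourier f y * g y" for y
  proof -
    have "(LINT x|lborel. f x * g y * cis (- (x \<bullet> y))) = (LINT x|lborel. f x * cis (- (x \<bullet> y)) * g y)"
      by (rule Bochner_Integration.integral_cong) auto
    then show ?thesis unfolding fourier_def by simp
  qed
  moreover have "(LINT y|lborel. f x * g y * cis (- (x \<bullet> y))) = f x * fourier g x" for x
    unfolding fourier_def by (simp add: inner_commute mult.assoc)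
  ultimately show ?thesis by simp
qed

lemma fourier_affine:
  fixes f :: "'a::euclidean_space \<Rightarrow> complex"
  assumes [measurable]: "f \<in> borel_measurable borel" and s: "s > 0"
  shows "fourier (\<lambda>x. f (s *\<^sub>R (x - c)) * cis (x \<bullet> w)) \<eta> =
    of_real (1 / s ^ DIM('a)) * cis (c \<bullet> (w - \<eta>)) * fourier f ((1 / s) *\<^sub>R (\<eta> - w))"
proof -
  let ?g = "\<lambda>y. f y * cis (- (y \<bullet> ((1 / s) *\<^sub>R (\<eta> - w))))"
  have "fourier (\<lambda>x. f (s *\<^sub>R (x - c)) * cis (x \<bullet> w)) \<eta> =
    (LINT x|lborel. cis (c \<bullet> (w - \<eta>)) * ?g (- s *\<^sub>R c + s *\<^sub>R x))"
    unfolding fourier_def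
  proof (rule Bochner_Integration.integral_cong[OF refl])
    fix x
    have 1: "- s *\<^sub>R c + s *\<^sub>R x = s *\<^sub>R (x - c)" by (simp add: algebra_simps)
    have 2: "(s *\<^sub>R (x - c)) \<bullet> ((1 / s) *\<^sub>R (\<eta> - w)) = (x - c) \<bullet> (\<eta> - w)" using s by simp
    show "f (s *\<^sub>R (x - c)) * cis (x \<bullet> w) * cis (- (x \<bullet> \<eta>)) = cis (c \<bullet> (w - \<eta>)) * ?g (- s *\<^sub>R c + s *\<^sub>R x)"
      unfolding 1 2 by (simp add: cis_mult algebra_simps inner_diff_left inner_diff_right)
  qed
  also have "\<dots> = cis (c \<bullet> (w - \<eta>)) * (LINT x|lborel. ?g (- s *\<^sub>R c + s *\<^sub>R x))" by simp
  also have "(LINT x|lborel. ?g (- s *\<^sub>R c + s *\<^sub>R x)) = of_real (1 / s ^ DIM('a)) * fourier f ((1 / s) *\<^sub>R (\<eta> - w))"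
    using s by (subst lborel_affine_integral(2)[of ?g s]) (auto simp: fourier_def)
  finally show ?thesis by simp
qed

lemma lborel_integral_reflect:
  fixes f :: "'a::euclidean_space \<Rightarrow> complex"
  assumes "f \<in> borel_measurable borel"
  shows "(LINT x|lborel. f (- x)) = (LINT x|lborel. f x)"
  using lborel_affine_integral(2)[OF assms, of "-1" 0] by simp

lemma fourier_reflect:
  assumes [measurable]: "f \<in> borel_measurable borel"
  shows "fourier (\<lambda>x. f (- x)) \<eta> = fourier f (- \<eta>)"
  using lborel_integral_reflect[of "\<lambda>x. f x * cis (x \<bullet> \<eta>)"] unfolding fourier_def by simp

lemma fourier_cnj: "cnj (fourier f \<eta>) = fourier (\<lambda>x. cnj (f x)) (- \<eta>)"
proof -
  have "cnj (fourier f \<eta>) = (LINT t|lborel. cnj (f t * cis (- (t \<bullet> \<eta>))))"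
    unfolding fourier_def by (rule Bochner_Integration.integral_cnj[symmetric])
  then show ?thesis unfolding fourier_def by (simp add: cis_cnj)
qed

lemma schwartz_integrable: "f \<in> schwartz \<Longrightarrow> integrable lborel f"
  by (intro rapid_integrable schwartz_rapid)

lemma schwartz_bounded:
  assumes "f \<in> schwartz" shows "\<exists>B>0. \<forall>x. cmod (f x) \<le> B"
  using bounded_family_bound[OF assms[unfolded schwartz_iff_bounded_family[where 'i=unit]], of "[]" 0] by auto

text \<open>The factor \<open>\<kappa> (\<eta> / n)\<close> makes the double integral absolutely convergent, and the multiplication formula moves the
  transform to this factor, where it concentrates at \<open>- x\<close> as \<open>n\<close> grows. A kernel of which only
  \<open>\<kappa> 0 = 1\<close> is known gives the constant as an integral.\<close>

lemma fourier_inversion_kernel: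
  fixes \<psi> \<kappa> :: "'a::euclidean_space \<Rightarrow> complex"
  assumes \<psi>: "\<psi> \<in> schwartz" and \<kappa>: "\<kappa> \<in> schwartz" and \<kappa>0: "\<kappa> 0 = 1"
  shows "fourier (fourier \<psi>) x = (LINT s|lborel. fourier \<kappa> s) * \<psi> (- x)"
proof -
  have [measurable]: "\<psi> \<in> borel_measurable borel" "\<kappa> \<in> borel_measurable borel"
    "fourier \<psi> \<in> borel_measurable borel" "fourier \<kappa> \<in> borel_measurable borel"
    using \<psi> \<kappa> by (auto intro: schwartz_borel schwartz_fourier)
  let ?k = "\<lambda>n \<eta>. \<kappa> ((1 / real (Suc n)) *\<^sub>R \<eta>) * cis (\<eta> \<bullet> (- x))"
  have k_s: "(\<lambda>\<eta>. \<kappa> ((1 / real (Suc n)) *\<^sub>R \<eta>)) \<in> schwartz" for n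
    using schwartz_affine[OF \<kappa>, of "1 / real (Suc n)" 0] by simp
  have ki: "integrable lborel (?k n)" for n
    using schwartz_integrable[OF k_s] by (rule integrable_cis) measurable
  obtain B where B: "B > 0" "\<And>y. cmod (\<psi> y) \<le> B" using schwartz_bounded[OF \<psi>] by blast
  obtain C where C: "C > 0" "\<And>y. cmod (\<kappa> y) \<le> C" using schwartz_bounded[OF \<kappa>] by blast
  have eq: "(LINT \<eta>|lborel. fourier \<psi> \<eta> * ?k n \<eta>) =
      (LINT s|lborel. \<psi> (- x + (1 / real (Suc n)) *\<^sub>R s) * fourier \<kappa> s)" for n
  proof -
    let ?n = "real (Suc n)"
    have "(LINT \<eta>|lborel. fourier \<psi> \<eta> * ?k n \<eta>) = (LINT y|lborel. \<psi> y * fourier (?k n) y)"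
      by (rule fourier_multiplication[OF schwartz_integrable[OF \<psi>] ki])
    also have "\<dots> = of_real (?n ^ DIM('a)) * (LINT y|lborel. \<psi> y * fourier \<kappa> (?n *\<^sub>R (y + x)))"
      using fourier_affine[of \<kappa> "1 / ?n" 0 "- x"]
      by (subst integral_mult_right_zero[symmetric], intro Bochner_Integration.integral_cong) (auto simp: power_divide)
    also have "(LINT y|lborel. \<psi> y * fourier \<kappa> (?n *\<^sub>R (y + x))) =
        of_real (1 / ?n ^ DIM('a)) * (LINT s|lborel. \<psi> (- x + (1 / ?n) *\<^sub>R s) * fourier \<kappa> s)"
    proof -
      have "(LINT y|lborel. \<psi> y * fourier \<kappa> (?n *\<^sub>R (y + x))) =
         (LINT y|lborel. (\<lambda>s. \<psi> (- x + (1 / ?n) *\<^sub>R s) * fourier \<kappa> s) (?n *\<^sub>R x + ?n *\<^sub>R y))"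
        by (rule Bochner_Integration.integral_cong) (auto simp: algebra_simps simp del: of_nat_Suc)
      also have "\<dots> = of_real (1 / \<bar>?n\<bar> ^ DIM('a)) * (LINT s|lborel. \<psi> (- x + (1 / ?n) *\<^sub>R s) * fourier \<kappa> s)"
        by (rule lborel_affine_integral(2)) auto
      finally show ?thesis by simp
    qed
    finally show ?thesis by (simp add: mult.assoc[symmetric] of_real_mult[symmetric] del: of_real_mult of_nat_Suc)
  qed
  have lim0: "(\<lambda>n. (1 / real (Suc n)) *\<^sub>R y) \<longlonglongrightarrow> 0" for y :: 'a
    using tendsto_scaleR[OF LIMSEQ_Suc[OF lim_1_over_n] tendsto_const[of y]] by simp
  have "(\<lambda>n. LINT \<eta>|lborel. fourier \<psi> \<eta> * ?k n \<eta>) \<longlonglongrightarrow> (LINT \<eta>|lborel. fourier \<psi> \<eta> * cis (\<eta> \<bullet> (- x)))"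
  proof (rule integral_dominated_convergence[where w="\<lambda>\<eta>. cmod (fourier \<psi> \<eta>) * C"])
    show "integrable lborel (\<lambda>\<eta>. cmod (fourier \<psi> \<eta>) * C)"
      by (intro integrable_mult_left integrable_norm schwartz_integrable schwartz_fourier \<psi>)
    show "AE \<eta> in lborel. (\<lambda>n. fourier \<psi> \<eta> * ?k n \<eta>) \<longlonglongrightarrow> fourier \<psi> \<eta> * cis (\<eta> \<bullet> (- x))"
    proof (intro AE_I2)
      fix \<eta>
      have "(\<lambda>n. \<kappa> ((1 / real (Suc n)) *\<^sub>R \<eta>)) \<longlonglongrightarrow> \<kappa> 0"
        using smooth_continuous_on[OF schwartz_smooth[OF \<kappa>], of UNIV] lim0[of \<eta>]
        by (auto simp: continuous_on_eq_continuous_at intro: isCont_tendsto_compose)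
      from tendsto_mult[OF tendsto_const[of "fourier \<psi> \<eta>"] tendsto_mult[OF this tendsto_const[of "cis (\<eta> \<bullet> (- x))"]]]
      show "(\<lambda>n. fourier \<psi> \<eta> * ?k n \<eta>) \<longlonglongrightarrow> fourier \<psi> \<eta> * cis (\<eta> \<bullet> (- x))" by (simp add: \<kappa>0)
    qed
    show "AE \<eta> in lborel. norm (fourier \<psi> \<eta> * ?k n \<eta>) \<le> cmod (fourier \<psi> \<eta>) * C" for n
      using C(2) by (intro AE_I2) (auto simp: norm_mult intro!: mult_left_mono)
  qed measurable
  moreover have "(\<lambda>n. LINT s|lborel. \<psi> (- x + (1 / real (Suc n)) *\<^sub>R s) * fourier \<kappa> s) \<longlonglongrightarrow>
      (LINT s|lborel. \<psi> (- x) * fourier \<kappa> s)"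
  proof (rule integral_dominated_convergence[where w="\<lambda>s. B * cmod (fourier \<kappa> s)"])
    show "integrable lborel (\<lambda>s. B * cmod (fourier \<kappa> s))"
      by (intro integrable_mult_right integrable_norm schwartz_integrable schwartz_fourier \<kappa>)
    show "AE s in lborel. (\<lambda>n. \<psi> (- x + (1 / real (Suc n)) *\<^sub>R s) * fourier \<kappa> s) \<longlonglongrightarrow> \<psi> (- x) * fourier \<kappa> s"
    proof (intro AE_I2 tendsto_mult tendsto_const)
      fix s
      have "(\<lambda>n. - x + (1 / real (Suc n)) *\<^sub>R s) \<longlonglongrightarrow> - x"
        using tendsto_add[OF tendsto_const[of "- x"] lim0[of s]] by simp
      then show "(\<lambda>n. \<psi> (- x + (1 / real (Suc n)) *\<^sub>R s)) \<longlonglongrightarrow> \<psi> (- x)"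
        using smooth_continuous_on[OF schwartz_smooth[OF \<psi>], of UNIV]
        by (auto simp: continuous_on_eq_continuous_at intro: isCont_tendsto_compose)
    qed
    show "AE s in lborel. norm (\<psi> (- x + (1 / real (Suc n)) *\<^sub>R s) * fourier \<kappa> s) \<le> B * cmod (fourier \<kappa> s)" for n
      using B(2) by (intro AE_I2) (auto simp: norm_mult intro!: mult_right_mono)
  qed measurable
  ultimately have "(LINT \<eta>|lborel. fourier \<psi> \<eta> * cis (\<eta> \<bullet> (- x))) = (LINT s|lborel. \<psi> (- x) * fourier \<kappa> s)"
    unfolding eq using LIMSEQ_unique by blast
  then show ?thesis unfolding fourier_def[of "fourier \<psi>"] by simp
qed

text \<open>In this normalisation the constant is $(2\pi)^d$. It is carried along without evaluation, because norms are compared up to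
  constants.\<close>

definition inversion_constant :: "'a::euclidean_space itself \<Rightarrow> complex \<Rightarrow> bool" where
  "inversion_constant _ c \<longleftrightarrow> c \<noteq> 0 \<and>
     (\<forall>\<psi>::'a \<Rightarrow> complex \<in> schwartz. \<forall>x. fourier (fourier \<psi>) x = c * \<psi> (- x))"

lemma schwartz_square_integrable:
  fixes f g :: "'a::euclidean_space \<Rightarrow> complex"
  assumes "f \<in> schwartz" "g \<in> schwartz"
  shows "integrable lborel (\<lambda>x. f x * g x)" "integrable lborel (\<lambda>x. (cmod (f x))\<^sup>2)"
proof -
  show "integrable lborel (\<lambda>x. f x * g x)" by (intro schwartz_integrable schwartz_mult assms)
  have "integrable lborel (\<lambda>x. cmod (f x * f x))"
    by (intro integrable_norm schwartz_integrable schwartz_mult assms)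
  then show "integrable lborel (\<lambda>x. (cmod (f x))\<^sup>2)" by (simp add: norm_mult power2_eq_square)
qed

lemma continuous_square_integral_pos:
  fixes f :: "'a::euclidean_space \<Rightarrow> complex"
  assumes c: "continuous_on UNIV f" and i: "integrable lborel (\<lambda>x. (cmod (f x))\<^sup>2)" and "f x \<noteq> 0"
  shows "0 < (LINT x|lborel. (cmod (f x))\<^sup>2)"
proof -
  have "(LINT x|lborel. (cmod (f x))\<^sup>2) \<noteq> 0"
  proof
    assume "(LINT x|lborel. (cmod (f x))\<^sup>2) = 0"
    then have "AE x in lborel. (cmod (f x))\<^sup>2 = 0"
      using i by (subst (asm) integral_nonneg_eq_0_iff_AE) auto
    then have "AE x in lborel. f x = 0" by simp
    have op: "open {x. f x \<noteq> 0}" using open_Collect_neq[OF c continuous_on_const[of UNIV 0]] .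
    have "emeasure lborel {x. f x \<noteq> 0} = 0"
      using \<open>AE x in lborel. f x = 0\<close> op by (subst (asm) AE_iff_measurable[OF _ refl]) (auto simp: borel_open)
    moreover obtain e where e: "e > 0" "ball x e \<subseteq> {x. f x \<noteq> 0}"
      using op assms(3) by (auto simp: open_contains_ball)
    ultimately have "emeasure lborel (ball x e) = 0"
      using emeasure_mono[OF e(2)] op by (metis borel_open sets_lborel le_zero_eq)
    moreover have "emeasure lborel (ball x e) = ennreal (unit_ball_vol (real DIM('a)) * e ^ DIM('a))"
      using e(1) by (intro emeasure_ball) simp
    moreover have "0 < unit_ball_vol (real DIM('a)) * e ^ DIM('a)" using e(1) by simp
    ultimately show False by (simp add: ennreal_eq_0_iff)
  qed
  then show ?thesis by (simp add: order_less_le integral_nonneg_AE)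
qed

text \<open>If the constant of the kernel were zero, then the multiplication formula would make all transforms of Schwartz
  functions vanish, among them that of \<open>\<kappa> * cnj \<kappa>\<close>, whose value at \<open>0\<close> is the squared norm of \<open>\<kappa>\<close>.\<close>

theorem inversion_constant_exists:
  fixes \<kappa> :: "'a::euclidean_space \<Rightarrow> complex"
  assumes \<kappa>: "\<kappa> \<in> schwartz" "\<kappa> 0 \<noteq> 0"
  shows "\<exists>c. inversion_constant TYPE('a) c"
proof -
  define \<kappa>' where "\<kappa>' x = (1 / \<kappa> 0) * \<kappa> x" for x
  have k: "\<kappa>' \<in> schwartz" "\<kappa>' 0 = 1"
    using schwartz_cmult[OF \<kappa>(1), of "1 / \<kappa> 0"] \<kappa>(2) unfolding \<kappa>'_def by auto
  define c where "c = (LINT s|lborel. fourier \<kappa>' s)"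
  have inv: "fourier (fourier \<psi>) x = c * \<psi> (- x)" if "\<psi> \<in> schwartz" for \<psi> :: "'a \<Rightarrow> complex" and x
    unfolding c_def by (rule fourier_inversion_kernel[OF that k])
  have "c \<noteq> 0"
  proof
    assume c0: "c = 0"
    have z: "fourier \<psi> x = 0" if \<psi>: "\<psi> \<in> schwartz" for \<psi> :: "'a \<Rightarrow> complex" and x
    proof (rule ccontr)
      assume nz: "fourier \<psi> x \<noteq> 0"
      define g where "g t = cnj (\<psi> (- t))" for t
      have g: "g \<in> schwartz" unfolding g_def by (intro schwartz_cnj schwartz_uminus \<psi>)
      have fg: "fourier g \<eta> = cnj (fourier \<psi> \<eta>)" for \<eta>
        unfolding fourier_cnj g_def using schwartz_borel[OF schwartz_cnj[OF \<psi>]]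
        by (rule fourier_reflect)
      have "(LINT x|lborel. fourier (fourier \<psi>) x * g x) = (LINT x|lborel. fourier \<psi> x * fourier g x)"
        by (intro fourier_multiplication schwartz_integrable schwartz_fourier \<psi> g)
      then have "(LINT x|lborel. complex_of_real ((cmod (fourier \<psi> x))\<^sup>2)) = 0"
        unfolding inv[OF \<psi>] c0 fg by (simp add: complex_norm_square del: of_real_power)
      then have "(LINT x|lborel. (cmod (fourier \<psi> x))\<^sup>2) = 0"
        by (simp only: integral_complex_of_real of_real_eq_0_iff)
      moreover have "0 < (LINT x|lborel. (cmod (fourier \<psi> x))\<^sup>2)"
        using \<psi> nz by (intro continuous_square_integral_pos[where x=x] smooth_continuous_on schwartz_smooth
            schwartz_fourier schwartz_square_integrable(2))
      ultimately show False by simp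
    qed
    have "fourier (\<lambda>x. \<kappa> x * cnj (\<kappa> x)) 0 = 0" by (intro z schwartz_mult schwartz_cnj \<kappa>)
    then have "(LINT x|lborel. complex_of_real ((cmod (\<kappa> x))\<^sup>2)) = 0"
      unfolding fourier_def by (simp add: complex_norm_square del: of_real_power)
    then have "(LINT x|lborel. (cmod (\<kappa> x))\<^sup>2) = 0"
      by (simp only: integral_complex_of_real of_real_eq_0_iff)
    moreover have "0 < (LINT x|lborel. (cmod (\<kappa> x))\<^sup>2)"
      using \<kappa> by (intro continuous_square_integral_pos[where x=0] smooth_continuous_on schwartz_smooth
          schwartz_square_integrable(2))
    ultimately show False by simp
  qed
  then show ?thesis unfolding inversion_constant_def using inv by blast
qed

text \<open>The multiplication formula for \<open>\<psi>\<close> and its reflected conjugate, whose transform is the conjugate of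
  \<open>fourier \<psi>\<close>.\<close>

theorem plancherel:
  fixes \<psi> :: "'a::euclidean_space \<Rightarrow> complex"
  assumes c: "inversion_constant TYPE('a) c" and \<psi>: "\<psi> \<in> schwartz"
  shows "(LINT x|lborel. (cmod (fourier \<psi> x))\<^sup>2) = cmod c * (LINT x|lborel. (cmod (\<psi> x))\<^sup>2)"
proof -
  define g where "g t = cnj (\<psi> (- t))" for t
  have g: "g \<in> schwartz" unfolding g_def by (intro schwartz_cnj schwartz_uminus \<psi>)
  have fg: "fourier g \<eta> = cnj (fourier \<psi> \<eta>)" for \<eta>
    unfolding fourier_cnj g_def using schwartz_borel[OF schwartz_cnj[OF \<psi>]] by (rule fourier_reflect)
  have [measurable]: "\<psi> \<in> borel_measurable borel" using \<psi> by (rule schwartz_borel)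
  have "(LINT x|lborel. fourier (fourier \<psi>) x * g x) = (LINT x|lborel. fourier \<psi> x * fourier g x)"
    by (intro fourier_multiplication schwartz_integrable schwartz_fourier \<psi> g)
  then have "(LINT x|lborel. complex_of_real ((cmod (fourier \<psi> x))\<^sup>2)) = (LINT x|lborel. c * (\<psi> (- x) * cnj (\<psi> (- x))))"
    using c \<psi> unfolding inversion_constant_def fg
    by (simp add: complex_norm_square g_def mult.assoc del: of_real_power)
  also have "\<dots> = c * (LINT x|lborel. \<psi> (- x) * cnj (\<psi> (- x)))" by simp
  also have "(LINT x|lborel. \<psi> (- x) * cnj (\<psi> (- x))) = (LINT x|lborel. \<psi> x * cnj (\<psi> x))"
    by (rule lborel_integral_reflect[of "\<lambda>x. \<psi> x * cnj (\<psi> x)"])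
       (intro schwartz_borel schwartz_mult schwartz_cnj \<psi>)
  also have "\<dots> = (LINT x|lborel. complex_of_real ((cmod (\<psi> x))\<^sup>2))"
    by (simp add: complex_norm_square del: of_real_power)
  finally have "complex_of_real (LINT x|lborel. (cmod (fourier \<psi> x))\<^sup>2) = c * of_real (LINT x|lborel. (cmod (\<psi> x))\<^sup>2)"
    by (simp only: integral_complex_of_real)
  then have "cmod (complex_of_real (LINT x|lborel. (cmod (fourier \<psi> x))\<^sup>2)) = cmod c * cmod (of_real (LINT x|lborel. (cmod (\<psi> x))\<^sup>2))"
    by (simp only: norm_mult)
  then show ?thesis by (simp add: integral_nonneg_AE)
qed

section \<open>Square integrable functions and the Riesz representation\<close>

definition l2on :: "'b measure \<Rightarrow> ('b \<Rightarrow> complex) \<Rightarrow> bool" where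
  "l2on M f \<longleftrightarrow> f \<in> borel_measurable M \<and> integrable M (\<lambda>x. (cmod (f x))\<^sup>2)"

definition nrm :: "'b measure \<Rightarrow> ('b \<Rightarrow> complex) \<Rightarrow> real" where
  "nrm M f = sqrt (LINT x|M. (cmod (f x))\<^sup>2)"

lemma nrm_nonneg [simp]: "0 \<le> nrm M f" by (simp add: nrm_def integral_nonneg_AE)
lemma nrm_square: "(nrm M f)\<^sup>2 = (LINT x|M. (cmod (f x))\<^sup>2)" by (simp add: nrm_def integral_nonneg_AE)

lemma l2on_borel [measurable_dest]: "l2on M f \<Longrightarrow> f \<in> borel_measurable M" by (simp add: l2on_def)
lemma l2on_integrable: "l2on M f \<Longrightarrow> integrable M (\<lambda>x. (cmod (f x))\<^sup>2)" by (simp add: l2on_def)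

lemma l2on_nn: "l2on M f \<Longrightarrow> (\<integral>\<^sup>+x. ennreal ((cmod (f x))\<^sup>2) \<partial>M) = ennreal ((nrm M f)\<^sup>2)"
  unfolding nrm_square by (rule nn_integral_eq_integral) (auto simp: l2on_def)

lemma l2on_bound:
  assumes "l2on M f" "g \<in> borel_measurable M" "\<And>x. (cmod (g x))\<^sup>2 \<le> K * (cmod (f x))\<^sup>2"
  shows "l2on M g"
  unfolding l2on_def
proof (intro conjI assms)
  note assms(2)[measurable]
  show "integrable M (\<lambda>x. (cmod (g x))\<^sup>2)"
    by (rule Bochner_Integration.integrable_bound[OF integrable_mult_right[OF l2on_integrable[OF assms(1)], of K]])
       (use assms(3) in \<open>auto intro: order_trans[OF _ abs_ge_self]\<close>)
qed

lemma l2on_cmult: "l2on M f \<Longrightarrow> l2on M (\<lambda>x. c * f x)"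
  by (rule l2on_bound[where K="(cmod c)\<^sup>2"]) (auto simp: norm_mult power_mult_distrib)

lemma borel_measurable_cnj [measurable]: "cnj \<in> borel_measurable borel"
  by (intro borel_measurable_continuous_onI continuous_intros)

lemma l2on_cnj: "l2on M f \<Longrightarrow> l2on M (\<lambda>x. cnj (f x))"
  by (rule l2on_bound[where K=1]) auto

lemma cmod_add_square_le: "(cmod (a + b))\<^sup>2 \<le> 2 * (cmod a)\<^sup>2 + 2 * (cmod b)\<^sup>2"
proof -
  have "(cmod (a + b))\<^sup>2 \<le> (cmod a + cmod b)\<^sup>2" by (intro power_mono norm_triangle_ineq) auto
  also have "\<dots> \<le> 2 * (cmod a)\<^sup>2 + 2 * (cmod b)\<^sup>2"
    using sum_squares_bound[of "cmod a" "cmod b"] by (simp add: power2_sum)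
  finally show ?thesis .
qed

lemma l2on_add: assumes "l2on M f" "l2on M g" shows "l2on M (\<lambda>x. f x + g x)"
  unfolding l2on_def
proof
  note [measurable] = l2on_borel[OF assms(1)] l2on_borel[OF assms(2)]
  show "(\<lambda>x. f x + g x) \<in> borel_measurable M" by measurable
  have "integrable M (\<lambda>x. 2 * (cmod (f x))\<^sup>2 + 2 * (cmod (g x))\<^sup>2)"
    using assms by (auto simp: l2on_def)
  then show "integrable M (\<lambda>x. (cmod (f x + g x))\<^sup>2)"
    by (rule Bochner_Integration.integrable_bound)
       (auto intro!: order_trans[OF cmod_add_square_le] order_trans[OF _ abs_ge_self])
qed

lemma l2on_diff: assumes "l2on M f" "l2on M g" shows "l2on M (\<lambda>x. f x - g x)"
  using l2on_add[OF assms(1) l2on_cmult[OF assms(2), of "-1"]] by simp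

lemma l2on_mult_integrable:
  assumes "l2on M f" "l2on M g" shows "integrable M (\<lambda>x. f x * g x)"
proof (rule Bochner_Integration.integrable_bound)
  note [measurable] = l2on_borel[OF assms(1)] l2on_borel[OF assms(2)]
  show "integrable M (\<lambda>x. (cmod (f x))\<^sup>2 + (cmod (g x))\<^sup>2)" using assms by (auto simp: l2on_def)
  have "cmod (f x) * cmod (g x) \<le> (cmod (f x))\<^sup>2 + (cmod (g x))\<^sup>2" for x
    using sum_squares_bound[of "cmod (f x)" "cmod (g x)"] mult_nonneg_nonneg[OF norm_ge_zero[of "f x"] norm_ge_zero[of "g x"]]
    by linarith
  then show "AE x in M. norm (f x * g x) \<le> norm ((cmod (f x))\<^sup>2 + (cmod (g x))\<^sup>2)"
    by (auto simp: norm_mult)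
  show "(\<lambda>x. f x * g x) \<in> borel_measurable M" by measurable
qed

lemma cauchy_schwarz_l2:
  assumes f: "l2on M f" and g: "l2on M g"
  shows "cmod (LINT x|M. f x * g x) \<le> nrm M f * nrm M g"
proof -
  note [measurable] = l2on_borel[OF f] l2on_borel[OF g]
  have "(\<integral>\<^sup>+x. ennreal (cmod (f x * g x)) \<partial>M) = ennreal (LINT x|M. cmod (f x * g x))"
    by (intro nn_integral_eq_integral integrable_norm l2on_mult_integrable f g) auto
  moreover have "(\<integral>\<^sup>+x. ennreal (cmod (f x * g x)) \<partial>M) = (\<integral>\<^sup>+x. ennreal (cmod (f x)) * ennreal (cmod (g x)) \<partial>M)"
    by (intro nn_integral_cong) (simp add: norm_mult ennreal_mult)
  moreover have "0 \<le> (LINT x|M. cmod (f x * g x))" by (rule integral_nonneg_AE) simp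
  ultimately have "ennreal ((LINT x|M. cmod (f x * g x))\<^sup>2) = (\<integral>\<^sup>+x. ennreal (cmod (f x)) * ennreal (cmod (g x)) \<partial>M)\<^sup>2"
    by (metis ennreal_power)
  also have "\<dots> \<le> (\<integral>\<^sup>+x. (ennreal (cmod (f x)))\<^sup>2 \<partial>M) * (\<integral>\<^sup>+x. (ennreal (cmod (g x)))\<^sup>2 \<partial>M)"
    by (rule Cauchy_Schwarz_nn_integral) auto
  also have "\<dots> = ennreal ((nrm M f * nrm M g)\<^sup>2)"
    using l2on_nn[OF f] l2on_nn[OF g] by (simp add: ennreal_power ennreal_mult power_mult_distrib)
  finally have "(LINT x|M. cmod (f x * g x))\<^sup>2 \<le> (nrm M f * nrm M g)\<^sup>2" by simp
  then have "(LINT x|M. cmod (f x * g x)) \<le> nrm M f * nrm M g" by (rule power2_le_imp_le) simp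
  then show ?thesis using integral_norm_bound[of M "\<lambda>x. f x * g x"] by linarith
qed

lemma ex_Inf_close: "bdd_below S \<Longrightarrow> S \<noteq> {} \<Longrightarrow> 0 < (e::real) \<Longrightarrow> \<exists>s\<in>S. s < Inf S + e"
  using cInf_lessD[of S "Inf S + e"] by auto

text \<open>A sequence that is Cauchy with geometric rate converges almost everywhere: the weighted sum
  \<open>\<Sum>n. 4 ^ n * \<bar>f (n + 1) - f n\<bar>\<^sup>2\<close> has a finite integral, so the increments decay geometrically at
  almost every point. Fatou's lemma turns this into convergence in norm.\<close>

lemma l2_geometric_complete:
  fixes f :: "nat \<Rightarrow> 'b \<Rightarrow> complex"
  assumes f: "\<And>n. l2on M (f n)"
    and c: "\<And>n k. n \<le> k \<Longrightarrow> (LINT x|M. (cmod (f k x - f n x))\<^sup>2) \<le> B * (1/16) ^ n"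
  shows "\<exists>h. l2on M h \<and> (\<forall>n. (nrm M (\<lambda>x. f n x - h x))\<^sup>2 \<le> B * (1/16) ^ n)"
proof -
  note [measurable] = l2on_borel[OF f]
  have B: "0 \<le> B" using c[of 0 0] by simp
  define h where "h x = lim (\<lambda>n. f n x)" for x
  have h_m [measurable]: "h \<in> borel_measurable M" unfolding h_def by measurable
  have d: "(\<integral>\<^sup>+x. ennreal ((cmod (f k x - f n x))\<^sup>2) \<partial>M) \<le> ennreal (B * (1/16) ^ n)" if "n \<le> k" for n k
    unfolding l2on_nn[OF l2on_diff[OF f f]] using c[OF that] by (simp add: nrm_square ennreal_leI)
  have conv: "AE x in M. (\<lambda>n. f n x) \<longlonglongrightarrow> h x"
  proof -
    \<comment> \<open>A factor between 1 and 16: the integrals of ?u n are summable, and bounded ?u n forces geometric decay.\<close>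
    let ?u = "\<lambda>n x. 4 ^ n * (cmod (f (Suc n) x - f n x))\<^sup>2"
    have "(\<integral>\<^sup>+x. (\<Sum>n. ennreal (?u n x)) \<partial>M) = (\<Sum>n. \<integral>\<^sup>+x. ennreal (?u n x) \<partial>M)"
      by (rule nn_integral_suminf) measurable
    also have "\<dots> \<le> (\<Sum>n. ennreal (B * (1/4) ^ n))"
    proof (intro suminf_le summableI)
      fix n
      have "(\<integral>\<^sup>+x. ennreal (?u n x) \<partial>M) = ennreal (4 ^ n) * (\<integral>\<^sup>+x. ennreal ((cmod (f (Suc n) x - f n x))\<^sup>2) \<partial>M)"
        by (subst nn_integral_cmult[symmetric]) (auto simp: ennreal_mult)
      also have "\<dots> \<le> ennreal (4 ^ n) * ennreal (B * (1/16) ^ n)"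
        by (intro mult_left_mono d) auto
      also have "\<dots> = ennreal (4 ^ n * (B * (1/16) ^ n))" by (rule ennreal_mult'[symmetric]) simp
      also have "4 ^ n * (B * (1/16) ^ n) = B * (1/4) ^ n"
      proof -
        have "(4::real) ^ n * (1/16) ^ n = (1/4) ^ n" unfolding power_mult_distrib[symmetric] by simp
        then show ?thesis by simp
      qed
      finally show "(\<integral>\<^sup>+x. ennreal (?u n x) \<partial>M) \<le> ennreal (B * (1/4) ^ n)" .
    qed
    also have "\<dots> < \<infinity>" using B by (subst suminf_ennreal2) (auto intro!: summable_mult)
    finally have "AE x in M. (\<Sum>n. ennreal (?u n x)) \<noteq> \<infinity>"
      by (intro nn_integral_PInf_AE) (auto simp: less_top)
    then show ?thesis
    proof (rule AE_mp[OF _ AE_I2], intro impI)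
      fix x assume "(\<Sum>n. ennreal (?u n x)) \<noteq> \<infinity>"
      then have s: "summable (\<lambda>n. ?u n x)" by (intro summable_suminf_not_top) auto
      then obtain K where K: "K > 0" "\<And>n. ?u n x \<le> K"
        using summable_imp_Bseq[OF s] by (auto simp: Bseq_def)
      have "cmod (f (Suc n) x - f n x) \<le> sqrt K * (1/2) ^ n" for n
      proof -
        have "(cmod (f (Suc n) x - f n x))\<^sup>2 \<le> K * (1/4) ^ n"
        proof -
          have "(1/4) ^ n * ?u n x \<le> (1/4) ^ n * K" by (rule mult_left_mono[OF K(2)]) simp
          moreover have "(1/4) ^ n * ((4::real) ^ n * z) = z" for z
            unfolding mult.assoc[symmetric] power_mult_distrib[symmetric] by simp
          ultimately show ?thesis by (simp only: mult.commute)
        qed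
        also have "K * (1/4) ^ n = (sqrt K * (1/2) ^ n)\<^sup>2"
        proof -
          have g: "(p * q ^ n)\<^sup>2 = p\<^sup>2 * (q * q) ^ n" for p q :: real
            by (simp add: power2_eq_square power_mult_distrib)
          show ?thesis unfolding g[of "sqrt K" "1/2"] using K(1) by simp
        qed
        finally show ?thesis by (rule power2_le_imp_le) (use K(1) in simp)
      qed
      note le = this
      have "summable (\<lambda>n. sqrt K * (1/2) ^ n)" by (intro summable_mult summable_geometric) simp
      then have "summable (\<lambda>n. f (Suc n) x - f n x)"
        by (rule summable_comparison_test') (rule le)
      then have "(\<lambda>n. \<Sum>i<n. f (Suc i) x - f i x) \<longlonglongrightarrow> (\<Sum>n. f (Suc n) x - f n x)"
        by (rule summable_LIMSEQ)
      then have "(\<lambda>n. f n x - f 0 x) \<longlonglongrightarrow> (\<Sum>n. f (Suc n) x - f n x)"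
        by (simp only: sum_lessThan_telescope[of "\<lambda>n. f n x"])
      from tendsto_add[OF this tendsto_const[of "f 0 x"]]
      have "convergent (\<lambda>n. f n x)" by (auto simp: convergent_def)
      then show "(\<lambda>n. f n x) \<longlonglongrightarrow> h x" unfolding h_def by (simp only: convergent_LIMSEQ_iff)
    qed
  qed
  have fat: "(\<integral>\<^sup>+x. ennreal ((cmod (f n x - h x))\<^sup>2) \<partial>M) \<le> ennreal (B * (1/16) ^ n)" for n
  proof -
    have "(\<integral>\<^sup>+x. ennreal ((cmod (f n x - h x))\<^sup>2) \<partial>M) =
        (\<integral>\<^sup>+x. liminf (\<lambda>k. ennreal ((cmod (f k x - f n x))\<^sup>2)) \<partial>M)"
    proof (rule nn_integral_cong_AE, use conv in \<open>rule AE_mp[OF _ AE_I2]\<close>, intro impI)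
      fix x assume "(\<lambda>n. f n x) \<longlonglongrightarrow> h x"
      then have "(\<lambda>k. ennreal ((cmod (f k x - f n x))\<^sup>2)) \<longlonglongrightarrow> ennreal ((cmod (h x - f n x))\<^sup>2)"
        by (intro tendsto_intros)
      then show "ennreal ((cmod (f n x - h x))\<^sup>2) = liminf (\<lambda>k. ennreal ((cmod (f k x - f n x))\<^sup>2))"
        by (metis lim_imp_Liminf norm_minus_commute trivial_limit_sequentially)
    qed
    also have "\<dots> \<le> liminf (\<lambda>k. \<integral>\<^sup>+x. ennreal ((cmod (f k x - f n x))\<^sup>2) \<partial>M)"
      by (rule nn_integral_liminf) measurable
    also have "\<dots> \<le> ennreal (B * (1/16) ^ n)"
      by (rule Liminf_le) (auto intro!: eventually_sequentiallyI[of n] d)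
    finally show ?thesis .
  qed
  have fh: "l2on M (\<lambda>x. f n x - h x)" for n
    unfolding l2on_def
  proof
    show "integrable M (\<lambda>x. (cmod (f n x - h x))\<^sup>2)"
      using fat[of n] by (intro integrableI_bounded) (auto intro: le_less_trans)
  qed measurable
  have "l2on M h" using l2on_diff[OF f[of 0] fh[of 0]] by simp
  moreover have "(nrm M (\<lambda>x. f n x - h x))\<^sup>2 \<le> B * (1/16) ^ n" for n
    using fat[of n] B unfolding l2on_nn[OF fh] by (simp add: ennreal_le_iff)
  ultimately show ?thesis by blast
qed

text \<open>The vanishing of the first variation at a minimum.\<close>

lemma quadratic_nonneg_imp_zero:
  fixes a F :: real
  assumes "\<And>t. 0 \<le> 2 * t * a + t\<^sup>2 * F" "0 \<le> F"
  shows "a = 0"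
proof (rule ccontr)
  assume a: "a \<noteq> 0"
  let ?t = "- a / (F + 1)"
  have "2 * ?t * a + ?t\<^sup>2 * F = - (a\<^sup>2 * (F + 2)) / (F + 1)\<^sup>2"
  proof -
    have F: "F + 1 \<noteq> 0" using assms(2) by simp
    have "2 * ?t * a + ?t\<^sup>2 * F = (- 2 * a\<^sup>2 * (F + 1)) / (F + 1)\<^sup>2 + a\<^sup>2 * F / (F + 1)\<^sup>2"
      using F by (simp add: power2_eq_square)
    also have "\<dots> = - (a\<^sup>2 * (F + 2)) / (F + 1)\<^sup>2"
      unfolding add_divide_distrib[symmetric] by (simp add: algebra_simps)
    finally show ?thesis .
  qed
  also have "\<dots> < 0" using a assms(2) by (intro divide_neg_pos) auto
  finally show False using assms(1)[of ?t] by simp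
qed

text \<open>A minimising sequence of \<open>\<integral> \<bar>f\<bar>\<^sup>2 - 2 Re (L f)\<close> on \<open>V\<close> is Cauchy by the parallelogram identity,
  and the Euler-Lagrange equation at its limit says that the conjugate of the limit represents \<open>L\<close>. The limit may lie
  outside of \<open>V\<close>; this is harmless, because the first variation is computed along the sequence.\<close>

theorem riesz_L2:
  fixes V :: "('b \<Rightarrow> complex) set" and L :: "('b \<Rightarrow> complex) \<Rightarrow> complex"
  assumes V: "\<And>f. f \<in> V \<Longrightarrow> l2on M f" and V0: "V \<noteq> {}"
    and Vadd: "\<And>f g. f \<in> V \<Longrightarrow> g \<in> V \<Longrightarrow> (\<lambda>x. f x + g x) \<in> V"
    and Vmul: "\<And>f c. f \<in> V \<Longrightarrow> (\<lambda>x. c * f x) \<in> V"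
    and Ladd: "\<And>f g. f \<in> V \<Longrightarrow> g \<in> V \<Longrightarrow> L (\<lambda>x. f x + g x) = L f + L g"
    and Lmul: "\<And>f c. f \<in> V \<Longrightarrow> L (\<lambda>x. c * f x) = c * L f"
    and bnd: "\<And>f. f \<in> V \<Longrightarrow> cmod (L f) \<le> C * nrm M f"
  shows "\<exists>h. l2on M h \<and> (\<forall>f\<in>V. L f = (LINT x|M. f x * h x))"
proof -
  define J where "J f = (LINT x|M. (cmod (f x))\<^sup>2) - 2 * Re (L f)" for f
  have Jlow: "- C\<^sup>2 \<le> J f" if "f \<in> V" for f
  proof -
    have "Re (L f) \<le> C * nrm M f" using bnd[OF that] complex_Re_le_cmod[of "L f"] by linarith
    moreover have "0 \<le> (nrm M f - C)\<^sup>2" by simp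
    ultimately have "2 * Re (L f) \<le> (nrm M f)\<^sup>2 + C\<^sup>2" by (simp add: power2_diff mult.commute)
    then show ?thesis unfolding J_def nrm_square[symmetric] by simp
  qed
  define m where "m = Inf (J ` V)"
  have bd: "bdd_below (J ` V)" using Jlow by (auto simp: bdd_below_def)
  have m: "m \<le> J f" if "f \<in> V" for f unfolding m_def using bd that by (auto intro: cInf_lower)
  have "\<exists>f. f \<in> V \<and> J f < m + (1/16) ^ n" for n
    using ex_Inf_close[OF bd, of "(1/16) ^ n"] V0 unfolding m_def by auto
  then obtain f where fV: "\<And>n. f n \<in> V" and fJ: "\<And>n. J (f n) < m + (1/16) ^ n" by metis
  have int2: "integrable M (\<lambda>x. (cmod (f x))\<^sup>2)" if "f \<in> V" for f using V[OF that] by (rule l2on_integrable)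
  \<comment> \<open>The midpoint of f and g belongs to V, so J is at least m there.\<close>
  have par: "(LINT x|M. (cmod (g x - f x))\<^sup>2) \<le> 2 * (J f - m) + 2 * (J g - m)" if f: "f \<in> V" and g: "g \<in> V" for f g
  proof -
    let ?h = "\<lambda>x. (1/2) * (f x + g x)"
    have h: "?h \<in> V" by (intro Vmul Vadd f g)
    have Lh: "L ?h = (1/2) * (L f + L g)" using Lmul[OF Vadd[OF f g], of "1/2"] Ladd[OF f g] by simp
    have pt: "(cmod (g x - f x))\<^sup>2 = 2 * (cmod (f x))\<^sup>2 + 2 * (cmod (g x))\<^sup>2 - 4 * (cmod (?h x))\<^sup>2" for x
    proof -
      have "4 * (cmod (?h x))\<^sup>2 = (cmod (f x + g x))\<^sup>2" by (simp add: norm_mult power_divide)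
      then show ?thesis unfolding cmod_power2 by (simp add: power2_eq_square algebra_simps)
    qed
    have "(LINT x|M. (cmod (g x - f x))\<^sup>2) =
      2 * (LINT x|M. (cmod (f x))\<^sup>2) + 2 * (LINT x|M. (cmod (g x))\<^sup>2) - 4 * (LINT x|M. (cmod (?h x))\<^sup>2)"
      unfolding pt using int2[OF f] int2[OF g] int2[OF h] by simp
    also have "\<dots> = 2 * J f + 2 * J g - 4 * J ?h" unfolding J_def Lh by (simp add: algebra_simps)
    finally show ?thesis using m[OF h] by simp
  qed
  have "(LINT x|M. (cmod (f k x - f n x))\<^sup>2) \<le> 4 * (1/16) ^ n" if "n \<le> k" for n k
  proof -
    define a b where "a = (1/16::real) ^ n" and "b = (1/16::real) ^ k"
    have "b \<le> a" unfolding a_def b_def using that by (intro power_decreasing) auto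
    moreover have "J (f n) < m + a" "J (f k) < m + b" unfolding a_def b_def by (rule fJ)+
    ultimately have "2 * (J (f n) - m) + 2 * (J (f k) - m) \<le> 4 * a" unfolding right_diff_distrib by linarith
    then show ?thesis using par[OF fV[of n] fV[of k]] unfolding a_def by (rule order_trans[rotated])
  qed
  from l2_geometric_complete[OF V[OF fV] this]
  obtain h where h: "l2on M h" and hn: "\<And>n. (nrm M (\<lambda>x. f n x - h x))\<^sup>2 \<le> 4 * (1/16) ^ n" by blast
  have ch: "l2on M (\<lambda>x. cnj (h x))" by (rule l2on_cnj[OF h])
  have hlim: "(\<lambda>n. nrm M (\<lambda>x. f n x - h x)) \<longlonglongrightarrow> 0"
  proof (rule Lim_null_comparison[where g="\<lambda>n. 2 * (1/4) ^ n"])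
    have "nrm M (\<lambda>x. f n x - h x) \<le> 2 * (1/4) ^ n" for n
    proof (rule power2_le_imp_le)
      have "(2 * q ^ n)\<^sup>2 = 4 * (q * q) ^ n" for q :: real
        by (simp add: power2_eq_square power_mult_distrib)
      note g = this
      show "(nrm M (\<lambda>x. f n x - h x))\<^sup>2 \<le> (2 * (1/4) ^ n)\<^sup>2" unfolding g using hn[of n] by simp
    qed simp
    then show "\<forall>\<^sub>F n in sequentially. norm (nrm M (\<lambda>x. f n x - h x)) \<le> 2 * (1/4) ^ n" by simp
    show "(\<lambda>n. 2 * (1/4) ^ n :: real) \<longlonglongrightarrow> 0"
      by (intro tendsto_mult_right_zero LIMSEQ_power_zero) auto
  qed
  have Re_eq: "Re (LINT x|M. g x * cnj (h x)) = Re (L g)" if g: "g \<in> V" for g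
  proof -
    let ?F = "LINT x|M. (cmod (g x))\<^sup>2"
    \<comment> \<open>J at the perturbation of f n by t * g is at least m, and J (f n) exceeds m by less than 16 ^ (- n).\<close>
    have ineq: "0 \<le> (1/16) ^ n + 2 * t * (Re (LINT x|M. g x * cnj (f n x)) - Re (L g)) + t\<^sup>2 * ?F" for n t
    proof -
      let ?k = "\<lambda>x. f n x + of_real t * g x"
      have k: "?k \<in> V" by (intro Vadd Vmul fV g)
      have i: "integrable M (\<lambda>x. g x * cnj (f n x))"
        by (intro l2on_mult_integrable V g l2on_cnj fV)
      have pt: "(cmod (?k x))\<^sup>2 = (cmod (f n x))\<^sup>2 + 2 * t * Re (g x * cnj (f n x)) + t\<^sup>2 * (cmod (g x))\<^sup>2" for x
        by (simp add: cmod_power2) (simp add: power2_eq_square algebra_simps)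
      have "(LINT x|M. (cmod (?k x))\<^sup>2) = (LINT x|M. (cmod (f n x))\<^sup>2) + 2 * t * Re (LINT x|M. g x * cnj (f n x)) + t\<^sup>2 * ?F"
        unfolding pt using int2[OF fV[of n]] int2[OF g] integrable_Re[OF i] i by (simp del: complex_cnj_cnj times_complex.sel)
      moreover have "L ?k = L (f n) + of_real t * L g" using Ladd[OF fV Vmul[OF g]] Lmul[OF g] by simp
      ultimately have "J ?k = J (f n) + 2 * t * (Re (LINT x|M. g x * cnj (f n x)) - Re (L g)) + t\<^sup>2 * ?F"
        unfolding J_def by (simp add: algebra_simps)
      then show ?thesis using m[OF k] fJ[of n] by linarith
    qed
    have "(\<lambda>n. LINT x|M. g x * cnj (f n x)) \<longlonglongrightarrow> (LINT x|M. g x * cnj (h x))"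
    proof (rule LIM_zero_cancel, rule Lim_null_comparison[where g="\<lambda>n. nrm M g * nrm M (\<lambda>x. f n x - h x)"])
      have "norm ((LINT x|M. g x * cnj (f n x)) - (LINT x|M. g x * cnj (h x))) \<le> nrm M g * nrm M (\<lambda>x. f n x - h x)" for n
      proof -
        have "(LINT x|M. g x * cnj (f n x)) - (LINT x|M. g x * cnj (h x)) = (LINT x|M. g x * cnj (f n x - h x))"
          by (subst Bochner_Integration.integral_diff[symmetric])
             (auto simp: algebra_simps intro!: l2on_mult_integrable V g l2on_cnj fV h)
        also have "norm \<dots> \<le> nrm M g * nrm M (\<lambda>x. cnj (f n x - h x))"
          by (intro cauchy_schwarz_l2 V g l2on_cnj l2on_diff fV h)
        also have "nrm M (\<lambda>x. cnj (f n x - h x)) = nrm M (\<lambda>x. f n x - h x)"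
          unfolding nrm_def complex_mod_cnj ..
        finally show ?thesis .
      qed
      then show "\<forall>\<^sub>F n in sequentially. norm ((LINT x|M. g x * cnj (f n x)) - (LINT x|M. g x * cnj (h x)))
          \<le> nrm M g * nrm M (\<lambda>x. f n x - h x)" by simp
      show "(\<lambda>n. nrm M g * nrm M (\<lambda>x. f n x - h x)) \<longlonglongrightarrow> 0" by (rule tendsto_mult_right_zero[OF hlim])
    qed
    then have lim: "(\<lambda>n. (1/16) ^ n + 2 * t * (Re (LINT x|M. g x * cnj (f n x)) - Re (L g)) + t\<^sup>2 * ?F)
      \<longlonglongrightarrow> 0 + 2 * t * (Re (LINT x|M. g x * cnj (h x)) - Re (L g)) + t\<^sup>2 * ?F" for t
      by (intro tendsto_intros LIMSEQ_power_zero) auto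
    have "0 \<le> 2 * t * (Re (LINT x|M. g x * cnj (h x)) - Re (L g)) + t\<^sup>2 * ?F" for t
      using LIMSEQ_le_const[OF lim[of t]] ineq[of _ t] unfolding add_0 by blast
    from quadratic_nonneg_imp_zero[OF this] show ?thesis by (simp add: integral_nonneg_AE)
  qed
  have "L g = (LINT x|M. g x * cnj (h x))" if g: "g \<in> V" for g
  proof (rule complex_eqI)
    show "Re (L g) = Re (LINT x|M. g x * cnj (h x))" using Re_eq[OF g] by simp
    have "Re (LINT x|M. (\<i> * g x) * cnj (h x)) = Re (L (\<lambda>x. \<i> * g x))" by (rule Re_eq[OF Vmul[OF g]])
    then have "Re (\<i> * (LINT x|M. g x * cnj (h x))) = Re (\<i> * L g)"
      unfolding Lmul[OF g] mult.assoc integral_mult_right_zero .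
    then show "Im (L g) = Im (LINT x|M. g x * cnj (h x))" by simp
  qed
  then show ?thesis using ch by blast
qed

section \<open>Norm bounds by duality with test functions\<close>

definition test_fun :: "('a::euclidean_space \<Rightarrow> complex) set" where
  "test_fun = {\<psi> \<in> schwartz. \<exists>T. \<forall>x. norm x > T \<longrightarrow> \<psi> x = 0}"

lemma test_fun_schwartz: "\<psi> \<in> test_fun \<Longrightarrow> \<psi> \<in> schwartz" by (simp add: test_fun_def)

lemma test_funI: "smooth \<psi> \<Longrightarrow> (\<And>x. norm x > T \<Longrightarrow> \<psi> x = 0) \<Longrightarrow> \<psi> \<in> test_fun"
  unfolding test_fun_def using schwartz_compact_support by blast

lemma emeasure_lborel_cball_less_top: "emeasure lborel (cball (x::'a::euclidean_space) r) < top"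
  using emeasure_bounded_finite[OF bounded_cball[of x r]] by simp

lemma integrable_bounded_support:
  fixes f :: "'a::euclidean_space \<Rightarrow> 'b::{banach, second_countable_topology}"
  assumes "f \<in> borel_measurable borel" "\<And>x. norm (f x) \<le> B" "\<And>x. norm x > T \<Longrightarrow> f x = 0"
  shows "integrable lborel f"
  by (rule integrableI_bounded_set[where A="cball 0 T" and B=B])
     (use assms in \<open>auto simp: not_le emeasure_lborel_cball_less_top\<close>)

lemma rapid_bounded_support:
  fixes f :: "'a::euclidean_space \<Rightarrow> complex"
  assumes [measurable]: "f \<in> borel_measurable borel" and B: "\<And>x. norm (f x) \<le> B" and T: "\<And>x. norm x > T \<Longrightarrow> f x = 0"
  shows "rapid f"
  unfolding rapid_def
proof (intro conjI allI assms)
  fix N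
  show "integrable lborel (\<lambda>t. (1 + norm t) ^ N * cmod (f t))"
  proof (rule integrable_bounded_support[where B="(1 + \<bar>T\<bar>) ^ N * B" and T=T])
    have B0: "0 \<le> B" using order_trans[OF norm_ge_zero B[of 0]] .
    show "norm ((1 + norm x) ^ N * cmod (f x)) \<le> (1 + \<bar>T\<bar>) ^ N * B" for x
    proof (cases "norm x > T")
      case True then show ?thesis using T B0 by simp
    next
      case False
      then have "(1 + norm x) ^ N \<le> (1 + \<bar>T\<bar>) ^ N" by (intro power_mono) auto
      then have "(1 + norm x) ^ N * cmod (f x) \<le> (1 + \<bar>T\<bar>) ^ N * B" by (intro mult_mono B) auto
      then show ?thesis by (simp add: abs_mult)
    qed
  qed (use T in auto)
qed

lemma poly_growth_fourier_rapid: assumes "rapid f" shows "poly_growth (\<lambda>i. fourier f)"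
  unfolding poly_growth_def
proof (intro conjI allI ballI)
  show "smooth (fourier f)" by (rule iter_deriv_fourier(1)[OF assms])
  fix vs :: "'a list" assume vs: "vs \<in> lists Basis"
  show "\<exists>K N. \<forall>i x. cmod (iter_deriv vs (fourier f) x) \<le> K * (1 + norm x) ^ N"
    by (rule exI[of _ "LINT t|lborel. cmod (cprod (- t) vs * f t)"], rule exI[of _ 0])
       (use fourier_bound[of "\<lambda>t. cprod (- t) vs * f t"] in \<open>simp add: iter_deriv_fourier(2)[OF assms vs]\<close>)
qed

text \<open>Mollification on the Fourier side: the convolution with a test function is the inverse
  transform of \<open>fourier f\<close>, which is smooth with bounded derivatives, times a Schwartz function.\<close>

lemma convolution_test_fun:
  fixes f \<kappa> :: "'a::euclidean_space \<Rightarrow> complex"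
  assumes c: "inversion_constant TYPE('a) c"
    and fm [measurable]: "f \<in> borel_measurable borel" and B: "\<And>x. norm (f x) \<le> B" and T: "\<And>x. norm x > T \<Longrightarrow> f x = 0"
    and \<kappa>: "\<kappa> \<in> schwartz" and R: "\<And>x. norm x > R \<Longrightarrow> \<kappa> x = 0"
  shows "(\<lambda>x. LINT y|lborel. f y * \<kappa> (x - y)) \<in> test_fun"
proof -
  define G where "G x = (LINT y|lborel. f y * \<kappa> (x - y))" for x
  have rf: "rapid f" by (rule rapid_bounded_support[OF fm B T])
  have fi: "integrable lborel f" by (rule rapid_integrable[OF rf])
  have k': "fourier \<kappa> \<in> schwartz" by (rule schwartz_fourier[OF \<kappa>])
  have s: "(\<lambda>\<eta>. fourier \<kappa> \<eta> * fourier f \<eta>) \<in> schwartz"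
    by (rule schwartz_mult_poly_growth[OF k' poly_growth_fourier_rapid[OF rf]])
  have eq: "fourier (\<lambda>\<eta>. fourier \<kappa> \<eta> * fourier f \<eta>) x = c * G (- x)" for x
  proof -
    have ki: "integrable lborel (\<lambda>\<eta>. fourier \<kappa> \<eta> * cis (- (\<eta> \<bullet> x)))"
      by (rule integrable_cis[OF schwartz_integrable[OF k']]) simp
    have "fourier (\<lambda>\<eta>. fourier \<kappa> \<eta> * fourier f \<eta>) x = (LINT \<eta>|lborel. fourier f \<eta> * (fourier \<kappa> \<eta> * cis (- (\<eta> \<bullet> x))))"
      unfolding fourier_def[of "\<lambda>\<eta>. fourier \<kappa> \<eta> * fourier f \<eta>"] by (rule Bochner_Integration.integral_cong) auto
    also have "\<dots> = (LINT y|lborel. f y * fourier (\<lambda>\<eta>. fourier \<kappa> \<eta> * cis (- (\<eta> \<bullet> x))) y)"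
      by (rule fourier_multiplication[OF fi ki])
    also have "\<dots> = (LINT y|lborel. c * (f y * \<kappa> (- x - y)))"
    proof (rule Bochner_Integration.integral_cong[OF refl])
      fix y
      have "fourier (\<lambda>\<eta>. fourier \<kappa> \<eta> * cis (- (\<eta> \<bullet> x))) y = fourier (fourier \<kappa>) (y + x)"
        using fourier_affine[OF schwartz_borel[OF k'], of 1 0 "- x" y] by simp
      also have "\<dots> = c * \<kappa> (- x - y)"
      proof -
        have "- (y + x) = - x - y" by simp
        then show ?thesis using c \<kappa> unfolding inversion_constant_def by metis
      qed
      finally show "f y * fourier (\<lambda>\<eta>. fourier \<kappa> \<eta> * cis (- (\<eta> \<bullet> x))) y = c * (f y * \<kappa> (- x - y))" by simp
    qed
    finally show ?thesis by (simp add: G_def)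
  qed
  have "G x = (1 / c) * fourier (\<lambda>\<eta>. fourier \<kappa> \<eta> * fourier f \<eta>) (- x)" for x
    using c unfolding eq by (simp add: inversion_constant_def)
  moreover have "(\<lambda>x. (1 / c) * fourier (\<lambda>\<eta>. fourier \<kappa> \<eta> * fourier f \<eta>) (- x)) \<in> schwartz"
    by (intro schwartz_cmult schwartz_uminus schwartz_fourier s)
  ultimately have "G \<in> schwartz" by (simp add: G_def[abs_def])
  moreover have "G x = 0" if "norm x > T + R" for x
  proof -
    have "f y * \<kappa> (x - y) = 0" for y
      using T[of y] R[of "x - y"] that norm_triangle_ineq[of y "x - y"] by fastforce
    then show ?thesis unfolding G_def by (simp only: integral_zero)
  qed
  ultimately show ?thesis unfolding G_def[abs_def] test_fun_def by blast
qed

definition mollifier :: "('a::euclidean_space \<Rightarrow> complex) \<Rightarrow> bool" where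
  "mollifier \<kappa> \<longleftrightarrow> \<kappa> \<in> test_fun \<and> (LINT x|lborel. \<kappa> x) = 1"

text \<open>Convolution with mollifiers of width \<open>1 / n\<close>. Bounds and supports stay uniform in \<open>n\<close>, as needed for
  dominated convergence.\<close>

lemma mollify_continuous:
  fixes f \<kappa> :: "'a::euclidean_space \<Rightarrow> complex"
  assumes c: "inversion_constant TYPE('a) c" and \<kappa>: "mollifier \<kappa>"
    and f: "continuous_on UNIV f" "\<And>x. norm (f x) \<le> B" "\<And>x. norm x > T \<Longrightarrow> f x = 0"
  shows "\<exists>\<theta> B' T'. (\<forall>n::nat. \<theta> n \<in> test_fun) \<and> (\<forall>n x. norm (\<theta> n x) \<le> B') \<and> (\<forall>n x. norm x > T' \<longrightarrow> \<theta> n x = 0) \<and>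
    (\<forall>x. (\<lambda>n. \<theta> n x) \<longlonglongrightarrow> f x)"
proof -
  have fm [measurable]: "f \<in> borel_measurable borel" by (rule borel_measurable_continuous_onI[OF f(1)])
  obtain R where ks: "\<kappa> \<in> schwartz" and R: "\<And>x. norm x > R \<Longrightarrow> \<kappa> x = 0" and k1: "(LINT x|lborel. \<kappa> x) = 1"
    using \<kappa> unfolding mollifier_def test_fun_def by blast
  have [measurable]: "\<kappa> \<in> borel_measurable borel" by (rule schwartz_borel[OF ks])
  have ki: "integrable lborel \<kappa>" by (rule schwartz_integrable[OF ks])
  define k where "k n x = of_real (real (Suc n) ^ DIM('a)) * \<kappa> (real (Suc n) *\<^sub>R x)" for n x
  define \<theta> where "\<theta> n x = (LINT y|lborel. f y * k n (x - y))" for n x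
  have t: "\<theta> n \<in> test_fun" for n
    unfolding \<theta>_def[abs_def]
  proof (rule convolution_test_fun[OF c fm f(2,3)])
    show "k n \<in> schwartz" unfolding k_def[abs_def]
      using schwartz_affine[OF ks, of "real (Suc n)" 0] by (intro schwartz_cmult) simp
    show "k n x = 0" if "norm x > \<bar>R\<bar>" for x
    proof -
      have "R < 1 * norm x" using that by linarith
      also have "\<dots> \<le> real (Suc n) * norm x" by (rule mult_right_mono) auto
      also have "\<dots> = norm (real (Suc n) *\<^sub>R x)" by (simp only: norm_scaleR abs_of_nat)
      finally have "norm (real (Suc n) *\<^sub>R x) > R" .
      then show ?thesis using R unfolding k_def by simp
    qed
  qed
  have \<theta>_eq: "\<theta> n x = (LINT s|lborel. f (x - (1 / real (Suc n)) *\<^sub>R s) * \<kappa> s)" for n x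
  proof -
    let ?n = "real (Suc n)"
    have "\<theta> n x = of_real (?n ^ DIM('a)) * (LINT y|lborel. (\<lambda>s. f (x - (1 / ?n) *\<^sub>R s) * \<kappa> s) (?n *\<^sub>R x + (- ?n) *\<^sub>R y))"
      unfolding \<theta>_def k_def
      by (subst integral_mult_right_zero[symmetric], rule Bochner_Integration.integral_cong)
         (auto simp: algebra_simps simp del: of_nat_Suc)
    also have "(LINT y|lborel. (\<lambda>s. f (x - (1 / ?n) *\<^sub>R s) * \<kappa> s) (?n *\<^sub>R x + (- ?n) *\<^sub>R y)) =
       of_real (1 / \<bar>- ?n\<bar> ^ DIM('a)) * (LINT s|lborel. f (x - (1 / ?n) *\<^sub>R s) * \<kappa> s)"
      by (rule lborel_affine_integral(2)) auto
    finally show ?thesis by (simp add: mult.assoc[symmetric] of_real_mult[symmetric] del: of_real_mult of_nat_Suc)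
  qed
  have B0: "0 \<le> B" using order_trans[OF norm_ge_zero f(2)[of 0]] .
  have bd: "norm (\<theta> n x) \<le> (LINT s|lborel. B * cmod (\<kappa> s))" for n x
    unfolding \<theta>_eq
  proof (rule order_trans[OF integral_norm_bound integral_mono'])
    show "integrable lborel (\<lambda>s. B * cmod (\<kappa> s))" using ki by auto
    show "norm (f (x - (1 / real (Suc n)) *\<^sub>R s) * \<kappa> s) \<le> B * cmod (\<kappa> s)" for s
      unfolding norm_mult by (intro mult_right_mono f) auto
  qed (use B0 in auto)
  have supp: "\<theta> n x = 0" if "norm x > T + \<bar>R\<bar>" for n x
  proof -
    have "f (x - (1 / real (Suc n)) *\<^sub>R s) * \<kappa> s = 0" for s
    proof (cases "norm s > R")
      case True then show ?thesis using R by simp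
    next
      case False
      have "norm ((1 / real (Suc n)) *\<^sub>R s) \<le> 1 * norm s" unfolding norm_scaleR by (intro mult_right_mono) auto
      then have "norm (x - (1 / real (Suc n)) *\<^sub>R s) > T"
        using that False norm_triangle_ineq2[of x "(1 / real (Suc n)) *\<^sub>R s"] by linarith
      then show ?thesis using f(3) by simp
    qed
    then show ?thesis unfolding \<theta>_eq by (simp only: integral_zero)
  qed
  have lim: "(\<lambda>n. \<theta> n x) \<longlonglongrightarrow> f x" for x
  proof -
    have "(\<lambda>n. LINT s|lborel. f (x - (1 / real (Suc n)) *\<^sub>R s) * \<kappa> s) \<longlonglongrightarrow> (LINT s|lborel. f x * \<kappa> s)"
    proof (rule integral_dominated_convergence[where w="\<lambda>s. B * cmod (\<kappa> s)"])
      show "integrable lborel (\<lambda>s. B * cmod (\<kappa> s))" using ki by auto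
      show "AE s in lborel. (\<lambda>n. f (x - (1 / real (Suc n)) *\<^sub>R s) * \<kappa> s) \<longlonglongrightarrow> f x * \<kappa> s"
      proof (intro AE_I2 tendsto_mult tendsto_const)
        fix s
        have "(\<lambda>n. x - (1 / real (Suc n)) *\<^sub>R s) \<longlonglongrightarrow> x - 0 *\<^sub>R s"
          by (intro tendsto_intros LIMSEQ_Suc[OF lim_1_over_n])
        then show "(\<lambda>n. f (x - (1 / real (Suc n)) *\<^sub>R s)) \<longlonglongrightarrow> f x"
          using f(1) by (auto simp: continuous_on_eq_continuous_at intro: isCont_tendsto_compose)
      qed
      show "AE s in lborel. norm (f (x - (1 / real (Suc n)) *\<^sub>R s) * \<kappa> s) \<le> B * cmod (\<kappa> s)" for n
        unfolding norm_mult by (intro AE_I2 mult_right_mono f) auto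
    qed measurable
    then show ?thesis using k1 unfolding \<theta>_eq by simp
  qed
  show ?thesis using t bd supp lim by blast
qed

text \<open>A measurable function is almost everywhere a limit of continuous functions. The projection to a
  disc and a continuous cut-off restore the bound and the support.\<close>

lemma bounded_measurable_limit_of_continuous:
  fixes f :: "'a::euclidean_space \<Rightarrow> complex"
  assumes f: "f \<in> borel_measurable borel" "\<And>x. norm (f x) \<le> B" "\<And>x. norm x > T \<Longrightarrow> f x = 0"
  shows "\<exists>g B' T'. (\<forall>n::nat. continuous_on UNIV (g n)) \<and> (\<forall>n x. norm (g n x) \<le> B') \<and>
    (\<forall>n x. norm x > T' \<longrightarrow> g n x = 0) \<and> (AE x in lborel. (\<lambda>n. g n x) \<longlonglongrightarrow> f x)"
proof -
  have "f measurable_on UNIV"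
    using f(1) by (intro lebesgue_measurable_imp_measurable_on) (auto intro: measurable_completion)
  then obtain N g where N: "negligible N" and g: "\<And>n. continuous_on UNIV (g n)"
    and lim: "\<And>x. x \<notin> N \<Longrightarrow> (\<lambda>n. g n x) \<longlonglongrightarrow> f x"
    unfolding measurable_on_def by auto
  have B0: "0 \<le> B" using order_trans[OF norm_ge_zero f(2)[of 0]] .
  define p :: "complex \<Rightarrow> complex" where "p = closest_point (cball 0 B)"
  have p: "continuous_on UNIV p" "\<And>z. norm (p z) \<le> B" "\<And>z. norm z \<le> B \<Longrightarrow> p z = z"
    unfolding p_def using B0 closest_point_in_set[of "cball (0::complex) B"]
    by (auto intro!: continuous_on_closest_point simp: closest_point_self)
  define cut :: "'a \<Rightarrow> real" where "cut x = max 0 (min 1 (\<bar>T\<bar> + 1 - norm x))" for x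
  have cut: "continuous_on UNIV cut" "\<And>x. 0 \<le> cut x" "\<And>x. cut x \<le> 1" "\<And>x. norm x \<le> T \<Longrightarrow> cut x = 1"
    "\<And>x. norm x > \<bar>T\<bar> + 1 \<Longrightarrow> cut x = 0"
    unfolding cut_def by (auto intro!: continuous_intros)
  let ?g = "\<lambda>n x. cut x *\<^sub>R p (g n x)"
  have 1: "continuous_on UNIV (?g n)" for n
    by (intro continuous_on_scaleR cut continuous_on_compose2[OF p(1) g]) auto
  have 2: "norm (?g n x) \<le> B" for n x
    using mult_mono[OF cut(3)[of x] p(2)[of "g n x"]] cut(2)[of x] by simp
  have 3: "?g n x = 0" if "norm x > \<bar>T\<bar> + 1" for n x using cut(5)[OF that] by simp
  have 4: "AE x in lborel. (\<lambda>n. ?g n x) \<longlonglongrightarrow> f x"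
  proof -
    have "AE x in lebesgue. x \<notin> N" using N by (simp add: negligible_iff_null_sets AE_not_in)
    then have "AE x in lborel. x \<notin> N" by (simp add: AE_completion_iff)
    then show ?thesis
    proof (rule AE_mp[OF _ AE_I2], intro impI)
      fix x assume x: "x \<notin> N"
      have "(\<lambda>n. p (g n x)) \<longlonglongrightarrow> p (f x)"
        using p(1) lim[OF x] by (auto simp: continuous_on_eq_continuous_at intro: isCont_tendsto_compose)
      then have "(\<lambda>n. cut x *\<^sub>R p (g n x)) \<longlonglongrightarrow> cut x *\<^sub>R p (f x)" by (intro tendsto_intros)
      moreover have "cut x *\<^sub>R p (f x) = f x"
        using p(3)[OF f(2)[of x]] cut(4)[of x] f(3)[of x] by (cases "norm x \<le> T") auto
      ultimately show "(\<lambda>n. ?g n x) \<longlonglongrightarrow> f x" by simp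
    qed
  qed
  show ?thesis
    by (rule exI[of _ ?g], rule exI[of _ B], rule exI[of _ "\<bar>T\<bar> + 1"], intro conjI allI impI 1 2 3 4)
qed

text \<open>Testing \<open>g\<close> against test functions determines its weighted norm: the bound passes to bounded
  measurable functions with bounded support by two dominated limits, and then \<open>\<theta> = w * cnj g\<close>,
  suitably truncated, is an admissible choice.\<close>

theorem norm_bound_by_duality:
  fixes g \<kappa> :: "'a::euclidean_space \<Rightarrow> complex" and w :: "'a \<Rightarrow> real"
  assumes c: "inversion_constant TYPE('a) c" and \<kappa>: "mollifier \<kappa>"
    and wc: "continuous_on UNIV w" and wp: "\<And>x. 0 < w x"
    and gm [measurable]: "g \<in> borel_measurable borel" and gi: "integrable lborel (\<lambda>x. w x * (cmod (g x))\<^sup>2)"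
    and C: "0 \<le> C"
    and bnd: "\<And>\<psi>. \<psi> \<in> test_fun \<Longrightarrow> cmod (LINT x|lborel. g x * \<psi> x) \<le> C * sqrt (LINT x|lborel. (cmod (\<psi> x))\<^sup>2 / w x)"
  shows "(LINT x|lborel. w x * (cmod (g x))\<^sup>2) \<le> C\<^sup>2"
proof -
  have wm [measurable]: "w \<in> borel_measurable borel" by (rule borel_measurable_continuous_onI[OF wc])
  define ok where "ok \<theta> \<longleftrightarrow> cmod (LINT x|lborel. g x * \<theta> x) \<le> C * sqrt (LINT x|lborel. (cmod (\<theta> x))\<^sup>2 / w x)" for \<theta>
  have bdd: "\<exists>K. \<forall>x. norm x \<le> T \<longrightarrow> w x \<le> K \<and> 1 / w x \<le> K" for T
  proof -
    have nz: "w x \<noteq> 0" for x using wp[of x] by simp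
    have "continuous_on (cball 0 T) w" by (rule continuous_on_subset[OF wc]) simp
    then have "compact (w ` cball 0 T)" "compact ((\<lambda>x. 1 / w x) ` cball 0 T)"
      using nz by (auto intro!: compact_continuous_image continuous_on_divide continuous_on_const)
    then have "bounded (w ` cball 0 T \<union> (\<lambda>x. 1 / w x) ` cball 0 T)" by (intro bounded_Un[THEN iffD2] conjI compact_imp_bounded)
    then obtain K where "\<And>y. y \<in> w ` cball 0 T \<union> (\<lambda>x. 1 / w x) ` cball 0 T \<Longrightarrow> norm y \<le> K" by (auto simp: bounded_iff)
    then have "w x \<le> K \<and> 1 / w x \<le> K" if "norm x \<le> T" for x
    proof -
      have "norm (w x) \<le> K" "norm (1 / w x) \<le> K"
        by (rule \<open>\<And>y. y \<in> _ \<Longrightarrow> norm y \<le> K\<close>, use that in simp)+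
      then show ?thesis unfolding real_norm_def using abs_ge_self[of "w x"] abs_ge_self[of "1 / w x"] by linarith
    qed
    then show ?thesis by blast
  qed
  \<comment> \<open>The bound is stable under uniformly bounded limits with a common bounded support.\<close>
  have lim: "ok f" if ok: "\<And>n. ok (\<theta> n)" and m: "\<And>n. \<theta> n \<in> borel_measurable borel" and fm: "f \<in> borel_measurable borel"
    and B: "\<And>n x. norm (\<theta> n x) \<le> B" and T: "\<And>n x. norm x > T \<Longrightarrow> \<theta> n x = 0"
    and l: "AE x in lborel. (\<lambda>n. \<theta> n x) \<longlonglongrightarrow> f x" for \<theta> :: "nat \<Rightarrow> 'a \<Rightarrow> complex" and f B T
  proof -
    note m[measurable] fm[measurable]
    have B0: "0 \<le> B" using order_trans[OF norm_ge_zero B[of 0 0]] .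
    obtain K where K: "\<And>x. norm x \<le> T \<Longrightarrow> w x \<le> K" "\<And>x. norm x \<le> T \<Longrightarrow> 1 / w x \<le> K" using bdd[of T] by blast
    have b: "integrable lborel (\<lambda>x::'a. K * indicator (cball 0 T) x)" for K :: real
      by (intro integrable_mult_right integrable_real_indicator)
         (auto simp: emeasure_lborel_cball_less_top)
    have "(\<lambda>n. LINT x|lborel. g x * \<theta> n x) \<longlonglongrightarrow> (LINT x|lborel. g x * f x)"
    proof (rule integral_dominated_convergence[where w="\<lambda>x. B * (w x * (cmod (g x))\<^sup>2) + B * K * indicator (cball 0 T) x"])
      show "integrable lborel (\<lambda>x. B * (w x * (cmod (g x))\<^sup>2) + B * K * indicator (cball 0 T) x)"
        by (rule Bochner_Integration.integrable_add[OF integrable_mult_right[OF gi] b])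
      show "AE x in lborel. (\<lambda>n. g x * \<theta> n x) \<longlonglongrightarrow> g x * f x"
        using l by (rule AE_mp[OF _ AE_I2]) (auto intro: tendsto_intros)
      show "AE x in lborel. norm (g x * \<theta> n x) \<le> B * (w x * (cmod (g x))\<^sup>2) + B * K * indicator (cball 0 T) x" for n
      proof (intro AE_I2)
        fix x
        have w0: "0 \<le> B * (w x * (cmod (g x))\<^sup>2)" using B0 wp[of x] by simp
        show "norm (g x * \<theta> n x) \<le> B * (w x * (cmod (g x))\<^sup>2) + B * K * indicator (cball 0 T) x"
        proof (cases "norm x > T")
          case True then show ?thesis using T w0 by simp
        next
          case False
          \<comment> \<open>Weighted integrability of the square yields local integrability of g.\<close>
          have "cmod (g x) \<le> w x * (cmod (g x))\<^sup>2 + 1 / w x"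
          proof (cases "cmod (g x) \<le> 1 / w x")
            case True
            moreover have "0 \<le> w x * (cmod (g x))\<^sup>2" using wp[of x] by simp
            ultimately show ?thesis by linarith
          next
            case False
            then have "1 \<le> w x * cmod (g x)" using wp[of x] by (simp add: field_simps)
            then have "cmod (g x) * 1 \<le> cmod (g x) * (w x * cmod (g x))" by (intro mult_left_mono) auto
            then have "cmod (g x) \<le> w x * (cmod (g x))\<^sup>2" by (simp add: power2_eq_square ac_simps)
            moreover have "0 < 1 / w x" using wp[of x] by simp
            ultimately show ?thesis by linarith
          qed
          also have "\<dots> \<le> w x * (cmod (g x))\<^sup>2 + K" using K(2)[of x] False by simp
          finally have "cmod (\<theta> n x) * cmod (g x) \<le> B * (w x * (cmod (g x))\<^sup>2 + K)"
            by (intro mult_mono B) (use B0 in auto)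
          then show ?thesis using False by (simp add: norm_mult algebra_simps)
        qed
      qed
    qed measurable
    moreover have "(\<lambda>n. LINT x|lborel. (cmod (\<theta> n x))\<^sup>2 / w x) \<longlonglongrightarrow> (LINT x|lborel. (cmod (f x))\<^sup>2 / w x)"
    proof (rule integral_dominated_convergence[where w="\<lambda>x. B\<^sup>2 * K * indicator (cball 0 T) x"])
      show "AE x in lborel. (\<lambda>n. (cmod (\<theta> n x))\<^sup>2 / w x) \<longlonglongrightarrow> (cmod (f x))\<^sup>2 / w x"
        using l by (rule AE_mp[OF _ AE_I2]) (auto intro!: tendsto_intros simp: less_imp_neq[OF wp, symmetric])
      show "AE x in lborel. norm ((cmod (\<theta> n x))\<^sup>2 / w x) \<le> B\<^sup>2 * K * indicator (cball 0 T) x" for n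
      proof (intro AE_I2)
        fix x
        show "norm ((cmod (\<theta> n x))\<^sup>2 / w x) \<le> B\<^sup>2 * K * indicator (cball 0 T) x"
        proof (cases "norm x > T")
          case True then show ?thesis using T by simp
        next
          case False
          have "(cmod (\<theta> n x))\<^sup>2 * (1 / w x) \<le> B\<^sup>2 * K"
            using K(2)[of x] False wp[of x] B[of n x] by (intro mult_mono power_mono) auto
          then show ?thesis using False wp[of x] by simp
        qed
      qed
    qed (use b in auto)
    ultimately show ?thesis using ok unfolding ok_def
      by (intro LIMSEQ_le[of "\<lambda>n. cmod (LINT x|lborel. g x * \<theta> n x)" _ "\<lambda>n. C * sqrt (LINT x|lborel. (cmod (\<theta> n x))\<^sup>2 / w x)"])
         (auto intro!: tendsto_intros)
  qed
  have okc: "ok f" if f: "continuous_on UNIV f" "\<And>x. norm (f x) \<le> B" "\<And>x. norm x > T \<Longrightarrow> f x = 0" for f B T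
  proof -
    obtain \<theta> B' T' where t: "\<And>n. \<theta> n \<in> test_fun" "\<And>n x. norm (\<theta> n x) \<le> B'" "\<And>n x. norm x > T' \<Longrightarrow> \<theta> n x = 0"
      "\<And>x. (\<lambda>n::nat. \<theta> n x) \<longlonglongrightarrow> f x"
      using mollify_continuous[OF c \<kappa> f] by blast
    show ?thesis
      by (rule lim[where \<theta>=\<theta>, OF _ _ borel_measurable_continuous_onI[OF f(1)] t(2,3)])
         (use t bnd in \<open>auto simp: ok_def intro: schwartz_borel test_fun_schwartz\<close>)
  qed
  have okm: "ok f" if f: "f \<in> borel_measurable borel" "\<And>x. norm (f x) \<le> B" "\<And>x. norm x > T \<Longrightarrow> f x = 0" for f B T
  proof -
    obtain h B' T' where h: "\<And>n::nat. continuous_on UNIV (h n)" "\<And>n x. norm (h n x) \<le> B'"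
      "\<And>n x. norm x > T' \<Longrightarrow> h n x = 0" "AE x in lborel. (\<lambda>n. h n x) \<longlonglongrightarrow> f x"
      using bounded_measurable_limit_of_continuous[OF f] by blast
    show ?thesis
      by (rule lim[OF okc[OF h(1,2,3)] borel_measurable_continuous_onI[OF h(1)] f(1) h(2,3,4)])
  qed
  \<comment> \<open>For the truncation of w * cnj g the bound reads I n \<le> C * sqrt (I n).\<close>
  define I where "I n = (LINT x|lborel. (if norm x \<le> real n \<and> cmod (g x) \<le> real n then w x * (cmod (g x))\<^sup>2 else 0))" for n
  have In: "I n \<le> C\<^sup>2" for n
  proof -
    define \<theta> where "\<theta> x = (if norm x \<le> real n \<and> cmod (g x) \<le> real n then of_real (w x) * cnj (g x) else 0)" for x
    obtain K where K: "\<And>x. norm x \<le> real n \<Longrightarrow> w x \<le> K" using bdd[of "real n"] by blast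
    have K0: "0 \<le> K" using order_trans[OF less_imp_le[OF wp[of 0]] K[of 0]] by simp
    have "ok \<theta>"
    proof (rule okm[where B="K * real n" and T="real n"])
      show "\<theta> \<in> borel_measurable borel" unfolding \<theta>_def by measurable
      show "norm (\<theta> x) \<le> K * real n" for x
        unfolding \<theta>_def using K[of x] wp[of x] K0 by (auto simp: norm_mult intro!: mult_mono)
    qed (auto simp: \<theta>_def)
    moreover have "g x * \<theta> x = of_real (if norm x \<le> real n \<and> cmod (g x) \<le> real n then w x * (cmod (g x))\<^sup>2 else 0)" for x
      unfolding \<theta>_def by (simp add: complex_norm_square del: of_real_power)
    moreover have "(cmod (\<theta> x))\<^sup>2 / w x = (if norm x \<le> real n \<and> cmod (g x) \<le> real n then w x * (cmod (g x))\<^sup>2 else 0)" for x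
      unfolding \<theta>_def using wp[of x] by (simp add: norm_mult power2_eq_square)
    ultimately have "cmod (of_real (I n)) \<le> C * sqrt (I n)"
      unfolding ok_def I_def by (simp only: integral_complex_of_real)
    moreover have I0: "0 \<le> I n" unfolding I_def using wp by (intro integral_nonneg_AE AE_I2) (auto simp: less_imp_le)
    ultimately have le: "sqrt (I n) * sqrt (I n) \<le> C * sqrt (I n)" by simp
    have "sqrt (I n) \<le> C"
    proof (cases "sqrt (I n) = 0")
      case False
      then have "0 < sqrt (I n)" using I0 by simp
      with le show ?thesis by (rule mult_right_le_imp_le)
    qed (use C in simp)
    then have "(sqrt (I n))\<^sup>2 \<le> C\<^sup>2" using I0 by (intro power_mono) auto
    then show ?thesis using I0 by simp
  qed
  have "I \<longlonglongrightarrow> (LINT x|lborel. w x * (cmod (g x))\<^sup>2)"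
    unfolding I_def[abs_def]
  proof (rule integral_dominated_convergence[where w="\<lambda>x. w x * (cmod (g x))\<^sup>2"])
    show "AE x in lborel. (\<lambda>n. if norm x \<le> real n \<and> cmod (g x) \<le> real n then w x * (cmod (g x))\<^sup>2 else 0) \<longlonglongrightarrow> w x * (cmod (g x))\<^sup>2"
    proof (intro AE_I2 tendsto_eventually)
      fix x
      obtain N where N: "max (norm x) (cmod (g x)) \<le> real N" using real_arch_simple by blast
      show "\<forall>\<^sub>F n in sequentially. (if norm x \<le> real n \<and> cmod (g x) \<le> real n then w x * (cmod (g x))\<^sup>2 else 0) = w x * (cmod (g x))\<^sup>2"
        using N by (intro eventually_sequentiallyI[of N]) auto
    qed
    show "AE x in lborel. norm (if norm x \<le> real n \<and> cmod (g x) \<le> real n then w x * (cmod (g x))\<^sup>2 else 0) \<le> w x * (cmod (g x))\<^sup>2" for n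
      using wp by (intro AE_I2) (auto simp: less_imp_le abs_mult)
  qed (use gi in measurable)
  then show ?thesis by (rule LIMSEQ_le_const2) (use In in blast)
qed

section \<open>Fourier series on a cube\<close>

lemma lborel_integral_prod:
  fixes f :: "'a::euclidean_space \<Rightarrow> real \<Rightarrow> complex"
  assumes f: "\<And>b. b \<in> Basis \<Longrightarrow> integrable lborel (f b)"
  shows "(LINT x|lborel. (\<Prod>b\<in>Basis. f b (x \<bullet> b))) = (\<Prod>b\<in>Basis. LINT t|lborel. f b t)"
proof -
  interpret product_sigma_finite "\<lambda>_::'a. lborel :: real measure"
    by (simp add: product_sigma_finite_def sigma_finite_lborel)
  have [measurable]: "\<And>b. b \<in> Basis \<Longrightarrow> f b \<in> borel_measurable borel" using f by auto
  have "(LINT x|lborel. (\<Prod>b\<in>Basis. f b (x \<bullet> b))) =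
      (LINT g|Pi\<^sub>M Basis (\<lambda>_. lborel). (\<Prod>b\<in>Basis. f b ((\<Sum>b\<in>Basis. g b *\<^sub>R b) \<bullet> b)))"
    by (subst lborel_eq, subst integral_distr) auto
  also have "\<dots> = (LINT g|Pi\<^sub>M Basis (\<lambda>_. lborel). (\<Prod>b\<in>Basis. f b (g b)))"
    by (intro Bochner_Integration.integral_cong refl prod.cong) simp
  also have "\<dots> = (\<Prod>b\<in>Basis. LINT t|lborel. f b t)" by (rule product_integral_prod) (auto intro: f)
  finally show ?thesis .
qed

text \<open>A cube with side \<open>2 * pi / s\<close>, on which the waves with frequencies \<open>s *\<^sub>R j\<close>, \<open>j\<close> integral, are orthogonal.\<close>

definition cell :: "'a::euclidean_space \<Rightarrow> real \<Rightarrow> 'a set" where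
  "cell c s = cbox (\<Sum>i\<in>Basis. (c \<bullet> i - pi / s) *\<^sub>R i) (\<Sum>i\<in>Basis. (c \<bullet> i + pi / s) *\<^sub>R i)"

definition open_cell :: "'a::euclidean_space \<Rightarrow> real \<Rightarrow> 'a set" where
  "open_cell c s = box (\<Sum>i\<in>Basis. (c \<bullet> i - pi / s) *\<^sub>R i) (\<Sum>i\<in>Basis. (c \<bullet> i + pi / s) *\<^sub>R i)"

definition wave :: "real \<Rightarrow> 'a::euclidean_space \<Rightarrow> 'a \<Rightarrow> complex" where
  "wave s j \<eta> = cis ((s *\<^sub>R j) \<bullet> \<eta>)"

lemma mem_cell: "x \<in> cell c s \<longleftrightarrow> (\<forall>i\<in>Basis. x \<bullet> i \<in> {c \<bullet> i - pi / s..c \<bullet> i + pi / s})"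
  unfolding cell_def mem_box by simp
lemma mem_open_cell: "x \<in> open_cell c s \<longleftrightarrow> (\<forall>i\<in>Basis. x \<bullet> i \<in> {c \<bullet> i - pi / s<..<c \<bullet> i + pi / s})"
  unfolding open_cell_def mem_box by simp
lemma open_cell_subset: "open_cell c s \<subseteq> cell c s"
  unfolding cell_def open_cell_def by (rule box_subset_cbox)
lemma compact_cell: "compact (cell c s)" unfolding cell_def by (rule compact_cbox)
lemma open_open_cell: "open (open_cell c s)" unfolding open_cell_def by (rule open_box)
lemma cell_borel [measurable]: "cell c s \<in> sets borel" unfolding cell_def by simp

lemma wave_mult: "wave s j \<eta> * wave s l \<eta> = wave s (j + l) \<eta>"
  by (simp add: wave_def cis_mult scaleR_add_right inner_add_left)
lemma wave_cnj: "cnj (wave s j \<eta>) = wave s (- j) \<eta>" by (simp add: wave_def cis_cnj)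
lemma wave_norm [simp]: "cmod (wave s j \<eta>) = 1" by (simp add: wave_def)
lemma wave_continuous: "continuous_on S (wave s j)"
  unfolding wave_def by (intro continuous_intros)
lemma wave_borel [measurable]: "wave s j \<in> borel_measurable borel"
  by (intro borel_measurable_continuous_onI wave_continuous)

lemma cis_sum: "cis (sum f A) = (\<Prod>a\<in>A. cis (f a))"
  by (induction A rule: infinite_finite_induct) (auto simp flip: cis_mult)

lemma wave_prod: "wave s j \<eta> = (\<Prod>b\<in>Basis. cis (s * (j \<bullet> b) * (\<eta> \<bullet> b)))"
proof -
  have "(s *\<^sub>R j) \<bullet> \<eta> = (\<Sum>b\<in>Basis. s * (j \<bullet> b) * (\<eta> \<bullet> b))"
    unfolding euclidean_inner[of "s *\<^sub>R j" \<eta>] by (simp add: mult.assoc)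
  then show ?thesis by (simp add: wave_def cis_sum)
qed

lemma int_lattice_uminus: "j \<in> int_lattice \<Longrightarrow> - j \<in> int_lattice" by (simp add: int_lattice_def)
lemma int_lattice_add: "j \<in> int_lattice \<Longrightarrow> l \<in> int_lattice \<Longrightarrow> j + l \<in> int_lattice"
  by (simp add: int_lattice_def inner_add_left)
lemma int_lattice_0: "0 \<in> int_lattice" by (simp add: int_lattice_def)
lemma int_lattice_Basis: "i \<in> Basis \<Longrightarrow> i \<in> int_lattice"
  by (auto simp: int_lattice_def inner_Basis)

lemma integral_cis_period:
  assumes s: "s > 0" and m: "m \<in> \<int>"
  shows "(LINT t|lborel. indicator {a - pi / s..a + pi / s} t *\<^sub>R cis (s * m * t)) = (if m = 0 then of_real (2 * pi / s) else 0)"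
proof (cases "m = 0")
  case True
  have "a - pi / s \<le> a + pi / s" using s by simp
  then have "(LINT t|lborel. indicator {a - pi / s..a + pi / s} t *\<^sub>R (1::complex)) = of_real (2 * pi / s)"
    by (subst integral_FTC_Icc[where F="\<lambda>t. of_real t"])
       (auto intro!: derivative_eq_intros continuous_intros)
  then show ?thesis using True by simp
next
  case False
  define k where "k = s * m"
  have k: "k \<noteq> 0" using s False by (simp add: k_def)
  let ?F = "\<lambda>t. (1 / (\<i> * of_real k)) * cis (k * t)"
  have d: "((\<lambda>t. cis (k * t)) has_vector_derivative k *\<^sub>R (\<i> * cis (k * t))) (at t within S)" for t S
  proof -
    have "((\<lambda>x. cis (k \<bullet> x)) has_derivative (\<lambda>h. \<i> * of_real (k \<bullet> h) * cis (k \<bullet> t))) (at t)"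
      by (rule has_derivative_cis_inner)
    then have "((\<lambda>x. cis (k * x)) has_derivative (\<lambda>h. h *\<^sub>R (k *\<^sub>R (\<i> * cis (k * t))))) (at t)"
      by (simp add: scaleR_conv_of_real ac_simps)
    then show ?thesis unfolding has_vector_derivative_def by (rule has_derivative_at_withinI)
  qed
  have "(?F has_vector_derivative cis (k * t)) (at t within S)" for t S
    using has_vector_derivative_mult_right[OF d[of t S], of "1 / (\<i> * of_real k)"] k
    by (simp add: scaleR_conv_of_real)
  moreover have "a - pi / s \<le> a + pi / s" using s by simp
  ultimately have "(LINT t|lborel. indicator {a - pi / s..a + pi / s} t *\<^sub>R cis (k * t)) = ?F (a + pi / s) - ?F (a - pi / s)"
    by (intro integral_FTC_Icc) (auto intro!: continuous_intros)
  also have "cis (k * (a + pi / s)) = cis (k * (a - pi / s)) * cis (2 * pi * m)"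
    using s by (simp add: cis_mult k_def field_simps)
  also have "cis (2 * pi * m) = 1" using m by (auto elim!: Ints_cases simp: cis_multiple_2pi)
  finally show ?thesis using False by (simp add: k_def)
qed

lemma indicator_cell:
  "(indicator (cell c s) \<eta> :: complex) = (\<Prod>b\<in>Basis. indicator {c \<bullet> b - pi / s..c \<bullet> b + pi / s} (\<eta> \<bullet> b))"
proof (cases "\<eta> \<in> cell c s")
  case True then show ?thesis by (auto simp: mem_cell indicator_def intro!: prod.neutral[symmetric])
next
  case False
  then obtain b where "b \<in> Basis" "\<eta> \<bullet> b \<notin> {c \<bullet> b - pi / s..c \<bullet> b + pi / s}" by (auto simp: mem_cell)
  then show ?thesis using False by (auto simp: indicator_def prod_zero_iff)
qed

text \<open>The integral factorises over the coordinates, and each factor extends over a full period.\<close>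

lemma cell_integral_wave:
  fixes c :: "'a::euclidean_space"
  assumes s: "s > 0" and j: "j \<in> int_lattice"
  shows "(LINT \<eta>|lborel. indicator (cell c s) \<eta> * wave s j \<eta>) = (if j = 0 then of_real ((2 * pi / s) ^ DIM('a)) else 0)"
proof -
  let ?f = "\<lambda>b t. indicator {c \<bullet> b - pi / s..c \<bullet> b + pi / s} t *\<^sub>R cis (s * (j \<bullet> b) * t)"
  have i: "integrable lborel (?f b)" for b
    by (rule borel_integrable_compact) (auto intro!: continuous_intros)
  have "indicator (cell c s) \<eta> * wave s j \<eta> = (\<Prod>b\<in>Basis. ?f b (\<eta> \<bullet> b))" for \<eta>
    unfolding indicator_cell wave_prod prod.distrib[symmetric]
    by (intro prod.cong refl) (simp add: indicator_def)
  then have "(LINT \<eta>|lborel. indicator (cell c s) \<eta> * wave s j \<eta>) = (\<Prod>b\<in>Basis. LINT t|lborel. ?f b t)"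
    using lborel_integral_prod[of ?f, OF i] by simp
  also have "\<dots> = (\<Prod>b\<in>Basis. if j \<bullet> b = 0 then of_real (2 * pi / s) else 0)"
    using j by (intro prod.cong refl integral_cis_period s) (auto simp: int_lattice_def)
  also have "\<dots> = (if j = 0 then of_real ((2 * pi / s) ^ DIM('a)) else 0)"
  proof (cases "j = 0")
    case False
    then obtain b where "b \<in> Basis" "j \<bullet> b \<noteq> 0" using euclidean_all_zero_iff by blast
    then show ?thesis using False by (auto simp: prod_zero_iff)
  qed simp
  finally show ?thesis .
qed

lemma integrable_cell:
  fixes F :: "'a::euclidean_space \<Rightarrow> complex"
  assumes "continuous_on (cell c s) F"
  shows "integrable lborel (\<lambda>\<eta>. indicator (cell c s) \<eta> * F \<eta>)"
  using borel_integrable_compact[OF compact_cell assms] 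
  by (rule Bochner_Integration.integrable_cong[THEN iffD1, rotated -1]) (auto simp: indicator_def)

text \<open>The polynomial \<open>P\<close> whose coefficients are the conjugated Fourier coefficients of \<open>F\<close> satisfies \<open>\<integral> F * P = S\<close>,
  the sum of their squares, and \<open>\<integral> \<bar>P\<bar>\<^sup>2\<close> is \<open>S\<close> times the volume of the cell by orthogonality. The Cauchy-Schwarz inequality concludes.\<close>

theorem bessel_inequality:
  fixes c :: "'a::euclidean_space"
  assumes s: "s > 0" and F: "l2on lborel F" "\<And>\<eta>. \<eta> \<notin> cell c s \<Longrightarrow> F \<eta> = 0"
    and J: "finite J" "J \<subseteq> int_lattice"
  shows "(\<Sum>j\<in>J. (cmod (LINT \<eta>|lborel. F \<eta> * wave s j \<eta>))\<^sup>2) \<le> (2 * pi / s) ^ DIM('a) * (LINT \<eta>|lborel. (cmod (F \<eta>))\<^sup>2)"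
proof -
  define V where "V = (2 * pi / s) ^ DIM('a)"
  have V: "0 \<le> V" using s by (simp add: V_def)
  let ?I = "\<lambda>\<eta>. indicator (cell c s) \<eta> :: complex"
  define b where "b j = (LINT \<eta>|lborel. F \<eta> * wave s j \<eta>)" for j
  define P where "P \<eta> = (\<Sum>j\<in>J. cnj (b j) * (?I \<eta> * wave s j \<eta>))" for \<eta>
  define S where "S = (\<Sum>j\<in>J. (cmod (b j))\<^sup>2)"
  have S0: "0 \<le> S" unfolding S_def by (intro sum_nonneg) auto
  have iw: "integrable lborel (\<lambda>\<eta>. ?I \<eta> * wave s j \<eta>)" for j by (intro integrable_cell wave_continuous)
  have Iw2: "l2on lborel (\<lambda>\<eta>. ?I \<eta> * wave s j \<eta>)" for j
  proof -
    have "integrable lborel (\<lambda>\<eta>. cmod (?I \<eta> * wave s j \<eta>))" using iw by (rule integrable_norm)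
    moreover have "(cmod (?I \<eta> * wave s j \<eta>))\<^sup>2 = cmod (?I \<eta> * wave s j \<eta>)" for \<eta>
      by (auto simp: indicator_def norm_mult)
    ultimately show ?thesis using iw unfolding l2on_def by (simp add: borel_measurable_integrable)
  qed
  have P2: "l2on lborel P" unfolding P_def[abs_def] using J(1)
  proof (induction J rule: finite_induct)
    case empty then show ?case by (simp add: l2on_def)
  next
    case (insert j J) then show ?case by (simp add: l2on_add l2on_cmult Iw2)
  qed
  have Fw: "F \<eta> * (?I \<eta> * wave s j \<eta>) = F \<eta> * wave s j \<eta>" for j \<eta>
    using F(2)[of \<eta>] by (auto simp: indicator_def)
  have iF: "integrable lborel (\<lambda>\<eta>. F \<eta> * wave s j \<eta>)" for j
    using l2on_mult_integrable[OF F(1) Iw2] unfolding Fw .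
  have "(LINT \<eta>|lborel. F \<eta> * P \<eta>) = (LINT \<eta>|lborel. (\<Sum>j\<in>J. cnj (b j) * (F \<eta> * wave s j \<eta>)))"
  proof (rule Bochner_Integration.integral_cong[OF refl])
    fix \<eta> show "F \<eta> * P \<eta> = (\<Sum>j\<in>J. cnj (b j) * (F \<eta> * wave s j \<eta>))"
      unfolding P_def sum_distrib_left Fw[symmetric] by (simp add: mult.left_commute)
  qed
  also have "\<dots> = (\<Sum>j\<in>J. cnj (b j) * b j)"
    unfolding b_def by (subst Bochner_Integration.integral_sum) (auto intro: iF)
  also have "\<dots> = of_real S"
    unfolding S_def of_real_sum by (intro sum.cong refl) (simp add: complex_norm_square mult.commute del: of_real_power)
  finally have FP: "(LINT \<eta>|lborel. F \<eta> * P \<eta>) = of_real S" .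
  have "complex_of_real (LINT \<eta>|lborel. (cmod (P \<eta>))\<^sup>2) = (LINT \<eta>|lborel. P \<eta> * cnj (P \<eta>))"
    unfolding integral_complex_of_real[symmetric] complex_norm_square ..
  also have "\<dots> = (LINT \<eta>|lborel. (\<Sum>j\<in>J. \<Sum>l\<in>J. cnj (b j) * b l * (?I \<eta> * wave s (j - l) \<eta>)))"
  proof (rule Bochner_Integration.integral_cong[OF refl])
    fix \<eta>
    have 1: "(?I \<eta> * wave s j \<eta>) * (?I \<eta> * wave s (- l) \<eta>) = ?I \<eta> * wave s (j - l) \<eta>" for j l
      using wave_mult[of s j \<eta> "- l"] by (auto simp: indicator_def)
    have 2: "cnj (P \<eta>) = (\<Sum>l\<in>J. b l * (?I \<eta> * wave s (- l) \<eta>))"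
      unfolding P_def cnj_sum by (intro sum.cong refl) (simp add: wave_cnj indicator_def)
    show "P \<eta> * cnj (P \<eta>) = (\<Sum>j\<in>J. \<Sum>l\<in>J. cnj (b j) * b l * (?I \<eta> * wave s (j - l) \<eta>))"
      unfolding 2 unfolding P_def sum_product 1[symmetric]
      by (intro sum.cong refl) (simp only: mult.assoc mult.left_commute)
  qed
  also have "\<dots> = (\<Sum>j\<in>J. \<Sum>l\<in>J. cnj (b j) * b l * (LINT \<eta>|lborel. ?I \<eta> * wave s (j - l) \<eta>))"
  proof -
    have i2: "integrable lborel (\<lambda>\<eta>. cnj (b j) * b l * (?I \<eta> * wave s (j - l) \<eta>))" for j l
      by (intro integrable_mult_right iw)
    show ?thesis
      by (simp only: Bochner_Integration.integral_sum[OF Bochner_Integration.integrable_sum[OF i2]]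
          Bochner_Integration.integral_sum[OF i2] integral_mult_right_zero)
  qed
  also have "\<dots> = (\<Sum>j\<in>J. \<Sum>l\<in>J. if l = j then cnj (b j) * b j * of_real V else 0)"
  proof (intro sum.cong refl)
    fix j l assume "j \<in> J" "l \<in> J"
    then have "j - l \<in> int_lattice" using J(2) int_lattice_add[of j "- l"] int_lattice_uminus[of l] by auto
    then show "cnj (b j) * b l * (LINT \<eta>|lborel. ?I \<eta> * wave s (j - l) \<eta>) = (if l = j then cnj (b j) * b j * of_real V else 0)"
      using cell_integral_wave[OF s, of "j - l" c] by (auto simp: V_def)
  qed
  also have "\<dots> = (\<Sum>j\<in>J. cnj (b j) * b j * of_real V)" using J(1) by simp
  also have "\<dots> = of_real (V * S)"
    unfolding S_def sum_distrib_left of_real_sum of_real_mult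
    by (intro sum.cong refl) (simp add: complex_norm_square mult.commute del: of_real_power)
  finally have PP: "(LINT \<eta>|lborel. (cmod (P \<eta>))\<^sup>2) = V * S" by (simp only: of_real_eq_iff)
  have "S \<le> nrm lborel F * sqrt (V * S)"
    using cauchy_schwarz_l2[OF F(1) P2] S0 unfolding FP nrm_def[of _ P] PP by simp
  then have "S\<^sup>2 \<le> (nrm lborel F * sqrt (V * S))\<^sup>2" using S0 by (intro power_mono) auto
  then have "S * S \<le> (V * (nrm lborel F)\<^sup>2) * S"
    using V S0 by (simp add: power_mult_distrib power2_eq_square ac_simps)
  then have "S \<le> V * (nrm lborel F)\<^sup>2"
    using S0 V by (cases "S = 0") (auto simp: mult_le_cancel_right)
  then show ?thesis unfolding S_def b_def V_def nrm_square .
qed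

text \<open>Powers of a kernel with a unique maximum concentrate at that point: close to \<open>x\<close> they are at
  least \<open>p ^ N\<close>, and they are at most \<open>q ^ N\<close> with \<open>q < p\<close> away from \<open>x\<close>.\<close>

lemma peaking_kernel:
  fixes H :: "'a::euclidean_space \<Rightarrow> complex" and K :: "'a \<Rightarrow> real"
  assumes Q: "compact Q" and x: "x \<in> interior Q"
    and H: "continuous_on Q H" and K: "continuous_on UNIV K"
    and K1: "\<And>\<eta>. 0 \<le> K \<eta>" "K x = 1" "\<And>\<eta>. \<eta> \<in> Q \<Longrightarrow> \<eta> \<noteq> x \<Longrightarrow> K \<eta> < 1"
    and zero: "\<And>N::nat. (LINT \<eta>|lborel. indicator Q \<eta> * (H \<eta> * of_real (K \<eta> ^ N))) = 0"
  shows "H x = 0"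
proof (rule ccontr)
  assume Hx: "H x \<noteq> 0"
  define G where "G \<eta> = Re (H \<eta> / H x)" for \<eta>
  have xQ: "x \<in> Q" using x interior_subset by blast
  have G: "continuous_on Q G" unfolding G_def using Hx by (intro continuous_intros H) auto
  have "continuous_on (interior Q) G" by (rule continuous_on_subset[OF G interior_subset])
  then have "isCont G x" using x by (simp add: continuous_on_eq_continuous_at)
  then have "(G \<longlongrightarrow> G x) (nhds x)" by (simp add: isCont_def tendsto_at_iff_tendsto_nhds)
  moreover have "G x > 1 / 2" using Hx by (simp add: G_def)
  ultimately have "\<forall>\<^sub>F y in nhds x. G y > 1 / 2" by (rule order_tendstoD(1))
  moreover have "\<forall>\<^sub>F y in nhds x. y \<in> interior Q" using x by (intro eventually_nhds_in_open) auto
  ultimately have "\<forall>\<^sub>F y in nhds x. G y > 1 / 2 \<and> y \<in> Q"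
    by eventually_elim (use interior_subset in auto)
  then obtain r where r: "r > 0" "\<And>y. dist y x < r \<Longrightarrow> G y > 1 / 2 \<and> y \<in> Q"
    by (auto simp: eventually_nhds_metric)
  \<comment> \<open>Away from x the kernel stays below some q < 1 by compactness, close to x it exceeds the midpoint p of q and 1.\<close>
  obtain q where q: "0 \<le> q" "q < 1" "\<And>y. y \<in> Q \<Longrightarrow> \<not> dist y x < r \<Longrightarrow> K y \<le> q"
  proof (cases "Q - ball x r = {}")
    case True
    then have "dist y x < r" if "y \<in> Q" for y using that by (auto simp: dist_commute)
    then show ?thesis using that[of 0] by auto
  next
    case False
    have "compact (Q - ball x r)" by (intro compact_diff Q open_ball)
    moreover have "continuous_on (Q - ball x r) K" by (rule continuous_on_subset[OF K]) simp
    ultimately obtain y where y: "y \<in> Q - ball x r" "\<And>z. z \<in> Q - ball x r \<Longrightarrow> K z \<le> K y"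
      using continuous_attains_sup[OF _ False] by blast
    have "K y < 1" using y(1) r(1) by (intro K1(3)) auto
    then show ?thesis using that[of "K y"] K1(1) y by (auto simp: dist_commute)
  qed
  define p where "p = (1 + q) / 2"
  have p: "q < p" "p < 1" "0 < p" using q by (auto simp: p_def)
  have "isCont K x" using K by (simp add: continuous_on_eq_continuous_at)
  then have "(K \<longlongrightarrow> K x) (nhds x)" by (simp add: isCont_def tendsto_at_iff_tendsto_nhds)
  then have "\<forall>\<^sub>F y in nhds x. K y > p" by (rule order_tendstoD(1)) (use p K1(2) in simp)
  then obtain e where e: "e > 0" "\<And>y. dist y x < e \<Longrightarrow> K y > p" by (auto simp: eventually_nhds_metric)
  define d where "d = min e r"
  have d: "d > 0" using e r by (simp add: d_def)
  obtain B where B: "\<And>y. y \<in> Q \<Longrightarrow> \<bar>G y\<bar> \<le> B"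
    using compact_imp_bounded[OF compact_continuous_image[OF G Q]] by (auto simp: bounded_iff)
  have B0: "0 \<le> B" using B[OF xQ] by linarith
  have Qb [measurable]: "Q \<in> sets borel" using Q by (simp add: borel_compact)
  note borel_open[OF open_ball, measurable]
  have iQ: "integrable lborel (\<lambda>y. indicator Q y :: real)"
    using emeasure_compact_finite[OF Q] by (intro integrable_real_indicator) (auto simp: Qb)
  have ib: "integrable lborel (\<lambda>y. indicator (ball x d) y :: real)"
    by (intro integrable_real_indicator) (auto simp: emeasure_bounded_finite[OF bounded_ball, unfolded infinity_ennreal_def])
  define v where "v = measure lborel (ball x d)"
  have v: "v > 0" unfolding v_def using d by (rule content_ball_pos)
  define w where "w = measure lborel Q"
  have main: "(1/2) * p ^ N * v \<le> B * q ^ N * w" for N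
  proof -
    have iG: "integrable lborel (\<lambda>y. indicator Q y *\<^sub>R (H y / H x * of_real (K y ^ N)))"
      using Hx by (intro borel_integrable_compact Q continuous_intros H continuous_on_subset[OF K]) auto
    have z: "(LINT y|lborel. indicator Q y *\<^sub>R (H y / H x * of_real (K y ^ N))) = 0"
    proof -
      have "(LINT y|lborel. indicator Q y *\<^sub>R (H y / H x * of_real (K y ^ N))) =
        (LINT y|lborel. (1 / H x) * (indicator Q y * (H y * of_real (K y ^ N))))"
        by (intro Bochner_Integration.integral_cong refl) (simp add: indicator_def)
      then show ?thesis using zero[of N] by simp
    qed
    have Re_int: "Re (indicator Q y *\<^sub>R (H y / H x * of_real (K y ^ N))) = indicator Q y * (G y * K y ^ N)" for y
    proof -
      have "Re (H y / H x * of_real (K y ^ N)) = G y * K y ^ N"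
        unfolding G_def by (simp only: times_complex.sel(1) Re_complex_of_real Im_complex_of_real mult_zero_right diff_zero)
      then show ?thesis by (simp only: scaleR_complex.sel)
    qed
    have "(LINT y|lborel. (1/2) * p ^ N * indicator (ball x d) y - B * q ^ N * indicator Q y) \<le>
      (LINT y|lborel. indicator Q y * (G y * K y ^ N))"
    proof (rule integral_mono)
      show "integrable lborel (\<lambda>y. (1/2) * p ^ N * indicator (ball x d) y - B * q ^ N * indicator Q y)"
        by (intro Bochner_Integration.integrable_diff integrable_mult_right ib iQ)
      show "integrable lborel (\<lambda>y. indicator Q y * (G y * K y ^ N))"
        using integrable_Re[OF iG] unfolding Re_int .
      fix y
      have pos: "0 \<le> B * q ^ N" "0 \<le> K y ^ N" using B0 q K1(1) by auto
      show "(1/2) * p ^ N * indicator (ball x d) y - B * q ^ N * indicator Q y \<le> indicator Q y * (G y * K y ^ N)"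
      proof (cases "dist y x < r")
        case True
        then have y: "G y > 1/2" "y \<in> Q" using r(2) by auto
        show ?thesis
        proof (cases "dist y x < d")
          case True
          then have "p ^ N \<le> K y ^ N" using e(2)[of y] p by (intro power_mono) (auto simp: d_def)
          then have "(1/2) * p ^ N \<le> G y * K y ^ N" using y p by (intro mult_mono) auto
          then show ?thesis using y(2) pos True by (simp add: dist_commute)
        next
          case False
          have "0 \<le> G y * K y ^ N" using y pos by simp
          then show ?thesis using y(2) pos False by (simp add: dist_commute)
        qed
      next
        case False
        then have nb: "y \<notin> ball x d" by (auto simp: d_def dist_commute)
        show ?thesis
        proof (cases "y \<in> Q")
          case True
          have "\<bar>G y * K y ^ N\<bar> \<le> B * q ^ N"
            unfolding abs_mult using B[OF True] q(3)[OF True False] K1(1)[of y] B0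
            by (intro mult_mono) (auto simp: power_mono)
          then show ?thesis using True nb by simp
        qed (use nb in simp)
      qed
    qed
    also have "(LINT y|lborel. indicator Q y * (G y * K y ^ N)) = 0"
      using integral_Re[OF iG] z unfolding Re_int by simp
    also have "(LINT y|lborel. (1/2) * p ^ N * indicator (ball x d) y - B * q ^ N * indicator Q y) =
        (1/2) * p ^ N * v - B * q ^ N * w"
      using ib iQ by (simp add: v_def w_def)
    finally show ?thesis by simp
  qed
  have "(\<lambda>N. B * w * (q / p) ^ N) \<longlonglongrightarrow> 0"
    using p q by (intro tendsto_mult_right_zero LIMSEQ_power_zero) auto
  moreover have "(1/2) * v \<le> B * w * (q / p) ^ N" for N
  proof -
    have "(1/2) * v = (1/2) * p ^ N * v / p ^ N" using p by simp
    also have "\<dots> \<le> B * q ^ N * w / p ^ N" using main[of N] p by (intro divide_right_mono) auto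
    also have "\<dots> = B * w * (q / p) ^ N" by (simp add: power_divide)
    finally show ?thesis .
  qed
  ultimately have "(1/2) * v \<le> 0" by (intro LIMSEQ_le_const) auto
  then show False using v by simp
qed

text \<open>This is an algebra, because waves multiply to waves; hence it contains the powers of a kernel that belongs to it.\<close>

inductive_set trig_poly :: "real \<Rightarrow> ('a::euclidean_space \<Rightarrow> complex) set" for s where
  wave: "j \<in> int_lattice \<Longrightarrow> wave s j \<in> trig_poly s"
| add: "f \<in> trig_poly s \<Longrightarrow> g \<in> trig_poly s \<Longrightarrow> (\<lambda>x. f x + g x) \<in> trig_poly s"
| cmult: "f \<in> trig_poly s \<Longrightarrow> (\<lambda>x. c * f x) \<in> trig_poly s"

lemma trig_poly_mult_wave:
  assumes "g \<in> trig_poly s" "j \<in> int_lattice" shows "(\<lambda>x. wave s j x * g x) \<in> trig_poly s"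
  using assms(1)
proof induction
  case (wave l)
  then show ?case using trig_poly.wave[OF int_lattice_add[OF assms(2) wave], of s] by (simp add: wave_mult)
next
  case (add f g)
  then show ?case using trig_poly.add by (simp add: distrib_left)
next
  case (cmult f c)
  then show ?case using trig_poly.cmult by (simp add: mult.left_commute)
qed

lemma trig_poly_mult:
  assumes "f \<in> trig_poly s" "g \<in> trig_poly s" shows "(\<lambda>x. f x * g x) \<in> trig_poly s"
  using assms(1)
proof induction
  case (wave j) then show ?case using trig_poly_mult_wave[OF assms(2)] by simp
next
  case (add f g) then show ?case using trig_poly.add by (simp add: distrib_right)
next
  case (cmult f c) then show ?case using trig_poly.cmult by (simp add: mult.assoc)
qed

lemma trig_poly_const: "(\<lambda>x. c) \<in> trig_poly s"
  using trig_poly.cmult[OF trig_poly.wave[OF int_lattice_0], of c s] by (simp add: wave_def)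

lemma trig_poly_power: "f \<in> trig_poly s \<Longrightarrow> (\<lambda>x. f x ^ n) \<in> trig_poly s"
  by (induction n) (auto intro: trig_poly_const trig_poly_mult)

lemma trig_poly_prod: "(\<And>i. i \<in> I \<Longrightarrow> f i \<in> trig_poly s) \<Longrightarrow> (\<lambda>x. \<Prod>i\<in>I. f i x) \<in> trig_poly s"
  by (induction I rule: infinite_finite_induct) (auto intro: trig_poly_const trig_poly_mult)

lemma trig_poly_continuous: "f \<in> trig_poly s \<Longrightarrow> continuous_on S f"
  by (induction rule: trig_poly.induct) (auto intro!: continuous_intros wave_continuous)

lemma trig_poly_orthogonal:
  assumes H: "continuous_on (cell c s) H"
    and zero: "\<And>j. j \<in> int_lattice \<Longrightarrow> (LINT \<eta>|lborel. indicator (cell c s) \<eta> * (H \<eta> * wave s j \<eta>)) = 0"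
  shows "f \<in> trig_poly s \<Longrightarrow> (LINT \<eta>|lborel. indicator (cell c s) \<eta> * (H \<eta> * f \<eta>)) = 0"
proof (induction rule: trig_poly.induct)
  case (add f g)
  have "integrable lborel (\<lambda>\<eta>. indicator (cell c s) \<eta> * (H \<eta> * f \<eta>))" if "f \<in> trig_poly s" for f
    by (intro integrable_cell continuous_intros H trig_poly_continuous[OF that])
  then show ?case using add by (simp add: distrib_left)
next
  case (cmult f k)
  have "(LINT \<eta>|lborel. indicator (cell c s) \<eta> * (H \<eta> * (k * f \<eta>))) = (LINT \<eta>|lborel. k * (indicator (cell c s) \<eta> * (H \<eta> * f \<eta>)))"
    by (intro Bochner_Integration.integral_cong refl) simp
  then show ?case using cmult by simp
qed (use zero in auto)

text \<open>The peaking kernel is the product of the functions \<open>(1 + cos) / 2\<close> of the coordinates of \<open>\<eta> - x\<close>. It is a trigonometric polynomial, and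
  \<open>x\<close> is its only maximum in the cell, because the cell extends over a single period and \<open>x\<close> is an inner point.\<close>

theorem fourier_coefficients_unique:
  fixes c :: "'a::euclidean_space"
  assumes s: "s > 0" and H: "continuous_on (cell c s) H"
    and zero: "\<And>j. j \<in> int_lattice \<Longrightarrow> (LINT \<eta>|lborel. indicator (cell c s) \<eta> * (H \<eta> * wave s j \<eta>)) = 0"
    and x: "x \<in> open_cell c s"
  shows "H x = 0"
proof -
  define k where "k i \<eta> = (1 + cos (s * ((\<eta> - x) \<bullet> i))) / 2" for i \<eta>
  define K where "K \<eta> = (\<Prod>i\<in>Basis. k i \<eta>)" for \<eta>
  have k01: "0 \<le> k i \<eta>" "k i \<eta> \<le> 1" for i \<eta>
  proof -
    define y where "y = cos (s * ((\<eta> - x) \<bullet> i))"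
    have "- 1 \<le> y" "y \<le> 1" unfolding y_def by (rule cos_ge_minus_one cos_le_one)+
    then show "0 \<le> k i \<eta>" "k i \<eta> \<le> 1" unfolding k_def y_def[symmetric] by auto
  qed
  have kt: "(\<lambda>\<eta>. of_real (k i \<eta>)) \<in> trig_poly s" if i: "i \<in> Basis" for i
  proof -
    let ?t = "\<lambda>\<eta>. 1 / 2 + ((cis (- (s * (x \<bullet> i))) / 4) * wave s i \<eta> + (cis (s * (x \<bullet> i)) / 4) * wave s (- i) \<eta>)"
    have "?t \<in> trig_poly s"
      by (intro trig_poly.add trig_poly_const trig_poly.cmult trig_poly.wave int_lattice_uminus int_lattice_Basis i)
    moreover have "?t \<eta> = of_real (k i \<eta>)" for \<eta>
    proof -
      have 1: "cis (- (s * (x \<bullet> i))) * wave s i \<eta> = cis (s * ((\<eta> - x) \<bullet> i))"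
        unfolding wave_def cis_mult by (simp add: algebra_simps inner_commute[of i])
      have 2: "cis (s * (x \<bullet> i)) * wave s (- i) \<eta> = cis (- (s * ((\<eta> - x) \<bullet> i)))"
        unfolding wave_def cis_mult by (simp add: algebra_simps inner_commute[of i])
      show ?thesis
        unfolding times_divide_eq_left 1 2 k_def by (auto simp: complex_eq_iff)
    qed
    ultimately show ?thesis by simp
  qed
  have "(\<lambda>\<eta>. \<Prod>i\<in>Basis. complex_of_real (k i \<eta>)) \<in> trig_poly s" by (rule trig_poly_prod) (rule kt)
  then have Kt: "(\<lambda>\<eta>. complex_of_real (K \<eta>)) \<in> trig_poly s" unfolding K_def by simp
  show ?thesis
  proof (rule peaking_kernel[where Q="cell c s" and K=K])
    show "compact (cell c s)" by (rule compact_cell)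
    show "x \<in> interior (cell c s)"
      using x open_cell_subset open_open_cell interior_maximal by blast
    show "continuous_on UNIV K" unfolding K_def k_def by (intro continuous_intros) auto
    show "0 \<le> K \<eta>" for \<eta> unfolding K_def using k01 by (intro prod_nonneg) auto
    show "K x = 1" unfolding K_def k_def by simp
    show "(LINT \<eta>|lborel. indicator (cell c s) \<eta> * (H \<eta> * of_real (K \<eta> ^ N))) = 0" for N
      using trig_poly_orthogonal[OF H zero trig_poly_power[OF Kt, of N]] by simp
    show "continuous_on (cell c s) H" by (rule H)
    fix \<eta> assume \<eta>: "\<eta> \<in> cell c s" "\<eta> \<noteq> x"
    then obtain i where i: "i \<in> Basis" "\<eta> \<bullet> i \<noteq> x \<bullet> i" using euclidean_eqI by blast
    have "\<eta> \<bullet> i \<in> {c \<bullet> i - pi / s..c \<bullet> i + pi / s}" "x \<bullet> i \<in> {c \<bullet> i - pi / s<..<c \<bullet> i + pi / s}"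
      using \<eta>(1) x i(1) by (auto simp: mem_cell mem_open_cell)
    then have "\<bar>(\<eta> - x) \<bullet> i\<bar> < 2 * (pi / s)" by (auto simp: inner_diff_left abs_if)
    then have "s * \<bar>(\<eta> - x) \<bullet> i\<bar> < s * (2 * (pi / s))" using s by (intro mult_strict_left_mono)
    then have lt: "\<bar>s * ((\<eta> - x) \<bullet> i)\<bar> < 2 * pi" using s by (simp add: abs_mult)
    have ne: "s * ((\<eta> - x) \<bullet> i) \<noteq> 0" using s i(2) by (simp add: inner_diff_left)
    have "cos (s * ((\<eta> - x) \<bullet> i)) \<noteq> 1"
    proof
      assume "cos (s * ((\<eta> - x) \<bullet> i)) = 1"
      then obtain m :: int where m: "s * ((\<eta> - x) \<bullet> i) = of_int m * 2 * pi" by (auto simp: cos_one_2pi_int)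
      then have "\<bar>of_int m :: real\<bar> * (2 * pi) < 1 * (2 * pi)" using lt by (simp add: abs_mult)
      then have "\<bar>of_int m :: real\<bar> < 1" by (rule mult_right_less_imp_less) simp
      then have "m = 0" by linarith
      then show False using m ne by simp
    qed
    then have "k i \<eta> < 1" unfolding k_def using cos_le_one[of "s * ((\<eta> - x) \<bullet> i)"] by (simp add: order_less_le)
    moreover have "K \<eta> = k i \<eta> * (\<Prod>i\<in>Basis - {i}. k i \<eta>)" unfolding K_def using i(1) by (simp add: prod.remove)
    moreover have "(\<Prod>i\<in>Basis - {i}. k i \<eta>) \<le> 1" using k01 by (intro prod_le_1) auto
    ultimately show "K \<eta> < 1" using k01(1)[of i \<eta>] by (metis mult_left_le order_le_less_trans)
  qed
qed

lemma half_open_cube_lattice_disjoint: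
  fixes j l :: "'a::euclidean_space"
  assumes "j \<in> int_lattice" "l \<in> int_lattice" "y \<in> half_open_cube j 1" "y \<in> half_open_cube l 1"
  shows "j = l"
proof (rule euclidean_eqI)
  fix i :: 'a assume i: "i \<in> Basis"
  obtain m n :: int where "j \<bullet> i = of_int m" "l \<bullet> i = of_int n"
    using assms(1,2) i unfolding int_lattice_def Ints_def by blast
  moreover have "j \<bullet> i \<le> y \<bullet> i" "y \<bullet> i < j \<bullet> i + 1" "l \<bullet> i \<le> y \<bullet> i" "y \<bullet> i < l \<bullet> i + 1"
    using assms(3,4) i by (auto simp: half_open_cube_def)
  ultimately have "real_of_int m < real_of_int (n + 1)" "real_of_int n < real_of_int (m + 1)"
    by (simp_all only: of_int_add of_int_1)
  then have "m < n + 1" "n < m + 1" by (simp_all only: of_int_less_iff)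
  then have "m = n" by linarith
  then show "j \<bullet> i = l \<bullet> i" using \<open>j \<bullet> i = of_int m\<close> \<open>l \<bullet> i = of_int n\<close> by simp
qed

lemma emeasure_half_open_cube:
  "half_open_cube (j :: 'a::euclidean_space) 1 \<in> sets borel" "emeasure lborel (half_open_cube j 1) = 1"
proof -
  have eq: "half_open_cube j 1 = (\<Inter>i\<in>Basis. {x. j \<bullet> i \<le> x \<bullet> i \<and> x \<bullet> i < j \<bullet> i + 1})"
    unfolding half_open_cube_def by auto
  show s: "half_open_cube j 1 \<in> sets borel"
    unfolding eq by (intro sets.finite_INT) (auto intro!: borel_measurable_le borel_measurable_less sets.sets_Collect_conj)
  have "emeasure lborel (box j (j + One)) \<le> emeasure lborel (half_open_cube j 1)"
    by (intro emeasure_mono) (use s in \<open>auto simp: half_open_cube_def mem_box inner_add_left less_imp_le\<close>)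
  moreover have "emeasure lborel (half_open_cube j 1) \<le> emeasure lborel (cbox j (j + One))"
    by (intro emeasure_mono) (auto simp: half_open_cube_def mem_box inner_add_left less_imp_le)
  moreover have "emeasure lborel (box j (j + One)) = 1" "emeasure lborel (cbox j (j + One)) = 1"
    by (auto simp: emeasure_lborel_box_eq emeasure_lborel_cbox_eq inner_add_left)
  ultimately show "emeasure lborel (half_open_cube j 1) = 1" by simp
qed

text \<open>The value at a lattice point is at most a constant times the value anywhere in the unit cube at this point, so the sum is
  bounded by an integral.\<close>

lemma lattice_sum_decay:
  fixes s :: real
  assumes s: "s > 0"
  shows "\<exists>C>0. \<forall>J::'a::euclidean_space set. finite J \<and> J \<subseteq> int_lattice \<longrightarrow> (\<Sum>j\<in>J. decay (s *\<^sub>R j)) \<le> C"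
proof -
  let ?N = "DIM('a) + 2"
  \<comment> \<open>A bounds the oscillation of the decay on a unit cube, whose diameter is at most DIM('a).\<close>
  define A where "A = (1 + s * real DIM('a)) ^ ?N"
  have A: "A > 0" unfolding A_def using s by (intro zero_less_power add_pos_nonneg) auto
  define I where "I = (LINT y|lborel. decay (s *\<^sub>R (y::'a)))"
  have bd: "integrable lborel (\<lambda>y::'a. decay (s *\<^sub>R y))"
  proof -
    have "integrable lborel (\<lambda>y::'a. complex_of_real (decay (0 + s *\<^sub>R y)))"
      using s integrable_decay by (subst lborel_affine_integral(1)[of "\<lambda>y. complex_of_real (decay y)"]) auto
    from integrable_Re[OF this] show ?thesis by simp
  qed
  have "(\<Sum>j\<in>J. decay (s *\<^sub>R j)) \<le> A * I" if J: "finite J" "J \<subseteq> int_lattice" for J :: "'a set"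
  proof -
    note cube = emeasure_half_open_cube
    have pt: "decay (s *\<^sub>R j) \<le> A * decay (s *\<^sub>R y)" if y: "y \<in> half_open_cube j 1" for j y :: 'a
    proof -
      have "j \<in> half_open_cube j 1" by (auto simp: half_open_cube_def)
      then have "norm (y - j) \<le> real DIM('a) * 1" by (rule half_open_cube_norm_diff[OF y])
      then have "norm (s *\<^sub>R y - s *\<^sub>R j) \<le> s * real DIM('a)"
        using s by (simp add: scaleR_diff_right[symmetric] mult_left_mono)
      moreover have "norm (s *\<^sub>R y) \<le> norm (s *\<^sub>R j) + norm (s *\<^sub>R y - s *\<^sub>R j)" by (rule norm_triangle_sub)
      moreover have "0 \<le> s * real DIM('a) * norm (s *\<^sub>R j)" using s by simp
      ultimately have "1 + norm (s *\<^sub>R y) \<le> (1 + s * real DIM('a)) * (1 + norm (s *\<^sub>R j))"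
        unfolding distrib_right distrib_left by linarith
      then have "(1 + norm (s *\<^sub>R y)) ^ ?N \<le> ((1 + s * real DIM('a)) * (1 + norm (s *\<^sub>R j))) ^ ?N" by (intro power_mono) auto
      then have le: "(1 + norm (s *\<^sub>R y)) ^ ?N \<le> A * (1 + norm (s *\<^sub>R j)) ^ ?N" unfolding A_def power_mult_distrib .
      have p: "0 < (1 + norm z) ^ ?N" for z :: 'a by (intro zero_less_power add_pos_nonneg) auto
      have "1 / (1 + norm (s *\<^sub>R j)) ^ ?N \<le> A * (1 / (1 + norm (s *\<^sub>R y)) ^ ?N)"
        using le p[of "s *\<^sub>R j"] p[of "s *\<^sub>R y"] by (simp add: divide_simps)
      then show ?thesis unfolding decay_def .
    qed
    have ic: "integrable lborel (\<lambda>y. indicator (half_open_cube j 1) y :: real)" for j :: 'a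
      by (intro integrable_real_indicator) (simp_all add: cube)
    have "(\<Sum>j\<in>J. decay (s *\<^sub>R j)) = (\<Sum>j\<in>J. LINT y|lborel. decay (s *\<^sub>R j) * indicator (half_open_cube j 1) y)"
      by (intro sum.cong refl) (simp add: measure_def cube)
    also have "\<dots> = (LINT y|lborel. (\<Sum>j\<in>J. decay (s *\<^sub>R j) * indicator (half_open_cube j 1) y))"
      by (intro Bochner_Integration.integral_sum[symmetric] integrable_mult_right ic)
    also have "\<dots> \<le> (LINT y|lborel. A * decay (s *\<^sub>R (y::'a)))"
    proof (rule integral_mono)
      show "integrable lborel (\<lambda>y. \<Sum>j\<in>J. decay (s *\<^sub>R j) * indicator (half_open_cube j 1) y)"
        by (intro Bochner_Integration.integrable_sum integrable_mult_right ic)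
      show "integrable lborel (\<lambda>y::'a. A * decay (s *\<^sub>R y))" by (rule integrable_mult_right[OF bd])
      fix y :: 'a
      have pos: "0 \<le> A * decay (s *\<^sub>R y)" using A less_imp_le[OF decay_pos[of "s *\<^sub>R y"]] by simp
      show "(\<Sum>j\<in>J. decay (s *\<^sub>R j) * indicator (half_open_cube j 1) y) \<le> A * decay (s *\<^sub>R y)"
      proof (cases "\<exists>l\<in>J. y \<in> half_open_cube l 1")
        case True
        then obtain l where l: "l \<in> J" "y \<in> half_open_cube l 1" by blast
        have "(\<Sum>j\<in>J. decay (s *\<^sub>R j) * indicator (half_open_cube j 1) y) = (\<Sum>j\<in>J. if j = l then decay (s *\<^sub>R l) else 0)"
          using half_open_cube_lattice_disjoint[of _ l y] l J(2)
          by (intro sum.cong refl) (auto simp: indicator_def)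
        also have "\<dots> = decay (s *\<^sub>R l)" using J(1) l(1) by simp
        also have "\<dots> \<le> A * decay (s *\<^sub>R y)" by (rule pt[OF l(2)])
        finally show ?thesis .
      next
        case False
        then have "(\<Sum>j\<in>J. decay (s *\<^sub>R j) * indicator (half_open_cube j 1) y) = 0"
          by (intro sum.neutral) auto
        then show ?thesis using pos by simp
      qed
    qed
    finally show ?thesis unfolding I_def by simp
  qed
  then have "(\<Sum>j\<in>J. decay (s *\<^sub>R j)) \<le> \<bar>A * I\<bar> + 1" if "finite J" "J \<subseteq> int_lattice" for J :: "'a set"
    using that by fastforce
  then show ?thesis by (intro exI[of _ "\<bar>A * I\<bar> + 1"]) simp
qed

definition lattice_ball :: "real \<Rightarrow> nat \<Rightarrow> 'a::euclidean_space set" where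
  "lattice_ball s n = {j \<in> int_lattice. norm (s *\<^sub>R j) \<le> real n}"

lemma lattice_ball_subset: "lattice_ball s n \<subseteq> int_lattice" by (auto simp: lattice_ball_def)

lemma finite_lattice_ball:
  assumes s: "s > 0" shows "finite (lattice_ball s n :: 'a::euclidean_space set)"
proof (rule ccontr)
  assume inf: "infinite (lattice_ball s n :: 'a set)"
  obtain C where C: "\<And>J::'a set. finite J \<Longrightarrow> J \<subseteq> int_lattice \<Longrightarrow> (\<Sum>j\<in>J. decay (s *\<^sub>R j)) \<le> C"
    using lattice_sum_decay[OF s, where 'a='a] by blast
  define p where "p = 1 / (1 + real n) ^ (DIM('a) + 2)"
  have p: "p > 0" by (simp add: p_def)
  obtain m :: nat where m: "C / p < real m" using reals_Archimedean2 by blast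
  obtain J :: "'a set" where J: "finite J" "card J = m" "J \<subseteq> lattice_ball s n"
    using infinite_arbitrarily_large[OF inf] by blast
  have "real m * p = (\<Sum>j\<in>J. p)" using J by simp
  also have "\<dots> \<le> (\<Sum>j\<in>J. decay (s *\<^sub>R j))"
  proof (rule sum_mono)
    fix j assume "j \<in> J"
    then have "norm (s *\<^sub>R j) \<le> real n" using J by (auto simp: lattice_ball_def)
    then show "p \<le> decay (s *\<^sub>R j)" unfolding p_def decay_def
      by (intro divide_left_mono power_mono mult_pos_pos zero_less_power add_pos_nonneg) auto
  qed
  also have "\<dots> \<le> C" using J lattice_ball_subset[of s n] by (intro C) auto
  finally show False using m p by (simp add: field_simps)
qed

text \<open>For functions that vanish outside of a cell this is the Fourier coefficient on the cell.\<close>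

definition fcoef :: "real \<Rightarrow> ('a::euclidean_space \<Rightarrow> complex) \<Rightarrow> 'a \<Rightarrow> complex" where
  "fcoef s h j = of_real ((s / (2 * pi)) ^ DIM('a)) * fourier h (s *\<^sub>R j)"

definition fsum :: "real \<Rightarrow> ('a::euclidean_space \<Rightarrow> complex) \<Rightarrow> nat \<Rightarrow> 'a \<Rightarrow> complex" where
  "fsum s h n \<eta> = (\<Sum>j\<in>lattice_ball s n. fcoef s h j * wave s j \<eta>)"

lemma fcoef_bound:
  fixes h :: "'a::euclidean_space \<Rightarrow> complex"
  assumes h: "h \<in> schwartz"
  shows "\<exists>K>0. \<forall>j. (1 + norm (s *\<^sub>R j)) * cmod (fcoef s h j) \<le> K * decay (s *\<^sub>R j)"
proof -
  obtain K where K: "K > 0" "\<And>x. (1 + norm x) ^ 1 * cmod (fourier h x) \<le> K * decay x"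
    using schwartz_bound_decay[OF schwartz_fourier[OF h]] by blast
  let ?m = "\<bar>(s / (2 * pi)) ^ DIM('a)\<bar>"
  have "(1 + norm (s *\<^sub>R j)) * cmod (fcoef s h j) \<le> (K * ?m + 1) * decay (s *\<^sub>R j)" for j :: 'a
  proof -
    have "(1 + norm (s *\<^sub>R j)) * cmod (fcoef s h j) = ?m * ((1 + norm (s *\<^sub>R j)) ^ 1 * cmod (fourier h (s *\<^sub>R j)))"
      unfolding fcoef_def norm_mult norm_of_real by (simp add: mult.left_commute)
    also have "\<dots> \<le> ?m * (K * decay (s *\<^sub>R j))" by (intro mult_left_mono K) auto
    also have "\<dots> \<le> (K * ?m + 1) * decay (s *\<^sub>R j)"
      using less_imp_le[OF decay_pos[of "s *\<^sub>R j"]] by (simp add: algebra_simps)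
    finally show ?thesis .
  qed
  moreover have "K * ?m + 1 > 0" using K(1) by (intro add_nonneg_pos mult_nonneg_nonneg) auto
  ultimately show ?thesis by blast
qed

text \<open>One factor \<open>1 + norm (s *\<^sub>R j)\<close> is spent on the rate, the remaining decay is summable over the lattice.\<close>

lemma fsum_cauchy:
  fixes h :: "'a::euclidean_space \<Rightarrow> complex"
  assumes s: "s > 0" and h: "h \<in> schwartz"
  shows "\<exists>K>0. \<forall>n m \<eta>. n \<le> m \<longrightarrow> cmod (fsum s h m \<eta> - fsum s h n \<eta>) \<le> K / (1 + real n)"
proof -
  obtain K where K: "K > 0" "\<And>j. (1 + norm (s *\<^sub>R j)) * cmod (fcoef s h j) \<le> K * decay (s *\<^sub>R j)"
    using fcoef_bound[OF h] by blast
  obtain C where C: "C > 0" "\<And>J::'a set. finite J \<Longrightarrow> J \<subseteq> int_lattice \<Longrightarrow> (\<Sum>j\<in>J. decay (s *\<^sub>R j)) \<le> C"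
    using lattice_sum_decay[OF s, where 'a='a] by blast
  have "cmod (fsum s h m \<eta> - fsum s h n \<eta>) \<le> (K * C) / (1 + real n)" if nm: "n \<le> m" for n m \<eta>
  proof -
    let ?D = "lattice_ball s m - lattice_ball s n :: 'a set"
    have sub: "lattice_ball s n \<subseteq> (lattice_ball s m :: 'a set)" using nm by (auto simp: lattice_ball_def)
    have "fsum s h m \<eta> - fsum s h n \<eta> = (\<Sum>j\<in>?D. fcoef s h j * wave s j \<eta>)"
      unfolding fsum_def by (rule sum_diff[symmetric, OF finite_lattice_ball[OF s] sub])
    also have "cmod \<dots> \<le> (\<Sum>j\<in>?D. cmod (fcoef s h j * wave s j \<eta>))" by (rule norm_sum)
    also have "\<dots> \<le> (\<Sum>j\<in>?D. K * decay (s *\<^sub>R j) / (1 + real n))"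
    proof (rule sum_mono)
      fix j assume "j \<in> ?D"
      then have j: "1 + real n \<le> 1 + norm (s *\<^sub>R j)" by (auto simp: lattice_ball_def)
      have "(1 + real n) * cmod (fcoef s h j) \<le> K * decay (s *\<^sub>R j)"
        using K(2)[of j] mult_right_mono[OF j norm_ge_zero[of "fcoef s h j"]] by linarith
      moreover have "0 < 1 + real n" by simp
      ultimately have "cmod (fcoef s h j) \<le> K * decay (s *\<^sub>R j) / (1 + real n)"
        by (simp only: pos_le_divide_eq mult.commute)
      then show "cmod (fcoef s h j * wave s j \<eta>) \<le> K * decay (s *\<^sub>R j) / (1 + real n)"
        by (simp only: norm_mult wave_norm mult_1_right)
    qed
    also have "\<dots> = K * (\<Sum>j\<in>?D. decay (s *\<^sub>R j)) / (1 + real n)"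
      by (simp add: sum_divide_distrib sum_distrib_left)
    also have "\<dots> \<le> K * C / (1 + real n)"
      using K(1) finite_lattice_ball[OF s] lattice_ball_subset
      by (intro divide_right_mono mult_left_mono C(2)) (auto dest: subsetD)
    finally show ?thesis .
  qed
  then show ?thesis using K(1) C(1) by (intro exI[of _ "K * C"]) auto
qed

lemma fsum_continuous: "continuous_on S (fsum s h n)"
  unfolding fsum_def[abs_def] by (intro continuous_intros wave_continuous)

text \<open>The limit of the partial sums is continuous and has the Fourier coefficients of \<open>h\<close>, hence it is \<open>h\<close>.\<close>

theorem fourier_series_converges:
  fixes h :: "'a::euclidean_space \<Rightarrow> complex"
  assumes s: "s > 0" and h: "h \<in> schwartz" and supp: "\<And>\<eta>. \<eta> \<notin> cell c s \<Longrightarrow> h \<eta> = 0"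
  shows "\<exists>K>0. \<forall>n. \<forall>\<eta>\<in>open_cell c s. cmod (h \<eta> - fsum s h n \<eta>) \<le> K / (1 + real n)"
proof -
  let ?I = "\<lambda>\<eta>. indicator (cell c s) \<eta> :: complex"
  obtain K where K: "K > 0" "\<And>n m \<eta>. n \<le> m \<Longrightarrow> cmod (fsum s h m \<eta> - fsum s h n \<eta>) \<le> K / (1 + real n)"
    using fsum_cauchy[OF s h] by blast
  define S where "S \<eta> = lim (\<lambda>n. fsum s h n \<eta>)" for \<eta>
  have Klim: "(\<lambda>n. K / (1 + real n)) \<longlonglongrightarrow> 0"
    using tendsto_mult_right_zero[OF LIMSEQ_Suc[OF lim_1_over_n], of K] by (simp add: field_simps)
  have conv: "(\<lambda>n. fsum s h n \<eta>) \<longlonglongrightarrow> S \<eta>" for \<eta>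
  proof -
    have "Cauchy (\<lambda>n. fsum s h n \<eta>)"
    proof (rule CauchyI)
      fix e :: real assume "e > 0"
      then have "\<forall>\<^sub>F n in sequentially. K / (1 + real n) < e / 2" by (intro order_tendstoD(2)[OF Klim]) auto
      then obtain N where N: "K / (1 + real N) < e / 2" by (auto simp: eventually_sequentially)
      have "cmod (fsum s h m \<eta> - fsum s h n \<eta>) < e" if "m \<ge> N" "n \<ge> N" for m n
      proof -
        have "cmod (fsum s h m \<eta> - fsum s h n \<eta>) \<le> cmod (fsum s h m \<eta> - fsum s h N \<eta>) + cmod (fsum s h n \<eta> - fsum s h N \<eta>)"
          using norm_triangle_ineq4[of "fsum s h m \<eta> - fsum s h N \<eta>" "fsum s h n \<eta> - fsum s h N \<eta>"] by simp
        then show ?thesis using K(2)[OF that(1), of \<eta>] K(2)[OF that(2), of \<eta>] N by linarith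
      qed
      then show "\<exists>M. \<forall>m\<ge>M. \<forall>n\<ge>M. cmod (fsum s h m \<eta> - fsum s h n \<eta>) < e" by blast
    qed
    then show ?thesis unfolding S_def by (simp add: Cauchy_convergent_iff convergent_LIMSEQ_iff)
  qed
  have err: "cmod (S \<eta> - fsum s h n \<eta>) \<le> K / (1 + real n)" for n \<eta>
  proof (rule LIMSEQ_le_const2)
    show "(\<lambda>m. cmod (fsum s h m \<eta> - fsum s h n \<eta>)) \<longlonglongrightarrow> cmod (S \<eta> - fsum s h n \<eta>)"
      by (intro tendsto_intros conv)
  qed (use K(2) in blast)
  have "uniform_limit UNIV (\<lambda>n. fsum s h n) S sequentially"
  proof (rule uniform_limitI)
    fix e :: real assume "e > 0"
    then have "\<forall>\<^sub>F n in sequentially. K / (1 + real n) < e" by (rule order_tendstoD(2)[OF Klim])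
    then show "\<forall>\<^sub>F n in sequentially. \<forall>\<eta>\<in>UNIV. dist (fsum s h n \<eta>) (S \<eta>) < e"
      by eventually_elim (use err in \<open>auto simp: dist_norm norm_minus_commute intro: le_less_trans\<close>)
  qed
  then have Sc: "continuous_on UNIV S"
    by (rule uniform_limit_theorem[rotated]) (auto intro: fsum_continuous always_eventually)
  define H where "H \<eta> = h \<eta> - S \<eta>" for \<eta>
  have hc: "continuous_on A h" for A by (rule smooth_continuous_on[OF schwartz_smooth[OF h]])
  have Hc: "continuous_on (cell c s) H" unfolding H_def by (intro continuous_intros hc continuous_on_subset[OF Sc]) auto
  \<comment> \<open>The index is reflected: the integral against the wave of index l selects the term - l of the series.\<close>
  have zero: "(LINT \<eta>|lborel. ?I \<eta> * (H \<eta> * wave s l \<eta>)) = 0" if l: "l \<in> int_lattice" for l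
  proof -
    define V where "V = complex_of_real ((2 * pi / s) ^ DIM('a))"
    have ih: "(LINT \<eta>|lborel. ?I \<eta> * (h \<eta> * wave s l \<eta>)) = fourier h (s *\<^sub>R (- l))"
      unfolding fourier_def
      by (intro Bochner_Integration.integral_cong refl) (use supp in \<open>auto simp: indicator_def wave_def inner_commute\<close>)
    have iS: "(LINT \<eta>|lborel. ?I \<eta> * (fsum s h n \<eta> * wave s l \<eta>)) =
      (\<Sum>j\<in>lattice_ball s n. if j = - l then fcoef s h j * V else 0)" for n
    proof -
      have "(LINT \<eta>|lborel. ?I \<eta> * (fsum s h n \<eta> * wave s l \<eta>)) =
        (LINT \<eta>|lborel. (\<Sum>j\<in>lattice_ball s n. fcoef s h j * (?I \<eta> * wave s (j + l) \<eta>)))"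
        unfolding fsum_def sum_distrib_left sum_distrib_right
        by (intro Bochner_Integration.integral_cong refl sum.cong) (simp add: wave_mult[symmetric])
      also have "\<dots> = (\<Sum>j\<in>lattice_ball s n. fcoef s h j * (LINT \<eta>|lborel. ?I \<eta> * wave s (j + l) \<eta>))"
      proof -
        have i2: "integrable lborel (\<lambda>\<eta>. fcoef s h j * (?I \<eta> * wave s (j + l) \<eta>))" for j
          by (intro integrable_mult_right integrable_cell wave_continuous)
        show ?thesis by (simp only: Bochner_Integration.integral_sum[OF i2] integral_mult_right_zero)
      qed
      also have "\<dots> = (\<Sum>j\<in>lattice_ball s n. if j = - l then fcoef s h j * V else 0)"
      proof (intro sum.cong refl)
        fix j :: 'a assume "j \<in> lattice_ball s n"
        then have "j + l \<in> int_lattice" using lattice_ball_subset l by (auto intro: int_lattice_add)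
        moreover have "j + l = 0 \<longleftrightarrow> j = - l" by (simp add: eq_neg_iff_add_eq_0)
        ultimately show "fcoef s h j * (LINT \<eta>|lborel. ?I \<eta> * wave s (j + l) \<eta>) = (if j = - l then fcoef s h j * V else 0)"
          using cell_integral_wave[OF s, of "j + l" c] by (auto simp: V_def)
      qed
      finally show ?thesis .
    qed
    obtain n0 where n0: "norm (s *\<^sub>R (- l)) \<le> real n0" using real_arch_simple by blast
    have iS': "(LINT \<eta>|lborel. ?I \<eta> * (fsum s h n \<eta> * wave s l \<eta>)) = fourier h (s *\<^sub>R (- l))" if "n \<ge> n0" for n
    proof -
      have "- l \<in> lattice_ball s n" using n0 that l by (auto simp: lattice_ball_def int_lattice_uminus)
      then have "(LINT \<eta>|lborel. ?I \<eta> * (fsum s h n \<eta> * wave s l \<eta>)) = fcoef s h (- l) * V"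
        unfolding iS sum.delta[OF finite_lattice_ball[OF s]] by simp
      also have "\<dots> = fourier h (s *\<^sub>R (- l))"
      proof -
        have "s / (2 * pi) * (2 * pi / s) = 1" using s by simp
        then have "(s / (2 * pi)) ^ DIM('a) * (2 * pi / s) ^ DIM('a) = 1"
          unfolding power_mult_distrib[symmetric] by (simp only: power_one)
        then have 1: "complex_of_real ((s / (2 * pi)) ^ DIM('a)) * V = 1"
          unfolding V_def of_real_mult[symmetric] by (simp only: of_real_1)
        have "x * F * y = x * y * F" for x y F :: complex by (simp add: ac_simps)
        then show ?thesis unfolding fcoef_def by (simp only: 1 mult_1_left)
      qed
      finally show ?thesis .
    qed
    have "(\<lambda>n. LINT \<eta>|lborel. ?I \<eta> * (fsum s h n \<eta> * wave s l \<eta>)) \<longlonglongrightarrow> (LINT \<eta>|lborel. ?I \<eta> * (S \<eta> * wave s l \<eta>))"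
    proof (rule integral_dominated_convergence[where w="\<lambda>\<eta>. indicator (cell c s) \<eta> * (cmod (S \<eta>) + K)"])
      show "integrable lborel (\<lambda>\<eta>. indicator (cell c s) \<eta> * (cmod (S \<eta>) + K))"
      proof -
        have "continuous_on (cell c s) (\<lambda>\<eta>. cmod (S \<eta>) + K)"
          by (intro continuous_intros continuous_on_subset[OF Sc]) simp
        from borel_integrable_compact[OF compact_cell this] show ?thesis by simp
      qed
      show "AE \<eta> in lborel. (\<lambda>n. ?I \<eta> * (fsum s h n \<eta> * wave s l \<eta>)) \<longlonglongrightarrow> ?I \<eta> * (S \<eta> * wave s l \<eta>)"
        by (intro AE_I2 tendsto_intros conv)
      have [measurable]: "S \<in> borel_measurable borel" by (rule borel_measurable_continuous_onI[OF Sc])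
      show "(\<lambda>\<eta>. ?I \<eta> * (S \<eta> * wave s l \<eta>)) \<in> borel_measurable lborel" by measurable
      have [measurable]: "fsum s h n \<in> borel_measurable borel" for n
        by (intro borel_measurable_continuous_onI fsum_continuous)
      show "(\<lambda>\<eta>. ?I \<eta> * (fsum s h n \<eta> * wave s l \<eta>)) \<in> borel_measurable lborel" for n by measurable
      show "AE \<eta> in lborel. norm (?I \<eta> * (fsum s h n \<eta> * wave s l \<eta>)) \<le> indicator (cell c s) \<eta> * (cmod (S \<eta>) + K)" for n
      proof (intro AE_I2)
        fix \<eta>
        have "K / (1 + real n) \<le> K" using K(1) by (simp add: divide_le_eq mult_le_cancel_left1)
        then have "cmod (fsum s h n \<eta>) \<le> cmod (S \<eta>) + K"
          using err[of \<eta> n] norm_triangle_ineq3[of "fsum s h n \<eta>" "S \<eta>"] by (simp add: norm_minus_commute)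
        then show "norm (?I \<eta> * (fsum s h n \<eta> * wave s l \<eta>)) \<le> indicator (cell c s) \<eta> * (cmod (S \<eta>) + K)"
          by (simp add: indicator_def norm_mult)
      qed
    qed
    moreover have "(\<lambda>n. LINT \<eta>|lborel. ?I \<eta> * (fsum s h n \<eta> * wave s l \<eta>)) \<longlonglongrightarrow> fourier h (s *\<^sub>R (- l))"
      using iS' by (intro tendsto_eventually eventually_sequentiallyI[of n0])
    ultimately have "(LINT \<eta>|lborel. ?I \<eta> * (S \<eta> * wave s l \<eta>)) = fourier h (s *\<^sub>R (- l))"
      by (rule LIMSEQ_unique)
    moreover have "(LINT \<eta>|lborel. ?I \<eta> * (H \<eta> * wave s l \<eta>)) =
      (LINT \<eta>|lborel. ?I \<eta> * (h \<eta> * wave s l \<eta>)) - (LINT \<eta>|lborel. ?I \<eta> * (S \<eta> * wave s l \<eta>))"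
    proof -
      have "?I \<eta> * (H \<eta> * wave s l \<eta>) = ?I \<eta> * (h \<eta> * wave s l \<eta>) - ?I \<eta> * (S \<eta> * wave s l \<eta>)" for \<eta>
        by (simp add: H_def algebra_simps)
      then show ?thesis
        by (simp only:) (intro Bochner_Integration.integral_diff integrable_cell continuous_intros hc
            wave_continuous continuous_on_subset[OF Sc] subset_UNIV)
    qed
    ultimately show ?thesis unfolding ih by simp
  qed
  have "cmod (h \<eta> - fsum s h n \<eta>) \<le> K / (1 + real n)" if "\<eta> \<in> open_cell c s" for n \<eta>
    using fourier_coefficients_unique[OF s Hc zero that] err[of \<eta> n] by (simp add: H_def)
  then show ?thesis using K(1) by blast
qed

lemma fourier_iter_deriv:
  assumes "h \<in> schwartz" "vs \<in> lists Basis"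
  shows "iter_deriv vs h \<in> schwartz" "fourier (iter_deriv vs h) \<eta> = cprod \<eta> vs * fourier h \<eta>"
proof -
  have *: "iter_deriv vs h \<in> schwartz \<and> fourier (iter_deriv vs h) \<eta> = cprod \<eta> vs * fourier h \<eta>"
    using assms(2)
  proof (induction vs)
    case Nil then show ?case using assms by (simp add: cprod_def)
  next
    case (Cons v vs)
    then have v: "v \<in> Basis" and IH: "iter_deriv vs h \<in> schwartz" "fourier (iter_deriv vs h) \<eta> = cprod \<eta> vs * fourier h \<eta>"
      by auto
    have "pd v (iter_deriv vs h) \<in> schwartz"
      using IH(1) bounded_family_pd[of "\<lambda>_::unit. iter_deriv vs h", OF _ v] unfolding schwartz_iff_bounded_family[where 'i=unit] by simp
    then show ?case using fourier_pd[OF IH(1) v, of \<eta>] IH(2) by (simp add: cprod_def inner_commute)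
  qed
  then show "iter_deriv vs h \<in> schwartz" "fourier (iter_deriv vs h) \<eta> = cprod \<eta> vs * fourier h \<eta>" by auto
qed

text \<open>Differentiation acts on the waves and on the coefficients by the same symbol.\<close>

lemma iter_deriv_fsum:
  assumes h: "h \<in> schwartz" and vs: "vs \<in> lists Basis"
  shows "smooth (fsum s h n)" "iter_deriv vs (fsum s h n) = fsum s (iter_deriv vs h) n"
proof -
  have sm: "smooth (\<lambda>\<eta>. fcoef s h j * wave s j \<eta>)" for j
    unfolding wave_def by (intro smooth_mult smooth_const iter_deriv_cis)
  show "smooth (fsum s h n)" unfolding fsum_def[abs_def] by (intro smooth_sum sm)
  have "iter_deriv vs (fsum s h n) = (\<lambda>\<eta>. \<Sum>j\<in>lattice_ball s n. iter_deriv vs (\<lambda>\<eta>. fcoef s h j * wave s j \<eta>) \<eta>)"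
    unfolding fsum_def[abs_def] by (rule iter_deriv_sum[OF sm vs])
  also have "\<dots> = fsum s (iter_deriv vs h) n"
  proof -
    have "iter_deriv vs (\<lambda>\<eta>. fcoef s h j * wave s j \<eta>) = (\<lambda>\<eta>. fcoef s (iter_deriv vs h) j * wave s j \<eta>)" for j
      unfolding wave_def iter_deriv_cmult[OF iter_deriv_cis(1) vs] iter_deriv_cis(2)[OF vs] fcoef_def
        fourier_iter_deriv(2)[OF h vs]
      by (simp only: mult.assoc mult.left_commute)
    then show ?thesis unfolding fsum_def[abs_def] by simp
  qed
  finally show "iter_deriv vs (fsum s h n) = fsum s (iter_deriv vs h) n" .
qed

section \<open>Tempered distributions and Fourier series\<close>

lemma temperedD:
  assumes "u \<in> tempered"
  shows "f \<in> schwartz \<Longrightarrow> g \<in> schwartz \<Longrightarrow> u (\<lambda>x. f x + g x) = u f + u g"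
    and "f \<in> schwartz \<Longrightarrow> u (\<lambda>x. c * f x) = c * u f"
  using assms unfolding tempered_def by auto

lemma tempered_sum:
  assumes u: "u \<in> tempered" and f: "\<And>i. i \<in> I \<Longrightarrow> f i \<in> schwartz" and I: "finite I"
  shows "u (\<lambda>x. \<Sum>i\<in>I. f i x) = (\<Sum>i\<in>I. u (f i)) \<and> (\<lambda>x. \<Sum>i\<in>I. f i x) \<in> schwartz"
  using I f
proof (induction I rule: finite_induct)
  case empty
  have "u (\<lambda>x. 0 * 0) = 0 * u (\<lambda>x. 0)" by (rule temperedD(2)[OF u schwartz_zero])
  then show ?case by (simp add: schwartz_zero)
next
  case (insert i I)
  then show ?case by (simp add: temperedD(1)[OF u] schwartz_add)
qed

lemma finite_lists_le: "finite {vs::'a::euclidean_space list. vs \<in> lists Basis \<and> length vs \<le> N}"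
  using finite_lists_length_le[of "Basis :: 'a set" N]
  by (rule rev_finite_subset) auto

text \<open>A single norm \<open>schwartz_norm N\<close> controls the distribution, and it consists of finitely many suprema.\<close>

lemma tempered_bounded_family:
  fixes f :: "'i \<Rightarrow> 'a::euclidean_space \<Rightarrow> complex"
  assumes u: "u \<in> tempered" and f: "bounded_family f"
  shows "\<exists>K>0. \<forall>i. cmod (u (f i)) \<le> K"
proof -
  obtain C N where C: "\<And>f. f \<in> schwartz \<Longrightarrow> cmod (u f) \<le> C * schwartz_norm N f"
    using u unfolding tempered_def by blast
  have "\<forall>vs. \<exists>K. vs \<in> lists Basis \<longrightarrow> (\<forall>i x. (1 + norm x) ^ N * cmod (iter_deriv vs (f i) x) \<le> K)"
    using bounded_familyD[OF f] by meson
  then obtain K where K: "\<And>vs i x. vs \<in> lists Basis \<Longrightarrow> (1 + norm x) ^ N * cmod (iter_deriv vs (f i) x) \<le> K vs"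
    by metis
  define S where "S = (\<Sum>vs | vs \<in> lists Basis \<and> length vs \<le> N. K vs)"
  have le: "schwartz_norm N (f i) \<le> S" for i
    unfolding schwartz_norm_def S_def by (intro sum_mono cSUP_least) (auto intro: K)
  have ge: "0 \<le> schwartz_norm N (f i)" for i
    unfolding schwartz_norm_def
  proof (intro sum_nonneg)
    fix vs assume "vs \<in> {vs \<in> lists (Basis::'a set). length vs \<le> N}"
    then have "bdd_above (range (\<lambda>x. (1 + norm x) ^ N * cmod (iter_deriv vs (f i) x)))"
      using K by (intro bdd_aboveI2[where M="K vs"]) auto
    then have "(1 + norm (0::'a)) ^ N * cmod (iter_deriv vs (f i) 0) \<le> (SUP x. (1 + norm x) ^ N * cmod (iter_deriv vs (f i) x))"
      by (rule cSUP_upper[OF UNIV_I])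
    then show "0 \<le> (SUP x. (1 + norm x) ^ N * cmod (iter_deriv vs (f i) x))"
      by (rule order_trans[rotated]) simp
  qed
  have "cmod (u (f i)) \<le> \<bar>C\<bar> * S + 1" for i
  proof -
    have "cmod (u (f i)) \<le> C * schwartz_norm N (f i)" by (rule C[OF bounded_family_schwartz[OF f]])
    also have "\<dots> \<le> \<bar>C\<bar> * S" using le[of i] ge[of i] by (intro mult_mono) auto
    finally show ?thesis by simp
  qed
  moreover have "0 < \<bar>C\<bar> * S + 1" using le[of undefined] ge[of undefined] by (intro add_nonneg_pos mult_nonneg_nonneg) auto
  ultimately show ?thesis by blast
qed

text \<open>A product with a function that is supported well inside an open set only feels the behaviour of
  the other factor on that set.\<close>

lemma bounded_family_mult_supported:
  fixes f :: "'a::euclidean_space \<Rightarrow> complex" and g :: "'i \<Rightarrow> 'a \<Rightarrow> complex"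
  assumes f: "f \<in> schwartz" "\<And>x. x \<notin> C \<Longrightarrow> f x = 0" and C: "closed C" "C \<subseteq> U" and g: "poly_growth_on U g"
  shows "bounded_family (\<lambda>i x. f x * g i x)"
  unfolding bounded_family_def
proof (intro conjI allI ballI)
  show "smooth (\<lambda>x. f x * g i x)" for i
    using f g by (intro smooth_mult) (auto simp: schwartz_smooth poly_growth_on_def)
  fix vs :: "'a list" and N assume vs: "vs \<in> lists Basis"
  have fs: "bounded_family (\<lambda>_::'i. f)" using f(1) schwartz_iff_bounded_family by blast
  obtain K where K: "\<And>i x. x \<in> U \<Longrightarrow> (1 + norm x) ^ N * cmod (iter_deriv vs (\<lambda>x. f x * g i x) x) \<le> K"
    using bounded_family_mult_on[OF vs fs g] by blast
  have "(1 + norm x) ^ N * cmod (iter_deriv vs (\<lambda>x. f x * g i x) x) \<le> max K 0" for i x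
  proof (cases "x \<in> C")
    case True then show ?thesis using K[of x i] C(2) by (auto simp: le_max_iff_disj)
  next
    case False
    have "iter_deriv vs (\<lambda>x. f x * g i x) x = iter_deriv vs (\<lambda>x. 0) x"
      by (rule iter_deriv_local[of "- C"]) (use C(1) f(2) False in auto)
    then show ?thesis by (simp add: iter_deriv_zero)
  qed
  then show "\<exists>K. \<forall>i x. (1 + norm x) ^ N * cmod (iter_deriv vs (\<lambda>x. f x * g i x) x) \<le> K" by blast
qed

text \<open>Every derivative of the partial sums converges on the cell at rate \<open>1 / n\<close>, being the partial sum of
  the derivative. So \<open>f * (h - fsum s h n)\<close>, multiplied by \<open>n\<close>, is a bounded family, and so is its
  transform.\<close>

theorem tempered_fourier_series:
  fixes f h :: "'a::euclidean_space \<Rightarrow> complex"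
  assumes u: "u \<in> tempered" and s: "s > 0"
    and f: "f \<in> schwartz" "\<And>\<eta>. \<eta> \<notin> C \<Longrightarrow> f \<eta> = 0" and h: "h \<in> schwartz" "\<And>\<eta>. \<eta> \<notin> C \<Longrightarrow> h \<eta> = 0"
    and C: "closed C" "C \<subseteq> open_cell c s"
  shows "(\<lambda>n. \<Sum>j\<in>lattice_ball s n. fcoef s h j * u (fourier (\<lambda>\<eta>. f \<eta> * wave s j \<eta>)))
    \<longlonglongrightarrow> u (fourier (\<lambda>\<eta>. f \<eta> * h \<eta>))"
proof -
  \<comment> \<open>The error, scaled by 1 + n to become a bounded family after multiplication by f.\<close>
  define E where "E n \<eta> = of_real (1 + real n) * (h \<eta> + (-1) * fsum s h n \<eta>)" for n \<eta>
  have sm: "smooth (\<lambda>\<eta>. h \<eta> + (-1) * fsum s h n \<eta>)" for n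
    by (intro smooth_add smooth_mult smooth_const schwartz_smooth h iter_deriv_fsum(1)[OF h(1), of "[]"]) simp
  have "poly_growth_on (open_cell c s) E"
    unfolding poly_growth_on_def
  proof (intro conjI allI ballI)
    show "smooth (E n)" for n unfolding E_def[abs_def] by (intro smooth_mult smooth_const sm)
    fix vs :: "'a list" assume vs: "vs \<in> lists Basis"
    have out: "iter_deriv vs h \<eta> = 0" if "\<eta> \<notin> cell c s" for \<eta>
    proof -
      have "\<eta> \<notin> C" using C(2) open_cell_subset that by blast
      then have "iter_deriv vs h \<eta> = iter_deriv vs (\<lambda>x. 0) \<eta>"
        by (intro iter_deriv_local[of "- C"]) (use C(1) h(2) in auto)
      then show ?thesis by (simp add: iter_deriv_zero)
    qed
    obtain K where K: "\<And>n \<eta>. \<eta> \<in> open_cell c s \<Longrightarrow> cmod (iter_deriv vs h \<eta> - fsum s (iter_deriv vs h) n \<eta>) \<le> K / (1 + real n)"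
      using fourier_series_converges[OF s fourier_iter_deriv(1)[OF h(1) vs] out] by blast
    have "cmod (iter_deriv vs (E n) \<eta>) \<le> K * (1 + norm \<eta>) ^ 0" if "\<eta> \<in> open_cell c s" for n \<eta>
    proof -
      have "iter_deriv vs (E n) = (\<lambda>\<eta>. of_real (1 + real n) * iter_deriv vs (\<lambda>\<eta>. h \<eta> + (-1) * fsum s h n \<eta>) \<eta>)"
        unfolding E_def[abs_def] by (rule iter_deriv_cmult[OF sm vs])
      also have "iter_deriv vs (\<lambda>\<eta>. h \<eta> + (-1) * fsum s h n \<eta>) = (\<lambda>\<eta>. iter_deriv vs h \<eta> + (-1) * fsum s (iter_deriv vs h) n \<eta>)"
      proof -
        have n1: "smooth (\<lambda>\<eta>. (-1) * fsum s h n \<eta>)"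
          by (intro smooth_mult smooth_const iter_deriv_fsum(1)[OF h(1) vs])
        show ?thesis
          by (simp only: iter_deriv_add[OF schwartz_smooth[OF h(1)] n1 vs]
              iter_deriv_cmult[OF iter_deriv_fsum(1)[OF h(1) vs] vs] iter_deriv_fsum(2)[OF h(1) vs])
      qed
      finally have "cmod (iter_deriv vs (E n) \<eta>) = (1 + real n) * cmod (iter_deriv vs h \<eta> - fsum s (iter_deriv vs h) n \<eta>)"
        by (simp only: norm_mult norm_of_real) simp
      also have "\<dots> \<le> (1 + real n) * (K / (1 + real n))" by (intro mult_left_mono K that) simp
      finally show ?thesis by simp
    qed
    then show "\<exists>K N. \<forall>n. \<forall>\<eta>\<in>open_cell c s. cmod (iter_deriv vs (E n) \<eta>) \<le> K * (1 + norm \<eta>) ^ N" by blast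
  qed
  from bounded_family_fourier[OF bounded_family_mult_supported[OF f C this]]
  have sb: "bounded_family (\<lambda>n. fourier (\<lambda>\<eta>. f \<eta> * E n \<eta>))" .
  obtain K where K: "\<And>n. cmod (u (fourier (\<lambda>\<eta>. f \<eta> * E n \<eta>))) \<le> K"
    using tempered_bounded_family[OF u sb] by blast
  have fw: "(\<lambda>\<eta>. f \<eta> * wave s j \<eta>) \<in> schwartz" for j
    unfolding wave_def by (rule schwartz_mult_poly_growth[OF f(1) poly_growth_cis])
  have fh: "(\<lambda>\<eta>. f \<eta> * h \<eta>) \<in> schwartz" by (rule schwartz_mult[OF f(1) h(1)])
  define R where "R n = (\<Sum>j\<in>lattice_ball s n. fcoef s h j * u (fourier (\<lambda>\<eta>. f \<eta> * wave s j \<eta>)))" for n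
  have eq: "u (fourier (\<lambda>\<eta>. f \<eta> * E n \<eta>)) = of_real (1 + real n) * (u (fourier (\<lambda>\<eta>. f \<eta> * h \<eta>)) - R n)" for n
  proof -
    let ?k = "complex_of_real (1 + real n)"
    have iw: "integrable lborel (\<lambda>\<eta>. f \<eta> * wave s j \<eta> * cis (- (\<eta> \<bullet> x)))" for j x
      by (rule integrable_cis[OF schwartz_integrable[OF fw]]) simp
    have ih: "integrable lborel (\<lambda>\<eta>. f \<eta> * h \<eta> * cis (- (\<eta> \<bullet> x)))" for x
      by (rule integrable_cis[OF schwartz_integrable[OF fh]]) simp
    have "fourier (\<lambda>\<eta>. f \<eta> * E n \<eta>) x = ?k * fourier (\<lambda>\<eta>. f \<eta> * h \<eta>) x
        + (\<Sum>j\<in>lattice_ball s n. (- ?k * fcoef s h j) * fourier (\<lambda>\<eta>. f \<eta> * wave s j \<eta>) x)" for x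
    proof -
      have "f \<eta> * E n \<eta> * cis (- (\<eta> \<bullet> x)) = ?k * (f \<eta> * h \<eta> * cis (- (\<eta> \<bullet> x)))
        + (\<Sum>j\<in>lattice_ball s n. (- ?k * fcoef s h j) * (f \<eta> * wave s j \<eta> * cis (- (\<eta> \<bullet> x))))" for \<eta>
      proof -
        have "(\<Sum>j\<in>lattice_ball s n. (- ?k * fcoef s h j) * (f \<eta> * wave s j \<eta> * cis (- (\<eta> \<bullet> x)))) =
          (- ?k * f \<eta> * cis (- (\<eta> \<bullet> x))) * fsum s h n \<eta>"
        proof -
          have ac: "(k * a) * (b * w * e) = (k * b * e) * (a * w)" for k a b w e :: complex by (simp add: ac_simps)
          show ?thesis unfolding fsum_def sum_distrib_left by (intro sum.cong refl ac)
        qed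
        moreover have "b * (k * (p + (-1) * q)) * e = k * (b * p * e) + (- k * b * e) * q" for b k p q e :: complex
          by (simp add: algebra_simps)
        ultimately show ?thesis unfolding E_def by (simp only:)
      qed
      then have "fourier (\<lambda>\<eta>. f \<eta> * E n \<eta>) x = (LINT \<eta>|lborel. ?k * (f \<eta> * h \<eta> * cis (- (\<eta> \<bullet> x)))
        + (\<Sum>j\<in>lattice_ball s n. (- ?k * fcoef s h j) * (f \<eta> * wave s j \<eta> * cis (- (\<eta> \<bullet> x)))))"
        unfolding fourier_def by (simp only:)
      also have "\<dots> = (LINT \<eta>|lborel. ?k * (f \<eta> * h \<eta> * cis (- (\<eta> \<bullet> x)))) +
          (LINT \<eta>|lborel. (\<Sum>j\<in>lattice_ball s n. (- ?k * fcoef s h j) * (f \<eta> * wave s j \<eta> * cis (- (\<eta> \<bullet> x)))))"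
        by (rule Bochner_Integration.integral_add[OF integrable_mult_right[OF ih]
            Bochner_Integration.integrable_sum[OF integrable_mult_right[OF iw]]])
      also have "(LINT \<eta>|lborel. (\<Sum>j\<in>lattice_ball s n. (- ?k * fcoef s h j) * (f \<eta> * wave s j \<eta> * cis (- (\<eta> \<bullet> x))))) =
          (\<Sum>j\<in>lattice_ball s n. LINT \<eta>|lborel. (- ?k * fcoef s h j) * (f \<eta> * wave s j \<eta> * cis (- (\<eta> \<bullet> x))))"
        by (rule Bochner_Integration.integral_sum[OF integrable_mult_right[OF iw]])
      finally show ?thesis by (simp only: integral_mult_right_zero fourier_def)
    qed
    then have fe: "fourier (\<lambda>\<eta>. f \<eta> * E n \<eta>) = (\<lambda>x. ?k * fourier (\<lambda>\<eta>. f \<eta> * h \<eta>) x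
        + (\<Sum>j\<in>lattice_ball s n. (- ?k * fcoef s h j) * fourier (\<lambda>\<eta>. f \<eta> * wave s j \<eta>) x))" by blast
    have s1: "(\<lambda>x. (- ?k * fcoef s h j) * fourier (\<lambda>\<eta>. f \<eta> * wave s j \<eta>) x) \<in> schwartz" for j
      by (intro schwartz_cmult schwartz_fourier fw)

    have ts: "u (\<lambda>x. \<Sum>j\<in>lattice_ball s n. (- ?k * fcoef s h j) * fourier (\<lambda>\<eta>. f \<eta> * wave s j \<eta>) x) =
        (\<Sum>j\<in>lattice_ball s n. u (\<lambda>x. (- ?k * fcoef s h j) * fourier (\<lambda>\<eta>. f \<eta> * wave s j \<eta>) x))"
      "(\<lambda>x. \<Sum>j\<in>lattice_ball s n. (- ?k * fcoef s h j) * fourier (\<lambda>\<eta>. f \<eta> * wave s j \<eta>) x) \<in> schwartz"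
      using tempered_sum[OF u _ finite_lattice_ball[OF s], of n "\<lambda>j x. (- ?k * fcoef s h j) * fourier (\<lambda>\<eta>. f \<eta> * wave s j \<eta>) x"] s1
      by blast+
    have "u (fourier (\<lambda>\<eta>. f \<eta> * E n \<eta>)) = ?k * u (fourier (\<lambda>\<eta>. f \<eta> * h \<eta>)) +
        (\<Sum>j\<in>lattice_ball s n. (- ?k * fcoef s h j) * u (fourier (\<lambda>\<eta>. f \<eta> * wave s j \<eta>)))"
      unfolding fe
      by (subst temperedD(1)[OF u schwartz_cmult[OF schwartz_fourier[OF fh]] ts(2)])
         (simp only: ts(1) temperedD(2)[OF u schwartz_fourier[OF fh]] temperedD(2)[OF u schwartz_fourier[OF fw]])
    also have "(\<Sum>j\<in>lattice_ball s n. (- ?k * fcoef s h j) * u (fourier (\<lambda>\<eta>. f \<eta> * wave s j \<eta>))) = - ?k * R n"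
      unfolding R_def sum_distrib_left by (simp only: mult.assoc)
    also have "?k * u (fourier (\<lambda>\<eta>. f \<eta> * h \<eta>)) + - ?k * R n = ?k * (u (fourier (\<lambda>\<eta>. f \<eta> * h \<eta>)) - R n)"
      unfolding right_diff_distrib mult_minus_left by (rule add_uminus_conv_diff)
    finally show ?thesis .
  qed
  have "cmod (R n - u (fourier (\<lambda>\<eta>. f \<eta> * h \<eta>))) \<le> K * (1 / (1 + real n))" for n
  proof -
    define z where "z = u (fourier (\<lambda>\<eta>. f \<eta> * h \<eta>))"
    have p: "0 < 1 + real n" by simp
    have "cmod (of_real (1 + real n) * (z - R n)) \<le> K" using K[of n] unfolding eq z_def .
    then have "cmod (z - R n) * (1 + real n) \<le> K"
      unfolding norm_mult norm_of_real abs_of_pos[OF p] by (simp only: mult.commute)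
    then have "cmod (z - R n) \<le> K / (1 + real n)" unfolding pos_le_divide_eq[OF p] .
    then show ?thesis unfolding z_def[symmetric] norm_minus_commute[of "R n"] by simp
  qed
  moreover have "(\<lambda>n. K * (1 / (1 + real n))) \<longlonglongrightarrow> 0"
    using tendsto_mult_right_zero[OF LIMSEQ_Suc[OF lim_1_over_n], of K] by simp
  ultimately have "(\<lambda>n. R n - u (fourier (\<lambda>\<eta>. f \<eta> * h \<eta>))) \<longlonglongrightarrow> 0"
    by (rule Lim_null_comparison[OF always_eventually[OF allI]])
  then show ?thesis unfolding R_def by (simp only: LIM_zero_iff)
qed

section \<open>Geometry of the subdyadic centers\<close>

text \<open>Together with the covering property, these are the facts about the selection on which the frame rests. The
  third one holds because the candidate that is processed first lies in the innermost annulus and is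
  retained.\<close>

lemma subdyadic_centersE:
  fixes \<xi> :: "nat \<Rightarrow> 'a::euclidean_space"
  assumes "subdyadic_centers \<alpha> a \<rho> \<xi>"
  shows "1 \<le> norm (\<xi> k)" "k \<noteq> l \<Longrightarrow> sel_ball \<alpha> a \<rho> (\<xi> k) \<inter> sel_ball \<alpha> a \<rho> (\<xi> l) = {}"
    "\<exists>k. norm (\<xi> k) < 2"
proof -
  obtain S z where S: "\<And>n. candidates \<alpha> \<rho> n (S n)" and z: "processing_order S z"
    and \<xi>: "bij_betw \<xi> UNIV {z i | i. retained \<alpha> a \<rho> z i}"
    using assms unfolding subdyadic_centers_def by (elim exE conjE) (rule that, auto)
  have Sann: "S n \<subseteq> annulus n" for n
    using S[of n] unfolding candidates_def by (elim exE conjE) auto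
  have bij: "bij_betw z UNIV (\<Union>n. S n)"
    and ord: "\<And>m n i j. m < n \<Longrightarrow> z i \<in> S m \<Longrightarrow> z j \<in> S n \<Longrightarrow> i < j"
    using z unfolding processing_order_def by simp_all
  have zS: "\<exists>n. z i \<in> S n" for i using bij_betwE[OF bij] by auto
  have xz: "\<exists>i. \<xi> k = z i \<and> retained \<alpha> a \<rho> z i" for k using bij_betwE[OF \<xi>] by auto
  show "1 \<le> norm (\<xi> k)"
  proof -
    obtain n where "\<xi> k \<in> annulus n" using xz[of k] zS Sann by fastforce
    then have "(2::real) ^ n \<le> norm (\<xi> k)" by (simp add: annulus_def)
    then show ?thesis using one_le_power[of "2::real" n] by linarith
  qed
  show "sel_ball \<alpha> a \<rho> (\<xi> k) \<inter> sel_ball \<alpha> a \<rho> (\<xi> l) = {}" if "k \<noteq> l"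
  proof -
    obtain i j where i: "\<xi> k = z i" "retained \<alpha> a \<rho> z i" and j: "\<xi> l = z j" "retained \<alpha> a \<rho> z j"
      using xz by meson
    have "\<xi> k \<noteq> \<xi> l" using bij_betw_imp_inj_on[OF \<xi>] that by (auto dest: injD)
    then have "i < j \<or> j < i" using i j by (metis linorder_neqE_nat)
    then show ?thesis
      using i j retained.simps[of \<alpha> a \<rho> z i] retained.simps[of \<alpha> a \<rho> z j] by auto
  qed
  show "\<exists>k. norm (\<xi> k) < 2"
  proof -
    obtain P pick where P: "partition_on UNIV P"
      "\<forall>Q\<in>P. Q \<inter> annulus 0 \<noteq> {} \<longrightarrow> pick Q \<in> Q \<inter> annulus 0"
      "S 0 = pick ` {Q \<in> P. Q \<inter> annulus 0 \<noteq> {}}"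
      using S[of 0] unfolding candidates_def by (elim exE conjE) (rule that, assumption+)
    obtain e :: 'a where e: "norm e = 1" using vector_choose_size[of 1] by auto
    obtain Q where "Q \<in> P" "e \<in> Q" using P(1) unfolding partition_on_def by blast
    moreover have "e \<in> annulus 0" using e by (simp add: annulus_def)
    ultimately have "S 0 \<noteq> {}" using P(3) by blast
    then obtain x where "x \<in> S 0" by blast
    then obtain i where i: "z i \<in> S 0" using bij_betw_imp_surj_on[OF bij] by (metis UNIV_I UN_I rangeE)
    obtain m where m: "z 0 \<in> S m" using zS by blast
    have "m = 0" using ord[of 0 m i 0] i m by auto
    then have "norm (z 0) < 2" using m Sann[of 0] by (auto simp: annulus_def)
    moreover have "retained \<alpha> a \<rho> z 0" by (simp add: retained.simps[of \<alpha> a \<rho> z 0])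
    then have "z 0 \<in> range \<xi>" unfolding bij_betw_imp_surj_on[OF \<xi>] by auto
    ultimately show ?thesis by auto
  qed
qed

lemma powr_comparison:
  fixes x y \<kappa> \<gamma> :: real
  assumes "0 < x" "0 < y" "1 \<le> \<kappa>" "x \<le> \<kappa> * y" "y \<le> \<kappa> * x"
  shows "x powr \<gamma> \<le> \<kappa> powr \<bar>\<gamma>\<bar> * y powr \<gamma>"
proof (cases "0 \<le> \<gamma>")
  case True
  then have "x powr \<gamma> \<le> (\<kappa> * y) powr \<gamma>" using assms by (intro powr_mono2) auto
  then show ?thesis using True assms by (simp add: powr_mult)
next
  case False
  have "y / \<kappa> \<le> x" using assms by (simp add: divide_le_eq mult.commute)
  then have "x powr \<gamma> \<le> (y / \<kappa>) powr \<gamma>" using assms False by (intro powr_mono2') auto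
  also have "\<dots> = \<kappa> powr (- \<gamma>) * y powr \<gamma>" using assms by (simp add: powr_divide powr_minus field_simps)
  finally show ?thesis using False by simp
qed

lemma jbracket_pos: "0 < jbracket \<eta>" unfolding jbracket_def by (simp add: add_pos_nonneg)

lemma jbracket_comparison: "jbracket \<eta> \<le> 2 * (1 + norm \<eta>)" "1 + norm \<eta> \<le> 2 * jbracket \<eta>"
proof -
  have "jbracket \<eta> \<le> 1 + norm \<eta>"
    unfolding jbracket_def by (rule real_le_lsqrt) (auto simp: power2_sum)
  then show "jbracket \<eta> \<le> 2 * (1 + norm \<eta>)" using norm_ge_zero[of \<eta>] by argo
  have "1 \<le> jbracket \<eta>" "norm \<eta> \<le> jbracket \<eta>" unfolding jbracket_def by (auto intro: real_le_rsqrt)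
  then show "1 + norm \<eta> \<le> 2 * jbracket \<eta>" by simp
qed

lemma jbracket_continuous: "continuous_on S jbracket"
  unfolding jbracket_def by (intro continuous_intros)

text \<open>The volumes of the small balls add up to at most the volume of the large one.\<close>

lemma disjoint_balls_card:
  fixes x :: "'i \<Rightarrow> 'a::euclidean_space"
  assumes K: "finite K" and s: "0 < s" and T: "0 \<le> T"
    and disj: "\<And>k l. k \<in> K \<Longrightarrow> l \<in> K \<Longrightarrow> k \<noteq> l \<Longrightarrow> ball (x k) s \<inter> ball (x l) s = {}"
    and sub: "\<And>k. k \<in> K \<Longrightarrow> ball (x k) s \<subseteq> ball c T"
  shows "real (card K) \<le> (T / s) ^ DIM('a)"
proof -
  define V where "V = unit_ball_vol (real DIM('a))"
  have V: "0 < V" by (simp add: V_def)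
  have "measure lborel (\<Union>k\<in>K. ball (x k) s) = (\<Sum>k\<in>K. measure lborel (ball (x k) s))"
  proof (intro measure_finite_Union K)
    show "emeasure lborel (ball (x k) s) \<noteq> \<infinity>" for k
      using emeasure_bounded_finite[OF bounded_ball[of "x k" s]] by simp
  qed (use disj in \<open>auto simp: disjoint_family_on_def\<close>)
  also have "\<dots> = real (card K) * (V * s ^ DIM('a))" using s by (simp add: content_ball V_def)
  finally have "real (card K) * (V * s ^ DIM('a)) = measure lborel (\<Union>k\<in>K. ball (x k) s)" ..
  also have "\<dots> \<le> measure lborel (ball c T)"
    proof (rule measure_mono_fmeasurable)
    show "ball c T \<in> fmeasurable lborel"
      using emeasure_bounded_finite[OF bounded_ball[of c T]] by (intro fmeasurableI) auto
  qed (use sub in \<open>auto intro: borel_open open_UN\<close>)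
  also have "\<dots> = V * T ^ DIM('a)" using T by (simp add: content_ball V_def)
  finally have "V * (real (card K) * s ^ DIM('a)) \<le> V * T ^ DIM('a)" by (simp only: mult.left_commute)
  then have "real (card K) * s ^ DIM('a) \<le> T ^ DIM('a)" using V by (simp only: mult_le_cancel_left_pos)
  then show ?thesis using s by (simp add: power_divide pos_le_divide_eq)
qed

lemma finite_card_le_if_finite_subsets:
  assumes "\<And>F. finite F \<Longrightarrow> F \<subseteq> K \<Longrightarrow> real (card F) \<le> M"
  shows "finite K \<and> real (card K) \<le> M"
proof -
  have "finite K"
  proof (rule ccontr)
    assume "infinite K"
    obtain n :: nat where "M < real n" using reals_Archimedean2 by blast
    moreover obtain F where "finite F" "card F = n" "F \<subseteq> K" using infinite_arbitrarily_large[OF \<open>infinite K\<close>] by blast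
    ultimately show False using assms[of F] by simp
  qed
  then show ?thesis using assms by blast
qed

text \<open>Here \<open>t\<close> stands for the product of the two constants in the radius of the selection balls.\<close>

locale separated_centers =
  fixes \<alpha> t :: real and \<xi> :: "nat \<Rightarrow> 'a::euclidean_space"
  assumes alpha: "0 < \<alpha>" and t: "0 < t" and xi: "\<And>k. 1 \<le> norm (\<xi> k)"
    and disj: "\<And>k l. k \<noteq> l \<Longrightarrow>
      ball (\<xi> k) (t * norm (\<xi> k) powr (1 - \<alpha>)) \<inter> ball (\<xi> l) (t * norm (\<xi> l) powr (1 - \<alpha>)) = {}"
begin

definition rad :: "nat \<Rightarrow> real" where "rad k = norm (\<xi> k) powr (1 - \<alpha>)"

lemma norm_xi_pos: "0 < norm (\<xi> k)" using xi[of k] by linarith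
lemma rad_pos: "0 < rad k" using norm_xi_pos[of k] by (simp add: rad_def)

text \<open>Since \<open>1 - \<alpha> < 1\<close>, the radius \<open>R * rad k\<close> is at most half of \<open>norm (\<xi> k)\<close> for all centers outside of a bounded
  set, so all points of the ball have the same size as its center.\<close>

lemma size_comparison:
  assumes R: "0 \<le> R"
  shows "\<exists>\<kappa>\<ge>1. \<forall>k \<eta>. norm (\<eta> - \<xi> k) \<le> R * rad k \<longrightarrow>
    1 + norm \<eta> \<le> \<kappa> * (1 + norm (\<xi> k)) \<and> 1 + norm (\<xi> k) \<le> \<kappa> * (1 + norm \<eta>)"
proof -
  \<comment> \<open>A center with norm (\<xi> k) powr \<alpha> < 2 * R has norm at most B.\<close>
  define B where "B = (2 * R) powr (1 / \<alpha>)"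
  have B: "0 \<le> B" by (simp add: B_def)
  define \<kappa> where "\<kappa> = 2 + R + B"
  have "1 + norm \<eta> \<le> \<kappa> * (1 + norm (\<xi> k)) \<and> 1 + norm (\<xi> k) \<le> \<kappa> * (1 + norm \<eta>)"
    if d: "norm (\<eta> - \<xi> k) \<le> R * rad k" for k \<eta>
  proof
    define x y where "x = norm (\<xi> k)" and "y = norm \<eta>"
    have x: "1 \<le> x" and y: "0 \<le> y" using xi by (auto simp: x_def y_def)
    have dx: "y \<le> x + R * rad k" "x \<le> y + R * rad k"
      using d norm_triangle_sub[of \<eta> "\<xi> k"] norm_triangle_sub[of "\<xi> k" \<eta>]
      by (auto simp: x_def y_def norm_minus_commute)
    have "rad k \<le> x powr 1" unfolding rad_def x_def[symmetric] using x alpha by (intro powr_mono) auto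
    then have "R * rad k \<le> R * x" using x R by (intro mult_left_mono) auto
    then have "1 + y \<le> 1 * (1 + x) + R * (1 + x)" using dx(1) R by (simp add: distrib_left)
    also have "\<dots> = (1 + R) * (1 + x)" by (simp add: distrib_right)
    also have "\<dots> \<le> \<kappa> * (1 + x)" using x B by (intro mult_right_mono) (auto simp: \<kappa>_def)
    finally show "1 + norm \<eta> \<le> \<kappa> * (1 + norm (\<xi> k))" by (simp add: x_def y_def)
    have "1 + x \<le> \<kappa> * (1 + y)"
    proof (cases "2 * R \<le> x powr \<alpha>")
      case True
      have "rad k * (2 * R) \<le> rad k * x powr \<alpha>" using True rad_pos[of k] by (intro mult_left_mono) auto
      also have "\<dots> = x" unfolding rad_def x_def[symmetric] using x by (simp add: powr_add[symmetric])
      finally have "2 * (R * rad k) \<le> x" by (simp add: ac_simps)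
      then have "1 + x \<le> 2 * (1 + y)" using dx(2) by simp
      also have "\<dots> \<le> \<kappa> * (1 + y)" using y R B by (intro mult_right_mono) (auto simp: \<kappa>_def)
      finally show ?thesis .
    next
      case False
      have "x = (x powr \<alpha>) powr (1 / \<alpha>)" using x alpha by (simp add: powr_powr)
      also have "\<dots> \<le> B" unfolding B_def using False alpha by (intro powr_mono2) auto
      finally have "1 + x \<le> \<kappa> * 1" using R by (simp add: \<kappa>_def)
      also have "\<dots> \<le> \<kappa> * (1 + y)" using y R B by (intro mult_left_mono) (auto simp: \<kappa>_def)
      finally show ?thesis .
    qed
    then show "1 + norm (\<xi> k) \<le> \<kappa> * (1 + norm \<eta>)" by (simp add: x_def y_def)
  qed
  moreover have "1 \<le> \<kappa>" using R B by (simp add: \<kappa>_def)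
  ultimately show ?thesis by blast
qed

lemma weight_comparison:
  assumes R: "0 \<le> R"
  shows "\<exists>\<kappa>>0. \<forall>k \<eta>. norm (\<eta> - \<xi> k) \<le> R * rad k \<longrightarrow>
    (1 + norm (\<xi> k)) powr \<gamma> \<le> \<kappa> * jbracket \<eta> powr \<gamma> \<and> jbracket \<eta> powr \<gamma> \<le> \<kappa> * (1 + norm (\<xi> k)) powr \<gamma>"
proof -
  obtain \<kappa> where \<kappa>: "\<kappa> \<ge> 1" "\<And>k \<eta>. norm (\<eta> - \<xi> k) \<le> R * rad k \<Longrightarrow>
    1 + norm \<eta> \<le> \<kappa> * (1 + norm (\<xi> k)) \<and> 1 + norm (\<xi> k) \<le> \<kappa> * (1 + norm \<eta>)"
    using size_comparison[OF R] by blast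
  have "(1 + norm (\<xi> k)) powr \<gamma> \<le> (2 * \<kappa>) powr \<bar>\<gamma>\<bar> * jbracket \<eta> powr \<gamma> \<and>
      jbracket \<eta> powr \<gamma> \<le> (2 * \<kappa>) powr \<bar>\<gamma>\<bar> * (1 + norm (\<xi> k)) powr \<gamma>"
    if d: "norm (\<eta> - \<xi> k) \<le> R * rad k" for k \<eta>
  proof -
    have "1 + norm (\<xi> k) \<le> \<kappa> * (1 + norm \<eta>)" using \<kappa>(2)[OF d] by simp
    also have "\<dots> \<le> \<kappa> * (2 * jbracket \<eta>)" using \<kappa>(1) jbracket_comparison(2)[of \<eta>] by (intro mult_left_mono) auto
    finally have 1: "1 + norm (\<xi> k) \<le> 2 * \<kappa> * jbracket \<eta>" by simp
    have "jbracket \<eta> \<le> 2 * (1 + norm \<eta>)" by (rule jbracket_comparison)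
    also have "\<dots> \<le> 2 * (\<kappa> * (1 + norm (\<xi> k)))" using \<kappa>(2)[OF d] by (intro mult_left_mono) auto
    finally have 2: "jbracket \<eta> \<le> 2 * \<kappa> * (1 + norm (\<xi> k))" by simp
    have p: "0 < 1 + norm (\<xi> k)" by (intro add_pos_nonneg) auto
    show ?thesis
      using powr_comparison[OF p jbracket_pos _ 1 2] powr_comparison[OF jbracket_pos p _ 2 1] \<kappa>(1) by auto
  qed
  moreover have "0 < (2 * \<kappa>) powr \<bar>\<gamma>\<bar>" using \<kappa>(1) by simp
  ultimately show ?thesis by blast
qed

lemma rad_comparison:
  assumes R: "0 \<le> R"
  shows "\<exists>\<kappa>>0. \<forall>k \<eta>. norm (\<eta> - \<xi> k) \<le> R * rad k \<longrightarrow>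
    rad k \<le> \<kappa> * jbracket \<eta> powr (1 - \<alpha>) \<and> jbracket \<eta> powr (1 - \<alpha>) \<le> \<kappa> * rad k"
proof -
  let ?g = "1 - \<alpha>"
  obtain \<kappa> where \<kappa>: "\<kappa> > 0" "\<And>k \<eta>. norm (\<eta> - \<xi> k) \<le> R * rad k \<Longrightarrow>
    (1 + norm (\<xi> k)) powr ?g \<le> \<kappa> * jbracket \<eta> powr ?g \<and> jbracket \<eta> powr ?g \<le> \<kappa> * (1 + norm (\<xi> k)) powr ?g"
    using weight_comparison[OF R, of ?g] by blast
  have "rad k \<le> (2 powr \<bar>?g\<bar> * \<kappa>) * jbracket \<eta> powr ?g \<and> jbracket \<eta> powr ?g \<le> (2 powr \<bar>?g\<bar> * \<kappa>) * rad k"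
    if d: "norm (\<eta> - \<xi> k) \<le> R * rad k" for k \<eta>
  proof
    have c: "norm (\<xi> k) \<le> 2 * (1 + norm (\<xi> k))" "1 + norm (\<xi> k) \<le> 2 * norm (\<xi> k)" using xi[of k] by auto
    have p: "0 < 1 + norm (\<xi> k)" by (intro add_pos_nonneg) auto
    have "rad k \<le> 2 powr \<bar>?g\<bar> * (1 + norm (\<xi> k)) powr ?g"
      unfolding rad_def by (rule powr_comparison[OF norm_xi_pos p _ c]) simp
    also have "\<dots> \<le> 2 powr \<bar>?g\<bar> * (\<kappa> * jbracket \<eta> powr ?g)" using \<kappa>(2)[OF d] by (intro mult_left_mono) auto
    finally show "rad k \<le> (2 powr \<bar>?g\<bar> * \<kappa>) * jbracket \<eta> powr ?g" by (simp add: mult.assoc)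
    have "jbracket \<eta> powr ?g \<le> \<kappa> * (1 + norm (\<xi> k)) powr ?g" using \<kappa>(2)[OF d] by simp
    also have "\<dots> \<le> \<kappa> * (2 powr \<bar>?g\<bar> * rad k)"
      unfolding rad_def using \<kappa>(1) by (intro mult_left_mono powr_comparison[OF p norm_xi_pos _ c(2,1)]) auto
    finally show "jbracket \<eta> powr ?g \<le> (2 powr \<bar>?g\<bar> * \<kappa>) * rad k" by (simp add: ac_simps)
  qed
  moreover have "0 < 2 powr \<bar>?g\<bar> * \<kappa>" using \<kappa>(1) by simp
  ultimately show ?thesis by blast
qed

text \<open>A volume count: the radii of all balls that contain \<open>\<eta>\<close> are comparable with each other.\<close>

lemma bounded_overlap:
  assumes R: "0 \<le> R"
  shows "\<exists>M. \<forall>\<eta>. finite {k. norm (\<eta> - \<xi> k) \<le> R * rad k} \<and> real (card {k. norm (\<eta> - \<xi> k) \<le> R * rad k}) \<le> M"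
proof -
  obtain \<kappa> where \<kappa>: "\<kappa> > 0" "\<And>k \<eta>. norm (\<eta> - \<xi> k) \<le> R * rad k \<Longrightarrow>
    rad k \<le> \<kappa> * jbracket \<eta> powr (1 - \<alpha>) \<and> jbracket \<eta> powr (1 - \<alpha>) \<le> \<kappa> * rad k"
    using rad_comparison[OF R] by blast
  have "real (card F) \<le> ((R + t) * \<kappa> / (t / \<kappa>)) ^ DIM('a)"
    if F: "finite F" "F \<subseteq> {k. norm (\<eta> - \<xi> k) \<le> R * rad k}" for F \<eta>
  proof -
    define N where "N = jbracket \<eta> powr (1 - \<alpha>)"
    have N: "N > 0" using jbracket_pos[of \<eta>] by (simp add: N_def)
    have FD: "norm (\<eta> - \<xi> k) \<le> R * rad k" "rad k \<le> \<kappa> * N" "N \<le> \<kappa> * rad k" if "k \<in> F" for k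
      using F(2) that \<kappa>(2)[of \<eta> k] by (auto simp: N_def)
    have "t / \<kappa> * N \<le> t * rad k" if "k \<in> F" for k
    proof -
      have "t * N \<le> t * (\<kappa> * rad k)" using FD(3)[OF that] t by (intro mult_left_mono) auto
      then show ?thesis using \<kappa>(1) by (simp add: divide_le_eq ac_simps)
    qed
    note le = this
    have "real (card F) \<le> (((R + t) * \<kappa> * N) / (t / \<kappa> * N)) ^ DIM('a)"
    proof (rule disjoint_balls_card[where x=\<xi> and c=\<eta>])
      show "0 < t / \<kappa> * N" using t \<kappa>(1) N by simp
      show "0 \<le> (R + t) * \<kappa> * N" using R t \<kappa>(1) N by simp
      show "ball (\<xi> k) (t / \<kappa> * N) \<inter> ball (\<xi> l) (t / \<kappa> * N) = {}" if "k \<in> F" "l \<in> F" "k \<noteq> l" for k l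
      proof -
        have "ball (\<xi> k) (t / \<kappa> * N) \<subseteq> ball (\<xi> k) (t * norm (\<xi> k) powr (1 - \<alpha>))" if "k \<in> F" for k
          using le[OF that] unfolding rad_def by (intro subset_ball)
        then show ?thesis using disj[OF that(3)] that by blast
      qed
      show "ball (\<xi> k) (t / \<kappa> * N) \<subseteq> ball \<eta> ((R + t) * \<kappa> * N)" if k: "k \<in> F" for k
      proof
        fix y assume "y \<in> ball (\<xi> k) (t / \<kappa> * N)"
        then have "dist (\<xi> k) y < t * rad k" using le[OF k] by simp
        moreover have "dist \<eta> (\<xi> k) \<le> R * rad k" using FD(1)[OF k] by (simp add: dist_norm)
        ultimately have "dist \<eta> y < (R + t) * rad k"
          using dist_triangle[of \<eta> y "\<xi> k"] by (simp add: distrib_right)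
        also have "\<dots> \<le> (R + t) * (\<kappa> * N)" using FD(2)[OF k] R t by (intro mult_left_mono) auto
        finally show "y \<in> ball \<eta> ((R + t) * \<kappa> * N)" by (simp add: mult.assoc)
      qed
    qed (rule F(1))
    also have "((R + t) * \<kappa> * N) / (t / \<kappa> * N) = (R + t) * \<kappa> / (t / \<kappa>)" using N by simp
    finally show ?thesis .
  qed
  then have "finite {k. norm (\<eta> - \<xi> k) \<le> R * rad k} \<and>
      real (card {k. norm (\<eta> - \<xi> k) \<le> R * rad k}) \<le> ((R + t) * \<kappa> / (t / \<kappa>)) ^ DIM('a)" for \<eta>
    by (rule finite_card_le_if_finite_subsets)
  then show ?thesis by blast
qed

text \<open>A volume count again, as the radii are bounded below for bounded centers.\<close>

lemma finite_bounded_centers: "finite {k. norm (\<xi> k) \<le> B}"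
proof -
  define g where "g = \<bar>1 - \<alpha>\<bar>"
  define B' where "B' = max B 1"
  have B': "1 \<le> B'" "B \<le> B'" by (auto simp: B'_def)
  define s where "s = t / B' powr g"
  have s: "s > 0" using t B' by (simp add: s_def)
  have le: "s \<le> t * rad k" if "norm (\<xi> k) \<le> B" for k
  proof -
    have "norm (\<xi> k) powr (- g) \<le> rad k"
      unfolding rad_def using xi[of k] by (intro powr_mono) (auto simp: g_def)
    moreover have "B' powr (- g) \<le> norm (\<xi> k) powr (- g)"
      using that B' norm_xi_pos[of k] by (intro powr_mono2') (auto simp: g_def)
    ultimately have "t * B' powr (- g) \<le> t * rad k" using t by (intro mult_left_mono) auto
    then show ?thesis by (simp add: s_def powr_minus divide_inverse)
  qed
  have "real (card F) \<le> ((B' + s) / s) ^ DIM('a)" if F: "finite F" "F \<subseteq> {k. norm (\<xi> k) \<le> B}" for F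
  proof (rule disjoint_balls_card[where x=\<xi> and c=0])
    show "ball (\<xi> k) s \<inter> ball (\<xi> l) s = {}" if "k \<in> F" "l \<in> F" "k \<noteq> l" for k l
    proof -
      have "ball (\<xi> k) s \<subseteq> ball (\<xi> k) (t * norm (\<xi> k) powr (1 - \<alpha>))" if "k \<in> F" for k
        using le[of k] F(2) that unfolding rad_def by (intro subset_ball) auto
      then show ?thesis using disj[OF that(3)] that by blast
    qed
    show "ball (\<xi> k) s \<subseteq> ball 0 (B' + s)" if k: "k \<in> F" for k
    proof
      fix y assume y: "y \<in> ball (\<xi> k) s"
      have "norm (\<xi> k) \<le> B'" using k F(2) B' by auto
      moreover have "norm y \<le> norm (\<xi> k) + norm (y - \<xi> k)" by (rule norm_triangle_sub)
      ultimately show "y \<in> ball 0 (B' + s)" using y by (simp add: dist_norm norm_minus_commute)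
    qed
  qed (use F s B' in auto)
  then show ?thesis using finite_card_le_if_finite_subsets by blast
qed

end

section \<open>Packets on the Fourier side\<close>

text \<open>On the ball with radius \<open>R\<^sub>0 * rad k\<close> around \<open>\<xi> k\<close> the \<open>k\<close>-th bump is bounded below. These
  balls cover all frequencies, the low ones included.\<close>

locale packet_frame = separated_centers \<alpha> t \<xi>
  for \<alpha> t :: real and \<xi> :: "nat \<Rightarrow> 'a::euclidean_space" +
  fixes \<phi> :: "'a \<Rightarrow> complex" and b \<rho> m\<^sub>0 R\<^sub>0 R\<^sub>1 :: real and c :: complex
  assumes phi: "\<phi> \<in> schwartz" and phi_real: "\<And>t. \<phi> t \<in> \<real>" and phi_even: "\<And>t. \<phi> (- t) = \<phi> t"
    and phi_supp: "closure {\<zeta>. fourier \<phi> \<zeta> \<noteq> 0} \<subseteq> ball 0 R\<^sub>1"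
    and m0: "0 < m\<^sub>0" "\<And>\<zeta>. norm \<zeta> \<le> R\<^sub>0 \<Longrightarrow> m\<^sub>0 \<le> cmod (fourier \<phi> \<zeta>)"
    and R0: "0 < R\<^sub>0" "R\<^sub>0 < R\<^sub>1"
    and b: "0 < b" and \<rho>: "0 < \<rho>" and bR: "b * \<rho> * R\<^sub>1 < pi"
    and c: "inversion_constant TYPE('a) c"
    and cover: "\<And>\<eta>. \<exists>k. norm (\<eta> - \<xi> k) \<le> R\<^sub>0 * rad k"
begin

lemma R1_pos: "0 < R\<^sub>1" using R0 by linarith
lemma c_nz: "c \<noteq> 0" using c by (simp add: inversion_constant_def)
lemma b\<rho>: "0 < b * \<rho>" using b \<rho> by simp

definition bump :: "nat \<Rightarrow> 'a \<Rightarrow> complex" where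
  "bump k \<eta> = fourier \<phi> ((1 / rad k) *\<^sub>R (\<eta> - \<xi> k))"

definition supp :: "nat \<Rightarrow> 'a set" where
  "supp k = (\<lambda>\<eta>. (1 / rad k) *\<^sub>R (\<eta> - \<xi> k)) -` closure {\<zeta>. fourier \<phi> \<zeta> \<noteq> 0}"

text \<open>The nodes of the \<open>k\<close>-th packets are the multiples \<open>spacing k *\<^sub>R j\<close>, see \<open>node_eq\<close>.\<close>

definition spacing :: "nat \<Rightarrow> real" where "spacing k = b * \<rho> / rad k"

lemma spacing_pos: "0 < spacing k" using b\<rho> rad_pos[of k] by (simp add: spacing_def)

lemma fourier_phi_real: "cnj (fourier \<phi> \<zeta>) = fourier \<phi> \<zeta>"
proof -
  have "cnj (fourier \<phi> \<zeta>) = fourier (\<lambda>t. cnj (\<phi> t)) (- \<zeta>)" by (rule fourier_cnj)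
  also have "(\<lambda>t. cnj (\<phi> t)) = (\<lambda>t. \<phi> (- t))" using phi_real phi_even by (auto simp: Reals_cnj_iff)
  also have "fourier (\<lambda>t. \<phi> (- t)) (- \<zeta>) = fourier \<phi> \<zeta>"
    using fourier_reflect[OF schwartz_borel[OF phi], of "- \<zeta>"] by simp
  finally show ?thesis .
qed

lemma bump_square: "bump k \<eta> * bump k \<eta> = of_real ((cmod (bump k \<eta>))\<^sup>2)"
  unfolding complex_norm_square by (simp add: bump_def fourier_phi_real)

lemma bump_schwartz: "bump k \<in> schwartz"
  unfolding bump_def[abs_def] using rad_pos[of k] by (intro schwartz_affine schwartz_fourier phi) auto

lemma bump_borel [measurable]: "bump k \<in> borel_measurable borel"
  by (rule schwartz_borel[OF bump_schwartz])

lemma bump_zero: "\<eta> \<notin> supp k \<Longrightarrow> bump k \<eta> = 0"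
  unfolding supp_def bump_def using closure_subset[of "{\<zeta>. fourier \<phi> \<zeta> \<noteq> 0}"] by blast

lemma closed_supp: "closed (supp k)"
  unfolding supp_def by (intro continuous_closed_vimage closed_closure continuous_intros)

lemma supp_subset: "\<eta> \<in> supp k \<Longrightarrow> norm (\<eta> - \<xi> k) < R\<^sub>1 * rad k"
proof -
  assume "\<eta> \<in> supp k"
  then have "norm ((1 / rad k) *\<^sub>R (\<eta> - \<xi> k)) < R\<^sub>1" using phi_supp unfolding supp_def by auto
  then show ?thesis using rad_pos[of k] by (simp add: divide_less_eq)
qed

lemma bump_nonzero: "bump k \<eta> \<noteq> 0 \<Longrightarrow> norm (\<eta> - \<xi> k) \<le> R\<^sub>1 * rad k"
  using bump_zero[of \<eta> k] supp_subset[of \<eta> k] by (cases "\<eta> \<in> supp k") auto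

text \<open>This is the condition \<open>b * \<rho> * R\<^sub>1 < pi\<close>: a bump fits into a single cell of the lattice that is dual to
  its nodes.\<close>

lemma supp_open_cell: "supp k \<subseteq> open_cell (\<xi> k) (spacing k)"
proof
  fix \<eta> assume "\<eta> \<in> supp k"
  then have "norm (\<eta> - \<xi> k) < R\<^sub>1 * rad k" by (rule supp_subset)
  also have "\<dots> < pi / spacing k"
  proof -
    have "R\<^sub>1 * (b * \<rho>) < pi" using bR by (simp only: mult.commute)
    then have "R\<^sub>1 < pi / (b * \<rho>)" unfolding pos_less_divide_eq[OF b\<rho>] .
    then have "R\<^sub>1 * rad k < pi / (b * \<rho>) * rad k" using rad_pos[of k] by (rule mult_strict_right_mono)
    then show ?thesis by (simp add: spacing_def)
  qed
  finally have n: "norm (\<eta> - \<xi> k) < pi / spacing k" .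
  have "\<eta> \<bullet> i \<in> {\<xi> k \<bullet> i - pi / spacing k<..<\<xi> k \<bullet> i + pi / spacing k}" if "i \<in> Basis" for i
  proof -
    have "\<bar>(\<eta> - \<xi> k) \<bullet> i\<bar> < pi / spacing k" using Basis_le_norm[OF that, of "\<eta> - \<xi> k"] n by linarith
    then show ?thesis unfolding inner_diff_left by (auto simp: abs_less_iff)
  qed
  then show "\<eta> \<in> open_cell (\<xi> k) (spacing k)" by (simp add: mem_open_cell)
qed

abbreviation node :: "nat \<Rightarrow> 'a \<Rightarrow> 'a" where "node k j \<equiv> lattice_point \<alpha> b \<rho> (\<xi> k) j"

lemma node_eq: "node k j = spacing k *\<^sub>R j"
proof -
  have "norm (\<xi> k) powr (\<alpha> - 1) = 1 / rad k"
    unfolding rad_def using powr_minus_divide[of "norm (\<xi> k)" "1 - \<alpha>"] by simp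
  then show ?thesis by (simp add: lattice_point_def spacing_def)
qed

definition amp :: "nat \<Rightarrow> real" where "amp k = rad k powr (real DIM('a) / 2)"

lemma amp_pos: "0 < amp k" using rad_pos[of k] by (simp add: amp_def)
lemma amp_square: "amp k * amp k = rad k ^ DIM('a)"
  using rad_pos[of k] by (simp add: amp_def powr_add[symmetric] powr_realpow)

lemma packet_eq: "packet \<alpha> \<phi> x (\<xi> k) y = of_real (amp k) * \<phi> (rad k *\<^sub>R (y - x)) * cis (y \<bullet> \<xi> k)"
proof -
  have "norm (\<xi> k) powr (real DIM('a) / 2 * (1 - \<alpha>)) = amp k"
    unfolding amp_def rad_def powr_powr by (simp only: mult.commute)
  then show ?thesis unfolding packet_def rad_def[symmetric] by simp
qed

lemma packet_schwartz: "(\<lambda>t. cnj (packet \<alpha> \<phi> x (\<xi> k) t)) \<in> schwartz"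
proof (rule schwartz_cnj)
  have "(\<lambda>t. \<phi> (rad k *\<^sub>R (t - x))) \<in> schwartz" using rad_pos[of k] by (intro schwartz_affine phi) auto
  from schwartz_mult_poly_growth[OF schwartz_cmult[OF this, of "of_real (amp k)"] poly_growth_cis[of "\<xi> k"]]
  show "packet \<alpha> \<phi> x (\<xi> k) \<in> schwartz"
    unfolding packet_eq[abs_def] by (simp add: inner_commute)
qed

text \<open>Dilation, translation and modulation are interchanged by the transform, and inversion recovers the
  window, which is even and real.\<close>

lemma fourier_bump_wave:
  "fourier (\<lambda>\<eta>. bump k \<eta> * wave (spacing k) j \<eta>) =
    (\<lambda>t. (c * of_real (amp k) * cis (\<xi> k \<bullet> node k j)) * cnj (packet \<alpha> \<phi> (node k j) (\<xi> k) t))"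
proof
  fix t
  let ?x = "node k j"
  have "fourier (\<lambda>\<eta>. bump k \<eta> * wave (spacing k) j \<eta>) t =
      fourier (\<lambda>\<eta>. fourier \<phi> ((1 / rad k) *\<^sub>R (\<eta> - \<xi> k)) * cis (\<eta> \<bullet> ?x)) t"
    unfolding bump_def wave_def node_eq by (simp add: inner_commute)
  also have "\<dots> = of_real (1 / (1 / rad k) ^ DIM('a)) * cis (\<xi> k \<bullet> (?x - t)) *
      fourier (fourier \<phi>) ((1 / (1 / rad k)) *\<^sub>R (t - ?x))"
    using rad_pos[of k] by (intro fourier_affine schwartz_borel schwartz_fourier phi) simp
  also have "fourier (fourier \<phi>) ((1 / (1 / rad k)) *\<^sub>R (t - ?x)) = c * \<phi> (rad k *\<^sub>R (t - ?x))"
    using c phi phi_even unfolding inversion_constant_def by simp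
  also have "of_real (1 / (1 / rad k) ^ DIM('a)) = complex_of_real (amp k) * of_real (amp k)"
    unfolding of_real_mult[symmetric] amp_square by (simp add: power_divide)
  also have "cis (\<xi> k \<bullet> (?x - t)) = cis (\<xi> k \<bullet> ?x) * cis (- (t \<bullet> \<xi> k))"
    by (simp add: cis_mult inner_diff_right inner_commute)
  finally have 1: "fourier (\<lambda>\<eta>. bump k \<eta> * wave (spacing k) j \<eta>) t =
     complex_of_real (amp k) * of_real (amp k) * (cis (\<xi> k \<bullet> ?x) * cis (- (t \<bullet> \<xi> k))) * (c * \<phi> (rad k *\<^sub>R (t - ?x)))" .
  have 2: "cnj (packet \<alpha> \<phi> ?x (\<xi> k) t) = of_real (amp k) * \<phi> (rad k *\<^sub>R (t - ?x)) * cis (- (t \<bullet> \<xi> k))"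
    unfolding packet_eq using phi_real by (simp add: cis_cnj Reals_cnj_iff)
  have ac: "p * q * (e * f) * (k * l) = (k * p * e) * (q * l * f)" for p q e f k l :: complex
    by (simp add: ac_simps)
  show "fourier (\<lambda>\<eta>. bump k \<eta> * wave (spacing k) j \<eta>) t =
    (c * of_real (amp k) * cis (\<xi> k \<bullet> ?x)) * cnj (packet \<alpha> \<phi> ?x (\<xi> k) t)"
    unfolding 1 2 by (rule ac)
qed

abbreviation coef :: "'a dist \<Rightarrow> nat \<Rightarrow> 'a \<Rightarrow> complex" where
  "coef u k j \<equiv> coefficient \<alpha> b \<phi> \<rho> \<xi> j k u"

lemma bump_wave_coefficient:
  assumes "u \<in> tempered"
  shows "cmod (u (fourier (\<lambda>\<eta>. bump k \<eta> * wave (spacing k) j \<eta>))) = cmod c * amp k * cmod (coef u k j)"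
  unfolding fourier_bump_wave temperedD(2)[OF assms packet_schwartz]
  using amp_pos[of k] by (simp add: coefficient_def pairing_def norm_mult)

text \<open>The amplitude of the packets makes these products of normalising factors independent of \<open>k\<close>, respectively
  proportional to the square of the amplitude.\<close>

lemma bessel_bump_constant:
  "(amp k * (spacing k / (2 * pi)) ^ DIM('a)) * (amp k * (2 * pi / spacing k) ^ DIM('a) * (spacing k / (2 * pi)) ^ DIM('a)) = (b * \<rho> / (2 * pi)) ^ DIM('a)"
  "(2 * pi / spacing k) ^ DIM('a) = (amp k)\<^sup>2 * (2 * pi / (b * \<rho>)) ^ DIM('a)"
proof -
  have r: "rad k \<noteq> 0" using rad_pos[of k] by simp
  have s: "spacing k \<noteq> 0" using spacing_pos[of k] by simp
  have "2 * pi / spacing k * (spacing k / (2 * pi)) = 1" using s by simp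
  then have 1: "(2 * pi / spacing k) ^ DIM('a) * (spacing k / (2 * pi)) ^ DIM('a) = 1"
    unfolding power_mult_distrib[symmetric] by (simp only: power_one)
  have 2: "rad k * (spacing k / (2 * pi)) = b * \<rho> / (2 * pi)" using r by (simp add: spacing_def)
  have "(amp k * x) * (amp k * y * x) = (amp k * amp k * x) * (y * x)" for x y by (simp add: ac_simps)
  note this[of "(spacing k / (2 * pi)) ^ DIM('a)" "(2 * pi / spacing k) ^ DIM('a)"]
  also have "(amp k * amp k * (spacing k / (2 * pi)) ^ DIM('a)) * ((2 * pi / spacing k) ^ DIM('a) * (spacing k / (2 * pi)) ^ DIM('a))
      = (rad k * (spacing k / (2 * pi))) ^ DIM('a)"
    unfolding 1 amp_square by (simp only: power_mult_distrib mult_1_right)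
  finally show "(amp k * (spacing k / (2 * pi)) ^ DIM('a)) * (amp k * (2 * pi / spacing k) ^ DIM('a) * (spacing k / (2 * pi)) ^ DIM('a)) = (b * \<rho> / (2 * pi)) ^ DIM('a)"
    unfolding 2 .
  have "2 * pi / spacing k = rad k * (2 * pi / (b * \<rho>))" using r by (simp add: spacing_def)
  then show "(2 * pi / spacing k) ^ DIM('a) = (amp k)\<^sup>2 * (2 * pi / (b * \<rho>)) ^ DIM('a)"
    unfolding power2_eq_square amp_square power_mult_distrib[symmetric] by simp
qed

lemma sum_mult_le_sqrt:
  fixes x y :: "'i \<Rightarrow> real"
  shows "(\<Sum>i\<in>I. \<bar>x i\<bar> * \<bar>y i\<bar>) \<le> sqrt (\<Sum>i\<in>I. (x i)\<^sup>2) * sqrt (\<Sum>i\<in>I. (y i)\<^sup>2)"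
  using L2_set_mult_ineq[of x y I] by (simp add: L2_set_def)

text \<open>The Fourier series of \<open>h\<close> on the cell expresses the action on \<open>bump k * h\<close> through the coefficients of
  \<open>u\<close>, and Bessel's inequality bounds the coefficients of \<open>h\<close>.\<close>

lemma localized_bound:
  assumes u: "u \<in> tempered" and h: "h \<in> schwartz" "\<And>\<eta>. \<eta> \<notin> supp k \<Longrightarrow> h \<eta> = 0"
    and S: "\<And>J. finite J \<Longrightarrow> J \<subseteq> int_lattice \<Longrightarrow> (\<Sum>j\<in>J. (cmod (coef u k j))\<^sup>2) \<le> S"
  shows "cmod (u (fourier (\<lambda>\<eta>. bump k \<eta> * h \<eta>))) \<le>
    cmod c * sqrt ((b * \<rho> / (2 * pi)) ^ DIM('a)) * sqrt S * nrm lborel h"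
proof (rule LIMSEQ_le_const2)
  let ?s = "spacing k" and ?d = "DIM('a)"
  show "(\<lambda>n. cmod (\<Sum>j\<in>lattice_ball ?s n. fcoef ?s h j * u (fourier (\<lambda>\<eta>. bump k \<eta> * wave ?s j \<eta>))))
      \<longlonglongrightarrow> cmod (u (fourier (\<lambda>\<eta>. bump k \<eta> * h \<eta>)))"
    by (intro tendsto_norm tempered_fourier_series[OF u spacing_pos bump_schwartz bump_zero h closed_supp supp_open_cell])
  have h2: "l2on lborel h"
    unfolding l2on_def using schwartz_borel[OF h(1)] schwartz_square_integrable(2)[OF h(1) h(1)] by simp
  have hc: "h \<eta> = 0" if "\<eta> \<notin> cell (\<xi> k) ?s" for \<eta>
    using h(2)[of \<eta>] that supp_open_cell open_cell_subset by blast
  define W where "W = (?s / (2 * pi)) ^ ?d"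
  define V where "V = (2 * pi / ?s) ^ ?d"
  have WV: "0 \<le> W" "0 \<le> V" using spacing_pos[of k] by (auto simp: W_def V_def)
  have "cmod (\<Sum>j\<in>lattice_ball ?s n. fcoef ?s h j * u (fourier (\<lambda>\<eta>. bump k \<eta> * wave ?s j \<eta>)))
    \<le> cmod c * sqrt ((b * \<rho> / (2 * pi)) ^ ?d) * sqrt S * nrm lborel h" for n
  proof -
    let ?J = "lattice_ball ?s n :: 'a set"
    have J: "finite ?J" "?J \<subseteq> int_lattice" by (rule finite_lattice_ball[OF spacing_pos] lattice_ball_subset)+
    \<comment> \<open>The coefficient fcoef at j is W times the integral against the wave of index - j.\<close>
    have J': "finite (uminus ` ?J)" "uminus ` ?J \<subseteq> int_lattice"
      using J by (auto intro: int_lattice_uminus)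
    have fc: "fcoef ?s h j = of_real W * (LINT \<eta>|lborel. h \<eta> * wave ?s (- j) \<eta>)" for j
      unfolding fcoef_def fourier_def W_def wave_def by (simp add: inner_commute)
    have "(\<Sum>j\<in>?J. (cmod (fcoef ?s h j))\<^sup>2) = W\<^sup>2 * (\<Sum>j\<in>?J. (cmod (LINT \<eta>|lborel. h \<eta> * wave ?s (- j) \<eta>))\<^sup>2)"
      unfolding fc norm_mult power_mult_distrib sum_distrib_left by simp
    also have "(\<Sum>j\<in>?J. (cmod (LINT \<eta>|lborel. h \<eta> * wave ?s (- j) \<eta>))\<^sup>2) =
        (\<Sum>j\<in>uminus ` ?J. (cmod (LINT \<eta>|lborel. h \<eta> * wave ?s j \<eta>))\<^sup>2)"
      by (simp add: sum.reindex)
    also have "W\<^sup>2 * \<dots> \<le> W\<^sup>2 * (V * (nrm lborel h)\<^sup>2)"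
      unfolding V_def nrm_square using bessel_inequality[OF spacing_pos h2 hc J'] by (intro mult_left_mono) auto
    finally have fs: "(\<Sum>j\<in>?J. (cmod (fcoef ?s h j))\<^sup>2) \<le> W\<^sup>2 * V * (nrm lborel h)\<^sup>2" by simp
    have "cmod (\<Sum>j\<in>?J. fcoef ?s h j * u (fourier (\<lambda>\<eta>. bump k \<eta> * wave ?s j \<eta>))) \<le>
        (\<Sum>j\<in>?J. cmod (fcoef ?s h j * u (fourier (\<lambda>\<eta>. bump k \<eta> * wave ?s j \<eta>))))" by (rule norm_sum)
    also have "\<dots> = (cmod c * amp k) * (\<Sum>j\<in>?J. \<bar>cmod (fcoef ?s h j)\<bar> * \<bar>cmod (coef u k j)\<bar>)"
      unfolding norm_mult bump_wave_coefficient[OF u] sum_distrib_left abs_norm_cancel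
      by (intro sum.cong refl) (simp only: ac_simps)
    also have "\<dots> \<le> (cmod c * amp k) * (sqrt (W\<^sup>2 * V * (nrm lborel h)\<^sup>2) * sqrt S)"
    proof (intro mult_left_mono order_trans[OF sum_mult_le_sqrt] mult_mono real_sqrt_le_mono fs S J)
      show "0 \<le> sqrt (\<Sum>j\<in>?J. (cmod (coef u k j))\<^sup>2)" by (intro real_sqrt_ge_zero sum_nonneg) simp
      show "0 \<le> cmod c * amp k" using amp_pos[of k] by simp
    qed (use WV in auto)
    also have "\<dots> = cmod c * (amp k * sqrt (W\<^sup>2 * V * (nrm lborel h)\<^sup>2)) * sqrt S" by (simp only: mult.assoc)
    also have "amp k * sqrt (W\<^sup>2 * V * (nrm lborel h)\<^sup>2) = sqrt ((b * \<rho> / (2 * pi)) ^ ?d) * nrm lborel h"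
    proof -
      have "(amp k)\<^sup>2 * (W\<^sup>2 * V) = (b * \<rho> / (2 * pi)) ^ ?d"
        using bessel_bump_constant(1)[of k] unfolding W_def[symmetric] V_def[symmetric]
        by (simp add: power2_eq_square ac_simps)
      then have "sqrt ((amp k)\<^sup>2 * (W\<^sup>2 * V) * (nrm lborel h)\<^sup>2) = sqrt ((b * \<rho> / (2 * pi)) ^ ?d) * nrm lborel h"
        by (simp add: real_sqrt_mult)
      moreover have "sqrt ((amp k)\<^sup>2 * (W\<^sup>2 * V) * (nrm lborel h)\<^sup>2) = amp k * sqrt (W\<^sup>2 * V * (nrm lborel h)\<^sup>2)"
        unfolding mult.assoc real_sqrt_mult[of "(amp k)\<^sup>2"] using amp_pos[of k] by simp
      ultimately show ?thesis by simp
    qed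
    also have "cmod c * (sqrt ((b * \<rho> / (2 * pi)) ^ ?d) * nrm lborel h) * sqrt S =
        cmod c * sqrt ((b * \<rho> / (2 * pi)) ^ ?d) * sqrt S * nrm lborel h"
      by (simp only: mult.assoc mult.commute[of "nrm lborel h"])
    finally show ?thesis .
  qed
  then show "\<exists>N. \<forall>n\<ge>N. cmod (\<Sum>j\<in>lattice_ball ?s n. fcoef ?s h j * u (fourier (\<lambda>\<eta>. bump k \<eta> * wave ?s j \<eta>)))
    \<le> cmod c * sqrt ((b * \<rho> / (2 * pi)) ^ ?d) * sqrt S * nrm lborel h" by blast
qed

text \<open>Up to a factor of modulus \<open>cmod c * amp k\<close>, the coefficients of \<open>u\<close> are the Fourier coefficients of
  \<open>g * bump k\<close> on the cell.\<close>

lemma coefficient_bessel: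
  assumes u: "u \<in> tempered" and g: "fourier_dist u = fun_dist g" and l2: "l2on lborel (\<lambda>\<eta>. g \<eta> * bump k \<eta>)"
    and J: "finite J" "J \<subseteq> int_lattice"
  shows "(\<Sum>j\<in>J. (cmod (coef u k j))\<^sup>2) \<le>
    (2 * pi / (b * \<rho>)) ^ DIM('a) / (cmod c)\<^sup>2 * (LINT \<eta>|lborel. (cmod (g \<eta> * bump k \<eta>))\<^sup>2)"
proof -
  let ?s = "spacing k" and ?I = "LINT \<eta>|lborel. (cmod (g \<eta> * bump k \<eta>))\<^sup>2"
  have eq: "cmod c * amp k * cmod (coef u k j) = cmod (LINT \<eta>|lborel. (g \<eta> * bump k \<eta>) * wave ?s j \<eta>)" for j
  proof -
    have s: "(\<lambda>\<eta>. bump k \<eta> * wave ?s j \<eta>) \<in> schwartz"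
      unfolding wave_def by (rule schwartz_mult_poly_growth[OF bump_schwartz poly_growth_cis])
    have "u (fourier (\<lambda>\<eta>. bump k \<eta> * wave ?s j \<eta>)) = fourier_dist u (\<lambda>\<eta>. bump k \<eta> * wave ?s j \<eta>)"
      using s by (simp add: fourier_dist_def)
    also have "\<dots> = (LINT \<eta>|lborel. (g \<eta> * bump k \<eta>) * wave ?s j \<eta>)"
      unfolding g using s by (simp add: fun_dist_def mult.assoc)
    finally show ?thesis using bump_wave_coefficient[OF u, of k j] by simp
  qed
  have "(cmod c)\<^sup>2 * (amp k)\<^sup>2 * (\<Sum>j\<in>J. (cmod (coef u k j))\<^sup>2) =
      (\<Sum>j\<in>J. (cmod (LINT \<eta>|lborel. (g \<eta> * bump k \<eta>) * wave ?s j \<eta>))\<^sup>2)"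
    unfolding eq[symmetric] power_mult_distrib sum_distrib_left ..
  also have "\<dots> \<le> (2 * pi / ?s) ^ DIM('a) * ?I"
  proof (rule bessel_inequality[OF spacing_pos l2 _ J])
    show "g \<eta> * bump k \<eta> = 0" if "\<eta> \<notin> cell (\<xi> k) ?s" for \<eta>
      using bump_zero[of \<eta> k] that supp_open_cell open_cell_subset by (metis mult_zero_right subsetD)
  qed
  also have "\<dots> = (amp k)\<^sup>2 * ((2 * pi / (b * \<rho>)) ^ DIM('a) * ?I)" unfolding bessel_bump_constant(2) by simp
  finally have "(amp k)\<^sup>2 * ((cmod c)\<^sup>2 * (\<Sum>j\<in>J. (cmod (coef u k j))\<^sup>2)) \<le> (amp k)\<^sup>2 * ((2 * pi / (b * \<rho>)) ^ DIM('a) * ?I)"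
    by (simp only: ac_simps)
  then have "(cmod c)\<^sup>2 * (\<Sum>j\<in>J. (cmod (coef u k j))\<^sup>2) \<le> (2 * pi / (b * \<rho>)) ^ DIM('a) * ?I"
    using amp_pos[of k] by (simp add: mult_le_cancel_left_pos)
  moreover have "0 < (cmod c)\<^sup>2" using c_nz by simp
  ultimately show ?thesis by (simp add: pos_le_divide_eq mult.commute)
qed

section \<open>The square function of the bumps\<close>

definition weight :: "real \<Rightarrow> nat \<Rightarrow> real" where "weight \<gamma> k = (1 + norm (\<xi> k)) powr \<gamma>"

text \<open>The weight that Parseval's identity on the cells produces when it is summed over \<open>k\<close>.\<close>

definition square_fun :: "real \<Rightarrow> 'a \<Rightarrow> real" where
  "square_fun \<gamma> \<eta> = (\<Sum>k. weight \<gamma> k * (cmod (bump k \<eta>))\<^sup>2)"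

lemma weight_pos: "0 < weight \<gamma> k"
proof -
  have "0 < 1 + norm (\<xi> k)" by (intro add_pos_nonneg) auto
  then show ?thesis by (simp add: weight_def)
qed

lemma overlap_finite: "finite {k. norm (\<eta> - \<xi> k) \<le> R\<^sub>1 * rad k}"
  using bounded_overlap[of R\<^sub>1] R1_pos by auto

lemma square_fun_sums: "(\<lambda>k. weight \<gamma> k * (cmod (bump k \<eta>))\<^sup>2) sums square_fun \<gamma> \<eta>"
  unfolding square_fun_def using bump_nonzero by (intro summable_sums summable_finite[OF overlap_finite[of \<eta>]]) auto

lemma square_fun_eq_sum:
  assumes "finite K" "\<And>k. bump k \<eta> \<noteq> 0 \<Longrightarrow> k \<in> K"
  shows "square_fun \<gamma> \<eta> = (\<Sum>k\<in>K. weight \<gamma> k * (cmod (bump k \<eta>))\<^sup>2)"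
  unfolding square_fun_def using assms by (intro suminf_finite) auto

text \<open>The lower bound uses a single bump that does not vanish at \<open>\<eta>\<close>, the upper bound uses the bounded overlap;
  the weights are comparable with the one at \<open>\<eta>\<close> in both cases.\<close>

lemma square_fun_bounds: "\<exists>C\<^sub>1>0. \<exists>C\<^sub>2>0. \<forall>\<eta>. C\<^sub>1 * jbracket \<eta> powr \<gamma> \<le> square_fun \<gamma> \<eta> \<and> square_fun \<gamma> \<eta> \<le> C\<^sub>2 * jbracket \<eta> powr \<gamma>"
proof -
  obtain \<kappa> where \<kappa>: "\<kappa> > 0" "\<And>k \<eta>. norm (\<eta> - \<xi> k) \<le> R\<^sub>1 * rad k \<Longrightarrow>
    weight \<gamma> k \<le> \<kappa> * jbracket \<eta> powr \<gamma> \<and> jbracket \<eta> powr \<gamma> \<le> \<kappa> * weight \<gamma> k"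
    using weight_comparison[of R\<^sub>1 \<gamma>] R1_pos unfolding weight_def by auto
  obtain M where M: "\<And>\<eta>. real (card {k. norm (\<eta> - \<xi> k) \<le> R\<^sub>1 * rad k}) \<le> M"
    using bounded_overlap[of R\<^sub>1] R1_pos by auto
  obtain B where B: "B > 0" "\<And>\<zeta>. cmod (fourier \<phi> \<zeta>) \<le> B" using schwartz_bounded[OF schwartz_fourier[OF phi]] by blast
  have jb: "0 < jbracket \<eta> powr \<gamma>" for \<eta> using jbracket_pos[of \<eta>] by simp
  have low: "(m\<^sub>0\<^sup>2 / \<kappa>) * jbracket \<eta> powr \<gamma> \<le> square_fun \<gamma> \<eta>" for \<eta>
  proof -
    obtain k where k: "norm (\<eta> - \<xi> k) \<le> R\<^sub>0 * rad k" using cover by blast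
    have "R\<^sub>0 * rad k \<le> R\<^sub>1 * rad k" using R0 rad_pos[of k] by (intro mult_right_mono) auto
    then have k1: "norm (\<eta> - \<xi> k) \<le> R\<^sub>1 * rad k" using k by linarith
    have "norm ((1 / rad k) *\<^sub>R (\<eta> - \<xi> k)) \<le> R\<^sub>0" using k rad_pos[of k] by (simp add: divide_le_eq)
    then have "m\<^sub>0 \<le> cmod (bump k \<eta>)" unfolding bump_def by (rule m0(2))
    then have "m\<^sub>0\<^sup>2 \<le> (cmod (bump k \<eta>))\<^sup>2" using m0(1) by (intro power_mono) auto
    moreover have "jbracket \<eta> powr \<gamma> / \<kappa> \<le> weight \<gamma> k"
      using \<kappa>(1) \<kappa>(2)[OF k1] by (simp add: divide_le_eq mult.commute)
    ultimately have "(jbracket \<eta> powr \<gamma> / \<kappa>) * m\<^sub>0\<^sup>2 \<le> weight \<gamma> k * (cmod (bump k \<eta>))\<^sup>2"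
      using weight_pos[of \<gamma> k] by (intro mult_mono) auto
    also have "\<dots> \<le> square_fun \<gamma> \<eta>"
    proof -
      have "(\<Sum>k\<in>{k}. weight \<gamma> k * (cmod (bump k \<eta>))\<^sup>2) \<le> square_fun \<gamma> \<eta>"
        unfolding square_fun_def using less_imp_le[OF weight_pos[of \<gamma>]]
        by (intro sum_le_suminf sums_summable[OF square_fun_sums]) auto
      then show ?thesis by simp
    qed
    finally show ?thesis by (simp add: ac_simps)
  qed
  have up: "square_fun \<gamma> \<eta> \<le> ((\<bar>M\<bar> + 1) * (\<kappa> * B\<^sup>2)) * jbracket \<eta> powr \<gamma>" for \<eta>
  proof -
    let ?K = "{k. norm (\<eta> - \<xi> k) \<le> R\<^sub>1 * rad k}"
    have "square_fun \<gamma> \<eta> = (\<Sum>k\<in>?K. weight \<gamma> k * (cmod (bump k \<eta>))\<^sup>2)"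
      by (rule square_fun_eq_sum[OF overlap_finite]) (use bump_nonzero in blast)
    also have "\<dots> \<le> (\<Sum>k\<in>?K. (\<kappa> * jbracket \<eta> powr \<gamma>) * B\<^sup>2)"
    proof (rule sum_mono)
      fix k assume "k \<in> ?K"
      then show "weight \<gamma> k * (cmod (bump k \<eta>))\<^sup>2 \<le> (\<kappa> * jbracket \<eta> powr \<gamma>) * B\<^sup>2"
        using \<kappa>(2)[of \<eta> k] \<kappa>(1) jb[of \<eta>] B(2) weight_pos[of \<gamma> k] unfolding bump_def
        by (intro mult_mono power_mono) auto
    qed
    also have "\<dots> = real (card ?K) * ((\<kappa> * jbracket \<eta> powr \<gamma>) * B\<^sup>2)" by simp
    also have "\<dots> \<le> (\<bar>M\<bar> + 1) * ((\<kappa> * jbracket \<eta> powr \<gamma>) * B\<^sup>2)"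
      using M[of \<eta>] \<kappa>(1) jb[of \<eta>] by (intro mult_right_mono) auto
    finally show ?thesis by (simp add: ac_simps)
  qed
  have "0 < m\<^sub>0\<^sup>2 / \<kappa>" using m0 \<kappa>(1) by simp
  moreover have "0 < (\<bar>M\<bar> + 1) * (\<kappa> * B\<^sup>2)" using \<kappa>(1) B(1) by (intro mult_pos_pos add_nonneg_pos) auto
  ultimately show ?thesis using low up by blast
qed

lemma square_fun_pos: "0 < square_fun \<gamma> \<eta>"
proof -
  obtain C\<^sub>1 where "C\<^sub>1 > 0" "C\<^sub>1 * jbracket \<eta> powr \<gamma> \<le> square_fun \<gamma> \<eta>" using square_fun_bounds[of \<gamma>] by blast
  moreover have "0 < jbracket \<eta> powr \<gamma>" using jbracket_pos[of \<eta>] by simp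
  ultimately show ?thesis by (meson less_le_trans mult_pos_pos)
qed

lemma locally_finite: "\<exists>K. finite K \<and> (\<forall>\<eta> k. norm \<eta> \<le> T \<longrightarrow> bump k \<eta> \<noteq> 0 \<longrightarrow> k \<in> K)"
proof -
  obtain \<kappa> where \<kappa>: "\<kappa> \<ge> 1" "\<And>k \<eta>. norm (\<eta> - \<xi> k) \<le> R\<^sub>1 * rad k \<Longrightarrow> 1 + norm (\<xi> k) \<le> \<kappa> * (1 + norm \<eta>)"
    using size_comparison[of R\<^sub>1] R1_pos by auto
  have "norm (\<xi> k) \<le> \<kappa> * (1 + T)" if "norm \<eta> \<le> T" "bump k \<eta> \<noteq> 0" for \<eta> k
  proof -
    have "1 + norm (\<xi> k) \<le> \<kappa> * (1 + norm \<eta>)" by (rule \<kappa>(2)[OF bump_nonzero[OF that(2)]])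
    also have "\<dots> \<le> \<kappa> * (1 + T)" using \<kappa>(1) that(1) by (intro mult_left_mono) auto
    finally show ?thesis by linarith
  qed
  then show ?thesis using finite_bounded_centers[of "\<kappa> * (1 + T)"] by blast
qed

text \<open>The sum is locally finite, and the squared moduli are squares because the bumps are real.\<close>

lemma square_fun_smooth: "smooth (\<lambda>\<eta>. complex_of_real (square_fun \<gamma> \<eta>))"
proof (rule smooth_local)
  fix x :: 'a
  obtain K where K: "finite K" "\<And>\<eta> k. norm \<eta> \<le> norm x + 1 \<Longrightarrow> bump k \<eta> \<noteq> 0 \<Longrightarrow> k \<in> K"
    using locally_finite by blast
  let ?g = "\<lambda>\<eta>. \<Sum>k\<in>K. complex_of_real (weight \<gamma> k) * (bump k \<eta> * bump k \<eta>)"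
  have "smooth ?g"
    by (intro smooth_sum smooth_mult smooth_const schwartz_smooth bump_schwartz)
  moreover have "complex_of_real (square_fun \<gamma> y) = ?g y" if "y \<in> ball x 1" for y
  proof -
    have "norm y \<le> norm x + norm (y - x)" by (rule norm_triangle_sub)
    then have "norm y \<le> norm x + 1" using that by (simp add: dist_norm norm_minus_commute)
    then have "square_fun \<gamma> y = (\<Sum>k\<in>K. weight \<gamma> k * (cmod (bump k y))\<^sup>2)" using K by (intro square_fun_eq_sum) auto
    then show ?thesis by (simp add: bump_square)
  qed
  ultimately show "\<exists>U g. open U \<and> x \<in> U \<and> smooth g \<and> (\<forall>y\<in>U. complex_of_real (square_fun \<gamma> y) = g y)"
    by (intro exI[of _ "ball x 1"] exI[of _ ?g]) auto
qed

end

section \<open>Cut-offs and integrability with weights\<close>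

lemma schwartz_lipschitz:
  fixes f :: "'a::euclidean_space \<Rightarrow> complex"
  assumes f: "f \<in> schwartz"
  shows "\<exists>L\<ge>0. \<forall>x. cmod (f x - f 0) \<le> L * norm x"
proof -
  have sm: "smooth f" by (rule schwartz_smooth[OF f])
  have fs: "bounded_family (\<lambda>_::unit. f)" using f schwartz_iff_bounded_family by blast
  have "\<forall>v. \<exists>K. v \<in> Basis \<longrightarrow> (\<forall>x. cmod (pd v f x) \<le> K)"
    using bounded_familyD[OF fs, of "[_]" 0] by auto
  then obtain K where K: "\<And>v x. v \<in> Basis \<Longrightarrow> cmod (pd v f x) \<le> K v" by metis
  define L where "L = (\<Sum>v\<in>Basis. K v)"
  have K0: "0 \<le> K v" if "v \<in> Basis" for v using order_trans[OF norm_ge_zero K[OF that, of 0]] .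
  have L0: "0 \<le> L" unfolding L_def by (intro sum_nonneg K0)
  have der: "(f has_derivative frechet_derivative f (at x)) (at x within UNIV)" for x
    using smooth_has_derivative[OF sm] by simp
  have "cmod (f x - f 0) \<le> L * norm (x - 0)" for x
  proof (rule differentiable_bound[OF convex_UNIV der])
    fix x
    have lin: "linear (frechet_derivative f (at x))" by (rule has_derivative_linear[OF der])
    show "onorm (frechet_derivative f (at x)) \<le> L"
    proof (rule onorm_bound[OF L0])
      fix h :: 'a
      have "frechet_derivative f (at x) h = frechet_derivative f (at x) (\<Sum>v\<in>Basis. (h \<bullet> v) *\<^sub>R v)"
        by (simp add: euclidean_representation)
      also have "\<dots> = (\<Sum>v\<in>Basis. (h \<bullet> v) *\<^sub>R pd v f x)"
        by (simp add: linear_sum[OF lin] linear_scale[OF lin])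
      also have "cmod \<dots> \<le> (\<Sum>v\<in>Basis. norm h * K v)"
      proof (rule sum_norm_le)
        fix v :: 'a assume v: "v \<in> Basis"
        show "cmod ((h \<bullet> v) *\<^sub>R pd v f x) \<le> norm h * K v"
          unfolding norm_scaleR by (intro mult_mono Basis_le_norm v K) auto
      qed
      finally show "cmod (frechet_derivative f (at x) h) \<le> L * norm h"
        by (simp add: L_def sum_distrib_left mult.commute)
    qed
  qed auto
  then show ?thesis using L0 by auto
qed

text \<open>The error \<open>cut (\<eta> / n) - 1\<close> of the cut-off, multiplied by \<open>n\<close>, is a uniform multiplier of polynomial growth. So
  its product with \<open>\<psi>\<close> and the transform of this product are bounded families, on which \<open>u\<close> is bounded.\<close>

theorem tempered_cutoff:
  fixes cut \<psi> :: "'a::euclidean_space \<Rightarrow> complex"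
  assumes u: "u \<in> tempered" and cut: "cut \<in> schwartz" "cut 0 = 1" and \<psi>: "\<psi> \<in> schwartz"
  shows "(\<lambda>n. u (fourier (\<lambda>\<eta>. \<psi> \<eta> * cut ((1 / real (Suc n)) *\<^sub>R \<eta>)))) \<longlonglongrightarrow> u (fourier \<psi>)"
proof -
  define X where "X n \<eta> = cut ((1 / real (Suc n)) *\<^sub>R (\<eta> - 0))" for n \<eta>
  have Xs: "X n \<in> schwartz" for n unfolding X_def[abs_def] by (intro schwartz_affine cut) simp
  define E where "E n \<eta> = of_real (real (Suc n)) * (X n \<eta> + (-1))" for n \<eta>
  have smX: "smooth (\<lambda>\<eta>. X n \<eta> + (-1))" for n by (intro smooth_add smooth_const schwartz_smooth Xs)
  obtain L where L: "L \<ge> 0" "\<And>x. cmod (cut x - cut 0) \<le> L * norm x" using schwartz_lipschitz[OF cut(1)] by blast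
  have "poly_growth E"
    unfolding poly_growth_def
  proof (intro conjI allI ballI)
    show "smooth (E n)" for n unfolding E_def[abs_def] by (intro smooth_mult smooth_const smX)
    fix vs :: "'a list" assume vs: "vs \<in> lists Basis"
    have fs: "bounded_family (\<lambda>_::unit. cut)" using cut(1) schwartz_iff_bounded_family by blast
    obtain K where K: "K > 0" "\<And>x. cmod (iter_deriv vs cut x) \<le> K" using bounded_familyD[OF fs vs, of 0] by auto
    have "cmod (iter_deriv vs (E n) x) \<le> (L + K) * (1 + norm x) ^ 1" for n x
    proof (cases vs)
      case Nil
      have "cmod (E n x) = real (Suc n) * cmod (cut ((1 / real (Suc n)) *\<^sub>R x) - cut 0)"
        unfolding E_def X_def norm_mult norm_of_real cut(2) by simp
      also have "\<dots> \<le> real (Suc n) * (L * norm ((1 / real (Suc n)) *\<^sub>R x))" by (intro mult_left_mono L) simp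
      also have "\<dots> = L * norm x" by (simp del: of_nat_Suc)
      also have "\<dots> \<le> (L + K) * (1 + norm x) ^ 1" using L(1) K(1) by (simp add: mult_mono)
      finally show ?thesis using Nil by simp
    next
      case (Cons v ws)
      have "iter_deriv vs (E n) = (\<lambda>x. of_real (real (Suc n)) * iter_deriv vs (\<lambda>\<eta>. X n \<eta> + (-1)) x)"
        unfolding E_def[abs_def] by (rule iter_deriv_cmult[OF smX vs])
      also have "iter_deriv vs (\<lambda>\<eta>. X n \<eta> + (-1)) = iter_deriv vs (X n)"
        by (simp only: iter_deriv_add[OF schwartz_smooth[OF Xs] smooth_const vs] iter_deriv_const)
           (simp add: Cons)
      also have "iter_deriv vs (X n) = (\<lambda>x. of_real (1 / real (Suc n)) ^ length vs * iter_deriv vs cut ((1 / real (Suc n)) *\<^sub>R (x - 0)))"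
        unfolding X_def[abs_def] by (rule iter_deriv_affine(2)[OF schwartz_smooth[OF cut(1)] vs])
      finally have "cmod (iter_deriv vs (E n) x) =
          (real (Suc n) * (1 / real (Suc n)) ^ length vs) * cmod (iter_deriv vs cut ((1 / real (Suc n)) *\<^sub>R (x - 0)))"
        by (simp only: norm_mult norm_power norm_of_real) simp
      also have "\<dots> \<le> 1 * K"
      proof (intro mult_mono K)
        have "real (Suc n) * (1 / real (Suc n)) ^ length vs = (1 / real (Suc n)) ^ length ws"
          unfolding Cons by (simp del: of_nat_Suc)
        also have "\<dots> \<le> 1" by (intro power_le_one) auto
        finally show "real (Suc n) * (1 / real (Suc n)) ^ length vs \<le> 1" .
      qed auto
      also have "\<dots> \<le> (L + K) * (1 + norm x) ^ 1"
        using L(1) K(1) mult_mono[of K "L + K" 1 "1 + norm x"] by simp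
      finally show ?thesis .
    qed
    then show "\<exists>K N. \<forall>n x. cmod (iter_deriv vs (E n) x) \<le> K * (1 + norm x) ^ N" by blast
  qed
  moreover have "bounded_family (\<lambda>_::nat. \<psi>)" using \<psi> schwartz_iff_bounded_family by blast
  ultimately have "bounded_family (\<lambda>n. fourier (\<lambda>\<eta>. \<psi> \<eta> * E n \<eta>))" by (intro bounded_family_fourier bounded_family_mult)
  then obtain K where K: "\<And>n. cmod (u (fourier (\<lambda>\<eta>. \<psi> \<eta> * E n \<eta>))) \<le> K"
    using tempered_bounded_family[OF u] by blast
  define z where "z = u (fourier \<psi>)"
  define zn where "zn n = u (fourier (\<lambda>\<eta>. \<psi> \<eta> * X n \<eta>))" for n
  have \<psi>X: "(\<lambda>\<eta>. \<psi> \<eta> * X n \<eta>) \<in> schwartz" for n by (rule schwartz_mult[OF \<psi> Xs])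
  have eq: "u (fourier (\<lambda>\<eta>. \<psi> \<eta> * E n \<eta>)) = of_real (real (Suc n)) * (zn n - z)" for n
  proof -
    let ?k = "complex_of_real (real (Suc n))"
    have i: "integrable lborel (\<lambda>\<eta>. f \<eta> * cis (- (\<eta> \<bullet> x)))" if "f \<in> schwartz" for f and x :: 'a
      by (rule integrable_cis[OF schwartz_integrable[OF that]]) simp
    have "fourier (\<lambda>\<eta>. \<psi> \<eta> * E n \<eta>) x = ?k * fourier (\<lambda>\<eta>. \<psi> \<eta> * X n \<eta>) x + (- ?k) * fourier \<psi> x" for x
    proof -
      have "\<psi> \<eta> * E n \<eta> * cis (- (\<eta> \<bullet> x)) =
        ?k * (\<psi> \<eta> * X n \<eta> * cis (- (\<eta> \<bullet> x))) + (- ?k) * (\<psi> \<eta> * cis (- (\<eta> \<bullet> x)))" for \<eta>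
      proof -
        have "p * (k * (q + (-1))) * e = k * (p * q * e) + (- k) * (p * e)" for p q k e :: complex
          by (simp add: algebra_simps)
        then show ?thesis unfolding E_def by (simp only:)
      qed
      then show ?thesis unfolding fourier_def
        by (simp only: Bochner_Integration.integral_add[OF integrable_mult_right[OF i[OF \<psi>X]] integrable_mult_right[OF i[OF \<psi>]]]
            integral_mult_right_zero)
    qed
    then have "fourier (\<lambda>\<eta>. \<psi> \<eta> * E n \<eta>) = (\<lambda>x. ?k * fourier (\<lambda>\<eta>. \<psi> \<eta> * X n \<eta>) x + (- ?k) * fourier \<psi> x)" by blast
    then have "u (fourier (\<lambda>\<eta>. \<psi> \<eta> * E n \<eta>)) = ?k * zn n + (- ?k) * z"
      unfolding zn_def z_def
      by (simp only: temperedD(1)[OF u schwartz_cmult[OF schwartz_fourier[OF \<psi>X]] schwartz_cmult[OF schwartz_fourier[OF \<psi>]]]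
          temperedD(2)[OF u schwartz_fourier[OF \<psi>X]] temperedD(2)[OF u schwartz_fourier[OF \<psi>]])
    also have "\<dots> = ?k * (zn n - z)" unfolding right_diff_distrib mult_minus_left by (rule add_uminus_conv_diff)
    finally show ?thesis .
  qed
  have "cmod (zn n - z) \<le> K * (1 / real (Suc n))" for n
  proof -
    have p: "0 < real (Suc n)" by simp
    have "cmod (of_real (real (Suc n)) * (zn n - z)) \<le> K" using K[of n] unfolding eq .
    then have "cmod (zn n - z) * real (Suc n) \<le> K"
      unfolding norm_mult norm_of_real abs_of_pos[OF p] by (simp only: mult.commute)
    then have "cmod (zn n - z) \<le> K / real (Suc n)" unfolding pos_le_divide_eq[OF p] .
    then show ?thesis by simp
  qed
  moreover have "(\<lambda>n. K * (1 / real (Suc n))) \<longlonglongrightarrow> 0"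
    by (rule tendsto_mult_right_zero[OF LIMSEQ_Suc[OF lim_1_over_n]])
  ultimately have "(\<lambda>n. zn n - z) \<longlonglongrightarrow> 0"
    by (rule Lim_null_comparison[OF always_eventually[OF allI]])
  then show ?thesis unfolding zn_def z_def X_def by (simp only: LIM_zero_iff diff_zero)
qed

lemma jbracket_powr_le: "\<exists>K>0. \<exists>N. \<forall>\<eta>::'a::euclidean_space. jbracket \<eta> powr \<gamma> \<le> K * (1 + norm \<eta>) ^ N"
proof -
  obtain N :: nat where N: "\<gamma> \<le> real N" using real_arch_simple by blast
  have "jbracket \<eta> powr \<gamma> \<le> 2 powr \<bar>\<gamma>\<bar> * (1 + norm \<eta>) ^ N" for \<eta> :: 'a
  proof -
    have p: "0 < 1 + norm \<eta>" by (intro add_pos_nonneg) auto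
    have "jbracket \<eta> powr \<gamma> \<le> 2 powr \<bar>\<gamma>\<bar> * (1 + norm \<eta>) powr \<gamma>"
      by (rule powr_comparison[OF jbracket_pos p _ jbracket_comparison]) simp
    also have "\<dots> \<le> 2 powr \<bar>\<gamma>\<bar> * (1 + norm \<eta>) powr (real N)"
      using N by (intro mult_left_mono powr_mono) auto
    also have "(1 + norm \<eta>) powr (real N) = (1 + norm \<eta>) ^ N" using p by (rule powr_realpow)
    finally show ?thesis .
  qed
  moreover have "0 < 2 powr \<bar>\<gamma>\<bar>" by simp
  ultimately show ?thesis by blast
qed

lemma schwartz_weighted_integrable:
  fixes \<psi> :: "'a::euclidean_space \<Rightarrow> complex"
  assumes \<psi>: "\<psi> \<in> schwartz"
  shows "integrable lborel (\<lambda>\<eta>. jbracket \<eta> powr \<gamma> * (cmod (\<psi> \<eta>))\<^sup>2)"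
proof -
  have [measurable]: "\<psi> \<in> borel_measurable borel" by (rule schwartz_borel[OF \<psi>])
  have [measurable]: "(jbracket :: 'a \<Rightarrow> real) \<in> borel_measurable borel"
    by (rule borel_measurable_continuous_onI[OF jbracket_continuous])
  obtain K N where K: "K > 0" "\<And>\<eta>::'a. jbracket \<eta> powr \<gamma> \<le> K * (1 + norm \<eta>) ^ N" using jbracket_powr_le by blast
  obtain B where B: "B > 0" "\<And>x. cmod (\<psi> x) \<le> B" using schwartz_bounded[OF \<psi>] by blast
  obtain D where D: "D > 0" "\<And>x. (1 + norm x) ^ N * cmod (\<psi> x) \<le> D * decay x" using schwartz_bound_decay[OF \<psi>] by blast
  have "jbracket \<eta> powr \<gamma> * (cmod (\<psi> \<eta>))\<^sup>2 \<le> K * (D * decay \<eta>) * B" for \<eta>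
  proof -
    have "jbracket \<eta> powr \<gamma> * (cmod (\<psi> \<eta>))\<^sup>2 \<le> (K * (1 + norm \<eta>) ^ N) * (cmod (\<psi> \<eta>))\<^sup>2"
      by (intro mult_right_mono K) auto
    also have "\<dots> = K * ((1 + norm \<eta>) ^ N * cmod (\<psi> \<eta>)) * cmod (\<psi> \<eta>)" by (simp add: power2_eq_square)
    also have "\<dots> \<le> K * (D * decay \<eta>) * B"
      using K(1) D(1) less_imp_le[OF decay_pos[of \<eta>]] by (intro mult_mono mult_left_mono D B) auto
    finally show ?thesis .
  qed
  then have le: "norm (jbracket \<eta> powr \<gamma> * (cmod (\<psi> \<eta>))\<^sup>2) \<le> norm (K * (D * decay \<eta>) * B)" for \<eta>
    by (simp add: order_trans[OF _ abs_ge_self])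
  have "integrable lborel (\<lambda>\<eta>::'a. K * (D * decay \<eta>) * B)"
    by (intro integrable_mult_left integrable_mult_right integrable_decay)
  then show ?thesis by (rule Bochner_Integration.integrable_bound[OF _ _ AE_I2[OF le]]) measurable
qed

lemma fourier_add:
  fixes f g :: "'a::euclidean_space \<Rightarrow> complex"
  assumes "f \<in> schwartz" "g \<in> schwartz"
  shows "fourier (\<lambda>x. f x + g x) = (\<lambda>y. fourier f y + fourier g y)"
proof
  fix y :: 'a
  have i: "integrable lborel (\<lambda>\<eta>. f \<eta> * cis (- (\<eta> \<bullet> y)))" if "f \<in> schwartz" for f :: "'a \<Rightarrow> complex"
    by (rule integrable_cis[OF schwartz_integrable[OF that]]) simp
  show "fourier (\<lambda>x. f x + g x) y = fourier f y + fourier g y"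
    unfolding fourier_def distrib_right by (rule Bochner_Integration.integral_add[OF i[OF assms(1)] i[OF assms(2)]])
qed

lemma fourier_cmult: "fourier (\<lambda>x. c * f x) = (\<lambda>y. c * fourier f y)"
  unfolding fourier_def by (simp add: mult.assoc)

lemma fourier_sum:
  fixes f :: "'i \<Rightarrow> 'a::euclidean_space \<Rightarrow> complex"
  assumes "\<And>i. i \<in> I \<Longrightarrow> f i \<in> schwartz" "finite I"
  shows "fourier (\<lambda>x. \<Sum>i\<in>I. f i x) = (\<lambda>y. \<Sum>i\<in>I. fourier (f i) y)"
proof
  fix y :: 'a
  have i: "integrable lborel (\<lambda>\<eta>. f i \<eta> * cis (- (\<eta> \<bullet> y)))" if "i \<in> I" for i
    by (rule integrable_cis[OF schwartz_integrable[OF assms(1)[OF that]]]) simp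
  show "fourier (\<lambda>x. \<Sum>i\<in>I. f i x) y = (\<Sum>i\<in>I. fourier (f i) y)"
    unfolding fourier_def sum_distrib_right by (rule Bochner_Integration.integral_sum[OF i])
qed

lemma test_fun_add: "f \<in> test_fun \<Longrightarrow> g \<in> test_fun \<Longrightarrow> (\<lambda>x. f x + g x) \<in> test_fun"
proof -
  assume f: "f \<in> test_fun" and g: "g \<in> test_fun"
  obtain S T where "\<And>x. norm x > S \<Longrightarrow> f x = 0" "\<And>x. norm x > T \<Longrightarrow> g x = 0"
    using f g unfolding test_fun_def by blast
  then have "\<forall>x. norm x > max S T \<longrightarrow> f x + g x = 0" by simp
  then show ?thesis using f g schwartz_add unfolding test_fun_def by blast
qed

lemma test_fun_cmult: "f \<in> test_fun \<Longrightarrow> (\<lambda>x. c * f x) \<in> test_fun"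
  unfolding test_fun_def using schwartz_cmult by fastforce

lemma test_fun_mult_smooth: "f \<in> test_fun \<Longrightarrow> smooth g \<Longrightarrow> (\<lambda>x. f x * g x) \<in> test_fun"
proof -
  assume f: "f \<in> test_fun" and g: "smooth g"
  obtain T where T: "\<And>x. norm x > T \<Longrightarrow> f x = 0" using f unfolding test_fun_def by blast
  show ?thesis
    by (rule test_funI[where T=T]) (use T f g in \<open>auto intro: smooth_mult schwartz_smooth test_fun_schwartz\<close>)
qed

text \<open>The lattice is exhausted by finite balls, so this is monotone convergence.\<close>

lemma count_space_lattice_le:
  fixes f :: "'a::euclidean_space \<Rightarrow> ennreal"
  assumes "\<And>J. finite J \<Longrightarrow> J \<subseteq> int_lattice \<Longrightarrow> (\<Sum>j\<in>J. f j) \<le> B"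
  shows "(\<integral>\<^sup>+j. f j \<partial>count_space int_lattice) \<le> B"
proof -
  let ?f = "\<lambda>n j. f j * indicator (lattice_ball 1 n) j"
  have "(\<integral>\<^sup>+j. f j \<partial>count_space int_lattice) = (\<integral>\<^sup>+j. (SUP n. ?f n j) \<partial>count_space int_lattice)"
  proof (rule nn_integral_cong)
    fix j :: 'a assume "j \<in> space (count_space int_lattice)"
    then have j: "j \<in> int_lattice" by simp
    obtain n where "norm j \<le> real n" using real_arch_simple by blast
    then have "j \<in> lattice_ball 1 n" using j by (simp add: lattice_ball_def)
    then have "f j \<le> (SUP n. ?f n j)" by (intro SUP_upper2[of n]) auto
    moreover have "(SUP n. ?f n j) \<le> f j" by (rule SUP_least) (auto simp: indicator_def)
    ultimately show "f j = (SUP n. ?f n j)" by (rule antisym)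
  qed
  also have "\<dots> = (SUP n. \<integral>\<^sup>+j. ?f n j \<partial>count_space int_lattice)"
    by (rule nn_integral_monotone_convergence_SUP)
       (auto simp: incseq_def le_fun_def lattice_ball_def indicator_def)
  also have "\<dots> \<le> B"
  proof (rule SUP_least)
    fix n
    have fin: "finite (lattice_ball 1 n :: 'a set)" by (rule finite_lattice_ball) simp
    have "(\<integral>\<^sup>+j. ?f n j \<partial>count_space int_lattice) = (\<Sum>j\<in>lattice_ball 1 n. ?f n j)"
      by (rule nn_integral_count_space'[OF fin _ lattice_ball_subset]) simp
    also have "\<dots> = (\<Sum>j\<in>lattice_ball 1 n. f j)" by (intro sum.cong refl) simp
    also have "\<dots> \<le> B" by (rule assms[OF fin lattice_ball_subset])
    finally show "(\<integral>\<^sup>+j. ?f n j \<partial>count_space int_lattice) \<le> B" .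
  qed
  finally show ?thesis .
qed

lemma sum_le_count_space:
  fixes f :: "'i \<Rightarrow> ennreal"
  assumes "finite J" "J \<subseteq> A"
  shows "(\<Sum>j\<in>J. f j) \<le> (\<integral>\<^sup>+j. f j \<partial>count_space A)"
proof -
  have "(\<Sum>j\<in>J. f j) = (\<Sum>j\<in>J. f j * indicator J j)" by (intro sum.cong refl) simp
  also have "\<dots> = (\<integral>\<^sup>+j. f j * indicator J j \<partial>count_space A)"
    by (rule nn_integral_count_space'[symmetric, OF assms(1) _ assms(2)]) simp
  also have "\<dots> \<le> (\<integral>\<^sup>+j. f j \<partial>count_space A)"
    by (intro nn_integral_mono) (auto simp: indicator_def)
  finally show ?thesis .
qed

section \<open>The frame inequalities\<close>

context packet_frame
begin

definition square_sum :: "'a dist \<Rightarrow> nat \<Rightarrow> ennreal" where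
  "square_sum u k = (\<integral>\<^sup>+j. ennreal ((cmod (coef u k j))\<^sup>2) \<partial>count_space int_lattice)"

text \<open>The square of the modulation norm of order \<open>\<gamma> / 2\<close>, see \<open>modulation_norm_energy\<close>.\<close>

definition energy :: "real \<Rightarrow> 'a dist \<Rightarrow> ennreal" where
  "energy \<gamma> u = (\<integral>\<^sup>+k. square_sum u k * ennreal (weight \<gamma> k) \<partial>count_space UNIV)"

lemma jb_borel [measurable]: "(jbracket :: 'a \<Rightarrow> real) \<in> borel_measurable borel"
  by (rule borel_measurable_continuous_onI[OF jbracket_continuous])

text \<open>Bessel's inequality on each cell, summed over \<open>k\<close> by means of the square function.\<close>

theorem energy_le:
  "\<exists>C>0. \<forall>u g. u \<in> tempered \<longrightarrow> fourier_dist u = fun_dist g \<longrightarrow> g \<in> borel_measurable borel \<longrightarrow>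
     integrable lborel (\<lambda>\<eta>. jbracket \<eta> powr \<gamma> * (cmod (g \<eta>))\<^sup>2) \<longrightarrow>
     energy \<gamma> u \<le> ennreal (C * (LINT \<eta>|lborel. jbracket \<eta> powr \<gamma> * (cmod (g \<eta>))\<^sup>2))"
proof -
  obtain C\<^sub>2 where C2: "C\<^sub>2 > 0" "\<And>\<eta>. square_fun \<gamma> \<eta> \<le> C\<^sub>2 * jbracket \<eta> powr \<gamma>" using square_fun_bounds[of \<gamma>] by blast
  define D where "D = (2 * pi / (b * \<rho>)) ^ DIM('a) / (cmod c)\<^sup>2"
  have D: "D > 0" unfolding D_def using b\<rho> c_nz by (intro divide_pos_pos zero_less_power) auto
  have "energy \<gamma> u \<le> ennreal (D * C\<^sub>2 * (LINT \<eta>|lborel. jbracket \<eta> powr \<gamma> * (cmod (g \<eta>))\<^sup>2))"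
    if u: "u \<in> tempered" and g: "fourier_dist u = fun_dist g" and gm [measurable]: "g \<in> borel_measurable borel"
      and gi: "integrable lborel (\<lambda>\<eta>. jbracket \<eta> powr \<gamma> * (cmod (g \<eta>))\<^sup>2)" for u g
  proof -
    have w0: "0 \<le> weight \<gamma> k" for k using weight_pos[of \<gamma> k] by simp
    have single: "weight \<gamma> k * (cmod (bump k \<eta>))\<^sup>2 \<le> C\<^sub>2 * jbracket \<eta> powr \<gamma>" for k \<eta>
    proof -
      have "(\<Sum>k\<in>{k}. weight \<gamma> k * (cmod (bump k \<eta>))\<^sup>2) \<le> square_fun \<gamma> \<eta>"
        unfolding square_fun_def using w0 by (intro sum_le_suminf sums_summable[OF square_fun_sums]) auto
      then show ?thesis using C2(2)[of \<eta>] by simp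
    qed
    have l2: "l2on lborel (\<lambda>\<eta>. g \<eta> * bump k \<eta>)" for k
      unfolding l2on_def
    proof
      show "(\<lambda>\<eta>. g \<eta> * bump k \<eta>) \<in> borel_measurable lborel" by measurable
      have "(cmod (g \<eta> * bump k \<eta>))\<^sup>2 \<le> (C\<^sub>2 / weight \<gamma> k) * (jbracket \<eta> powr \<gamma> * (cmod (g \<eta>))\<^sup>2)" for \<eta>
      proof -
        have "(cmod (bump k \<eta>))\<^sup>2 \<le> C\<^sub>2 * jbracket \<eta> powr \<gamma> / weight \<gamma> k"
          using single[of k \<eta>] weight_pos[of \<gamma> k] by (simp add: pos_le_divide_eq mult.commute)
        then have "(cmod (g \<eta>))\<^sup>2 * (cmod (bump k \<eta>))\<^sup>2 \<le> (cmod (g \<eta>))\<^sup>2 * (C\<^sub>2 * jbracket \<eta> powr \<gamma> / weight \<gamma> k)"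
          by (intro mult_left_mono) auto
        then show ?thesis by (simp add: norm_mult power_mult_distrib ac_simps)
      qed
      then have le: "norm ((cmod (g \<eta> * bump k \<eta>))\<^sup>2) \<le> norm ((C\<^sub>2 / weight \<gamma> k) * (jbracket \<eta> powr \<gamma> * (cmod (g \<eta>))\<^sup>2))" for \<eta>
        by (simp only: real_norm_def abs_power2 order_trans[OF _ abs_ge_self])
      show "integrable lborel (\<lambda>\<eta>. (cmod (g \<eta> * bump k \<eta>))\<^sup>2)"
        by (rule Bochner_Integration.integrable_bound[OF integrable_mult_right[OF gi, of "C\<^sub>2 / weight \<gamma> k"] _ AE_I2[OF le]]) measurable
    qed
    have term_le: "square_sum u k * ennreal (weight \<gamma> k) \<le>
        (\<integral>\<^sup>+\<eta>. ennreal (D * (cmod (g \<eta>))\<^sup>2 * (weight \<gamma> k * (cmod (bump k \<eta>))\<^sup>2)) \<partial>lborel)" for k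
    proof -
      let ?I = "LINT \<eta>|lborel. (cmod (g \<eta> * bump k \<eta>))\<^sup>2"
      have "square_sum u k \<le> ennreal (D * ?I)"
        unfolding square_sum_def
      proof (rule count_space_lattice_le)
        fix J :: "'a set" assume J: "finite J" "J \<subseteq> int_lattice"
        have "(\<Sum>j\<in>J. ennreal ((cmod (coef u k j))\<^sup>2)) = ennreal (\<Sum>j\<in>J. (cmod (coef u k j))\<^sup>2)"
          by (rule sum_ennreal) simp
        also have "\<dots> \<le> ennreal (D * ?I)"
          unfolding D_def by (intro ennreal_leI coefficient_bessel u g l2 J)
        finally show "(\<Sum>j\<in>J. ennreal ((cmod (coef u k j))\<^sup>2)) \<le> ennreal (D * ?I)" .
      qed
      then have "square_sum u k * ennreal (weight \<gamma> k) \<le> ennreal (D * ?I) * ennreal (weight \<gamma> k)"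
        by (rule mult_right_mono) simp
      also have "\<dots> = ennreal (LINT \<eta>|lborel. D * weight \<gamma> k * (cmod (g \<eta> * bump k \<eta>))\<^sup>2)"
        using D w0 by (simp add: ennreal_mult''[symmetric] ac_simps)
      also have "\<dots> = (\<integral>\<^sup>+\<eta>. ennreal (D * weight \<gamma> k * (cmod (g \<eta> * bump k \<eta>))\<^sup>2) \<partial>lborel)"
        using l2[of k] D w0 unfolding l2on_def
        by (intro nn_integral_eq_integral[symmetric] integrable_mult_right) auto
      finally show ?thesis by (simp add: norm_mult power_mult_distrib ac_simps)
    qed
    have "energy \<gamma> u = (\<Sum>k. square_sum u k * ennreal (weight \<gamma> k))"
      unfolding energy_def by (rule nn_integral_count_space_nat)
    also have "\<dots> \<le> (\<Sum>k. \<integral>\<^sup>+\<eta>. ennreal (D * (cmod (g \<eta>))\<^sup>2 * (weight \<gamma> k * (cmod (bump k \<eta>))\<^sup>2)) \<partial>lborel)"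
      by (intro suminf_le term_le summableI)
    also have "\<dots> = (\<integral>\<^sup>+\<eta>. (\<Sum>k. ennreal (D * (cmod (g \<eta>))\<^sup>2 * (weight \<gamma> k * (cmod (bump k \<eta>))\<^sup>2))) \<partial>lborel)"
      by (rule nn_integral_suminf[symmetric]) measurable
    also have "\<dots> \<le> (\<integral>\<^sup>+\<eta>. ennreal (D * C\<^sub>2 * (jbracket \<eta> powr \<gamma> * (cmod (g \<eta>))\<^sup>2)) \<partial>lborel)"
    proof (rule nn_integral_mono)
      fix \<eta>
      have "(\<Sum>k. ennreal (D * (cmod (g \<eta>))\<^sup>2 * (weight \<gamma> k * (cmod (bump k \<eta>))\<^sup>2))) = ennreal (D * (cmod (g \<eta>))\<^sup>2 * square_fun \<gamma> \<eta>)"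
        using D w0 by (intro suminf_ennreal_eq sums_mult square_fun_sums) auto
      also have "\<dots> \<le> ennreal (D * (cmod (g \<eta>))\<^sup>2 * (C\<^sub>2 * jbracket \<eta> powr \<gamma>))"
        using D by (intro ennreal_leI mult_left_mono C2) auto
      finally show "(\<Sum>k. ennreal (D * (cmod (g \<eta>))\<^sup>2 * (weight \<gamma> k * (cmod (bump k \<eta>))\<^sup>2))) \<le>
          ennreal (D * C\<^sub>2 * (jbracket \<eta> powr \<gamma> * (cmod (g \<eta>))\<^sup>2))" by (simp add: ac_simps)
    qed
    also have "\<dots> = ennreal (LINT \<eta>|lborel. D * C\<^sub>2 * (jbracket \<eta> powr \<gamma> * (cmod (g \<eta>))\<^sup>2))"
      using gi D C2(1) by (intro nn_integral_eq_integral integrable_mult_right) auto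
    finally show ?thesis by simp
  qed
  moreover have "D * C\<^sub>2 > 0" using D C2 by simp
  ultimately show ?thesis by blast
qed

text \<open>A test function is written as \<open>\<psi> = (\<Sum>k. weight k * bump k * bump k) * (\<psi> / square_fun)\<close>. Each summand is estimated on its
  cell, and two applications of the Cauchy-Schwarz inequality, to the coefficients and to the sum over \<open>k\<close>,
  reassemble the weighted norms.\<close>

theorem test_fun_bound:
  "\<exists>C>0. \<forall>u \<psi>. u \<in> tempered \<longrightarrow> energy \<gamma> u < \<infinity> \<longrightarrow> \<psi> \<in> test_fun \<longrightarrow>
     cmod (u (fourier \<psi>)) \<le> C * sqrt (enn2real (energy \<gamma> u)) * sqrt (LINT \<eta>|lborel. (cmod (\<psi> \<eta>))\<^sup>2 / jbracket \<eta> powr \<gamma>)"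
proof -
  obtain C\<^sub>1 where C1: "C\<^sub>1 > 0" "\<And>\<eta>. C\<^sub>1 * jbracket \<eta> powr \<gamma> \<le> square_fun \<gamma> \<eta>" using square_fun_bounds[of \<gamma>] by blast
  define D where "D = cmod c * sqrt ((b * \<rho> / (2 * pi)) ^ DIM('a))"
  have D: "D > 0" unfolding D_def using c_nz b\<rho> by simp
  have "cmod (u (fourier \<psi>)) \<le> (D * sqrt (1 / C\<^sub>1)) * sqrt (enn2real (energy \<gamma> u)) * sqrt (LINT \<eta>|lborel. (cmod (\<psi> \<eta>))\<^sup>2 / jbracket \<eta> powr \<gamma>)"
    if u: "u \<in> tempered" and fin: "energy \<gamma> u < \<infinity>" and \<psi>: "\<psi> \<in> test_fun" for u \<psi>
  proof -
    have w0: "0 \<le> weight \<gamma> k" for k using weight_pos[of \<gamma> k] by simp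
    have part: "(\<Sum>k\<in>K. square_sum u k * ennreal (weight \<gamma> k)) \<le> energy \<gamma> u" if "finite K" for K
      unfolding energy_def by (rule sum_le_count_space[OF that]) simp
    have sfin: "square_sum u k < \<infinity>" for k
    proof -
      have "square_sum u k * ennreal (weight \<gamma> k) < \<infinity>"
        using part[of "{k}"] fin by (auto intro: le_less_trans)
      then show ?thesis using weight_pos[of \<gamma> k] by (auto simp: ennreal_mult_less_top)
    qed
    define S where "S k = enn2real (square_sum u k)" for k
    have S0: "0 \<le> S k" for k by (simp add: S_def)
    have Se: "square_sum u k = ennreal (S k)" for k using sfin[of k] by (simp add: S_def)
    have Sb: "(\<Sum>j\<in>J. (cmod (coef u k j))\<^sup>2) \<le> S k" if "finite J" "J \<subseteq> int_lattice" for J k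
    proof -
      have "ennreal (\<Sum>j\<in>J. (cmod (coef u k j))\<^sup>2) = (\<Sum>j\<in>J. ennreal ((cmod (coef u k j))\<^sup>2))"
        by (rule sum_ennreal[symmetric]) simp
      also have "\<dots> \<le> square_sum u k" unfolding square_sum_def by (rule sum_le_count_space[OF that])
      finally show ?thesis unfolding Se using S0 by (simp add: ennreal_le_iff)
    qed
    obtain T where \<psi>s: "\<psi> \<in> schwartz" and T: "\<And>\<eta>. norm \<eta> > T \<Longrightarrow> \<psi> \<eta> = 0" using \<psi> unfolding test_fun_def by blast
    obtain K where K: "finite K" "\<And>\<eta> k. norm \<eta> \<le> T \<Longrightarrow> bump k \<eta> \<noteq> 0 \<Longrightarrow> k \<in> K" using locally_finite by blast
    \<comment> \<open>K collects the bumps that meet the support of \<psi>, so the sum over K is the full square function there.\<close>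
    define \<theta> where "\<theta> \<eta> = \<psi> \<eta> * inverse (complex_of_real (square_fun \<gamma> \<eta>))" for \<eta>
    have Gnz: "complex_of_real (square_fun \<gamma> \<eta>) \<noteq> 0" for \<eta> using square_fun_pos[of \<gamma> \<eta>] by simp
    have \<theta>: "\<theta> \<in> schwartz"
      unfolding \<theta>_def[abs_def]
      by (intro test_fun_schwartz test_fun_mult_smooth[OF \<psi>] smooth_inverse square_fun_smooth Gnz)
    have [measurable]: "\<theta> \<in> borel_measurable borel" "\<psi> \<in> borel_measurable borel"
      using schwartz_borel \<theta> \<psi>s by auto
    have Gsum: "square_fun \<gamma> \<eta> = (\<Sum>k\<in>K. weight \<gamma> k * (cmod (bump k \<eta>))\<^sup>2)" if "norm \<eta> \<le> T" for \<eta>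
      using K that by (intro square_fun_eq_sum) auto
    define h where "h k \<eta> = bump k \<eta> * \<theta> \<eta>" for k \<eta>
    have hs: "h k \<in> schwartz" for k unfolding h_def[abs_def] by (rule schwartz_mult[OF bump_schwartz \<theta>])
    have hz: "h k \<eta> = 0" if "\<eta> \<notin> supp k" for k \<eta> unfolding h_def using bump_zero[OF that] by simp
    have bh: "(\<lambda>\<eta>. bump k \<eta> * h k \<eta>) \<in> schwartz" for k by (rule schwartz_mult[OF bump_schwartz hs])
    have dec: "\<psi> = (\<lambda>\<eta>. \<Sum>k\<in>K. of_real (weight \<gamma> k) * (bump k \<eta> * h k \<eta>))"
    proof
      fix \<eta>
      show "\<psi> \<eta> = (\<Sum>k\<in>K. of_real (weight \<gamma> k) * (bump k \<eta> * h k \<eta>))"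
      proof (cases "norm \<eta> \<le> T")
        case True
        have "(\<Sum>k\<in>K. of_real (weight \<gamma> k) * (bump k \<eta> * h k \<eta>)) = (\<Sum>k\<in>K. of_real (weight \<gamma> k * (cmod (bump k \<eta>))\<^sup>2) * \<theta> \<eta>)"
          unfolding h_def mult.assoc[symmetric] by (simp add: mult.assoc bump_square[symmetric] del: of_real_power)
        also have "\<dots> = of_real (square_fun \<gamma> \<eta>) * \<theta> \<eta>" unfolding Gsum[OF True] of_real_sum sum_distrib_right ..
        also have "\<dots> = \<psi> \<eta>" unfolding \<theta>_def using Gnz[of \<eta>] by simp
        finally show ?thesis by simp
      next
        case False
        then show ?thesis using T[of \<eta>] by (simp add: h_def \<theta>_def)
      qed
    qed
    have "u (fourier \<psi>) = (\<Sum>k\<in>K. of_real (weight \<gamma> k) * u (fourier (\<lambda>\<eta>. bump k \<eta> * h k \<eta>)))"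
    proof -
      have s: "(\<lambda>\<eta>. of_real (weight \<gamma> k) * (bump k \<eta> * h k \<eta>)) \<in> schwartz" for k by (rule schwartz_cmult[OF bh])
      have s': "(\<lambda>y. of_real (weight \<gamma> k) * fourier (\<lambda>\<eta>. bump k \<eta> * h k \<eta>) y) \<in> schwartz" for k
        by (rule schwartz_cmult[OF schwartz_fourier[OF bh]])
      have "fourier \<psi> = (\<lambda>y. \<Sum>k\<in>K. of_real (weight \<gamma> k) * fourier (\<lambda>\<eta>. bump k \<eta> * h k \<eta>) y)"
        by (subst dec, subst fourier_sum[OF s K(1)], subst fourier_cmult) (rule refl)
      then have "u (fourier \<psi>) = u (\<lambda>y. \<Sum>k\<in>K. of_real (weight \<gamma> k) * fourier (\<lambda>\<eta>. bump k \<eta> * h k \<eta>) y)" by (rule arg_cong)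
      also have "\<dots> = (\<Sum>k\<in>K. u (\<lambda>y. of_real (weight \<gamma> k) * fourier (\<lambda>\<eta>. bump k \<eta> * h k \<eta>) y))"
        by (rule tempered_sum[OF u s' K(1), THEN conjunct1])
      finally show ?thesis by (simp only: temperedD(2)[OF u schwartz_fourier[OF bh]])
    qed
    also have "cmod \<dots> \<le> (\<Sum>k\<in>K. weight \<gamma> k * (D * sqrt (S k) * nrm lborel (h k)))"
    proof (rule sum_norm_le)
      fix k
      have "cmod (u (fourier (\<lambda>\<eta>. bump k \<eta> * h k \<eta>))) \<le> D * sqrt (S k) * nrm lborel (h k)"
        unfolding D_def by (rule localized_bound[OF u hs hz Sb])
      then show "cmod (of_real (weight \<gamma> k) * u (fourier (\<lambda>\<eta>. bump k \<eta> * h k \<eta>))) \<le> weight \<gamma> k * (D * sqrt (S k) * nrm lborel (h k))"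
        using w0[of k] by (simp add: norm_mult mult_left_mono)
    qed
    also have "\<dots> = D * (\<Sum>k\<in>K. \<bar>sqrt (weight \<gamma> k * S k)\<bar> * \<bar>sqrt (weight \<gamma> k) * nrm lborel (h k)\<bar>)"
    proof -
      have "weight \<gamma> k * (D * sqrt (S k) * nrm lborel (h k)) =
          D * (\<bar>sqrt (weight \<gamma> k * S k)\<bar> * \<bar>sqrt (weight \<gamma> k) * nrm lborel (h k)\<bar>)" for k
      proof -
        have a: "\<bar>sqrt (weight \<gamma> k * S k)\<bar> = sqrt (weight \<gamma> k) * sqrt (S k)"
          "\<bar>sqrt (weight \<gamma> k) * nrm lborel (h k)\<bar> = sqrt (weight \<gamma> k) * nrm lborel (h k)"
          using w0 S0 by (simp_all add: real_sqrt_mult)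
        have "sqrt (weight \<gamma> k) * sqrt (weight \<gamma> k) = weight \<gamma> k" using w0[of k] by simp
        moreover have "D * (q * s * (q * n)) = (q * q) * (D * s * n)" for q s n by (simp add: ac_simps)
        ultimately show ?thesis unfolding a by simp
      qed
      then show ?thesis unfolding sum_distrib_left by (intro sum.cong refl)
    qed
    also have "\<dots> \<le> D * (sqrt (enn2real (energy \<gamma> u)) * sqrt ((1 / C\<^sub>1) * (LINT \<eta>|lborel. (cmod (\<psi> \<eta>))\<^sup>2 / jbracket \<eta> powr \<gamma>)))"
    proof (intro mult_left_mono order_trans[OF sum_mult_le_sqrt] mult_mono real_sqrt_le_mono)
      have "ennreal (\<Sum>k\<in>K. weight \<gamma> k * S k) = (\<Sum>k\<in>K. square_sum u k * ennreal (weight \<gamma> k))"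
        unfolding Se using w0 S0 by (subst sum_ennreal[symmetric]) (auto simp: ennreal_mult'' mult.commute)
      also have "\<dots> \<le> energy \<gamma> u" by (rule part[OF K(1)])
      also have "\<dots> = ennreal (enn2real (energy \<gamma> u))" using fin by simp
      finally have "(\<Sum>k\<in>K. weight \<gamma> k * S k) \<le> enn2real (energy \<gamma> u)" by (simp add: ennreal_le_iff)
      then show "(\<Sum>k\<in>K. (sqrt (weight \<gamma> k * S k))\<^sup>2) \<le> enn2real (energy \<gamma> u)" using w0 S0 by simp
      have ih: "integrable lborel (\<lambda>\<eta>. weight \<gamma> k * (cmod (h k \<eta>))\<^sup>2)" for k
        by (intro integrable_mult_right schwartz_square_integrable(2)[OF hs hs])
      have "(\<Sum>k\<in>K. (sqrt (weight \<gamma> k) * nrm lborel (h k))\<^sup>2) = (\<Sum>k\<in>K. LINT \<eta>|lborel. weight \<gamma> k * (cmod (h k \<eta>))\<^sup>2)"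
        using w0 by (simp add: power_mult_distrib nrm_square)
      also have "\<dots> = (LINT \<eta>|lborel. (\<Sum>k\<in>K. weight \<gamma> k * (cmod (h k \<eta>))\<^sup>2))"
        by (rule Bochner_Integration.integral_sum[symmetric, OF ih])
      also have "\<dots> \<le> (LINT \<eta>|lborel. (1 / C\<^sub>1) * ((cmod (\<psi> \<eta>))\<^sup>2 / jbracket \<eta> powr \<gamma>))"
      proof (rule integral_mono)
        show "integrable lborel (\<lambda>\<eta>. \<Sum>k\<in>K. weight \<gamma> k * (cmod (h k \<eta>))\<^sup>2)"
          by (intro Bochner_Integration.integrable_sum ih)
        have "(cmod (\<psi> \<eta>))\<^sup>2 / jbracket \<eta> powr \<gamma> = jbracket \<eta> powr (- \<gamma>) * (cmod (\<psi> \<eta>))\<^sup>2" for \<eta>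
          by (simp add: powr_minus divide_inverse)
        then show "integrable lborel (\<lambda>\<eta>. (1 / C\<^sub>1) * ((cmod (\<psi> \<eta>))\<^sup>2 / jbracket \<eta> powr \<gamma>))"
          using integrable_mult_right[OF schwartz_weighted_integrable[OF \<psi>s, of "- \<gamma>"], of "1 / C\<^sub>1"] by (simp only:)
        fix \<eta>
        show "(\<Sum>k\<in>K. weight \<gamma> k * (cmod (h k \<eta>))\<^sup>2) \<le> (1 / C\<^sub>1) * ((cmod (\<psi> \<eta>))\<^sup>2 / jbracket \<eta> powr \<gamma>)"
        proof (cases "norm \<eta> \<le> T")
          case True
          have jp: "0 < jbracket \<eta> powr \<gamma>" using jbracket_pos[of \<eta>] by simp
          have gp: "0 < square_fun \<gamma> \<eta>" by (rule square_fun_pos)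
          have "(\<Sum>k\<in>K. weight \<gamma> k * (cmod (h k \<eta>))\<^sup>2) = square_fun \<gamma> \<eta> * (cmod (\<theta> \<eta>))\<^sup>2"
            unfolding Gsum[OF True] sum_distrib_right h_def by (simp add: norm_mult power_mult_distrib mult.assoc)
          also have "\<dots> = (cmod (\<psi> \<eta>))\<^sup>2 / square_fun \<gamma> \<eta>"
          proof -
            have "cmod (\<theta> \<eta>) = cmod (\<psi> \<eta>) / square_fun \<gamma> \<eta>"
              using gp by (simp add: \<theta>_def norm_mult norm_inverse norm_divide divide_inverse mult.commute)
            then show ?thesis using gp by (simp add: power2_eq_square)
          qed
          also have "\<dots> \<le> (cmod (\<psi> \<eta>))\<^sup>2 / (C\<^sub>1 * jbracket \<eta> powr \<gamma>)"
            using C1 jp gp by (intro divide_left_mono mult_pos_pos) auto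
          finally show ?thesis by simp
        next
          case False
          then have "h k \<eta> = 0" for k using T[of \<eta>] by (simp add: h_def \<theta>_def)
          then show ?thesis using C1(1) by simp
        qed
      qed
      finally show "(\<Sum>k\<in>K. (sqrt (weight \<gamma> k) * nrm lborel (h k))\<^sup>2) \<le> (1 / C\<^sub>1) * (LINT \<eta>|lborel. (cmod (\<psi> \<eta>))\<^sup>2 / jbracket \<eta> powr \<gamma>)"
        by (simp only: integral_mult_right_zero)
      show "0 \<le> sqrt (enn2real (energy \<gamma> u))" by simp
      show "0 \<le> sqrt (\<Sum>k\<in>K. (sqrt (weight \<gamma> k) * nrm lborel (h k))\<^sup>2)" by (intro real_sqrt_ge_zero sum_nonneg) simp
      show "0 \<le> D" using D by simp
    qed
    finally show ?thesis by (simp only: real_sqrt_mult ac_simps)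
  qed
  moreover have "D * sqrt (1 / C\<^sub>1) > 0" using D C1(1) by simp
  ultimately show ?thesis by blast
qed

text \<open>The transform of the window is real and has bounded support, so its square can be normalised.\<close>

lemma mollifier_exists: "\<exists>\<kappa> :: 'a \<Rightarrow> complex. mollifier \<kappa>"
proof -
  let ?F = "\<lambda>\<zeta>. fourier \<phi> \<zeta> * fourier \<phi> \<zeta>"
  have fs: "fourier \<phi> \<in> schwartz" by (rule schwartz_fourier[OF phi])
  have f0: "fourier \<phi> \<zeta> = 0" if "norm \<zeta> > R\<^sub>1" for \<zeta>
    using phi_supp closure_subset[of "{\<zeta>. fourier \<phi> \<zeta> \<noteq> 0}"] that by (force simp: subset_iff)
  have ft: "fourier \<phi> \<in> test_fun" using fs f0 unfolding test_fun_def by blast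
  have Ft: "?F \<in> test_fun" by (rule test_fun_mult_smooth[OF ft schwartz_smooth[OF fs]])
  have F2: "?F \<zeta> = of_real ((cmod (fourier \<phi> \<zeta>))\<^sup>2)" for \<zeta>
    unfolding complex_norm_square by (simp add: fourier_phi_real)
  define I where "I = (LINT \<zeta>|lborel. (cmod (fourier \<phi> \<zeta>))\<^sup>2)"
  have nz: "fourier \<phi> 0 \<noteq> 0" using m0(1) m0(2)[of 0] R0 by auto
  have I: "I > 0" unfolding I_def
    by (rule continuous_square_integral_pos[OF smooth_continuous_on[OF schwartz_smooth[OF fs]]
          schwartz_square_integrable(2)[OF fs fs] nz])
  have "(LINT \<zeta>|lborel. ?F \<zeta>) = of_real I" unfolding F2 I_def by (simp only: integral_complex_of_real)
  then have "(LINT \<zeta>|lborel. (1 / of_real I) * ?F \<zeta>) = 1" using I by simp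
  then have "mollifier (\<lambda>\<zeta>. (1 / of_real I) * ?F \<zeta>)"
    unfolding mollifier_def using test_fun_cmult[OF Ft] by blast
  then show ?thesis by blast
qed

text \<open>The transform of the window does not vanish at \<open>0\<close> and can be normalised there.\<close>

lemma cutoff_exists: "\<exists>cut :: 'a \<Rightarrow> complex. cut \<in> test_fun \<and> cut 0 = 1"
proof -
  have fs: "fourier \<phi> \<in> schwartz" by (rule schwartz_fourier[OF phi])
  have f0: "fourier \<phi> \<zeta> = 0" if "norm \<zeta> > R\<^sub>1" for \<zeta>
    using phi_supp closure_subset[of "{\<zeta>. fourier \<phi> \<zeta> \<noteq> 0}"] that by (force simp: subset_iff)
  have ft: "fourier \<phi> \<in> test_fun" using fs f0 unfolding test_fun_def by blast
  have nz: "fourier \<phi> 0 \<noteq> 0" using m0(1) m0(2)[of 0] R0 by auto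
  show ?thesis
    by (rule exI[of _ "\<lambda>\<zeta>. (1 / fourier \<phi> 0) * fourier \<phi> \<zeta>"], intro conjI test_fun_cmult[OF ft]) (simp add: nz)
qed

text \<open>Finite energy makes the Fourier transform a weighted square integrable function: the Riesz
  representation gives a density on test functions, and cut-offs extend the formula to all
  Schwartz functions.\<close>

theorem density_exists:
  assumes u: "u \<in> tempered" and fin: "energy \<gamma> u < \<infinity>"
  shows "\<exists>g \<in> borel_measurable borel. integrable lborel (\<lambda>\<eta>. jbracket \<eta> powr \<gamma> * (cmod (g \<eta>))\<^sup>2) \<and>
    fourier_dist u = fun_dist g"
proof -
  let ?w = "\<lambda>\<eta>::'a. jbracket \<eta> powr (- \<gamma>)"
  \<comment> \<open>The norm on the right of test_fun_bound is the norm of the measure M, and a density h with respect to M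
    becomes g = ?w * h with respect to Lebesgue measure.\<close>
  define M where "M = density lborel (\<lambda>\<eta>. ennreal (?w \<eta>))"
  have wp: "0 < ?w \<eta>" for \<eta> using jbracket_pos[of \<eta>] by simp
  have inv: "1 / jbracket \<eta> powr \<gamma> = ?w \<eta>" for \<eta> by (simp add: powr_minus divide_inverse)
  have Mm: "f \<in> borel_measurable M \<longleftrightarrow> f \<in> borel_measurable borel" for f :: "'a \<Rightarrow> 'x::topological_space"
    by (simp add: M_def)
  have Mi: "integrable M f \<longleftrightarrow> integrable lborel (\<lambda>\<eta>. ?w \<eta> *\<^sub>R f \<eta>)"
    if "f \<in> borel_measurable borel" for f :: "'a \<Rightarrow> 'x::{banach, second_countable_topology}"
    unfolding M_def using that by (intro integrable_density) auto
  have MI: "(LINT \<eta>|M. f \<eta>) = (LINT \<eta>|lborel. ?w \<eta> *\<^sub>R f \<eta>)"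
    if "f \<in> borel_measurable borel" for f :: "'a \<Rightarrow> 'x::{banach, second_countable_topology}"
    unfolding M_def using that by (intro integral_density) auto
  have sq: "(cmod (\<psi> \<eta>))\<^sup>2 / jbracket \<eta> powr \<gamma> = ?w \<eta> *\<^sub>R (cmod (\<psi> \<eta>))\<^sup>2" for \<psi> and \<eta> :: 'a
    by (simp add: powr_minus divide_inverse)
  have l2: "l2on M \<psi>" if "\<psi> \<in> schwartz" for \<psi>
  proof -
    have [measurable]: "\<psi> \<in> borel_measurable borel" by (rule schwartz_borel[OF that])
    show ?thesis unfolding l2on_def Mm
      using schwartz_weighted_integrable[OF that, of "- \<gamma>"] by (subst Mi) auto
  qed
  obtain C where C: "C > 0" "\<And>\<psi>. \<psi> \<in> test_fun \<Longrightarrow> cmod (u (fourier \<psi>)) \<le>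
      C * sqrt (enn2real (energy \<gamma> u)) * sqrt (LINT \<eta>|lborel. (cmod (\<psi> \<eta>))\<^sup>2 / jbracket \<eta> powr \<gamma>)"
    using test_fun_bound[of \<gamma>] u fin by blast
  obtain cut :: "'a \<Rightarrow> complex" where chi: "cut \<in> test_fun" "cut 0 = 1" using cutoff_exists by blast
  have tn: "test_fun \<noteq> ({} :: ('a \<Rightarrow> complex) set)" using chi by blast
  have "\<exists>h. l2on M h \<and> (\<forall>\<psi>\<in>test_fun. u (fourier \<psi>) = (LINT x|M. \<psi> x * h x))"
  proof (rule riesz_L2[where C="C * sqrt (enn2real (energy \<gamma> u))"])
    fix \<psi> :: "'a \<Rightarrow> complex" assume \<psi>: "\<psi> \<in> test_fun"
    then have [measurable]: "\<psi> \<in> borel_measurable borel" by (intro schwartz_borel test_fun_schwartz)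
    show "l2on M \<psi>" by (rule l2[OF test_fun_schwartz[OF \<psi>]])
    have "nrm M \<psi> = sqrt (LINT \<eta>|lborel. (cmod (\<psi> \<eta>))\<^sup>2 / jbracket \<eta> powr \<gamma>)"
      unfolding nrm_def sq by (subst MI) auto
    then show "cmod (u (fourier \<psi>)) \<le> C * sqrt (enn2real (energy \<gamma> u)) * nrm M \<psi>" using C(2)[OF \<psi>] by simp
    show "u (fourier (\<lambda>x. k * \<psi> x)) = k * u (fourier \<psi>)" for k
      unfolding fourier_cmult by (rule temperedD(2)[OF u schwartz_fourier[OF test_fun_schwartz[OF \<psi>]]])
    show "u (fourier (\<lambda>x. \<psi> x + \<psi>' x)) = u (fourier \<psi>) + u (fourier \<psi>')" if "\<psi>' \<in> test_fun" for \<psi>'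
      unfolding fourier_add[OF test_fun_schwartz[OF \<psi>] test_fun_schwartz[OF that]]
      by (rule temperedD(1)[OF u]) (intro schwartz_fourier test_fun_schwartz \<psi> that)+
  qed (use tn in \<open>auto intro: test_fun_add test_fun_cmult\<close>)
  then obtain h where h: "l2on M h" and hu: "\<And>\<psi>. \<psi> \<in> test_fun \<Longrightarrow> u (fourier \<psi>) = (LINT x|M. \<psi> x * h x)" by blast
  have hm [measurable]: "h \<in> borel_measurable borel" using h unfolding l2on_def Mm by blast
  define g where "g \<eta> = of_real (?w \<eta>) * h \<eta>" for \<eta>
  have gm [measurable]: "g \<in> borel_measurable borel" unfolding g_def[abs_def] by measurable
  have "integrable lborel (\<lambda>\<eta>. ?w \<eta> *\<^sub>R (cmod (h \<eta>))\<^sup>2)"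
    using h unfolding l2on_def by (subst (asm) Mi) auto
  moreover have "jbracket \<eta> powr \<gamma> * (cmod (g \<eta>))\<^sup>2 = ?w \<eta> *\<^sub>R (cmod (h \<eta>))\<^sup>2" for \<eta>
  proof -
    have "jbracket \<eta> powr \<gamma> * ?w \<eta> = 1" using jbracket_pos[of \<eta>] by (simp add: powr_minus)
    moreover have "(cmod (g \<eta>))\<^sup>2 = ?w \<eta> * ?w \<eta> * (cmod (h \<eta>))\<^sup>2"
      using wp[of \<eta>] unfolding g_def norm_mult norm_of_real by (simp add: power2_eq_square)
    ultimately show ?thesis by (simp add: mult.assoc[symmetric])
  qed
  ultimately have gi: "integrable lborel (\<lambda>\<eta>. jbracket \<eta> powr \<gamma> * (cmod (g \<eta>))\<^sup>2)" by simp
  have rep: "u (fourier \<psi>) = (LINT \<eta>|lborel. g \<eta> * \<psi> \<eta>)" if \<psi>: "\<psi> \<in> test_fun" for \<psi>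
  proof -
    have [measurable]: "\<psi> \<in> borel_measurable borel" using \<psi> by (intro schwartz_borel test_fun_schwartz)
    have "u (fourier \<psi>) = (LINT \<eta>|lborel. ?w \<eta> *\<^sub>R (\<psi> \<eta> * h \<eta>))" unfolding hu[OF \<psi>] by (rule MI) measurable
    then show ?thesis by (simp add: g_def scaleR_conv_of_real ac_simps)
  qed
  have "u (fourier \<psi>) = (LINT \<eta>|lborel. g \<eta> * \<psi> \<eta>)" if \<psi>: "\<psi> \<in> schwartz" for \<psi>
  proof -
    have [measurable]: "\<psi> \<in> borel_measurable borel" "cut \<in> borel_measurable borel"
      using \<psi> chi by (auto intro: schwartz_borel test_fun_schwartz)
    let ?X = "\<lambda>n \<eta>. cut ((1 / real (Suc n)) *\<^sub>R \<eta>)"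
    have pt: "(\<lambda>\<eta>. \<psi> \<eta> * ?X n \<eta>) \<in> test_fun" for n
    proof -
      have "?X n \<in> schwartz" using schwartz_affine[OF test_fun_schwartz[OF chi(1)], of "1 / real (Suc n)" 0] by simp
      then have s: "(\<lambda>\<eta>. \<psi> \<eta> * ?X n \<eta>) \<in> schwartz" by (rule schwartz_mult[OF \<psi>])
      obtain T where T: "\<And>x. norm x > T \<Longrightarrow> cut x = 0" using chi unfolding test_fun_def by blast
      have "\<psi> \<eta> * ?X n \<eta> = 0" if "norm \<eta> > real (Suc n) * T" for \<eta>
      proof -
        have "norm ((1 / real (Suc n)) *\<^sub>R \<eta>) > T"
          using that by (simp add: less_divide_eq mult.commute del: of_nat_Suc)
        then show ?thesis using T by simp
      qed
      then show ?thesis using s unfolding test_fun_def by blast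
    qed
    obtain B where B: "B > 0" "\<And>x. cmod (cut x) \<le> B" using schwartz_bounded[OF test_fun_schwartz[OF chi(1)]] by blast
    have igp: "integrable lborel (\<lambda>\<eta>. g \<eta> * \<psi> \<eta>)"
    proof -
      have "integrable M (\<lambda>\<eta>. \<psi> \<eta> * h \<eta>)" by (rule l2on_mult_integrable[OF l2[OF \<psi>] h])
      then have "integrable lborel (\<lambda>\<eta>. ?w \<eta> *\<^sub>R (\<psi> \<eta> * h \<eta>))" by (subst (asm) Mi) auto
      then show ?thesis by (simp add: g_def scaleR_conv_of_real ac_simps)
    qed
    have "(\<lambda>n. LINT \<eta>|lborel. g \<eta> * (\<psi> \<eta> * ?X n \<eta>)) \<longlonglongrightarrow> (LINT \<eta>|lborel. g \<eta> * \<psi> \<eta>)"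
    proof (rule integral_dominated_convergence[where w="\<lambda>\<eta>. cmod (g \<eta> * \<psi> \<eta>) * B"])
      show "integrable lborel (\<lambda>\<eta>. cmod (g \<eta> * \<psi> \<eta>) * B)" by (intro integrable_mult_left integrable_norm igp)
      show "AE \<eta> in lborel. (\<lambda>n. g \<eta> * (\<psi> \<eta> * ?X n \<eta>)) \<longlonglongrightarrow> g \<eta> * \<psi> \<eta>"
      proof (intro AE_I2)
        fix \<eta> :: 'a
        have "(\<lambda>n. (1 / real (Suc n)) *\<^sub>R \<eta>) \<longlonglongrightarrow> 0"
          using tendsto_scaleR[OF LIMSEQ_Suc[OF lim_1_over_n] tendsto_const[of \<eta>]] by simp
        moreover have "isCont cut 0"
          using smooth_continuous_on[OF schwartz_smooth[OF test_fun_schwartz[OF chi(1)]], of UNIV]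
          by (simp add: continuous_on_eq_continuous_at)
        ultimately have "(\<lambda>n. ?X n \<eta>) \<longlonglongrightarrow> 1" using chi(2) isCont_tendsto_compose by fastforce
        from tendsto_mult[OF tendsto_const[of "g \<eta>"] tendsto_mult[OF tendsto_const[of "\<psi> \<eta>"] this]]
        show "(\<lambda>n. g \<eta> * (\<psi> \<eta> * ?X n \<eta>)) \<longlonglongrightarrow> g \<eta> * \<psi> \<eta>" by simp
      qed
      show "AE \<eta> in lborel. norm (g \<eta> * (\<psi> \<eta> * ?X n \<eta>)) \<le> cmod (g \<eta> * \<psi> \<eta>) * B" for n
        using B(2) by (intro AE_I2) (auto simp: norm_mult mult.assoc[symmetric] intro!: mult_left_mono)
    qed measurable
    moreover have "(\<lambda>n. LINT \<eta>|lborel. g \<eta> * (\<psi> \<eta> * ?X n \<eta>)) \<longlonglongrightarrow> u (fourier \<psi>)"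
      using tempered_cutoff[OF u test_fun_schwartz[OF chi(1)] chi(2) \<psi>] unfolding rep[OF pt] .
    ultimately show ?thesis by (rule LIMSEQ_unique[rotated])
  qed
  then have "fourier_dist u = fun_dist g"
    unfolding fourier_dist_def fun_dist_def by (intro restrict_ext) auto
  then show ?thesis using gm gi by blast
qed

text \<open>The bound on test functions is a bound by duality for the density.\<close>

theorem energy_ge:
  "\<exists>C>0. \<forall>u g. u \<in> tempered \<longrightarrow> energy \<gamma> u < \<infinity> \<longrightarrow> fourier_dist u = fun_dist g \<longrightarrow> g \<in> borel_measurable borel \<longrightarrow>
     integrable lborel (\<lambda>\<eta>. jbracket \<eta> powr \<gamma> * (cmod (g \<eta>))\<^sup>2) \<longrightarrow>
     (LINT \<eta>|lborel. jbracket \<eta> powr \<gamma> * (cmod (g \<eta>))\<^sup>2) \<le> C * enn2real (energy \<gamma> u)"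
proof -
  obtain C where C: "C > 0" "\<And>u \<psi>. u \<in> tempered \<Longrightarrow> energy \<gamma> u < \<infinity> \<Longrightarrow> \<psi> \<in> test_fun \<Longrightarrow> cmod (u (fourier \<psi>)) \<le>
      C * sqrt (enn2real (energy \<gamma> u)) * sqrt (LINT \<eta>|lborel. (cmod (\<psi> \<eta>))\<^sup>2 / jbracket \<eta> powr \<gamma>)"
    using test_fun_bound[of \<gamma>] by blast
  obtain \<kappa> :: "'a \<Rightarrow> complex" where \<kappa>: "mollifier \<kappa>" using mollifier_exists by blast
  have "(LINT \<eta>|lborel. jbracket \<eta> powr \<gamma> * (cmod (g \<eta>))\<^sup>2) \<le> C\<^sup>2 * enn2real (energy \<gamma> u)"
    if u: "u \<in> tempered" and fin: "energy \<gamma> u < \<infinity>" and g: "fourier_dist u = fun_dist g"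
      and gm: "g \<in> borel_measurable borel" and gi: "integrable lborel (\<lambda>\<eta>. jbracket \<eta> powr \<gamma> * (cmod (g \<eta>))\<^sup>2)" for u g
  proof -
    have "(LINT \<eta>|lborel. jbracket \<eta> powr \<gamma> * (cmod (g \<eta>))\<^sup>2) \<le> (C * sqrt (enn2real (energy \<gamma> u)))\<^sup>2"
    proof (rule norm_bound_by_duality[OF c \<kappa> _ _ gm gi])
      show "continuous_on UNIV (\<lambda>\<eta>::'a. jbracket \<eta> powr \<gamma>)"
        using jbracket_pos by (intro continuous_on_powr jbracket_continuous continuous_on_const) (auto simp: less_imp_neq[OF jbracket_pos, symmetric])
      show "0 < jbracket \<eta> powr \<gamma>" for \<eta> :: 'a using jbracket_pos[of \<eta>] by simp
      show "0 \<le> C * sqrt (enn2real (energy \<gamma> u))" using C(1) by simp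
      fix \<psi> :: "'a \<Rightarrow> complex" assume \<psi>: "\<psi> \<in> test_fun"
      have "u (fourier \<psi>) = fourier_dist u \<psi>" using test_fun_schwartz[OF \<psi>] by (simp add: fourier_dist_def)
      also have "\<dots> = (LINT \<eta>|lborel. g \<eta> * \<psi> \<eta>)" unfolding g using test_fun_schwartz[OF \<psi>] by (simp add: fun_dist_def)
      finally show "cmod (LINT \<eta>|lborel. g \<eta> * \<psi> \<eta>) \<le>
          C * sqrt (enn2real (energy \<gamma> u)) * sqrt (LINT \<eta>|lborel. (cmod (\<psi> \<eta>))\<^sup>2 / jbracket \<eta> powr \<gamma>)"
        using C(2)[OF u fin \<psi>] by simp
    qed
    then show ?thesis by (simp add: power_mult_distrib)
  qed
  moreover have "C\<^sup>2 > 0" using C(1) by simp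
  ultimately show ?thesis by blast
qed

end

section \<open>Square integrable functions as distributions\<close>

lemma schwartz_norm_upper:
  fixes \<psi> :: "'a::euclidean_space \<Rightarrow> complex"
  assumes \<psi>: "\<psi> \<in> schwartz"
  shows "(1 + norm x) ^ N * cmod (\<psi> x) \<le> schwartz_norm N \<psi>"
proof -
  let ?s = "\<lambda>vs. SUP x. (1 + norm x) ^ N * cmod (iter_deriv vs \<psi> x)"
  have up: "(1 + norm x) ^ N * cmod (iter_deriv vs \<psi> x) \<le> ?s vs" if vs: "vs \<in> lists Basis" for vs x
  proof -
    have fs: "bounded_family (\<lambda>_::unit. \<psi>)" using \<psi> schwartz_iff_bounded_family by blast
    obtain K where "\<And>x. (1 + norm x) ^ N * cmod (iter_deriv vs \<psi> x) \<le> K" using bounded_familyD[OF fs vs, of N] by auto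
    then have "bdd_above (range (\<lambda>x. (1 + norm x) ^ N * cmod (iter_deriv vs \<psi> x)))" by (intro bdd_aboveI2)
    then show ?thesis by (rule cSUP_upper[OF UNIV_I])
  qed
  have nn: "0 \<le> ?s vs" if "vs \<in> lists Basis" for vs
    by (rule order_trans[OF _ up[OF that, of 0]]) simp
  have "?s [] \<le> schwartz_norm N \<psi>" unfolding schwartz_norm_def
  proof (rule member_le_sum[of "[]" _ ?s])
    show "finite {vs::'a list. vs \<in> lists Basis \<and> length vs \<le> N}" by (rule finite_lists_le)
  qed (use nn in auto)
  then show ?thesis using up[of "[]" x] by simp
qed

lemma l2_fun_iff: "l2_fun g \<longleftrightarrow> l2on lborel g" by (simp add: l2_fun_def l2on_def)

lemma schwartz_l2: "\<psi> \<in> schwartz \<Longrightarrow> l2on lborel \<psi>"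
  using schwartz_borel schwartz_square_integrable(2) unfolding l2on_def by auto

lemma schwartz_nrm_le:
  fixes \<psi> :: "'a::euclidean_space \<Rightarrow> complex"
  assumes \<psi>: "\<psi> \<in> schwartz"
  shows "nrm lborel \<psi> \<le> sqrt (LINT x|lborel. (decay (x::'a) :: real)) * schwartz_norm (DIM('a) + 2) \<psi>"
proof -
  let ?N = "DIM('a) + 2" let ?S = "schwartz_norm ?N \<psi>"
  have S0: "0 \<le> ?S" using order_trans[OF _ schwartz_norm_upper[OF \<psi>, of 0 ?N]] by simp
  have le: "(cmod (\<psi> x))\<^sup>2 \<le> ?S\<^sup>2 * decay x" for x
  proof -
    have p: "1 \<le> (1 + norm x) ^ ?N" by (rule one_le_power) simp
    have s: "cmod (\<psi> x) \<le> ?S * decay x"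
      using schwartz_norm_upper[OF \<psi>, of x ?N] p unfolding decay_def by (simp add: pos_le_divide_eq mult.commute)
    have d: "decay x \<le> 1" using p unfolding decay_def by simp
    have "(cmod (\<psi> x))\<^sup>2 \<le> (?S * decay x)\<^sup>2" by (intro power_mono s) simp
    also have "\<dots> = ?S\<^sup>2 * decay x * decay x" by (simp add: power2_eq_square)
    also have "\<dots> \<le> ?S\<^sup>2 * decay x * 1" using d less_imp_le[OF decay_pos[of x]] by (intro mult_left_mono) auto
    finally show ?thesis by simp
  qed
  have "(LINT x|lborel. (cmod (\<psi> x))\<^sup>2) \<le> (LINT x|lborel. ?S\<^sup>2 * decay (x::'a))"
    by (rule integral_mono[OF schwartz_square_integrable(2)[OF \<psi> \<psi>] integrable_mult_right[OF integrable_decay] le])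
  also have "\<dots> = (LINT x|lborel. (decay (x::'a) :: real)) * ?S\<^sup>2" by simp
  finally have "nrm lborel \<psi> \<le> sqrt ((LINT x|lborel. (decay (x::'a) :: real)) * ?S\<^sup>2)"
    unfolding nrm_def by (rule real_sqrt_le_mono)
  then show ?thesis using S0 by (simp add: real_sqrt_mult)
qed

text \<open>By the Cauchy-Schwarz inequality, as the \<open>L\<^sup>2\<close> norm of a Schwartz function is bounded by one of the
  Schwartz norms.\<close>

lemma fun_dist_tempered:
  fixes g :: "'a::euclidean_space \<Rightarrow> complex"
  assumes g: "l2on lborel g"
  shows "fun_dist g \<in> tempered"
proof -
  have i: "integrable lborel (\<lambda>x. g x * f x)" if "f \<in> schwartz" for f
    by (rule l2on_mult_integrable[OF g schwartz_l2[OF that]])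
  have "fun_dist g (\<lambda>x. f x + h x) = fun_dist g f + fun_dist g h" if "f \<in> schwartz" "h \<in> schwartz" for f h
    unfolding fun_dist_def using that schwartz_add[OF that] Bochner_Integration.integral_add[OF i[OF that(1)] i[OF that(2)]]
    by (simp add: distrib_left)
  moreover have "fun_dist g (\<lambda>x. k * f x) = k * fun_dist g f" if "f \<in> schwartz" for f k
    unfolding fun_dist_def using that schwartz_cmult[OF that] by (simp add: mult.left_commute)
  moreover have "cmod (fun_dist g f) \<le> (nrm lborel g * sqrt (LINT x|lborel. (decay (x::'a) :: real))) * schwartz_norm (DIM('a) + 2) f"
    if f: "f \<in> schwartz" for f
  proof -
    have "cmod (fun_dist g f) \<le> nrm lborel g * nrm lborel f"
      using cauchy_schwarz_l2[OF g schwartz_l2[OF f]] f by (simp add: fun_dist_def)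
    also have "\<dots> \<le> nrm lborel g * (sqrt (LINT x|lborel. (decay (x::'a) :: real)) * schwartz_norm (DIM('a) + 2) f)"
      by (intro mult_left_mono schwartz_nrm_le f) simp
    finally show ?thesis by (simp add: mult.assoc)
  qed
  ultimately show ?thesis unfolding tempered_def fun_dist_def by blast
qed

lemma bessel_weight_square:
  "(cmod (bessel_weight \<beta> g \<eta>))\<^sup>2 = jbracket \<eta> powr (2 * \<beta>) * (cmod (g \<eta>))\<^sup>2"
  by (simp add: bessel_weight_def norm_mult power_mult_distrib power2_eq_square powr_add[symmetric])

text \<open>The weight is positive and continuous, so \<open>g\<close> inherits measurability from its weighted version.\<close>

lemma sobolev_density_iff:
  fixes g :: "'a::euclidean_space \<Rightarrow> complex"
  shows "sobolev_density \<beta> u g \<longleftrightarrow> fourier_dist u = fun_dist g \<and> g \<in> borel_measurable borel \<and>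
    integrable lborel (\<lambda>\<eta>. jbracket \<eta> powr (2 * \<beta>) * (cmod (g \<eta>))\<^sup>2)"
proof -
  have jm [measurable]: "(jbracket :: 'a \<Rightarrow> real) \<in> borel_measurable borel"
    by (rule borel_measurable_continuous_onI[OF jbracket_continuous])
  have inv: "(\<lambda>\<eta>. of_real (jbracket \<eta> powr (- \<beta>)) * bessel_weight \<beta> g \<eta>) = g"
  proof
    fix \<eta> :: 'a
    have "jbracket \<eta> powr (- \<beta>) * jbracket \<eta> powr \<beta> = 1" using jbracket_pos[of \<eta>] by (simp add: powr_minus)
    then have "complex_of_real (jbracket \<eta> powr (- \<beta>)) * of_real (jbracket \<eta> powr \<beta>) = 1"
      by (metis of_real_1 of_real_mult)
    then show "of_real (jbracket \<eta> powr (- \<beta>)) * bessel_weight \<beta> g \<eta> = g \<eta>"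
      unfolding bessel_weight_def mult.assoc[symmetric] by simp
  qed
  have "bessel_weight \<beta> g \<in> borel_measurable borel \<longleftrightarrow> g \<in> borel_measurable borel"
  proof
    assume [measurable]: "bessel_weight \<beta> g \<in> borel_measurable borel"
    have "(\<lambda>\<eta>. of_real (jbracket \<eta> powr (- \<beta>)) * bessel_weight \<beta> g \<eta>) \<in> borel_measurable borel" by measurable
    then show "g \<in> borel_measurable borel" unfolding inv .
  next
    assume [measurable]: "g \<in> borel_measurable borel"
    show "bessel_weight \<beta> g \<in> borel_measurable borel" unfolding bessel_weight_def[abs_def] by measurable
  qed
  then show ?thesis unfolding sobolev_density_def l2_fun_def bessel_weight_square by auto
qed

lemma sobolev_density_zero_iff:
  "sobolev_density 0 u g \<longleftrightarrow> fourier_dist u = fun_dist g \<and> l2on lborel g"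
proof -
  have "jbracket \<eta> powr (2 * 0) = 1" for \<eta> :: 'a using jbracket_pos[of \<eta>] by simp
  then show ?thesis unfolding sobolev_density_iff l2on_def by simp
qed

lemma sobolev_norm_density:
  assumes "u \<in> sobolev \<beta>"
  obtains g where "sobolev_density \<beta> u g"
    "sobolev_norm \<beta> u = sqrt (LINT \<eta>|lborel. jbracket \<eta> powr (2 * \<beta>) * (cmod (g \<eta>))\<^sup>2)"
proof
  show "sobolev_density \<beta> u (SOME g. sobolev_density \<beta> u g)" using assms unfolding sobolev_def by (intro someI_ex[of "sobolev_density \<beta> u"]) blast
  show "sobolev_norm \<beta> u =
      sqrt (LINT \<eta>|lborel. jbracket \<eta> powr (2 * \<beta>) * (cmod ((SOME g. sobolev_density \<beta> u g) \<eta>))\<^sup>2)"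
    unfolding sobolev_norm_def l2_norm_def bessel_weight_square ..
qed

section \<open>Plancherel's theorem for square integrable functions\<close>

context
  fixes c :: complex
  assumes c: "inversion_constant TYPE('a::euclidean_space) c"
begin

lemma c_nonzero: "cmod c > 0" using c by (simp add: inversion_constant_def)

lemma nrm_fourier: "\<psi> \<in> schwartz \<Longrightarrow> nrm lborel (fourier \<psi>) = sqrt (cmod c) * nrm lborel (\<psi> :: 'a \<Rightarrow> complex)"
  unfolding nrm_def plancherel[OF c] by (rule real_sqrt_mult)

text \<open>The inverse transform of \<open>\<psi>\<close> is \<open>fourier \<psi> (- x) / c\<close> by the inversion formula.\<close>

lemma inverse_fourier:
  fixes \<psi> :: "'a \<Rightarrow> complex"
  assumes \<psi>: "\<psi> \<in> schwartz"
  obtains X where "X \<in> schwartz" "fourier X = \<psi>" "nrm lborel X = nrm lborel \<psi> / sqrt (cmod c)"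
proof
  let ?X = "\<lambda>x. (1 / c) * fourier \<psi> (- x)"
  have f: "fourier \<psi> \<in> schwartz" by (rule schwartz_fourier[OF \<psi>])
  show X: "?X \<in> schwartz" by (intro schwartz_cmult schwartz_uminus f)
  show F: "fourier ?X = \<psi>"
  proof
    fix \<eta>
    have "fourier ?X \<eta> = (1 / c) * fourier (fourier \<psi>) (- \<eta>)"
      unfolding fourier_cmult fourier_reflect[OF schwartz_borel[OF f]] ..
    also have "\<dots> = \<psi> \<eta>" using c \<psi> by (simp add: inversion_constant_def)
    finally show "fourier ?X \<eta> = \<psi> \<eta>" .
  qed
  show "nrm lborel ?X = nrm lborel \<psi> / sqrt (cmod c)"
    using nrm_fourier[OF X] c_nonzero unfolding F by (simp add: field_simps)
qed

lemma l2_fourier_functional_bound: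
  fixes g :: "'a \<Rightarrow> complex"
  assumes g: "l2on lborel g" and \<psi>: "\<psi> \<in> schwartz"
  shows "cmod (fourier_dist (fun_dist g) \<psi>) \<le> nrm lborel g * sqrt (cmod c) * nrm lborel \<psi>"
  using cauchy_schwarz_l2[OF g schwartz_l2[OF schwartz_fourier[OF \<psi>]]] \<psi> schwartz_fourier[OF \<psi>]
  by (simp add: fourier_dist_def fun_dist_def nrm_fourier mult.assoc)

text \<open>Every Schwartz function is the transform of a Schwartz function, whose norm the Plancherel identity computes.\<close>

lemma distribution_bound_by_density:
  fixes G :: "'a \<Rightarrow> complex"
  assumes G: "l2on lborel G" and u: "fourier_dist u = fun_dist G" and \<psi>: "\<psi> \<in> schwartz"
  shows "cmod (u \<psi>) \<le> nrm lborel G / sqrt (cmod c) * nrm lborel \<psi>"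
proof -
  obtain X where X: "X \<in> schwartz" "fourier X = \<psi>" "nrm lborel X = nrm lborel \<psi> / sqrt (cmod c)"
    using inverse_fourier[OF \<psi>] by blast
  have "u \<psi> = fourier_dist u X" using X by (simp add: fourier_dist_def)
  also have "\<dots> = (LINT x|lborel. G x * X x)" unfolding u using X(1) by (simp add: fun_dist_def)
  finally have "cmod (u \<psi>) \<le> nrm lborel G * nrm lborel X"
    using cauchy_schwarz_l2[OF G schwartz_l2[OF X(1)]] by simp
  then show ?thesis unfolding X(3) by simp
qed

lemma schwartz_riesz:
  fixes L :: "'a dist"
  assumes "\<And>f h. f \<in> schwartz \<Longrightarrow> h \<in> schwartz \<Longrightarrow> L (\<lambda>x. f x + h x) = L f + L h"
    and "\<And>f k. f \<in> schwartz \<Longrightarrow> L (\<lambda>x. k * f x) = k * L f"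
    and "\<And>f. f \<in> schwartz \<Longrightarrow> cmod (L f) \<le> C * nrm lborel f"
  obtains h where "l2on lborel h" "\<And>f. f \<in> schwartz \<Longrightarrow> L f = fun_dist h f"
proof -
  have "\<exists>h. l2on lborel h \<and> (\<forall>f\<in>schwartz. L f = (LINT x|lborel. f x * h x))"
    by (rule riesz_L2[where C=C]) (use assms schwartz_l2 schwartz_add schwartz_cmult schwartz_zero in auto)
  then show ?thesis using that by (auto simp: fun_dist_def mult.commute)
qed

text \<open>By the Plancherel identity for Schwartz functions, the transform of an \<open>L\<^sup>2\<close> function and a distribution whose
  transform is an \<open>L\<^sup>2\<close> function are both bounded in the \<open>L\<^sup>2\<close> norm; the Riesz representation applies to each.\<close>

theorem L2_space_eq_sobolev: "(L2_space :: 'a dist set) = sobolev 0"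
proof (intro set_eqI iffI)
  fix u :: "'a dist" assume "u \<in> L2_space"
  then obtain g where g: "l2on lborel g" and u: "u = fun_dist g" unfolding L2_space_def l2_fun_iff by blast
  have t: "u \<in> tempered" unfolding u by (rule fun_dist_tempered[OF g])
  have "cmod (fourier_dist u \<psi>) \<le> (nrm lborel g * sqrt (cmod c)) * nrm lborel \<psi>" if "\<psi> \<in> schwartz" for \<psi>
    unfolding u by (rule l2_fourier_functional_bound[OF g that])
  moreover have "fourier_dist u (\<lambda>x. f x + h x) = fourier_dist u f + fourier_dist u h"
    if "f \<in> schwartz" "h \<in> schwartz" for f h
    using that schwartz_add[OF that] temperedD(1)[OF t schwartz_fourier[OF that(1)] schwartz_fourier[OF that(2)]]
    by (simp add: fourier_dist_def fourier_add)
  moreover have "fourier_dist u (\<lambda>x. k * f x) = k * fourier_dist u f" if "f \<in> schwartz" for f k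
    using that schwartz_cmult[OF that] temperedD(2)[OF t schwartz_fourier[OF that]]
    by (simp add: fourier_dist_def fourier_cmult)
  ultimately obtain h where h: "l2on lborel h" "\<And>f. f \<in> schwartz \<Longrightarrow> fourier_dist u f = fun_dist h f"
    using schwartz_riesz[of "fourier_dist u" "nrm lborel g * sqrt (cmod c)"] by blast
  have "fourier_dist u = fun_dist h"
  proof (rule extensionalityI)
    show "fourier_dist u \<in> extensional schwartz" "fun_dist h \<in> extensional schwartz"
      unfolding fourier_dist_def fun_dist_def by auto
  qed (rule h(2))
  then have "sobolev_density 0 u h" using h(1) unfolding sobolev_density_zero_iff by simp
  then show "u \<in> sobolev 0" using t unfolding sobolev_def by blast
next
  fix u :: "'a dist" assume "u \<in> sobolev 0"
  then obtain G where t: "u \<in> tempered" and G: "fourier_dist u = fun_dist G" "l2on lborel G"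
    unfolding sobolev_def sobolev_density_zero_iff by blast
  obtain h where h: "l2on lborel h" "\<And>f. f \<in> schwartz \<Longrightarrow> u f = fun_dist h f"
    using schwartz_riesz[of u, OF temperedD(1)[OF t] temperedD(2)[OF t] distribution_bound_by_density[OF G(2,1)]] by metis
  have "u = fun_dist h"
  proof (rule extensionalityI)
    show "u \<in> extensional schwartz" using t by (simp add: tempered_def)
    show "fun_dist h \<in> extensional schwartz" unfolding fun_dist_def by auto
  qed (rule h(2))
  then show "u \<in> L2_space" using h(1) unfolding L2_space_def l2_fun_iff by blast
qed

lemma nrm_le_by_duality:
  fixes g :: "'a \<Rightarrow> complex"
  assumes \<kappa>: "mollifier (\<kappa> :: 'a \<Rightarrow> complex)" and g: "l2on lborel g" and C: "0 \<le> C"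
    and bnd: "\<And>\<psi>. \<psi> \<in> schwartz \<Longrightarrow> cmod (fun_dist g \<psi>) \<le> C * nrm lborel \<psi>"
  shows "nrm lborel g \<le> C"
proof -
  have "(LINT x|lborel. 1 * (cmod (g x))\<^sup>2) \<le> C\<^sup>2"
  proof (rule norm_bound_by_duality[OF c \<kappa> _ _ _ _ C])
    show "g \<in> borel_measurable borel" "integrable lborel (\<lambda>x. 1 * (cmod (g x))\<^sup>2)" using g by (auto simp: l2on_def)
    show "cmod (LINT x|lborel. g x * \<psi> x) \<le> C * sqrt (LINT x|lborel. (cmod (\<psi> x))\<^sup>2 / 1)" if "\<psi> \<in> test_fun" for \<psi>
      using bnd[OF test_fun_schwartz[OF that]] test_fun_schwartz[OF that] by (simp add: nrm_def fun_dist_def)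
  qed auto
  then show ?thesis unfolding nrm_def using C by (simp add: real_le_lsqrt)
qed

text \<open>Either norm bounds the other by duality, which avoids an approximation of \<open>g\<close> by Schwartz functions.\<close>

lemma sobolev_norm_zero:
  fixes g :: "'a \<Rightarrow> complex"
  assumes \<kappa>: "mollifier (\<kappa> :: 'a \<Rightarrow> complex)" and g: "l2_fun g"
  shows "sobolev_norm 0 (fun_dist g) = sqrt (cmod c) * l2_norm g"
proof -
  have gl: "l2on lborel g" using g by (simp add: l2_fun_iff)
  have "fun_dist g \<in> sobolev 0" using L2_space_eq_sobolev g unfolding L2_space_def by blast
  then obtain G where G: "sobolev_density 0 (fun_dist g) G"
    "sobolev_norm 0 (fun_dist g) = sqrt (LINT \<eta>|lborel. jbracket \<eta> powr (2 * 0) * (cmod (G \<eta>))\<^sup>2)"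
    by (rule sobolev_norm_density)
  have "jbracket \<eta> powr (2 * 0) = 1" for \<eta> :: 'a using jbracket_pos[of \<eta>] by simp
  then have n: "sobolev_norm 0 (fun_dist g) = nrm lborel G" unfolding G(2) nrm_def by simp
  have Gl: "l2on lborel G" and F: "fourier_dist (fun_dist g) = fun_dist G"
    using G(1) unfolding sobolev_density_zero_iff by auto
  have "nrm lborel G \<le> nrm lborel g * sqrt (cmod c)"
    by (rule nrm_le_by_duality[OF \<kappa> Gl _ l2_fourier_functional_bound[OF gl, unfolded F]]) simp_all
  moreover have "nrm lborel g \<le> nrm lborel G / sqrt (cmod c)"
    by (rule nrm_le_by_duality[OF \<kappa> gl _ distribution_bound_by_density[OF Gl F]]) simp_all
  ultimately show ?thesis
    using c_nonzero unfolding n by (simp add: l2_norm_def nrm_def field_simps)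
qed

end

section \<open>The modulation norm as an energy\<close>

lemma epow_ennreal: "0 \<le> x \<Longrightarrow> epow (ennreal x) r = ennreal (x powr r)" by (simp add: epow_def)

lemma epow_two: "0 \<le> x \<Longrightarrow> epow (ennreal x) 2 = ennreal (x\<^sup>2)"
  by (simp add: epow_ennreal)

lemma epow_half: "0 \<le> x \<Longrightarrow> epow (ennreal x) (1 / 2) = ennreal (sqrt x)"
  by (simp add: epow_ennreal powr_half_sqrt)

lemma epow_half_times_two:
  assumes w: "0 < w"
  shows "epow (epow X (1 / 2) * ennreal w) 2 = X * ennreal (w\<^sup>2)"
proof (cases X)
  case (real x)
  then have "epow X (1 / 2) * ennreal w = ennreal (sqrt x * w)"
    using w by (simp add: epow_half ennreal_mult'')
  then have "epow (epow X (1 / 2) * ennreal w) 2 = ennreal ((sqrt x * w)\<^sup>2)" using w real by (simp add: epow_two)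
  also have "(sqrt x * w)\<^sup>2 = x * w\<^sup>2" using real by (simp add: power_mult_distrib)
  finally show ?thesis using real w by (simp add: ennreal_mult'')
next
  case top
  have "epow X (1 / 2) * ennreal w = \<infinity>" using w top by (simp add: epow_def ennreal_top_mult)
  then show ?thesis using top w by (simp add: epow_def ennreal_top_mult)
qed

context packet_frame
begin

lemma modulation_norm_energy: "modulation_norm \<alpha> b \<phi> \<rho> \<xi> 2 2 \<beta> u = epow (energy (2 * \<beta>) u) (1 / 2)"
proof -
  have two: "(2::ennreal) \<noteq> \<infinity>" "enn2real 2 = 2" by simp_all
  have w: "ennreal (((1 + norm (\<xi> k)) powr \<beta>)\<^sup>2) = ennreal (weight (2 * \<beta>) k)" for k
    by (simp add: weight_def power2_eq_square powr_add[symmetric])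
  have p: "0 < (1 + norm (\<xi> k)) powr \<beta>" for k using weight_pos[of \<beta> k] by (simp add: weight_def)
  show ?thesis
    unfolding modulation_norm_def lp_norm_def energy_def square_sum_def two(2) if_not_P[OF two(1)]
      epow_half_times_two[OF p] w by (simp add: epow_two)
qed

theorem modulation_space_sobolev:
  "modulation_space \<alpha> b \<phi> \<rho> \<xi> 2 2 \<beta> = sobolev \<beta> \<and>
   (\<exists>k>0. \<exists>K>0. \<forall>f \<in> sobolev \<beta>.
     ennreal (k * sobolev_norm \<beta> f) \<le> modulation_norm \<alpha> b \<phi> \<rho> \<xi> 2 2 \<beta> f \<and>
     modulation_norm \<alpha> b \<phi> \<rho> \<xi> 2 2 \<beta> f \<le> ennreal (K * sobolev_norm \<beta> f))"
proof -
  let ?I = "\<lambda>g :: 'a \<Rightarrow> complex. LINT \<eta>|lborel. jbracket \<eta> powr (2 * \<beta>) * (cmod (g \<eta>))\<^sup>2"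
  obtain K where K: "K > 0" "\<And>u g. u \<in> tempered \<Longrightarrow> sobolev_density \<beta> u g \<Longrightarrow> energy (2 * \<beta>) u \<le> ennreal (K * ?I g)"
    using energy_le[of "2 * \<beta>"] unfolding sobolev_density_iff by blast
  obtain L where L: "L > 0" "\<And>u g. u \<in> tempered \<Longrightarrow> energy (2 * \<beta>) u < \<infinity> \<Longrightarrow> sobolev_density \<beta> u g \<Longrightarrow>
      ?I g \<le> L * enn2real (energy (2 * \<beta>) u)"
    using energy_ge[of "2 * \<beta>"] unfolding sobolev_density_iff by blast
  have fin: "modulation_norm \<alpha> b \<phi> \<rho> \<xi> 2 2 \<beta> f < \<infinity> \<longleftrightarrow> energy (2 * \<beta>) f < \<infinity>" for f
    unfolding modulation_norm_energy by (simp add: epow_def less_top[symmetric])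
  have bounds: "ennreal (sqrt (1 / L) * sobolev_norm \<beta> f) \<le> modulation_norm \<alpha> b \<phi> \<rho> \<xi> 2 2 \<beta> f \<and>
      modulation_norm \<alpha> b \<phi> \<rho> \<xi> 2 2 \<beta> f \<le> ennreal (sqrt K * sobolev_norm \<beta> f)" if f: "f \<in> sobolev \<beta>" for f
  proof -
    have t: "f \<in> tempered" using f by (simp add: sobolev_def)
    obtain g where g: "sobolev_density \<beta> f g" "sobolev_norm \<beta> f = sqrt (?I g)" using sobolev_norm_density[OF f] .
    have up: "energy (2 * \<beta>) f \<le> ennreal (K * ?I g)" by (rule K(2)[OF t g(1)])
    then have f': "energy (2 * \<beta>) f < \<infinity>" by (rule order.strict_trans1) simp
    define e where "e = enn2real (energy (2 * \<beta>) f)"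
    have e: "energy (2 * \<beta>) f = ennreal e" and e0: "0 \<le> e" using f' by (simp_all add: e_def)
    have I0: "0 \<le> ?I g" by (intro integral_nonneg_AE AE_I2) auto
    have m: "modulation_norm \<alpha> b \<phi> \<rho> \<xi> 2 2 \<beta> f = ennreal (sqrt e)"
      unfolding modulation_norm_energy e by (rule epow_half[OF e0])
    have "e \<le> K * ?I g" using up I0 K(1) unfolding e by (simp add: ennreal_le_iff)
    then have a: "sqrt e \<le> sqrt K * sqrt (?I g)" unfolding real_sqrt_mult[symmetric] by (rule real_sqrt_le_mono)
    have "?I g \<le> L * e" unfolding e_def by (rule L(2)[OF t f' g(1)])
    then have "(1 / L) * ?I g \<le> e" using L(1) by (simp add: pos_divide_le_eq mult.commute)
    then have b: "sqrt (1 / L) * sqrt (?I g) \<le> sqrt e" unfolding real_sqrt_mult[symmetric] by (rule real_sqrt_le_mono)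
    show ?thesis unfolding m g(2) by (intro conjI ennreal_leI a b)
  qed
  have "modulation_space \<alpha> b \<phi> \<rho> \<xi> 2 2 \<beta> = sobolev \<beta>"
  proof (intro set_eqI iffI)
    fix f assume "f \<in> modulation_space \<alpha> b \<phi> \<rho> \<xi> 2 2 \<beta>"
    then have t: "f \<in> tempered" and e: "energy (2 * \<beta>) f < \<infinity>" unfolding modulation_space_def fin by auto
    show "f \<in> sobolev \<beta>" using density_exists[OF t e] t unfolding sobolev_def sobolev_density_iff by blast
  next
    fix f :: "'a dist" assume f: "f \<in> sobolev \<beta>"
    have "modulation_norm \<alpha> b \<phi> \<rho> \<xi> 2 2 \<beta> f < \<infinity>"
      by (rule order.strict_trans1[OF conjunct2[OF bounds[OF f]]]) simp
    then show "f \<in> modulation_space \<alpha> b \<phi> \<rho> \<xi> 2 2 \<beta>" using f by (simp add: modulation_space_def sobolev_def)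
  qed
  moreover have "sqrt (1 / L) > 0" "sqrt K > 0" using K(1) L(1) by simp_all
  ultimately show ?thesis using bounds by blast
qed

theorem modulation_space_L2:
  "modulation_space \<alpha> b \<phi> \<rho> \<xi> 2 2 0 = L2_space \<and>
   (\<exists>k>0. \<exists>K>0. \<forall>g. l2_fun g \<longrightarrow>
     ennreal (k * l2_norm g) \<le> modulation_norm \<alpha> b \<phi> \<rho> \<xi> 2 2 0 (fun_dist g) \<and>
     modulation_norm \<alpha> b \<phi> \<rho> \<xi> 2 2 0 (fun_dist g) \<le> ennreal (K * l2_norm g))"
proof -
  obtain k K where kK: "k > 0" "K > 0" "\<And>f. f \<in> sobolev 0 \<Longrightarrow>
     ennreal (k * sobolev_norm 0 f) \<le> modulation_norm \<alpha> b \<phi> \<rho> \<xi> 2 2 0 f \<and>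
     modulation_norm \<alpha> b \<phi> \<rho> \<xi> 2 2 0 f \<le> ennreal (K * sobolev_norm 0 f)"
    using modulation_space_sobolev[of 0] by blast
  obtain \<kappa> :: "'a \<Rightarrow> complex" where \<kappa>: "mollifier \<kappa>" using mollifier_exists by blast
  have "ennreal (k * sqrt (cmod c) * l2_norm g) \<le> modulation_norm \<alpha> b \<phi> \<rho> \<xi> 2 2 0 (fun_dist g) \<and>
     modulation_norm \<alpha> b \<phi> \<rho> \<xi> 2 2 0 (fun_dist g) \<le> ennreal (K * sqrt (cmod c) * l2_norm g)" if g: "l2_fun g" for g
  proof -
    have "fun_dist g \<in> sobolev 0" using L2_space_eq_sobolev[OF c] g unfolding L2_space_def by blast
    from kK(3)[OF this] show ?thesis unfolding sobolev_norm_zero[OF c \<kappa> g] by (simp only: mult.assoc)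
  qed
  moreover have "k * sqrt (cmod c) > 0" "K * sqrt (cmod c) > 0" using kK c_nz by simp_all
  ultimately show ?thesis using modulation_space_sobolev[of 0] L2_space_eq_sobolev[OF c] by blast
qed

end

section \<open>The subdyadic frame\<close>

text \<open>Frequencies of norm at least \<open>1\<close> are covered because \<open>A * \<rho> < R\<^sub>0\<close>. A frequency of norm less than \<open>1\<close> has distance at most \<open>3\<close> from
  a center of norm less than \<open>2\<close>, whose radius is at least \<open>2 powr (- max (\<alpha> - 1) 0)\<close>; this is why the window is required to
  be bounded below beyond \<open>3 * 2 powr max (\<alpha> - 1) 0\<close>.\<close>

lemma subdyadic_packet_frame:
  fixes \<xi> :: "nat \<Rightarrow> 'a::euclidean_space"
  assumes \<alpha>: "0 < \<alpha>" and a: "0 < a" and b: "0 < b"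
    and A: "covering_constant TYPE('a) \<alpha> a \<rho>\<^sub>0 A"
    and P: "subdyadic_frame_pair \<alpha> a b \<rho>\<^sub>0 A \<phi> \<rho> \<xi>"
  shows "\<exists>m\<^sub>0 R\<^sub>0 R\<^sub>1 c. packet_frame \<alpha> (a * \<rho>) \<xi> \<phi> b \<rho> m\<^sub>0 R\<^sub>0 R\<^sub>1 c"
proof -
  obtain m\<^sub>0 R\<^sub>0 R\<^sub>1 where \<rho>: "0 < \<rho>" "\<rho> \<le> \<rho>\<^sub>0" and s: "subdyadic_centers \<alpha> a \<rho> \<xi>"
    and W: "frame_window \<alpha> m\<^sub>0 R\<^sub>0 R\<^sub>1 \<phi>" and AR: "A * \<rho> < R\<^sub>0" and bR: "b * \<rho> * R\<^sub>1 < pi"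
    using P unfolding subdyadic_frame_pair_def by blast
  have phi: "\<phi> \<in> schwartz" and m0: "0 < m\<^sub>0" "\<And>\<zeta>. norm \<zeta> \<le> R\<^sub>0 \<Longrightarrow> m\<^sub>0 \<le> cmod (fourier \<phi> \<zeta>)"
    and R: "3 * 2 powr max (\<alpha> - 1) 0 < R\<^sub>0" "R\<^sub>0 < R\<^sub>1"
    using W unfolding frame_window_def by auto
  have R0: "0 < R\<^sub>0" using order.strict_trans[OF _ R(1), of 0] by simp
  have nz: "fourier \<phi> 0 \<noteq> 0" using m0(1) m0(2)[of 0] R0 by auto
  obtain c where c: "inversion_constant TYPE('a) c" using inversion_constant_exists[OF schwartz_fourier[OF phi] nz] by blast
  interpret separated_centers \<alpha> "a * \<rho>" \<xi>
    by unfold_locales (use subdyadic_centersE[OF s] \<alpha> a \<rho> in \<open>auto simp: sel_ball_def\<close>)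
  have cover: "\<exists>k. norm (\<eta> - \<xi> k) \<le> R\<^sub>0 * rad k" for \<eta>
  proof (cases "1 \<le> norm \<eta>")
    case True
    then obtain k where "\<eta> \<in> cball (\<xi> k) (A * \<rho> * norm (\<xi> k) powr (1 - \<alpha>))"
      using A \<rho> s unfolding covering_constant_def by blast
    then have "norm (\<eta> - \<xi> k) \<le> A * \<rho> * rad k" by (simp add: rad_def dist_norm norm_minus_commute)
    also have "\<dots> \<le> R\<^sub>0 * rad k" using AR less_imp_le[OF rad_pos[of k]] by (intro mult_right_mono) auto
    finally show ?thesis by blast
  next
    case False
    obtain k where k: "norm (\<xi> k) < 2" using subdyadic_centersE(3)[OF s] by blast
    have r: "1 \<le> 2 powr max (\<alpha> - 1) 0 * rad k"
    proof (cases "\<alpha> \<le> 1")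
      case True
      then have "1 \<le> rad k" unfolding rad_def using xi[of k] by (simp add: ge_one_powr_ge_zero)
      then show ?thesis using True by simp
    next
      case False
      then have "(2::real) powr (1 - \<alpha>) \<le> rad k"
        unfolding rad_def using xi[of k] k norm_xi_pos[of k] by (intro powr_mono2') auto
      then have "(2::real) powr (\<alpha> - 1) * 2 powr (1 - \<alpha>) \<le> 2 powr (\<alpha> - 1) * rad k" by (intro mult_left_mono) auto
      then show ?thesis using False by (simp add: powr_add[symmetric])
    qed
    have "norm (\<eta> - \<xi> k) \<le> 3" using norm_triangle_ineq4[of \<eta> "\<xi> k"] False k by linarith
    also have "3 \<le> 3 * (2 powr max (\<alpha> - 1) 0 * rad k)" using r by linarith
    also have "\<dots> \<le> R\<^sub>0 * rad k" unfolding mult.assoc[symmetric]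
      using R(1) less_imp_le[OF rad_pos[of k]] by (intro mult_right_mono) auto
    finally show ?thesis by blast
  qed
  have "packet_frame \<alpha> (a * \<rho>) \<xi> \<phi> b \<rho> m\<^sub>0 R\<^sub>0 R\<^sub>1 c"
    by unfold_locales (use W c cover b \<rho>(1) bR R R0 m0 in \<open>auto simp: frame_window_def\<close>)
  then show ?thesis by blast
qed

theorem proposition4p9:
  fixes \<alpha> \<beta> a b \<rho>\<^sub>0 A \<rho> :: real
    and \<phi> :: "'a::euclidean_space \<Rightarrow> complex" and \<xi> :: "nat \<Rightarrow> 'a"
  assumes "0 < \<alpha>" and "0 < a" and "0 < b" and "0 < \<rho>\<^sub>0"
    and "covering_constant TYPE('a) \<alpha> a \<rho>\<^sub>0 A"
    and "subdyadic_frame_pair \<alpha> a b \<rho>\<^sub>0 A \<phi> \<rho> \<xi>"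
  shows "(modulation_space \<alpha> b \<phi> \<rho> \<xi> 2 2 \<beta> = sobolev \<beta> \<and>
          (\<exists>c>0. \<exists>C>0. \<forall>f \<in> sobolev \<beta>.
             ennreal (c * sobolev_norm \<beta> f) \<le> modulation_norm \<alpha> b \<phi> \<rho> \<xi> 2 2 \<beta> f \<and>
             modulation_norm \<alpha> b \<phi> \<rho> \<xi> 2 2 \<beta> f \<le> ennreal (C * sobolev_norm \<beta> f))) \<and>
         (modulation_space \<alpha> b \<phi> \<rho> \<xi> 2 2 0 = L2_space \<and>
          (\<exists>c>0. \<exists>C>0. \<forall>g. l2_fun g \<longrightarrow>
             ennreal (c * l2_norm g) \<le> modulation_norm \<alpha> b \<phi> \<rho> \<xi> 2 2 0 (fun_dist g) \<and>
             modulation_norm \<alpha> b \<phi> \<rho> \<xi> 2 2 0 (fun_dist g) \<le> ennreal (C * l2_norm g)))"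
proof -
  obtain m\<^sub>0 R\<^sub>0 R\<^sub>1 c where "packet_frame \<alpha> (a * \<rho>) \<xi> \<phi> b \<rho> m\<^sub>0 R\<^sub>0 R\<^sub>1 c"
    using subdyadic_packet_frame[OF assms(1,2,3,5,6)] by blast
  then interpret packet_frame \<alpha> "a * \<rho>" \<xi> \<phi> b \<rho> m\<^sub>0 R\<^sub>0 R\<^sub>1 c .
  show ?thesis using modulation_space_sobolev[of \<beta>] modulation_space_L2 by (rule conjI)
qed

end
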